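(* Let $A$ be a commutative ring, $n\ge1$ an integer, $S$ an index set, $A[Y]$ the polynomial ring over $A$ in independent variables $Y_s$, $s\in S$, $\mathfrak I\subseteq A[Y]$ an ideal, and $R=A[Y]/\mathfrak I$. Let $F$ be the free $A$-module with basis $e=T_1,\dots,T_n$, let $\beta:F\to A[Y]$ be an $A$-module homomorphism with $\beta(T_1)=1$, and write $f_k(Y)=\beta(T_k)$ for $k=1,\dots,n$. Let $A[U]$ be the polynomial ring over $A$ in independent variables $U^s_{ij}$, $s\in S$, $i,j=1,\dots,n$, and define ideals of $A[U]$ as follows: (1) $\mathfrak I_1$ is generated by the entries of the matrices $(U^s_{ij})(U^t_{ij})-(U^t_{ij})(U^s_{ij})$ for all $s,t\in S$; (2) $\mathfrak I_2$ is generated by the entries of the matrices $f((U^s_{ij}))$ for $f\in\mathfrak I$; (3) $\mathfrak I_3$ is generated by the coefficients of $T_1,\dots,T_n$ in $f_k((U^s_{ij}))T_1-T_k$ for $k=1,\dots,n$. Then, with $M$ the free $A$-module with basis $(Y_s)_{s\in S}$ (so that $A[Y]=\operatorname{Sym}_A(M)$), one has $H=A[U]/\mathfrak I_1$, with $\mu_H:H\otimes_AA[Y]\to H\otimes_A\operatorname{End}_A(F)$ determined by $\mu_H(1_H\otimes f(Y))=f((U^s_{ij}))$ for all $f(Y)\in A[Y]$; moreover $H_R=A[U]/(\mathfrak I_1,\mathfrak I_2)$ and $H_R^\beta=A[U]/(\mathfrak I_1,\mathfrak I_2,\mathfrak I_3)$.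
   Context: $(U^s_{ij})$ is the $n\times n$ matrix with entries $U^s_{ij}$, identified with $\sum_{i,j}U^s_{ij}\otimes T_{ij}\in A[U]\otimes_A\operatorname{End}_A(F)$ where $T_{ij}(T_k)=\delta_{jk}T_i$; it acts on $A[U]\otimes_AF$ accordingly. For $f\in A[Y]$, $f((U^s_{ij}))$ is the result of substituting $(U^s_{ij})$ for $Y_s$; this is well defined modulo $\mathfrak I_1$ because the matrices commute there (over $A[U]$ fix any order of the factors in each monomial; this does not affect the ideals $(\mathfrak I_1,\mathfrak I_2)$ and $(\mathfrak I_1,\mathfrak I_2,\mathfrak I_3)$). $N^\vee=\operatorname{Hom}_A(N,A)$; $\operatorname{ev}_e:\operatorname{End}_A(F)\to F$, $u\mapsto u(e)$. We also write $\beta$ for the composite $F\to A[Y]\to R$. Definition of $H$, $H_R$, $H_R^\beta$: Put $\Sigma=\operatorname{Sym}_A(M\otimes_A\operatorname{End}_A(F)^\vee)$, identified with $A[U]$ via $U^s_{ij}=Y_s\otimes T_{ij}^\vee$, where $(T_{ij}^\vee)$ is the dual basis of $(T_{ij})$. Let $\mu:\Sigma\otimes_AM\to\Sigma\otimes_A\operatorname{End}_A(F)$ be the $\Sigma$-linear map with $\mu(1\otimes x)=\sum_{i,j}(x\otimes T_{ij}^\vee)\otimes T_{ij}$ for $x\in M$. For a commutative ring $C$ and a $C$-linear map $u:N\to P$ with $P$ free of finite rank, $\mathfrak I_Z(u)\subseteq C$ is the ideal generated by all $\lambda(u(x))$, $x\in N$, $\lambda\in\operatorname{Hom}_C(P,C)$;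 for $p\in P$, $\mathfrak I_Z(p)$ is the ideal generated by all $\lambda(p)$. Then $H$ is the quotient of $\Sigma$ by the ideal generated by all $\mathfrak I_Z(\mu(1\otimes x)\mu(1\otimes y)-\mu(1\otimes y)\mu(1\otimes x))$, $x,y\in M$, and $\mu_H:H\otimes_A\operatorname{Sym}_A(M)\to H\otimes_A\operatorname{End}_A(F)$ is the $H$-algebra homomorphism with $\mu_H(1\otimes x)$ the image of $\mu(1\otimes x)$ for $x\in M$. $H_R=H/\mathfrak I_Z(v)$ with $v$ the composite $H\otimes_A\mathfrak I\to H\otimes_A\operatorname{Sym}_A(M)\xrightarrow{\mu_H}H\otimes_A\operatorname{End}_A(F)$, and $\mu_{H_R}:H_R\otimes_AR\to H_R\otimes_A\operatorname{End}_A(F)$ is induced by $\mu_H$. $H_R^\beta=H_R/\mathfrak I_Z(\operatorname{id}_{H_R\otimes_AF}-u)$ with $u=(\operatorname{id}_{H_R}\otimes\operatorname{ev}_e)\,\mu_{H_R}\,(\operatorname{id}_{H_R}\otimes\beta)$. *)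

theory Defs
  imports "HOL-Algebra.Module" "HOL-Algebra.QuotRing" "HOL-Algebra.Indexed_Polynomials"
begin

hide_const (open) Multiset.mult

text \<open>
  Everything is carrier based, so the zero ring is allowed as ground ring.  Modules and (not
  necessarily commutative) algebras over \<open>A\<close> are both \<^type>\<open>module\<close> records; for a mere
  module the fields \<open>mult\<close> and \<open>one\<close> are meaningless.
\<close>

section \<open>Modules and algebras\<close>

text \<open>Linear maps are functions relevant on the carrier only; they need not be extensional.\<close>

definition lin :: "('a, 'm) ring_scheme \<Rightarrow> ('a, 'n) module \<Rightarrow> ('a, 'p) module \<Rightarrow> ('n \<Rightarrow> 'p) set" where
  "lin A N P = {f \<in> carrier N \<rightarrow> carrier P.
     (\<forall>x\<in>carrier N. \<forall>y\<in>carrier N. f (x \<oplus>\<^bsub>N\<^esub> y) = f x \<oplus>\<^bsub>P\<^esub> f y) \<and>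
     (\<forall>a\<in>carrier A. \<forall>x\<in>carrier N. f (a \<odot>\<^bsub>N\<^esub> x) = a \<odot>\<^bsub>P\<^esub> f x)}"

definition alg_hom :: "('a, 'm) ring_scheme \<Rightarrow> ('a, 'b) module \<Rightarrow> ('a, 'c) module \<Rightarrow> ('b \<Rightarrow> 'c) set" where
  "alg_hom A B C = ring_hom B C \<inter> lin A B C"

definition alg_iso :: "('a, 'm) ring_scheme \<Rightarrow> ('a, 'b) module \<Rightarrow> ('a, 'c) module \<Rightarrow> ('b \<Rightarrow> 'c) set" where
  "alg_iso A B C = {f \<in> alg_hom A B C. bij_betw f (carrier B) (carrier C)}"

definition self_mod :: "('a, 'm) ring_scheme \<Rightarrow> ('a, 'a) module" where
  "self_mod A = \<lparr>carrier = carrier A, mult = mult A, one = one A, zero = zero A, add = add A,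
     smult = mult A\<rparr>"

definition hom_mod :: "('a, 'm) ring_scheme \<Rightarrow> ('a, 'n) module \<Rightarrow> ('a, 'p) module \<Rightarrow>
    ('a, 'n \<Rightarrow> 'p) module" where
  "hom_mod A N P = \<lparr>carrier = lin A N P \<inter> extensional (carrier N),
     mult = undefined, one = undefined,
     zero = (\<lambda>x\<in>carrier N. \<zero>\<^bsub>P\<^esub>),
     add = (\<lambda>f g. \<lambda>x\<in>carrier N. f x \<oplus>\<^bsub>P\<^esub> g x),
     smult = (\<lambda>a f. \<lambda>x\<in>carrier N. a \<odot>\<^bsub>P\<^esub> f x)\<rparr>"

definition end_alg :: "('a, 'm) ring_scheme \<Rightarrow> ('a, 'n) module \<Rightarrow> ('a, 'n \<Rightarrow> 'n) module" where
  "end_alg A N = (hom_mod A N N)\<lparr>mult := compose (carrier N), one := (\<lambda>x\<in>carrier N. x)\<rparr>"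

definition dual_mod :: "('a, 'm) ring_scheme \<Rightarrow> ('a, 'n) module \<Rightarrow> ('a, 'n \<Rightarrow> 'a) module" where
  "dual_mod A N = hom_mod A N (self_mod A)"

text \<open>Quotient of a module by a submodule, or of an algebra by an ideal (extending \<^const>\<open>FactRing\<close>
  by the scalar multiplication).\<close>

definition quot :: "('a, 'q) module \<Rightarrow> 'q set \<Rightarrow> ('a, 'q set) module" where
  "quot Q K = \<lparr>carrier = a_rcosets\<^bsub>Q\<^esub> K, mult = rcoset_mult Q K, one = K +>\<^bsub>Q\<^esub> \<one>\<^bsub>Q\<^esub>,
     zero = K, add = set_add Q, smult = (\<lambda>a C. \<Union>x\<in>C. K +>\<^bsub>Q\<^esub> (a \<odot>\<^bsub>Q\<^esub> x))\<rparr>"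

definition submod_gen :: "('a, 'm) ring_scheme \<Rightarrow> ('a, 'q) module \<Rightarrow> 'q set \<Rightarrow> 'q set" where
  "submod_gen A Q G = \<Inter>{K. submodule K A Q \<and> G \<subseteq> K}"

definition free_mod :: "('a, 'm) ring_scheme \<Rightarrow> 'x set \<Rightarrow> ('a, 'x \<Rightarrow> 'a) module" where
  "free_mod A V = \<lparr>carrier = {f. (\<forall>x. f x \<in> carrier A) \<and> (\<forall>x. x \<notin> V \<longrightarrow> f x = \<zero>\<^bsub>A\<^esub>) \<and>
       finite {x. f x \<noteq> \<zero>\<^bsub>A\<^esub>}},
     mult = undefined, one = undefined,
     zero = (\<lambda>x. \<zero>\<^bsub>A\<^esub>), add = (\<lambda>f g x. f x \<oplus>\<^bsub>A\<^esub> g x), smult = (\<lambda>a f x. a \<otimes>\<^bsub>A\<^esub> f x)\<rparr>"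

definition unit_vec :: "('a, 'm) ring_scheme \<Rightarrow> 'x \<Rightarrow> 'x \<Rightarrow> 'a" where
  "unit_vec A x = (\<lambda>y. if y = x then \<one>\<^bsub>A\<^esub> else \<zero>\<^bsub>A\<^esub>)"

section \<open>Tensor products\<close>

text \<open>\<open>N \<otimes>\<^sub>A P\<close> is the free module on pairs modulo the bilinearity relations.\<close>

definition tensor_rel :: "('a, 'm) ring_scheme \<Rightarrow> ('a, 'n) module \<Rightarrow> ('a, 'p) module \<Rightarrow>
    ('n \<times> 'p \<Rightarrow> 'a) set" where
  "tensor_rel A N P = (let Q = free_mod A (carrier N \<times> carrier P); d = (\<lambda>x y. unit_vec A (x, y)) in
     {d (x \<oplus>\<^bsub>N\<^esub> x') y \<ominus>\<^bsub>Q\<^esub> (d x y \<oplus>\<^bsub>Q\<^esub> d x' y) | x x' y.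
        x \<in> carrier N \<and> x' \<in> carrier N \<and> y \<in> carrier P} \<union>
     {d x (y \<oplus>\<^bsub>P\<^esub> y') \<ominus>\<^bsub>Q\<^esub> (d x y \<oplus>\<^bsub>Q\<^esub> d x y') | x y y'.
        x \<in> carrier N \<and> y \<in> carrier P \<and> y' \<in> carrier P} \<union>
     {d (a \<odot>\<^bsub>N\<^esub> x) y \<ominus>\<^bsub>Q\<^esub> a \<odot>\<^bsub>Q\<^esub> d x y | a x y.
        a \<in> carrier A \<and> x \<in> carrier N \<and> y \<in> carrier P} \<union>
     {d x (a \<odot>\<^bsub>P\<^esub> y) \<ominus>\<^bsub>Q\<^esub> a \<odot>\<^bsub>Q\<^esub> d x y | a x y.
        a \<in> carrier A \<and> x \<in> carrier N \<and> y \<in> carrier P})"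

definition tensor_ker :: "('a, 'm) ring_scheme \<Rightarrow> ('a, 'n) module \<Rightarrow> ('a, 'p) module \<Rightarrow>
    ('n \<times> 'p \<Rightarrow> 'a) set" where
  "tensor_ker A N P = submod_gen A (free_mod A (carrier N \<times> carrier P)) (tensor_rel A N P)"

definition tensor :: "('a, 'm) ring_scheme \<Rightarrow> ('a, 'n) module \<Rightarrow> ('a, 'p) module \<Rightarrow>
    ('a, ('n \<times> 'p \<Rightarrow> 'a) set) module" where
  "tensor A N P = quot (free_mod A (carrier N \<times> carrier P)) (tensor_ker A N P)"

definition tens :: "('a, 'm) ring_scheme \<Rightarrow> ('a, 'n) module \<Rightarrow> ('a, 'p) module \<Rightarrow>
    'n \<Rightarrow> 'p \<Rightarrow> ('n \<times> 'p \<Rightarrow> 'a) set" where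
  "tens A N P x y = tensor_ker A N P +>\<^bsub>free_mod A (carrier N \<times> carrier P)\<^esub> unit_vec A (x, y)"

text \<open>The linear map \<open>x \<otimes> y \<mapsto> b x y\<close> into the \<open>A\<close>-module \<open>Q\<close> induced by a bilinear map \<open>b\<close>.
  It is computed on an arbitrary representative of the coset \<open>C\<close>.\<close>

definition tensor_lift :: "('a, 'm) ring_scheme \<Rightarrow> ('a, 'q) module \<Rightarrow> ('n \<Rightarrow> 'p \<Rightarrow> 'q) \<Rightarrow>
    ('n \<times> 'p \<Rightarrow> 'a) set \<Rightarrow> 'q" where
  "tensor_lift A Q b C = (let r = (SOME r. r \<in> C) in
     finsum Q (\<lambda>(x, y). r (x, y) \<odot>\<^bsub>Q\<^esub> b x y) {z. r z \<noteq> \<zero>\<^bsub>A\<^esub>})"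

definition tensor_map :: "('a, 'm) ring_scheme \<Rightarrow> ('a, 'n1) module \<Rightarrow> ('a, 'p1) module \<Rightarrow>
    ('n \<Rightarrow> 'n1) \<Rightarrow> ('p \<Rightarrow> 'p1) \<Rightarrow> ('n \<times> 'p \<Rightarrow> 'a) set \<Rightarrow> ('n1 \<times> 'p1 \<Rightarrow> 'a) set" where
  "tensor_map A N1 P1 f g = tensor_lift A (tensor A N1 P1) (\<lambda>x y. tens A N1 P1 (f x) (g y))"

text \<open>For a commutative \<open>A\<close>-algebra \<open>B\<close>: \<open>B \<otimes>\<^sub>A N\<close> as a \<open>B\<close>-module, and as a \<open>B\<close>-algebra
  if \<open>N\<close> is an \<open>A\<close>-algebra.\<close>

definition base_change :: "('a, 'm) ring_scheme \<Rightarrow> ('a, 'b) module \<Rightarrow> ('a, 'n) module \<Rightarrow>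
    ('b, ('b \<times> 'n \<Rightarrow> 'a) set) module" where
  "base_change A B N = (let T = tensor A B N; t = tens A B N in
     \<lparr>carrier = carrier T,
      mult = (\<lambda>u v. tensor_lift A T (\<lambda>b x. tensor_lift A T (\<lambda>c y. t (b \<otimes>\<^bsub>B\<^esub> c) (x \<otimes>\<^bsub>N\<^esub> y)) v) u),
      one = t \<one>\<^bsub>B\<^esub> \<one>\<^bsub>N\<^esub>,
      zero = zero T, add = add T,
      smult = (\<lambda>b. tensor_lift A T (\<lambda>c x. t (b \<otimes>\<^bsub>B\<^esub> c) x))\<rparr>)"

section \<open>Polynomial rings and symmetric algebras\<close>

text \<open>Polynomials over \<open>A\<close> in variables indexed by \<open>V\<close>, in the representation of
  \<^theory>\<open>HOL-Algebra.Indexed_Polynomials\<close>: monomials are multisets.\<close>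

definition mpoly :: "('a, 'm) ring_scheme \<Rightarrow> 'x set \<Rightarrow> ('a, 'x multiset \<Rightarrow> 'a) module" where
  "mpoly A V = \<lparr>carrier = ring.indexed_pset A V (carrier A),
     mult = (\<lambda>p q m. finsum A (\<lambda>k. p k \<otimes>\<^bsub>A\<^esub> q (m - k)) {k. k \<subseteq># m}),
     one = ring.indexed_const A \<one>\<^bsub>A\<^esub>,
     zero = ring.indexed_const A \<zero>\<^bsub>A\<^esub>,
     add = ring.indexed_padd A,
     smult = (\<lambda>a p m. a \<otimes>\<^bsub>A\<^esub> p m)\<rparr>"

text \<open>Substitution of \<open>x s\<close> for the variable \<open>s\<close> in \<open>f\<close>, with values in an \<open>A\<close>-algebra \<open>B\<close> that may be
  noncommutative: \<open>arr\<close> arranges the factors of each monomial in a list.\<close>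

definition poly_eval :: "('a, 'm) ring_scheme \<Rightarrow> ('a, 'b) module \<Rightarrow> ('x multiset \<Rightarrow> 'x list) \<Rightarrow>
    ('x \<Rightarrow> 'b) \<Rightarrow> ('x multiset \<Rightarrow> 'a) \<Rightarrow> 'b" where
  "poly_eval A B arr x f =
     finsum B (\<lambda>m. f m \<odot>\<^bsub>B\<^esub> foldr (\<lambda>s r. x s \<otimes>\<^bsub>B\<^esub> r) (arr m) \<one>\<^bsub>B\<^esub>) {m. f m \<noteq> \<zero>\<^bsub>A\<^esub>}"

text \<open>An arbitrary arrangement, for substitution into commutative algebras.\<close>

definition some_arr :: "'x multiset \<Rightarrow> 'x list" where
  "some_arr m = (SOME l. mset l = m)"

text \<open>\<open>Sym\<^sub>A(N)\<close> is the polynomial ring on the elements of \<open>N\<close> modulo the linear relations.\<close>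

definition sym_ideal :: "('a, 'm) ring_scheme \<Rightarrow> ('a, 'n) module \<Rightarrow> ('n multiset \<Rightarrow> 'a) set" where
  "sym_ideal A N = (let Q = mpoly A (carrier N); V = ring.indexed_var A in
     Idl\<^bsub>Q\<^esub> ({V (x \<oplus>\<^bsub>N\<^esub> y) \<ominus>\<^bsub>Q\<^esub> (V x \<oplus>\<^bsub>Q\<^esub> V y) | x y. x \<in> carrier N \<and> y \<in> carrier N} \<union>
             {V (a \<odot>\<^bsub>N\<^esub> x) \<ominus>\<^bsub>Q\<^esub> a \<odot>\<^bsub>Q\<^esub> V x | a x. a \<in> carrier A \<and> x \<in> carrier N}))"

definition sym_alg :: "('a, 'm) ring_scheme \<Rightarrow> ('a, 'n) module \<Rightarrow> ('a, ('n multiset \<Rightarrow> 'a) set) module" where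
  "sym_alg A N = quot (mpoly A (carrier N)) (sym_ideal A N)"

definition sym_inc :: "('a, 'm) ring_scheme \<Rightarrow> ('a, 'n) module \<Rightarrow> 'n \<Rightarrow> ('n multiset \<Rightarrow> 'a) set" where
  "sym_inc A N x = sym_ideal A N +>\<^bsub>mpoly A (carrier N)\<^esub> ring.indexed_var A x"

section \<open>The ideals of zeros\<close>

definition Z_map :: "('c, 'm) ring_scheme \<Rightarrow> ('c, 'n) module \<Rightarrow> ('c, 'p) module \<Rightarrow> ('n \<Rightarrow> 'p) \<Rightarrow> 'c set" where
  "Z_map C N P u = Idl\<^bsub>C\<^esub> {l (u x) | l x. l \<in> lin C P (self_mod C) \<and> x \<in> carrier N}"

definition Z_elt :: "('c, 'm) ring_scheme \<Rightarrow> ('c, 'p) module \<Rightarrow> 'p \<Rightarrow> 'c set" where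
  "Z_elt C P p = Idl\<^bsub>C\<^esub> {l p | l. l \<in> lin C P (self_mod C)}"

section \<open>The free module \<open>F\<close> and its endomorphisms\<close>

abbreviation FM :: "('a, 'm) ring_scheme \<Rightarrow> nat \<Rightarrow> ('a, nat \<Rightarrow> 'a) module" where
  "FM A n \<equiv> free_mod A {1..n}"

abbreviation EndF :: "('a, 'm) ring_scheme \<Rightarrow> nat \<Rightarrow> ('a, (nat \<Rightarrow> 'a) \<Rightarrow> nat \<Rightarrow> 'a) module" where
  "EndF A n \<equiv> end_alg A (FM A n)"

text \<open>\<open>T\<^sub>i\<^sub>j(T\<^sub>k) = \<delta>\<^sub>j\<^sub>k T\<^sub>i\<close>; hence the coordinate of \<open>g\<close> at \<open>T\<^sub>i\<^sub>j\<close> is the \<open>i\<close>-th coordinate of \<open>g(T\<^sub>j)\<close>.\<close>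

definition T_end :: "('a, 'm) ring_scheme \<Rightarrow> nat \<Rightarrow> nat \<Rightarrow> nat \<Rightarrow> (nat \<Rightarrow> 'a) \<Rightarrow> nat \<Rightarrow> 'a" where
  "T_end A n i j = (\<lambda>v\<in>carrier (FM A n). v j \<odot>\<^bsub>FM A n\<^esub> unit_vec A i)"

definition T_dual :: "('a, 'm) ring_scheme \<Rightarrow> nat \<Rightarrow> nat \<Rightarrow> nat \<Rightarrow> ((nat \<Rightarrow> 'a) \<Rightarrow> nat \<Rightarrow> 'a) \<Rightarrow> 'a" where
  "T_dual A n i j = (\<lambda>g\<in>carrier (EndF A n). g (unit_vec A j) i)"

section \<open>The algebras \<open>H\<close>, \<open>H\<^sub>R\<close> and \<open>H\<^sub>R\<^sup>\<beta>\<close>\<close>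

text \<open>Here \<open>M\<close> is an arbitrary \<open>A\<close>-module and \<open>R\<close> is the quotient of \<open>Sym\<^sub>A(M)\<close> by the ideal \<open>J\<close>.\<close>

definition Sig :: "('a, 'm) ring_scheme \<Rightarrow> nat \<Rightarrow> ('a, 'x) module \<Rightarrow> _" where
  "Sig A n M = sym_alg A (tensor A M (dual_mod A (EndF A n)))"

text \<open>The element \<open>x \<otimes> T\<^sub>i\<^sub>j\<^sup>\<or>\<close> of \<open>\<Sigma>\<close>.\<close>

definition Sig_gen :: "('a, 'm) ring_scheme \<Rightarrow> nat \<Rightarrow> ('a, 'x) module \<Rightarrow> 'x \<Rightarrow> nat \<Rightarrow> nat \<Rightarrow> _" where
  "Sig_gen A n M x i j = sym_inc A (tensor A M (dual_mod A (EndF A n)))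
     (tens A M (dual_mod A (EndF A n)) x (T_dual A n i j))"

definition mu :: "('a, 'm) ring_scheme \<Rightarrow> nat \<Rightarrow> ('a, 'x) module \<Rightarrow> _" where
  "mu A n M = (let \<Sigma> = Sig A n M; E = base_change A \<Sigma> (EndF A n) in
     tensor_lift A (tensor A \<Sigma> (EndF A n))
       (\<lambda>\<sigma> x. \<sigma> \<odot>\<^bsub>E\<^esub> finsum E (\<lambda>(i, j). tens A \<Sigma> (EndF A n) (Sig_gen A n M x i j) (T_end A n i j))
                          ({1..n} \<times> {1..n})))"

definition H_ideal :: "('a, 'm) ring_scheme \<Rightarrow> nat \<Rightarrow> ('a, 'x) module \<Rightarrow> _" where
  "H_ideal A n M = (let \<Sigma> = Sig A n M; E = base_change A \<Sigma> (EndF A n);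
       \<mu>1 = (\<lambda>x. mu A n M (tens A \<Sigma> M \<one>\<^bsub>\<Sigma>\<^esub> x)) in
     Idl\<^bsub>\<Sigma>\<^esub> (\<Union>x\<in>carrier M. \<Union>y\<in>carrier M.
       Z_elt \<Sigma> E (\<mu>1 x \<otimes>\<^bsub>E\<^esub> \<mu>1 y \<ominus>\<^bsub>E\<^esub> \<mu>1 y \<otimes>\<^bsub>E\<^esub> \<mu>1 x)))"

definition Halg :: "('a, 'm) ring_scheme \<Rightarrow> nat \<Rightarrow> ('a, 'x) module \<Rightarrow> _" where
  "Halg A n M = quot (Sig A n M) (H_ideal A n M)"

definition mu_H :: "('a, 'm) ring_scheme \<Rightarrow> nat \<Rightarrow> ('a, 'x) module \<Rightarrow> _" where
  "mu_H A n M = (let \<Sigma> = Sig A n M; H = Halg A n M; P = sym_alg A M; E = EndF A n in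
     (THE g. g \<in> extensional (carrier (base_change A H P)) \<and>
        g \<in> alg_hom H (base_change A H P) (base_change A H E) \<and>
        (\<forall>x\<in>carrier M. g (tens A H P \<one>\<^bsub>H\<^esub> (sym_inc A M x)) =
           tensor_map A H E (\<lambda>\<sigma>. H_ideal A n M +>\<^bsub>\<Sigma>\<^esub> \<sigma>) (\<lambda>t. t)
             (mu A n M (tens A \<Sigma> M \<one>\<^bsub>\<Sigma>\<^esub> x)))))"

definition HR_ideal :: "('a, 'm) ring_scheme \<Rightarrow> nat \<Rightarrow> ('a, 'x) module \<Rightarrow> ('x multiset \<Rightarrow> 'a) set set \<Rightarrow> _" where
  "HR_ideal A n M J = (let H = Halg A n M; P = sym_alg A M in
     Z_map H (base_change A H (P\<lparr>carrier := J\<rparr>)) (base_change A H (EndF A n))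
       (\<lambda>z. mu_H A n M (tensor_map A H P (\<lambda>h. h) (\<lambda>p. p) z)))"

definition HR :: "('a, 'm) ring_scheme \<Rightarrow> nat \<Rightarrow> ('a, 'x) module \<Rightarrow> ('x multiset \<Rightarrow> 'a) set set \<Rightarrow> _" where
  "HR A n M J = quot (Halg A n M) (HR_ideal A n M J)"

definition mu_HR :: "('a, 'm) ring_scheme \<Rightarrow> nat \<Rightarrow> ('a, 'x) module \<Rightarrow> ('x multiset \<Rightarrow> 'a) set set \<Rightarrow> _" where
  "mu_HR A n M J = (let H = Halg A n M; K = HR A n M J; P = sym_alg A M; R = quot P J;
       E = EndF A n; \<pi> = (\<lambda>h. HR_ideal A n M J +>\<^bsub>H\<^esub> h) in
     (THE g. g \<in> extensional (carrier (base_change A K R)) \<and>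
        g \<in> alg_hom K (base_change A K R) (base_change A K E) \<and>
        (\<forall>h\<in>carrier H. \<forall>p\<in>carrier P. g (tens A K R (\<pi> h) (J +>\<^bsub>P\<^esub> p)) =
           tensor_map A K E \<pi> (\<lambda>t. t) (mu_H A n M (tens A H P h p)))))"

text \<open>\<open>\<beta>\<close> is a map \<open>F \<rightarrow> R\<close>, and \<open>e = T\<^sub>1\<close>.\<close>

definition HRb_ideal :: "('a, 'm) ring_scheme \<Rightarrow> nat \<Rightarrow> ('a, 'x) module \<Rightarrow> ('x multiset \<Rightarrow> 'a) set set \<Rightarrow>
    ((nat \<Rightarrow> 'a) \<Rightarrow> ('x multiset \<Rightarrow> 'a) set set) \<Rightarrow> _" where
  "HRb_ideal A n M J \<beta> = (let K = HR A n M J; R = quot (sym_alg A M) J; KF = base_change A K (FM A n);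
       u = (\<lambda>z. tensor_map A K (FM A n) (\<lambda>h. h) (\<lambda>g. g (unit_vec A 1))
                 (mu_HR A n M J (tensor_map A K R (\<lambda>h. h) \<beta> z))) in
     Z_map K KF KF (\<lambda>z. z \<ominus>\<^bsub>KF\<^esub> u z))"

definition HRb :: "('a, 'm) ring_scheme \<Rightarrow> nat \<Rightarrow> ('a, 'x) module \<Rightarrow> ('x multiset \<Rightarrow> 'a) set set \<Rightarrow>
    ((nat \<Rightarrow> 'a) \<Rightarrow> ('x multiset \<Rightarrow> 'a) set set) \<Rightarrow> _" where
  "HRb A n M J \<beta> = quot (HR A n M J) (HRb_ideal A n M J \<beta>)"

section \<open>Matrices\<close>

definition mat_alg :: "nat \<Rightarrow> ('a, 'b) module \<Rightarrow> ('a, nat \<times> nat \<Rightarrow> 'b) module" where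
  "mat_alg n B = (let V = {1..n} \<times> {1..n} in
     \<lparr>carrier = V \<rightarrow>\<^sub>E carrier B,
      mult = (\<lambda>p q. \<lambda>(i, j)\<in>V. finsum B (\<lambda>k. p (i, k) \<otimes>\<^bsub>B\<^esub> q (k, j)) {1..n}),
      one = (\<lambda>(i, j)\<in>V. if i = j then \<one>\<^bsub>B\<^esub> else \<zero>\<^bsub>B\<^esub>),
      zero = (\<lambda>x\<in>V. \<zero>\<^bsub>B\<^esub>),
      add = (\<lambda>p q. \<lambda>x\<in>V. p x \<oplus>\<^bsub>B\<^esub> q x),
      smult = (\<lambda>a p. \<lambda>x\<in>V. a \<odot>\<^bsub>B\<^esub> p x)\<rparr>)"

text \<open>The identification of a matrix \<open>p\<close> over \<open>B\<close> with \<open>\<Sum>\<^sub>i\<^sub>j p\<^sub>i\<^sub>j \<otimes> T\<^sub>i\<^sub>j\<close> in \<open>B \<otimes>\<^sub>A End\<^sub>A(F)\<close>.\<close>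

definition mat_tens :: "('a, 'm) ring_scheme \<Rightarrow> nat \<Rightarrow> ('a, 'b) module \<Rightarrow> (nat \<times> nat \<Rightarrow> 'b) \<Rightarrow> _" where
  "mat_tens A n B p = finsum (base_change A B (EndF A n))
     (\<lambda>(i, j). tens A B (EndF A n) (p (i, j)) (T_end A n i j)) ({1..n} \<times> {1..n})"

text \<open>The action of a matrix on \<open>B \<otimes>\<^sub>A F\<close>, the latter written in the coordinates of the basis
  \<open>1 \<otimes> T\<^sub>k\<close>.\<close>

definition mat_vec :: "nat \<Rightarrow> ('a, 'b) module \<Rightarrow> (nat \<times> nat \<Rightarrow> 'b) \<Rightarrow> (nat \<Rightarrow> 'b) \<Rightarrow> nat \<Rightarrow> 'b" where
  "mat_vec n B p v = (\<lambda>i. if i \<in> {1..n} then finsum B (\<lambda>j. p (i, j) \<otimes>\<^bsub>B\<^esub> v j) {1..n} else \<zero>\<^bsub>B\<^esub>)"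

section \<open>The polynomial ring \<open>A[U]\<close>, its ideals, and the identifications\<close>

abbreviation AU :: "('a, 'm) ring_scheme \<Rightarrow> nat \<Rightarrow> 's set \<Rightarrow>
    ('a, ('s \<times> nat \<times> nat) multiset \<Rightarrow> 'a) module" where
  "AU A n S \<equiv> mpoly A (S \<times> {1..n} \<times> {1..n})"

definition U_mat :: "('a, 'm) ring_scheme \<Rightarrow> nat \<Rightarrow> 's \<Rightarrow> nat \<times> nat \<Rightarrow>
    ('s \<times> nat \<times> nat) multiset \<Rightarrow> 'a" where
  "U_mat A n s = (\<lambda>(i, j)\<in>{1..n} \<times> {1..n}. ring.indexed_var A (s, i, j))"

definition subst_U :: "('a, 'm) ring_scheme \<Rightarrow> nat \<Rightarrow> 's set \<Rightarrow> ('s multiset \<Rightarrow> 's list) \<Rightarrow>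
    ('s multiset \<Rightarrow> 'a) \<Rightarrow> nat \<times> nat \<Rightarrow> ('s \<times> nat \<times> nat) multiset \<Rightarrow> 'a" where
  "subst_U A n S arr f = poly_eval A (mat_alg n (AU A n S)) arr (U_mat A n) f"

definition I1_gens :: "('a, 'm) ring_scheme \<Rightarrow> nat \<Rightarrow> 's set \<Rightarrow> (('s \<times> nat \<times> nat) multiset \<Rightarrow> 'a) set" where
  "I1_gens A n S = (let E = mat_alg n (AU A n S) in
     {(U_mat A n s \<otimes>\<^bsub>E\<^esub> U_mat A n t \<ominus>\<^bsub>E\<^esub> U_mat A n t \<otimes>\<^bsub>E\<^esub> U_mat A n s) (i, j) | s t i j.
        s \<in> S \<and> t \<in> S \<and> i \<in> {1..n} \<and> j \<in> {1..n}})"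

definition I2_gens :: "('a, 'm) ring_scheme \<Rightarrow> nat \<Rightarrow> 's set \<Rightarrow> ('s multiset \<Rightarrow> 's list) \<Rightarrow>
    ('s multiset \<Rightarrow> 'a) set \<Rightarrow> (('s \<times> nat \<times> nat) multiset \<Rightarrow> 'a) set" where
  "I2_gens A n S arr I = {subst_U A n S arr f (i, j) | f i j. f \<in> I \<and> i \<in> {1..n} \<and> j \<in> {1..n}}"

definition I3_gens :: "('a, 'm) ring_scheme \<Rightarrow> nat \<Rightarrow> 's set \<Rightarrow> ('s multiset \<Rightarrow> 's list) \<Rightarrow>
    ((nat \<Rightarrow> 'a) \<Rightarrow> 's multiset \<Rightarrow> 'a) \<Rightarrow> (('s \<times> nat \<times> nat) multiset \<Rightarrow> 'a) set" where
  "I3_gens A n S arr \<beta> = (let B = AU A n S in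
     {(mat_vec n B (subst_U A n S arr (\<beta> (unit_vec A k))) (unit_vec B 1)
         \<ominus>\<^bsub>FM B n\<^esub> unit_vec B k) i | k i. k \<in> {1..n} \<and> i \<in> {1..n}})"

definition I1 :: "('a, 'm) ring_scheme \<Rightarrow> nat \<Rightarrow> 's set \<Rightarrow> (('s \<times> nat \<times> nat) multiset \<Rightarrow> 'a) set" where
  "I1 A n S = Idl\<^bsub>AU A n S\<^esub> (I1_gens A n S)"

definition I2 :: "('a, 'm) ring_scheme \<Rightarrow> nat \<Rightarrow> 's set \<Rightarrow> ('s multiset \<Rightarrow> 's list) \<Rightarrow>
    ('s multiset \<Rightarrow> 'a) set \<Rightarrow> (('s \<times> nat \<times> nat) multiset \<Rightarrow> 'a) set" where
  "I2 A n S arr I = Idl\<^bsub>AU A n S\<^esub> (I2_gens A n S arr I)"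

definition I3 :: "('a, 'm) ring_scheme \<Rightarrow> nat \<Rightarrow> 's set \<Rightarrow> ('s multiset \<Rightarrow> 's list) \<Rightarrow>
    ((nat \<Rightarrow> 'a) \<Rightarrow> 's multiset \<Rightarrow> 'a) \<Rightarrow> (('s \<times> nat \<times> nat) multiset \<Rightarrow> 'a) set" where
  "I3 A n S arr \<beta> = Idl\<^bsub>AU A n S\<^esub> (I3_gens A n S arr \<beta>)"

text \<open>The identifications \<open>A[Y] = Sym\<^sub>A(M)\<close> for \<open>M\<close> free with basis \<open>(Y\<^sub>s)\<close>, and \<open>A[U] = \<Sigma>\<close> via
  \<open>U\<^sup>s\<^sub>i\<^sub>j = Y\<^sub>s \<otimes> T\<^sub>i\<^sub>j\<^sup>\<or>\<close>.\<close>

definition Y_ident :: "('a, 'm) ring_scheme \<Rightarrow> 's set \<Rightarrow> ('s multiset \<Rightarrow> 'a) \<Rightarrow> (('s \<Rightarrow> 'a) multiset \<Rightarrow> 'a) set" where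
  "Y_ident A S = poly_eval A (sym_alg A (free_mod A S)) some_arr
     (\<lambda>s. sym_inc A (free_mod A S) (unit_vec A s))"

definition U_ident :: "('a, 'm) ring_scheme \<Rightarrow> nat \<Rightarrow> 's set \<Rightarrow> (('s \<times> nat \<times> nat) multiset \<Rightarrow> 'a) \<Rightarrow> _" where
  "U_ident A n S = poly_eval A (Sig A n (free_mod A S)) some_arr
     (\<lambda>(s, i, j). Sig_gen A n (free_mod A S) (unit_vec A s) i j)"

end

(*
  The maps p |-> sum_ij p_ij (x) T_ij identify mat_n(C) with C (x) End(F), for every A-algebra C; so
  the ideal of zeros of an element is generated by its n^2 matrix entries, and likewise for the n
  coordinates of an element of C (x) F.  Since M is free on the Y_s and commutators are bilinear, the
  ideal defining H is generated by the entries of the commutators of the generic matrices, that is by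
  I_1.  Over a quotient C of A[U] in which these matrices commute, f |-> f((U^s_ij)) is an algebra
  homomorphism A[Y] -> mat_n(C), and mu_H and mu_{H_R}, being determined by their values on the Y_s,
  are its extensions of scalars.  Reading off entries then shows that the ideals defining H_R in H
  and H_R^beta in H_R are generated by the images of I_2 and I_3; for I_3 one uses that ev_e picks
  the first column.  Composing the successive quotients of A[U] gives the three presentations.
*)
theory Submission
  imports Defs
begin

section \<open>Linear maps\<close>

text \<open>\<open>mu_H\<close> and \<open>mu_HR\<close> are definite descriptions, so nothing can
  be read off from them until a map with the required values has been built and proved unique. Both
  are built by one lifting lemma from an algebra homomorphism into matrices. The obstacle is that
  over A[U] the generic matrices need not commute: substitution is only linear there and depends on
  the chosen order of the factors. Multiplicativity is therefore claimed only in algebras where the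
  generators of I_1 vanish, and the order of the factors is carried along as a fixed but arbitrary
  parameter \<open>arr\<close>. The second device is \<open>surj_ker\<close>: instead of composing
  isomorphisms between quotients, each of H, H_R, H_R^beta is reached by a surjection from A[U]
  whose kernel is recorded as an ideal with explicit generators. Passing to the quotient by the
  ideal generated by the image of a set G merely adds G to these generators, so each presentation
  reduces to showing that the defining ideal of zeros is generated by such an image.\<close>

lemma linI:
  assumes "\<And>x. x \<in> carrier N \<Longrightarrow> f x \<in> carrier P"
    and "\<And>x y. x \<in> carrier N \<Longrightarrow> y \<in> carrier N \<Longrightarrow> f (x \<oplus>\<^bsub>N\<^esub> y) = f x \<oplus>\<^bsub>P\<^esub> f y"
    and "\<And>a x. a \<in> carrier A \<Longrightarrow> x \<in> carrier N \<Longrightarrow> f (a \<odot>\<^bsub>N\<^esub> x) = a \<odot>\<^bsub>P\<^esub> f x"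
  shows "f \<in> lin A N P"
  using assms unfolding lin_def by simp

lemma lin_closed: "f \<in> lin A N P \<Longrightarrow> x \<in> carrier N \<Longrightarrow> f x \<in> carrier P"
  unfolding lin_def by auto

lemma lin_add: "f \<in> lin A N P \<Longrightarrow> x \<in> carrier N \<Longrightarrow> y \<in> carrier N \<Longrightarrow> f (x \<oplus>\<^bsub>N\<^esub> y) = f x \<oplus>\<^bsub>P\<^esub> f y"
  unfolding lin_def by auto

lemma lin_smult: "f \<in> lin A N P \<Longrightarrow> a \<in> carrier A \<Longrightarrow> x \<in> carrier N \<Longrightarrow> f (a \<odot>\<^bsub>N\<^esub> x) = a \<odot>\<^bsub>P\<^esub> f x"
  unfolding lin_def by auto

lemma module_abelian_group: "module A N \<Longrightarrow> abelian_group N"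
  by (rule module.axioms(2))

lemma module_cring: "module A N \<Longrightarrow> cring A"
  by (rule module.axioms(1))

lemma lin_zero:
  assumes "module A N" "module A P" "f \<in> lin A N P"
  shows "f \<zero>\<^bsub>N\<^esub> = \<zero>\<^bsub>P\<^esub>"
proof -
  interpret N: module A N by fact
  interpret P: module A P by fact
  have "f (\<zero>\<^bsub>A\<^esub> \<odot>\<^bsub>N\<^esub> \<zero>\<^bsub>N\<^esub>) = \<zero>\<^bsub>A\<^esub> \<odot>\<^bsub>P\<^esub> f \<zero>\<^bsub>N\<^esub>"
    by (rule lin_smult[OF assms(3)]) simp_all
  then show ?thesis using lin_closed[OF assms(3)] by simp
qed

lemma lin_minus:
  assumes "module A N" "module A P" "f \<in> lin A N P" "x \<in> carrier N" "y \<in> carrier N"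
  shows "f (x \<ominus>\<^bsub>N\<^esub> y) = f x \<ominus>\<^bsub>P\<^esub> f y"
proof -
  interpret N: module A N by fact
  interpret P: module A P by fact
  \<comment> \<open>\<open>lin\<close> records only sums and scalar multiples, so negation is
    expressed as multiplication by -1.\<close>
  have m: "\<ominus>\<^bsub>N\<^esub> y = (\<ominus>\<^bsub>A\<^esub> \<one>\<^bsub>A\<^esub>) \<odot>\<^bsub>N\<^esub> y" using assms(5) by (simp add: N.smult_l_minus)
  have "f (\<ominus>\<^bsub>N\<^esub> y) = (\<ominus>\<^bsub>A\<^esub> \<one>\<^bsub>A\<^esub>) \<odot>\<^bsub>P\<^esub> f y"
    unfolding m by (rule lin_smult[OF assms(3)]) (simp_all add: assms(5))
  also have "\<dots> = \<ominus>\<^bsub>P\<^esub> f y" using lin_closed[OF assms(3)] assms(5) by (simp add: P.smult_l_minus)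
  finally show ?thesis unfolding a_minus_def using assms(3-5) by (simp add: lin_add[OF assms(3)])
qed

lemma lin_comp: "f \<in> lin A N P \<Longrightarrow> g \<in> lin A P Q \<Longrightarrow> (\<lambda>x. g (f x)) \<in> lin A N Q"
proof -
  assume f: "f \<in> lin A N P" and g: "g \<in> lin A P Q"
  show ?thesis
    by (rule linI) (simp_all add: lin_closed[OF f] lin_closed[OF g] lin_add[OF f] lin_add[OF g]
        lin_smult[OF f] lin_smult[OF g])
qed

lemma lin_cong:
  assumes "f \<in> lin A N P" "module A N" "\<And>x. x \<in> carrier N \<Longrightarrow> g x = f x"
  shows "g \<in> lin A N P"
proof -
  interpret N: module A N by fact
  show ?thesis using assms(1,3) by (intro linI) (simp_all add: lin_closed[OF assms(1)] lin_add[OF assms(1)] lin_smult[OF assms(1)])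
qed

lemma lin_id: "(\<lambda>x. x) \<in> lin A N N"
  unfolding lin_def by simp

lemma lin_zero_fun: "module A P \<Longrightarrow> (\<lambda>x. \<zero>\<^bsub>P\<^esub>) \<in> lin A N P"
proof -
  assume "module A P"
  then interpret P: module A P .
  show ?thesis by (rule linI) simp_all
qed

lemma lin_plus:
  assumes "module A P" "f \<in> lin A N P" "g \<in> lin A N P"
  shows "(\<lambda>x. f x \<oplus>\<^bsub>P\<^esub> g x) \<in> lin A N P"
proof -
  interpret P: module A P by fact
  show ?thesis
    using lin_closed[OF assms(2)] lin_closed[OF assms(3)]
    by (intro linI) (simp_all add: lin_add[OF assms(2)] lin_add[OF assms(3)] lin_smult[OF assms(2)]
        lin_smult[OF assms(3)] P.smult_r_distr P.a_ac)
qed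

lemma lin_minus_fun:
  assumes "module A P" "f \<in> lin A N P" "g \<in> lin A N P"
  shows "(\<lambda>x. f x \<ominus>\<^bsub>P\<^esub> g x) \<in> lin A N P"
proof -
  interpret P: module A P by fact
  show ?thesis
    using lin_closed[OF assms(2)] lin_closed[OF assms(3)]
    by (intro linI) (simp_all add: lin_add[OF assms(2)] lin_add[OF assms(3)] lin_smult[OF assms(2)]
        lin_smult[OF assms(3)] P.smult_r_distr P.smult_r_minus a_minus_def P.minus_add P.a_ac)
qed

lemma lin_smult_fun:
  assumes "module A P" "f \<in> lin A N P" "a \<in> carrier A"
  shows "(\<lambda>x. a \<odot>\<^bsub>P\<^esub> f x) \<in> lin A N P"
proof -
  interpret P: module A P by fact
  have c: "b \<odot>\<^bsub>P\<^esub> (a \<odot>\<^bsub>P\<^esub> x) = a \<odot>\<^bsub>P\<^esub> (b \<odot>\<^bsub>P\<^esub> x)" if "b \<in> carrier A" "x \<in> carrier P" for b x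
    using that assms(3) by (simp add: P.smult_assoc1[symmetric] P.m_comm)
  show ?thesis
    using lin_closed[OF assms(2)] assms(3)
    by (intro linI) (simp_all add: lin_add[OF assms(2)] lin_smult[OF assms(2)] P.smult_r_distr c)
qed

section \<open>Finite sums under additive and linear maps\<close>

lemma finsum_additive:
  assumes "abelian_monoid G" "abelian_monoid K"
    and h: "\<And>x. x \<in> carrier G \<Longrightarrow> h x \<in> carrier K"
      "\<And>x y. x \<in> carrier G \<Longrightarrow> y \<in> carrier G \<Longrightarrow> h (x \<oplus>\<^bsub>G\<^esub> y) = h x \<oplus>\<^bsub>K\<^esub> h y" "h \<zero>\<^bsub>G\<^esub> = \<zero>\<^bsub>K\<^esub>"
    and f: "\<And>i. i \<in> Z \<Longrightarrow> f i \<in> carrier G"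
  shows "h (finsum G f Z) = finsum K (\<lambda>i. h (f i)) Z"
proof -
  interpret G: abelian_monoid G by fact
  interpret K: abelian_monoid K by fact
  show ?thesis
  proof (cases "finite Z")
    case True
    then show ?thesis using f
    proof (induction Z)
      case (insert i Z)
      then have "f \<in> Z \<rightarrow> carrier G" "(\<lambda>i. h (f i)) \<in> Z \<rightarrow> carrier K" using h(1) by auto
      with insert show ?case by (simp add: h)
    qed (simp add: h)
  \<comment> \<open>For an infinite index set \<open>finsum\<close> is zero by convention, so the
    identity reduces to h preserving zero.\<close>
  qed (simp add: h(3) G.finsum_infinite K.finsum_infinite)
qed

lemma lin_finsum:
  assumes "module A N" "module A P" "f \<in> lin A N P" "\<And>i. i \<in> Z \<Longrightarrow> g i \<in> carrier N"
  shows "f (finsum N g Z) = finsum P (\<lambda>i. f (g i)) Z"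
proof (rule finsum_additive)
  show "abelian_monoid N" "abelian_monoid P"
    using assms(1,2) by (auto dest: module_abelian_group abelian_group.axioms(1))
  show "f \<zero>\<^bsub>N\<^esub> = \<zero>\<^bsub>P\<^esub>" by (rule lin_zero[OF assms(1-3)])
qed (simp_all add: lin_closed[OF assms(3)] lin_add[OF assms(3)] assms(4))

lemma finsum_cl:
  assumes "module A N" "\<And>i. i \<in> Z \<Longrightarrow> f i \<in> carrier N"
  shows "finsum N f Z \<in> carrier N"
proof -
  interpret N: module A N by fact
  show ?thesis using assms(2) by (intro N.finsum_closed) auto
qed

text \<open>The case of zero serves twice: for the empty sum, and for infinite index sets, where
  \<open>finsum\<close> is zero by convention.\<close>

lemma finsum_induct:
  assumes "abelian_monoid G" "\<And>i. i \<in> Z \<Longrightarrow> f i \<in> carrier G \<and> Pr (f i)"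
    "Pr \<zero>\<^bsub>G\<^esub>" "\<And>x y. x \<in> carrier G \<Longrightarrow> y \<in> carrier G \<Longrightarrow> Pr x \<Longrightarrow> Pr y \<Longrightarrow> Pr (x \<oplus>\<^bsub>G\<^esub> y)"
  shows "Pr (finsum G f Z)"
proof -
  interpret G: abelian_monoid G by fact
  show ?thesis
  proof (cases "finite Z")
    case True
    then show ?thesis using assms(2)
    proof (induction Z)
      case (insert i Z)
      then have f: "f \<in> Z \<rightarrow> carrier G" by simp
      with insert show ?case by (simp add: assms(4))
    qed (simp add: assms(3))
  qed (simp add: assms(3) G.finsum_infinite)
qed

lemma lin_finsum_fun:
  assumes "module A P" "module A N" "\<And>i. i \<in> Z \<Longrightarrow> f i \<in> lin A N P"
  shows "(\<lambda>x. finsum P (\<lambda>i. f i x) Z) \<in> lin A N P"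
proof -
  interpret P: module A P by fact
  interpret N: module A N by fact
  show ?thesis
  proof (cases "finite Z")
    case True
    then show ?thesis using assms(3)
    proof (induction Z)
      case empty
      then show ?case by (simp add: lin_zero_fun assms(1))
    next
      case (insert i Z)
      have "(\<lambda>x. f i x \<oplus>\<^bsub>P\<^esub> finsum P (\<lambda>i. f i x) Z) \<in> lin A N P"
        using insert by (intro lin_plus assms(1)) auto
      moreover have "finsum P (\<lambda>i. f i x) (insert i Z) = f i x \<oplus>\<^bsub>P\<^esub> finsum P (\<lambda>i. f i x) Z"
        if "x \<in> carrier N" for x
        using insert that by (intro P.finsum_insert) (blast intro: lin_closed)+
      ultimately show ?case by (rule lin_cong[OF _ assms(2)])
    qed
  qed (simp add: P.finsum_infinite lin_zero_fun assms(1))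
qed

section \<open>Bilinear maps and free modules\<close>

text \<open>The curried form makes every partial application literally a member of
  \<open>lin\<close>, so facts about linear maps apply in either argument without
  uncurrying.\<close>

definition bilin :: "('a, 'm) ring_scheme \<Rightarrow> ('a, 'n) module \<Rightarrow> ('a, 'p) module \<Rightarrow> ('a, 'q) module \<Rightarrow>
    ('n \<Rightarrow> 'p \<Rightarrow> 'q) \<Rightarrow> bool" where
  "bilin A N P Q b \<longleftrightarrow> (\<forall>x\<in>carrier N. b x \<in> lin A P Q) \<and> (\<forall>y\<in>carrier P. (\<lambda>x. b x y) \<in> lin A N Q)"

lemma bilinD1: "bilin A N P Q b \<Longrightarrow> x \<in> carrier N \<Longrightarrow> b x \<in> lin A P Q"
  unfolding bilin_def by blast

lemma bilinD2: "bilin A N P Q b \<Longrightarrow> y \<in> carrier P \<Longrightarrow> (\<lambda>x. b x y) \<in> lin A N Q"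
  unfolding bilin_def by blast

lemma bilin_closed: "bilin A N P Q b \<Longrightarrow> x \<in> carrier N \<Longrightarrow> y \<in> carrier P \<Longrightarrow> b x y \<in> carrier Q"
  by (rule lin_closed[OF bilinD1])

lemma bilin_comp: "bilin A N P Q b \<Longrightarrow> f \<in> lin A N' N \<Longrightarrow> g \<in> lin A P' P \<Longrightarrow>
    bilin A N' P' Q (\<lambda>x y. b (f x) (g y))"
proof -
  assume b: "bilin A N P Q b" and f: "f \<in> lin A N' N" and g: "g \<in> lin A P' P"
  show ?thesis unfolding bilin_def
    using lin_comp[OF g bilinD1[OF b lin_closed[OF f]]] lin_comp[OF f bilinD2[OF b lin_closed[OF g]]]
    by blast
qed

lemma bilin_post: "bilin A N P Q b \<Longrightarrow> f \<in> lin A Q Q' \<Longrightarrow> bilin A N P Q' (\<lambda>x y. f (b x y))"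
proof -
  assume b: "bilin A N P Q b" and f: "f \<in> lin A Q Q'"
  show ?thesis unfolding bilin_def
    using lin_comp[OF bilinD1[OF b] f] lin_comp[OF bilinD2[OF b] f] by blast
qed

lemma self_mod_simps [simp]:
  "carrier (self_mod A) = carrier A" "mult (self_mod A) = mult A" "one (self_mod A) = one A"
  "zero (self_mod A) = zero A" "add (self_mod A) = add A" "smult (self_mod A) = mult A"
  unfolding self_mod_def by simp_all

section \<open>Records that share their additive structure\<close>

lemma a_inv_cong:
  assumes "carrier G = carrier K" "add G = add K" "zero G = zero K"
  shows "a_inv G = a_inv K"
  unfolding a_inv_def m_inv_def using assms by simp

lemma a_minus_cong:
  assumes "carrier G = carrier K" "add G = add K" "zero G = zero K"
  shows "a_minus G = a_minus K"
  by (intro ext) (simp add: a_minus_def a_inv_cong[OF assms] assms(2))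

text \<open>Moves a sum between records on one carrier, such as \<open>tensor\<close> and
  \<open>base_change\<close>, or a ring and its \<open>self_mod\<close>, which differ only in fields
  that \<open>finsum\<close> does not read.\<close>

lemma finsum_record_cong:
  assumes "carrier G = carrier K" "add G = add K" "zero G = zero K"
  shows "finsum G f Z = finsum K f Z"
  unfolding finsum_def finprod_def using assms by simp

lemma abelian_group_record_cong:
  assumes "abelian_group G" "carrier G = carrier K" "add G = add K" "zero G = zero K"
  shows "abelian_group K"
  using abelian_groupE[OF assms(1)] unfolding assms(2-) by (intro abelian_groupI) simp_all

lemma module_record_cong:
  assumes "module A N" "carrier N = carrier P" "add N = add P" "zero N = zero P" "smult N = smult P"
  shows "module A P"
proof (rule moduleI)
  interpret N: module A N by fact
  show "abelian_group P"
    by (rule abelian_group_record_cong[OF N.abelian_group_axioms assms(2-4)])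
  show "cring A" by (rule module_cring[OF assms(1)])
qed (use module.smult_closed[OF assms(1)] module.smult_l_distr[OF assms(1)]
  module.smult_r_distr[OF assms(1)] module.smult_assoc1[OF assms(1)] module.smult_one[OF assms(1)] in
  \<open>simp_all add: assms(2-5)\<close>)

lemma module_self_mod: "cring A \<Longrightarrow> module A (self_mod A)"
proof -
  assume "cring A"
  then interpret cring A .
  have "abelian_group (self_mod A)"
    by (rule abelian_group_record_cong[OF abelian_group_axioms]) simp_all
  then show ?thesis
    by (intro moduleI) (simp_all add: cring_axioms l_distr r_distr m_assoc)
qed

section \<open>Free modules and linear extension from a basis\<close>

lemma free_mod_simps [simp]:
  "\<zero>\<^bsub>free_mod A V\<^esub> = (\<lambda>x. \<zero>\<^bsub>A\<^esub>)" "add (free_mod A V) = (\<lambda>f g x. f x \<oplus>\<^bsub>A\<^esub> g x)"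
  "smult (free_mod A V) = (\<lambda>a f x. a \<otimes>\<^bsub>A\<^esub> f x)"
  unfolding free_mod_def by simp_all

lemma free_mod_carrier:
  "carrier (free_mod A V) = {f. (\<forall>x. f x \<in> carrier A) \<and> (\<forall>x. x \<notin> V \<longrightarrow> f x = \<zero>\<^bsub>A\<^esub>) \<and>
       finite {x. f x \<noteq> \<zero>\<^bsub>A\<^esub>}}"
  unfolding free_mod_def by simp

lemma free_modI: "(\<And>x. f x \<in> carrier A) \<Longrightarrow> (\<And>x. x \<notin> V \<Longrightarrow> f x = \<zero>\<^bsub>A\<^esub>) \<Longrightarrow> finite {x. f x \<noteq> \<zero>\<^bsub>A\<^esub>} \<Longrightarrow>
    f \<in> carrier (free_mod A V)"
  unfolding free_mod_def by simp

lemma free_mod_coeff: "f \<in> carrier (free_mod A V) \<Longrightarrow> f x \<in> carrier A"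
  unfolding free_mod_def by simp

lemma free_mod_outside: "f \<in> carrier (free_mod A V) \<Longrightarrow> x \<notin> V \<Longrightarrow> f x = \<zero>\<^bsub>A\<^esub>"
  unfolding free_mod_def by simp

lemma free_mod_finite: "f \<in> carrier (free_mod A V) \<Longrightarrow> finite {x. f x \<noteq> \<zero>\<^bsub>A\<^esub>}"
  unfolding free_mod_def by simp

lemma module_free_mod:
  assumes "cring A" shows "module A (free_mod A V)"
proof -
  interpret A: cring A by fact
  have ag: "abelian_group (free_mod A V)"
  proof (rule abelian_groupI)
    fix f g assume fg: "f \<in> carrier (free_mod A V)" "g \<in> carrier (free_mod A V)"
    have "finite {x. f x \<oplus>\<^bsub>A\<^esub> g x \<noteq> \<zero>\<^bsub>A\<^esub>}"
      by (rule finite_subset[OF _ finite_UnI[OF free_mod_finite[OF fg(1)] free_mod_finite[OF fg(2)]]]) auto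
    then show "f \<oplus>\<^bsub>free_mod A V\<^esub> g \<in> carrier (free_mod A V)"
      using fg by (simp add: free_mod_carrier)
    show "f \<oplus>\<^bsub>free_mod A V\<^esub> g = g \<oplus>\<^bsub>free_mod A V\<^esub> f"
      using fg by (simp add: free_mod_carrier A.a_comm)
  next
    fix f assume f: "f \<in> carrier (free_mod A V)"
    have "{x. \<ominus>\<^bsub>A\<^esub> f x \<noteq> \<zero>\<^bsub>A\<^esub>} \<subseteq> {x. f x \<noteq> \<zero>\<^bsub>A\<^esub>}" by auto
    then have "finite {x. \<ominus>\<^bsub>A\<^esub> f x \<noteq> \<zero>\<^bsub>A\<^esub>}" using free_mod_finite[OF f] by (rule finite_subset)
    then have "(\<lambda>x. \<ominus>\<^bsub>A\<^esub> f x) \<in> carrier (free_mod A V)" using f by (simp add: free_mod_carrier)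
    moreover have "(\<lambda>x. \<ominus>\<^bsub>A\<^esub> f x) \<oplus>\<^bsub>free_mod A V\<^esub> f = \<zero>\<^bsub>free_mod A V\<^esub>"
      using f by (simp add: free_mod_carrier A.l_neg)
    ultimately show "\<exists>y\<in>carrier (free_mod A V). y \<oplus>\<^bsub>free_mod A V\<^esub> f = \<zero>\<^bsub>free_mod A V\<^esub>" by blast
  qed (simp_all add: free_mod_carrier A.a_assoc)
  show ?thesis
  proof (rule moduleI[OF A.cring_axioms ag])
    fix a f assume a: "a \<in> carrier A" and f: "f \<in> carrier (free_mod A V)"
    have "{x. a \<otimes>\<^bsub>A\<^esub> f x \<noteq> \<zero>\<^bsub>A\<^esub>} \<subseteq> {x. f x \<noteq> \<zero>\<^bsub>A\<^esub>}" using a by auto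
    then have "finite {x. a \<otimes>\<^bsub>A\<^esub> f x \<noteq> \<zero>\<^bsub>A\<^esub>}" using free_mod_finite[OF f] by (rule finite_subset)
    then show "a \<odot>\<^bsub>free_mod A V\<^esub> f \<in> carrier (free_mod A V)" using a f by (simp add: free_mod_carrier)
  qed (simp_all add: free_mod_carrier A.l_distr A.r_distr A.m_assoc)
qed

lemma unit_vec_closed: "cring A \<Longrightarrow> v \<in> V \<Longrightarrow> unit_vec A v \<in> carrier (free_mod A V)"
proof (rule free_modI)
  assume "cring A"
  then interpret A: cring A .
  show "unit_vec A v x \<in> carrier A" for x by (simp add: unit_vec_def)
  have "{x. unit_vec A v x \<noteq> \<zero>\<^bsub>A\<^esub>} \<subseteq> {v}" by (auto simp: unit_vec_def)
  then show "finite {x. unit_vec A v x \<noteq> \<zero>\<^bsub>A\<^esub>}" by (rule finite_subset) simp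
qed (auto simp: unit_vec_def)

text \<open>The linear extension of a family b on the basis vectors. Both \<open>tensor_lift\<close>
  on a representative and \<open>poly_eval\<close> on a polynomial are instances, which is why the
  sum runs over the support of r.\<close>

definition lsum :: "('a, 'm) ring_scheme \<Rightarrow> ('a, 'q) module \<Rightarrow> ('v \<Rightarrow> 'q) \<Rightarrow> ('v \<Rightarrow> 'a) \<Rightarrow> 'q" where
  "lsum A Q b r = finsum Q (\<lambda>v. r v \<odot>\<^bsub>Q\<^esub> b v) {v. r v \<noteq> \<zero>\<^bsub>A\<^esub>}"

text \<open>Indices outside the support contribute zero multiples. Enlarging the index set lets sums
  with different supports be compared term by term.\<close>

lemma lsum_eq_finsum:
  assumes "module A Q" "finite Z" "{v. r v \<noteq> \<zero>\<^bsub>A\<^esub>} \<subseteq> Z" "\<And>v. v \<in> Z \<Longrightarrow> r v \<in> carrier A"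
    "\<And>v. v \<in> Z \<Longrightarrow> b v \<in> carrier Q"
  shows "lsum A Q b r = finsum Q (\<lambda>v. r v \<odot>\<^bsub>Q\<^esub> b v) Z"
proof -
  interpret Q: module A Q by fact
  show ?thesis unfolding lsum_def
    by (rule Q.add.finprod_mono_neutral_cong_left) (use assms(2-) in auto)
qed

lemma lsum_lin:
  assumes "module A Q" "\<And>v. v \<in> V \<Longrightarrow> b v \<in> carrier Q"
  shows "lsum A Q b \<in> lin A (free_mod A V) Q"
proof -
  interpret Q: module A Q by fact
  have cl: "lsum A Q b r \<in> carrier Q" if "r \<in> carrier (free_mod A V)" for r
    unfolding lsum_def using that assms(2) free_mod_outside[OF that]
    by (intro finsum_cl[OF assms(1)] Q.smult_closed) (auto simp: free_mod_coeff)
  show ?thesis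
  proof (rule linI)
    fix r s assume r: "r \<in> carrier (free_mod A V)" and s: "s \<in> carrier (free_mod A V)"
    \<comment> \<open>A common index set: through cancellation the support of r + s may be strictly
      smaller than this union.\<close>
    define Z where "Z = {v. r v \<noteq> \<zero>\<^bsub>A\<^esub>} \<union> {v. s v \<noteq> \<zero>\<^bsub>A\<^esub>}"
    have Z: "finite Z" "Z \<subseteq> V"
      using r s by (auto simp: Z_def free_mod_finite dest: free_mod_outside)
    have b: "b v \<in> carrier Q" if "v \<in> Z" for v using that Z assms(2) by auto
    have "lsum A Q b (r \<oplus>\<^bsub>free_mod A V\<^esub> s) = finsum Q (\<lambda>v. (r v \<oplus>\<^bsub>A\<^esub> s v) \<odot>\<^bsub>Q\<^esub> b v) Z"
      using r s by (subst lsum_eq_finsum[OF assms(1) Z(1)]) (auto simp: b Z_def free_mod_coeff)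
    also have "\<dots> = finsum Q (\<lambda>v. r v \<odot>\<^bsub>Q\<^esub> b v \<oplus>\<^bsub>Q\<^esub> s v \<odot>\<^bsub>Q\<^esub> b v) Z"
      using r s b by (intro Q.finsum_cong' refl) (simp_all add: free_mod_coeff Q.smult_l_distr)
    also have "\<dots> = finsum Q (\<lambda>v. r v \<odot>\<^bsub>Q\<^esub> b v) Z \<oplus>\<^bsub>Q\<^esub> finsum Q (\<lambda>v. s v \<odot>\<^bsub>Q\<^esub> b v) Z"
      using r s b by (intro Q.finsum_addf) (simp_all add: free_mod_coeff)
    also have "\<dots> = lsum A Q b r \<oplus>\<^bsub>Q\<^esub> lsum A Q b s"
      using r s by (subst (1 2) lsum_eq_finsum[OF assms(1) Z(1)]) (auto simp: b Z_def free_mod_coeff)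
    finally show "lsum A Q b (r \<oplus>\<^bsub>free_mod A V\<^esub> s) = lsum A Q b r \<oplus>\<^bsub>Q\<^esub> lsum A Q b s" .
  next
    fix a r assume a: "a \<in> carrier A" and r: "r \<in> carrier (free_mod A V)"
    \<comment> \<open>The support of a r can shrink when a is a zero divisor, so both sums are taken
      over the support of r.\<close>
    define Z where "Z = {v. r v \<noteq> \<zero>\<^bsub>A\<^esub>}"
    have Z: "finite Z" "Z \<subseteq> V"
      using r by (auto simp: Z_def free_mod_finite dest: free_mod_outside)
    have b: "b v \<in> carrier Q" if "v \<in> Z" for v using that Z assms(2) by auto
    have "lsum A Q b (a \<odot>\<^bsub>free_mod A V\<^esub> r) = finsum Q (\<lambda>v. (a \<otimes>\<^bsub>A\<^esub> r v) \<odot>\<^bsub>Q\<^esub> b v) Z"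
      using a r by (subst lsum_eq_finsum[OF assms(1) Z(1)]) (auto simp: b Z_def free_mod_coeff)
    also have "\<dots> = finsum Q (\<lambda>v. a \<odot>\<^bsub>Q\<^esub> (r v \<odot>\<^bsub>Q\<^esub> b v)) Z"
      using a r b by (intro Q.finsum_cong' refl) (simp_all add: free_mod_coeff Q.smult_assoc1)
    also have "\<dots> = a \<odot>\<^bsub>Q\<^esub> lsum A Q b r"
      unfolding lsum_def Z_def[symmetric] using a r b Z(1)
      by (intro Q.finsum_smult_ldistr[symmetric]) (simp_all add: free_mod_coeff)
    finally show "lsum A Q b (a \<odot>\<^bsub>free_mod A V\<^esub> r) = a \<odot>\<^bsub>Q\<^esub> lsum A Q b r" .
  qed (rule cl)
qed

lemma lsum_unit:
  assumes "module A Q" "b v \<in> carrier Q"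
  shows "lsum A Q b (unit_vec A v) = b v"
proof -
  interpret Q: module A Q by fact
  have "lsum A Q b (unit_vec A v) = finsum Q (\<lambda>w. unit_vec A v w \<odot>\<^bsub>Q\<^esub> b w) {v}"
    by (rule lsum_eq_finsum) (use assms in \<open>auto simp: unit_vec_def split: if_splits\<close>)
  also have "\<dots> = b v" using assms(2) by (simp add: unit_vec_def)
  finally show ?thesis .
qed

lemma coeff_lin: "cring A \<Longrightarrow> (\<lambda>r. r v) \<in> lin A (free_mod A V) (self_mod A)"
  by (rule linI) (simp_all add: free_mod_coeff)

text \<open>Checked coefficient by coefficient: taking the coefficient at w is linear, and only the
  term v = w of the sum survives.\<close>

lemma free_expand:
  assumes "cring A" "r \<in> carrier (free_mod A V)"
  shows "lsum A (free_mod A V) (unit_vec A) r = r"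
proof (rule ext)
  fix w
  interpret A: cring A by fact
  note mf = module_free_mod[OF assms(1), of V]
  interpret F: module A "free_mod A V" by (rule mf)
  note r = free_mod_finite[OF assms(2)] free_mod_coeff[OF assms(2)] free_mod_outside[OF assms(2)]
  have "lsum A (free_mod A V) (unit_vec A) r w =
      finsum (self_mod A) (\<lambda>v. (r v \<odot>\<^bsub>free_mod A V\<^esub> unit_vec A v) w) {v. r v \<noteq> \<zero>\<^bsub>A\<^esub>}"
    unfolding lsum_def using r(3)
    by (intro lin_finsum[OF mf module_self_mod[OF assms(1)] coeff_lin] F.smult_closed unit_vec_closed
       r assms(1)) auto
  also have "\<dots> = finsum A (\<lambda>v. (r v \<odot>\<^bsub>free_mod A V\<^esub> unit_vec A v) w) {v. r v \<noteq> \<zero>\<^bsub>A\<^esub>}"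
    by (rule finsum_record_cong) simp_all
  also have "\<dots> = finsum A (\<lambda>v. if w = v then r v else \<zero>\<^bsub>A\<^esub>) {v. r v \<noteq> \<zero>\<^bsub>A\<^esub>}"
    using r by (intro A.finsum_cong' refl) (auto simp: unit_vec_def)
  also have "\<dots> = r w"
  proof (cases "r w = \<zero>\<^bsub>A\<^esub>")
    case True
    then have "finsum A (\<lambda>v. if w = v then r v else \<zero>\<^bsub>A\<^esub>) {v. r v \<noteq> \<zero>\<^bsub>A\<^esub>} =
        finsum A (\<lambda>v. \<zero>\<^bsub>A\<^esub>) {v. r v \<noteq> \<zero>\<^bsub>A\<^esub>}"
      by (intro A.finsum_cong' refl) auto
    then show ?thesis using True by (simp add: A.finsum_zero)
  next
    case False
    then show ?thesis using r by (intro A.finsum_singleton) auto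
  qed
  finally show "lsum A (free_mod A V) (unit_vec A) r w = r w" .
qed

text \<open>Obtained by rewriting r as its basis expansion. The scalar appears in the generating
  case because the predicate is not assumed to be stable under scalars.\<close>

lemma free_induct:
  assumes "cring A" "r \<in> carrier (free_mod A V)"
    and "Pr (\<lambda>x. \<zero>\<^bsub>A\<^esub>)"
    and "\<And>a v. a \<in> carrier A \<Longrightarrow> v \<in> V \<Longrightarrow> Pr (a \<odot>\<^bsub>free_mod A V\<^esub> unit_vec A v)"
    and "\<And>r s. r \<in> carrier (free_mod A V) \<Longrightarrow> s \<in> carrier (free_mod A V) \<Longrightarrow> Pr r \<Longrightarrow> Pr s \<Longrightarrow>
      Pr (r \<oplus>\<^bsub>free_mod A V\<^esub> s)"
  shows "Pr r"
proof -
  interpret F: module A "free_mod A V" by (rule module_free_mod[OF assms(1)])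
  have "Pr (finsum (free_mod A V) (\<lambda>v. r v \<odot>\<^bsub>free_mod A V\<^esub> unit_vec A v) {v. r v \<noteq> \<zero>\<^bsub>A\<^esub>})"
  proof (rule finsum_induct[where Pr = Pr])
    fix v assume "v \<in> {v. r v \<noteq> \<zero>\<^bsub>A\<^esub>}"
    then have "v \<in> V" "r v \<in> carrier A"
      using free_mod_outside[OF assms(2)] free_mod_coeff[OF assms(2)] by auto
    then show "r v \<odot>\<^bsub>free_mod A V\<^esub> unit_vec A v \<in> carrier (free_mod A V) \<and>
        Pr (r v \<odot>\<^bsub>free_mod A V\<^esub> unit_vec A v)"
      by (intro conjI assms(4) F.smult_closed unit_vec_closed[OF assms(1)])
  next
    show "Pr \<zero>\<^bsub>free_mod A V\<^esub>" using assms(3) by simp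
    show "Pr (r \<oplus>\<^bsub>free_mod A V\<^esub> s)" if "r \<in> carrier (free_mod A V)" "s \<in> carrier (free_mod A V)" "Pr r" "Pr s"
      for r s using that by (rule assms(5))
  qed (rule F.abelian_monoid_axioms)
  then show ?thesis using free_expand[OF assms(1,2)] unfolding lsum_def by (simp only:)
qed

lemma free_ext:
  assumes "module A Q" "f \<in> lin A (free_mod A V) Q" "g \<in> lin A (free_mod A V) Q"
    "\<And>v. v \<in> V \<Longrightarrow> f (unit_vec A v) = g (unit_vec A v)" "r \<in> carrier (free_mod A V)"
  shows "f r = g r"
proof -
  note c = module_cring[OF assms(1)]
  note mf = module_free_mod[OF c, of V]
  show ?thesis
    using c assms(5)
  proof (rule free_induct[where Pr = "\<lambda>r. f r = g r"])
    show "f (\<lambda>x. \<zero>\<^bsub>A\<^esub>) = g (\<lambda>x. \<zero>\<^bsub>A\<^esub>)"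
      using lin_zero[OF mf assms(1) assms(2)] lin_zero[OF mf assms(1) assms(3)] by simp
  next
    fix a v assume "a \<in> carrier A" "v \<in> V"
    then show "f (a \<odot>\<^bsub>free_mod A V\<^esub> unit_vec A v) = g (a \<odot>\<^bsub>free_mod A V\<^esub> unit_vec A v)"
      by (simp only: lin_smult[OF assms(2)] lin_smult[OF assms(3)] unit_vec_closed[OF c] assms(4))
  qed (simp only: lin_add[OF assms(2)] lin_add[OF assms(3)])
qed

text \<open>Linear extension is applied once in each argument: with a basis vector in the first
  argument it gives equality for all s, and then s is held fixed.\<close>

lemma free_bilin_ext:
  assumes "module A Q" "bilin A (free_mod A V) (free_mod A W) Q b" "bilin A (free_mod A V) (free_mod A W) Q b'"
    and "\<And>v w. v \<in> V \<Longrightarrow> w \<in> W \<Longrightarrow> b (unit_vec A v) (unit_vec A w) = b' (unit_vec A v) (unit_vec A w)"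
    and "r \<in> carrier (free_mod A V)" "s \<in> carrier (free_mod A W)"
  shows "b r s = b' r s"
proof -
  have 1: "b (unit_vec A v) s = b' (unit_vec A v) s" if v: "v \<in> V" for v
  proof (rule free_ext[OF assms(1), where f = "b (unit_vec A v)" and g = "b' (unit_vec A v)"])
    have u: "unit_vec A v \<in> carrier (free_mod A V)"
      by (rule unit_vec_closed[OF module_cring[OF assms(1)] v])
    show "b (unit_vec A v) \<in> lin A (free_mod A W) Q" "b' (unit_vec A v) \<in> lin A (free_mod A W) Q"
      by (rule bilinD1[OF assms(2) u], rule bilinD1[OF assms(3) u])
    show "b (unit_vec A v) (unit_vec A w) = b' (unit_vec A v) (unit_vec A w)" if "w \<in> W" for w
      using \<open>v \<in> V\<close> that by (rule assms(4))
  qed (rule assms(6))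
  show ?thesis
    by (rule free_ext[OF assms(1), where f = "\<lambda>r. b r s" and g = "\<lambda>r. b' r s",
        OF bilinD2[OF assms(2,6)] bilinD2[OF assms(3,6)] 1 assms(5)])
qed

lemma module_minus_zero_iff:
  assumes "module A N" "x \<in> carrier N" "y \<in> carrier N"
  shows "x \<ominus>\<^bsub>N\<^esub> y = \<zero>\<^bsub>N\<^esub> \<longleftrightarrow> x = y"
proof -
  interpret N: module A N by fact
  have "(x \<ominus>\<^bsub>N\<^esub> y) \<oplus>\<^bsub>N\<^esub> y = x"
    using assms(2,3) by (simp add: a_minus_def N.a_assoc N.l_neg)
  then show ?thesis using assms(2,3) by (auto simp: a_minus_def N.r_neg)
qed

section \<open>Quotient modules and algebras\<close>

text \<open>\<open>nalg\<close> stands for unital, not necessarily associative algebras: multiplicativity of a linear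
  map between them is all that most arguments need. \<open>galg\<close> adds associativity.\<close>

definition nalg :: "('a, 'm) ring_scheme \<Rightarrow> ('a, 'b) module \<Rightarrow> bool" where
  "nalg A B \<longleftrightarrow> module A B \<and> \<one>\<^bsub>B\<^esub> \<in> carrier B \<and> bilin A B B B (mult B)"

definition galg :: "('a, 'm) ring_scheme \<Rightarrow> ('a, 'b) module \<Rightarrow> bool" where
  "galg A B \<longleftrightarrow> nalg A B \<and> Group.monoid B"

lemma nalg_module: "nalg A B \<Longrightarrow> module A B"
  and nalg_one: "nalg A B \<Longrightarrow> \<one>\<^bsub>B\<^esub> \<in> carrier B"
  and nalg_bilin: "nalg A B \<Longrightarrow> bilin A B B B (mult B)"
  unfolding nalg_def by simp_all

lemma galg_nalg: "galg A B \<Longrightarrow> nalg A B"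
  and galg_monoid: "galg A B \<Longrightarrow> Group.monoid B"
  unfolding galg_def by simp_all

lemma algebra_module: "algebra A B \<Longrightarrow> module A B"
  by (rule algebra.axioms(1))

lemma algebra_cring: "algebra A B \<Longrightarrow> cring B"
  by (rule algebra.axioms(2))

lemma algebra_galg:
  assumes "algebra A B" shows "galg A B"
proof -
  interpret M: cring B by (rule algebra_cring[OF assms])
  interpret algebra A B by fact
  \<comment> \<open>\<open>algebra\<close> states compatibility with scalars for the left factor
    only; commutativity carries it over to the right factor.\<close>
  have c: "x \<otimes>\<^bsub>B\<^esub> (a \<odot>\<^bsub>B\<^esub> y) = a \<odot>\<^bsub>B\<^esub> (x \<otimes>\<^bsub>B\<^esub> y)" if "a \<in> carrier A" "x \<in> carrier B" "y \<in> carrier B" for a x y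
  proof -
    have "x \<otimes>\<^bsub>B\<^esub> (a \<odot>\<^bsub>B\<^esub> y) = (a \<odot>\<^bsub>B\<^esub> y) \<otimes>\<^bsub>B\<^esub> x"
      by (rule M.m_comm) (use that in simp_all)
    also have "\<dots> = a \<odot>\<^bsub>B\<^esub> (x \<otimes>\<^bsub>B\<^esub> y)"
      using that by (simp add: smult_assoc2 M.m_comm[of x y])
    finally show ?thesis .
  qed
  have "bilin A B B B (mult B)"
    unfolding bilin_def by (intro conjI ballI linI) (simp_all add: c smult_assoc2 M.l_distr M.r_distr)
  then show ?thesis
    unfolding galg_def nalg_def by (simp add: module_axioms M.monoid_axioms)
qed

lemma algebra_nalg: "algebra A B \<Longrightarrow> nalg A B"
  by (rule galg_nalg[OF algebra_galg])

text \<open>The elements of T all have the form p x, so each module law descends from N. The fact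
  \<open>ball\<close> turns quantification over T into quantification over N, which avoids choosing
  preimages one at a time.\<close>

lemma module_image:
  assumes "module A N" and p: "p ` carrier N = carrier T"
    and add: "\<And>x y. x \<in> carrier N \<Longrightarrow> y \<in> carrier N \<Longrightarrow> p x \<oplus>\<^bsub>T\<^esub> p y = p (x \<oplus>\<^bsub>N\<^esub> y)"
    and zero: "\<zero>\<^bsub>T\<^esub> = p \<zero>\<^bsub>N\<^esub>"
    and smult: "\<And>a x. a \<in> carrier A \<Longrightarrow> x \<in> carrier N \<Longrightarrow> a \<odot>\<^bsub>T\<^esub> p x = p (a \<odot>\<^bsub>N\<^esub> x)"
  shows "module A T"
proof -
  interpret N: module A N by fact
  have ball: "(\<forall>x\<in>carrier T. R x) \<longleftrightarrow> (\<forall>x\<in>carrier N. R (p x))" for R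
    unfolding p[symmetric] by blast
  have cl: "p x \<in> carrier T" if "x \<in> carrier N" for x using that p by blast
  have "abelian_group T"
  proof (rule abelian_groupI)
    have "\<forall>x\<in>carrier T. \<forall>y\<in>carrier T. x \<oplus>\<^bsub>T\<^esub> y \<in> carrier T"
      unfolding ball by (simp add: add cl)
    then show "x \<oplus>\<^bsub>T\<^esub> y \<in> carrier T" if "x \<in> carrier T" "y \<in> carrier T" for x y using that by blast
    show "\<zero>\<^bsub>T\<^esub> \<in> carrier T" unfolding zero by (rule cl) simp
    have "\<forall>x\<in>carrier T. \<forall>y\<in>carrier T. \<forall>z\<in>carrier T. x \<oplus>\<^bsub>T\<^esub> y \<oplus>\<^bsub>T\<^esub> z = x \<oplus>\<^bsub>T\<^esub> (y \<oplus>\<^bsub>T\<^esub> z)"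
      unfolding ball by (simp add: add N.a_assoc)
    then show "x \<oplus>\<^bsub>T\<^esub> y \<oplus>\<^bsub>T\<^esub> z = x \<oplus>\<^bsub>T\<^esub> (y \<oplus>\<^bsub>T\<^esub> z)"
      if "x \<in> carrier T" "y \<in> carrier T" "z \<in> carrier T" for x y z using that by blast
    have "\<forall>x\<in>carrier T. \<forall>y\<in>carrier T. x \<oplus>\<^bsub>T\<^esub> y = y \<oplus>\<^bsub>T\<^esub> x"
      unfolding ball by (simp add: add N.a_comm)
    then show "x \<oplus>\<^bsub>T\<^esub> y = y \<oplus>\<^bsub>T\<^esub> x" if "x \<in> carrier T" "y \<in> carrier T" for x y using that by blast
    have "\<forall>x\<in>carrier T. \<zero>\<^bsub>T\<^esub> \<oplus>\<^bsub>T\<^esub> x = x"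
      unfolding ball zero by (simp add: add)
    then show "\<zero>\<^bsub>T\<^esub> \<oplus>\<^bsub>T\<^esub> x = x" if "x \<in> carrier T" for x using that by blast
    have "\<forall>x\<in>carrier T. \<exists>y\<in>carrier T. y \<oplus>\<^bsub>T\<^esub> x = \<zero>\<^bsub>T\<^esub>"
      unfolding ball
    proof
      fix x assume x: "x \<in> carrier N"
      then have "p (\<ominus>\<^bsub>N\<^esub> x) \<oplus>\<^bsub>T\<^esub> p x = \<zero>\<^bsub>T\<^esub>" by (simp add: add zero N.l_neg)
      then show "\<exists>y\<in>carrier T. y \<oplus>\<^bsub>T\<^esub> p x = \<zero>\<^bsub>T\<^esub>" using cl[of "\<ominus>\<^bsub>N\<^esub> x"] x by auto
    qed
    then show "\<exists>y\<in>carrier T. y \<oplus>\<^bsub>T\<^esub> x = \<zero>\<^bsub>T\<^esub>" if "x \<in> carrier T" for x using that by blast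
  qed
  then show ?thesis
  proof (rule moduleI[OF N.is_cring])
    have "\<forall>x\<in>carrier T. \<forall>a\<in>carrier A. a \<odot>\<^bsub>T\<^esub> x \<in> carrier T"
      unfolding ball by (simp add: smult cl)
    then show "a \<odot>\<^bsub>T\<^esub> x \<in> carrier T" if "a \<in> carrier A" "x \<in> carrier T" for a x using that by blast
    have "\<forall>x\<in>carrier T. \<forall>a\<in>carrier A. \<forall>b\<in>carrier A. (a \<oplus>\<^bsub>A\<^esub> b) \<odot>\<^bsub>T\<^esub> x = a \<odot>\<^bsub>T\<^esub> x \<oplus>\<^bsub>T\<^esub> b \<odot>\<^bsub>T\<^esub> x"
      unfolding ball by (simp add: smult add N.smult_l_distr)
    then show "(a \<oplus>\<^bsub>A\<^esub> b) \<odot>\<^bsub>T\<^esub> x = a \<odot>\<^bsub>T\<^esub> x \<oplus>\<^bsub>T\<^esub> b \<odot>\<^bsub>T\<^esub> x"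
      if "a \<in> carrier A" "b \<in> carrier A" "x \<in> carrier T" for a b x using that by blast
    have "\<forall>x\<in>carrier T. \<forall>y\<in>carrier T. \<forall>a\<in>carrier A. a \<odot>\<^bsub>T\<^esub> (x \<oplus>\<^bsub>T\<^esub> y) = a \<odot>\<^bsub>T\<^esub> x \<oplus>\<^bsub>T\<^esub> a \<odot>\<^bsub>T\<^esub> y"
      unfolding ball by (simp add: smult add N.smult_r_distr)
    then show "a \<odot>\<^bsub>T\<^esub> (x \<oplus>\<^bsub>T\<^esub> y) = a \<odot>\<^bsub>T\<^esub> x \<oplus>\<^bsub>T\<^esub> a \<odot>\<^bsub>T\<^esub> y"
      if "a \<in> carrier A" "x \<in> carrier T" "y \<in> carrier T" for a x y using that by blast
    have "\<forall>x\<in>carrier T. \<forall>a\<in>carrier A. \<forall>b\<in>carrier A. (a \<otimes>\<^bsub>A\<^esub> b) \<odot>\<^bsub>T\<^esub> x = a \<odot>\<^bsub>T\<^esub> (b \<odot>\<^bsub>T\<^esub> x)"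
      unfolding ball by (simp add: smult N.smult_assoc1)
    then show "(a \<otimes>\<^bsub>A\<^esub> b) \<odot>\<^bsub>T\<^esub> x = a \<odot>\<^bsub>T\<^esub> (b \<odot>\<^bsub>T\<^esub> x)"
      if "a \<in> carrier A" "b \<in> carrier A" "x \<in> carrier T" for a b x using that by blast
    have "\<forall>x\<in>carrier T. \<one>\<^bsub>A\<^esub> \<odot>\<^bsub>T\<^esub> x = x"
      unfolding ball by (simp add: smult)
    then show "\<one>\<^bsub>A\<^esub> \<odot>\<^bsub>T\<^esub> x = x" if "x \<in> carrier T" for x using that by blast
  qed
qed

lemma algebra_image:
  assumes "algebra A B" and p: "p ` carrier B = carrier T"
    and add: "\<And>x y. x \<in> carrier B \<Longrightarrow> y \<in> carrier B \<Longrightarrow> p x \<oplus>\<^bsub>T\<^esub> p y = p (x \<oplus>\<^bsub>B\<^esub> y)"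
    and zero: "\<zero>\<^bsub>T\<^esub> = p \<zero>\<^bsub>B\<^esub>"
    and smult: "\<And>a x. a \<in> carrier A \<Longrightarrow> x \<in> carrier B \<Longrightarrow> a \<odot>\<^bsub>T\<^esub> p x = p (a \<odot>\<^bsub>B\<^esub> x)"
    and mult: "\<And>x y. x \<in> carrier B \<Longrightarrow> y \<in> carrier B \<Longrightarrow> p x \<otimes>\<^bsub>T\<^esub> p y = p (x \<otimes>\<^bsub>B\<^esub> y)"
    and one: "\<one>\<^bsub>T\<^esub> = p \<one>\<^bsub>B\<^esub>"
  shows "algebra A T"
proof -
  interpret BM: cring B by (rule algebra_cring[OF assms(1)])
  interpret B: algebra A B by fact
  have mT: "module A T"
    by (rule module_image[OF B.module_axioms p add zero smult])
  interpret T: module A T by (rule mT)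
  have ball: "(\<forall>x\<in>carrier T. R x) \<longleftrightarrow> (\<forall>x\<in>carrier B. R (p x))" for R
    unfolding p[symmetric] by blast
  have cl: "p x \<in> carrier T" if "x \<in> carrier B" for x using that p by blast
  have "Group.comm_monoid T"
  proof (rule comm_monoidI)
    have "\<forall>x\<in>carrier T. \<forall>y\<in>carrier T. x \<otimes>\<^bsub>T\<^esub> y \<in> carrier T"
      unfolding ball by (simp add: mult cl)
    then show "x \<otimes>\<^bsub>T\<^esub> y \<in> carrier T" if "x \<in> carrier T" "y \<in> carrier T" for x y using that by blast
    show "\<one>\<^bsub>T\<^esub> \<in> carrier T" unfolding one by (rule cl) simp
    have "\<forall>x\<in>carrier T. \<forall>y\<in>carrier T. \<forall>z\<in>carrier T. x \<otimes>\<^bsub>T\<^esub> y \<otimes>\<^bsub>T\<^esub> z = x \<otimes>\<^bsub>T\<^esub> (y \<otimes>\<^bsub>T\<^esub> z)"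
      unfolding ball by (simp add: mult BM.m_assoc)
    then show "x \<otimes>\<^bsub>T\<^esub> y \<otimes>\<^bsub>T\<^esub> z = x \<otimes>\<^bsub>T\<^esub> (y \<otimes>\<^bsub>T\<^esub> z)"
      if "x \<in> carrier T" "y \<in> carrier T" "z \<in> carrier T" for x y z using that by blast
    have "\<forall>x\<in>carrier T. \<forall>y\<in>carrier T. x \<otimes>\<^bsub>T\<^esub> y = y \<otimes>\<^bsub>T\<^esub> x"
      unfolding ball by (simp add: mult BM.m_comm)
    then show "x \<otimes>\<^bsub>T\<^esub> y = y \<otimes>\<^bsub>T\<^esub> x" if "x \<in> carrier T" "y \<in> carrier T" for x y using that by blast
    have "\<forall>x\<in>carrier T. \<one>\<^bsub>T\<^esub> \<otimes>\<^bsub>T\<^esub> x = x"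
      unfolding ball one by (simp add: mult)
    then show "\<one>\<^bsub>T\<^esub> \<otimes>\<^bsub>T\<^esub> x = x" if "x \<in> carrier T" for x using that by blast
  qed
  moreover have "\<forall>x\<in>carrier T. \<forall>y\<in>carrier T. \<forall>z\<in>carrier T. (x \<oplus>\<^bsub>T\<^esub> y) \<otimes>\<^bsub>T\<^esub> z = x \<otimes>\<^bsub>T\<^esub> z \<oplus>\<^bsub>T\<^esub> y \<otimes>\<^bsub>T\<^esub> z"
    unfolding ball by (simp add: mult add BM.l_distr)
  ultimately have "cring T"
    by (intro cringI T.abelian_group_axioms) blast+
  moreover have "\<forall>x\<in>carrier T. \<forall>y\<in>carrier T. \<forall>a\<in>carrier A. (a \<odot>\<^bsub>T\<^esub> x) \<otimes>\<^bsub>T\<^esub> y = a \<odot>\<^bsub>T\<^esub> (x \<otimes>\<^bsub>T\<^esub> y)"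
    unfolding ball by (simp add: mult smult B.smult_assoc2)
  ultimately show ?thesis
    unfolding algebra_def algebra_axioms_def using mT by blast
qed

lemma submodule_abelian_subgroup:
  assumes "module A Q" "submodule K A Q"
  shows "abelian_subgroup K Q"
  by (rule abelian_subgroupI3[OF additive_subgroupI[OF submodule.axioms(1)[OF assms(2)]]
      module_abelian_group[OF assms(1)]])

lemma quot_simps [simp]: "zero (quot Q K) = K" "one (quot Q K) = K +>\<^bsub>Q\<^esub> \<one>\<^bsub>Q\<^esub>"
  unfolding quot_def by simp_all

lemma quot_carrier: "carrier (quot Q K) = (+>\<^bsub>Q\<^esub>) K ` carrier Q"
  unfolding quot_def A_RCOSETS_def' a_r_coset_def' by auto

lemma quot_add:
  assumes "module A Q" "submodule K A Q" "x \<in> carrier Q" "y \<in> carrier Q"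
  shows "(K +>\<^bsub>Q\<^esub> x) \<oplus>\<^bsub>quot Q K\<^esub> (K +>\<^bsub>Q\<^esub> y) = K +>\<^bsub>Q\<^esub> (x \<oplus>\<^bsub>Q\<^esub> y)"
  using abelian_subgroup.a_rcos_sum[OF submodule_abelian_subgroup[OF assms(1,2)] assms(3,4)]
  unfolding quot_def by simp

lemma coset_eq_iff:
  assumes "module A Q" "submodule K A Q" "x \<in> carrier Q" "y \<in> carrier Q"
  shows "K +>\<^bsub>Q\<^esub> x = K +>\<^bsub>Q\<^esub> y \<longleftrightarrow> x \<ominus>\<^bsub>Q\<^esub> y \<in> K"
proof -
  interpret abelian_subgroup K Q by (rule submodule_abelian_subgroup[OF assms(1,2)])
  have "K +>\<^bsub>Q\<^esub> x = K +>\<^bsub>Q\<^esub> y \<longleftrightarrow> x \<in> K +>\<^bsub>Q\<^esub> y"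
    using a_repr_independence'[of x y] a_repr_independenceD[of x y] assms(3,4) by auto
  also have "\<dots> \<longleftrightarrow> x \<ominus>\<^bsub>Q\<^esub> y \<in> K"
    unfolding a_minus_def by (rule a_rcos_module[OF assms(4,3)])
  finally show ?thesis .
qed

text \<open>The definition takes a union over all representatives of the coset. A scalar sends
  representatives that differ by an element of K to elements that again differ by an element of K,
  so all members of the union are one and the same coset.\<close>

lemma quot_smult:
  assumes "module A Q" "submodule K A Q" "a \<in> carrier A" "x \<in> carrier Q"
  shows "a \<odot>\<^bsub>quot Q K\<^esub> (K +>\<^bsub>Q\<^esub> x) = K +>\<^bsub>Q\<^esub> (a \<odot>\<^bsub>Q\<^esub> x)"
proof -
  interpret Q: module A Q by fact
  interpret abelian_subgroup K Q by (rule submodule_abelian_subgroup[OF assms(1,2)])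
  have "K +>\<^bsub>Q\<^esub> (a \<odot>\<^bsub>Q\<^esub> y) = K +>\<^bsub>Q\<^esub> (a \<odot>\<^bsub>Q\<^esub> x)" if "y \<in> K +>\<^bsub>Q\<^esub> x" for y
  proof -
    have y: "y \<in> carrier Q" by (rule a_elemrcos_carrier[OF assms(4) that])
    have "y \<oplus>\<^bsub>Q\<^esub> \<ominus>\<^bsub>Q\<^esub> x \<in> K" by (rule a_rcos_module_imp[OF assms(4) that])
    then have "a \<odot>\<^bsub>Q\<^esub> (y \<oplus>\<^bsub>Q\<^esub> \<ominus>\<^bsub>Q\<^esub> x) \<in> K" by (rule submodule.smult_closed[OF assms(2,3)])
    then have "a \<odot>\<^bsub>Q\<^esub> y \<ominus>\<^bsub>Q\<^esub> a \<odot>\<^bsub>Q\<^esub> x \<in> K"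
      using assms(3,4) y by (simp add: Q.smult_r_distr Q.smult_r_minus a_minus_def)
    then show ?thesis
      using coset_eq_iff[OF assms(1,2), of "a \<odot>\<^bsub>Q\<^esub> y" "a \<odot>\<^bsub>Q\<^esub> x"] assms(3,4) y by simp
  qed
  then have "(\<Union>y\<in>K +>\<^bsub>Q\<^esub> x. K +>\<^bsub>Q\<^esub> (a \<odot>\<^bsub>Q\<^esub> y)) = (\<Union>y\<in>K +>\<^bsub>Q\<^esub> x. K +>\<^bsub>Q\<^esub> (a \<odot>\<^bsub>Q\<^esub> x))"
    by (rule SUP_cong[OF refl])
  also have "\<dots> = K +>\<^bsub>Q\<^esub> (a \<odot>\<^bsub>Q\<^esub> x)"
    using a_rcos_self[OF assms(4)] by (intro SUP_const) blast
  finally show ?thesis unfolding quot_def by (simp only: module.simps)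
qed

lemma coset_zero:
  assumes "module A Q" "submodule K A Q"
  shows "K +>\<^bsub>Q\<^esub> \<zero>\<^bsub>Q\<^esub> = K"
proof -
  interpret abelian_subgroup K Q by (rule submodule_abelian_subgroup[OF assms(1,2)])
  show ?thesis by (rule a_rcos_const) simp
qed

lemma module_quot:
  assumes "module A Q" "submodule K A Q"
  shows "module A (quot Q K)"
  by (rule module_image[OF assms(1), where p = "(+>\<^bsub>Q\<^esub>) K"])
    (simp_all add: quot_carrier quot_add[OF assms] quot_smult[OF assms] coset_zero[OF assms])

lemma quot_proj_lin:
  assumes "module A Q" "submodule K A Q"
  shows "(+>\<^bsub>Q\<^esub>) K \<in> lin A Q (quot Q K)"
  by (rule linI) (simp_all add: quot_carrier quot_add[OF assms] quot_smult[OF assms])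

text \<open>Scalars from A act through elements of B, as a x = (a 1) x, so absorption by B gives
  stability under A.\<close>

lemma ideal_submodule:
  assumes "algebra A B" "ideal K B"
  shows "submodule K A B"
proof -
  interpret BM: cring B by (rule algebra_cring[OF assms(1)])
  interpret B: algebra A B by fact
  interpret K: ideal K B by fact
  show ?thesis
  proof (rule B.submoduleI)
    show "K \<subseteq> carrier B" by (rule K.a_subset)
    fix a x assume a: "a \<in> carrier A" and x: "x \<in> K"
    then have "a \<odot>\<^bsub>B\<^esub> x = (a \<odot>\<^bsub>B\<^esub> \<one>\<^bsub>B\<^esub>) \<otimes>\<^bsub>B\<^esub> x" by (simp add: B.smult_assoc2 K.a_Hcarr)
    then show "a \<odot>\<^bsub>B\<^esub> x \<in> K" using a x by (simp add: K.I_l_closed)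
  qed simp_all
qed

lemma quot_mult:
  assumes "ideal K B" "x \<in> carrier B" "y \<in> carrier B"
  shows "(K +>\<^bsub>B\<^esub> x) \<otimes>\<^bsub>quot B K\<^esub> (K +>\<^bsub>B\<^esub> y) = K +>\<^bsub>B\<^esub> (x \<otimes>\<^bsub>B\<^esub> y)"
  using ideal.rcoset_mult_add[OF assms] unfolding quot_def by simp

lemma algebra_quot:
  assumes "algebra A B" "ideal K B"
  shows "algebra A (quot B K)"
proof -
  note f = algebra_module[OF assms(1)] ideal_submodule[OF assms]
  show ?thesis
    by (rule algebra_image[OF assms(1), where p = "(+>\<^bsub>B\<^esub>) K"])
      (simp_all add: quot_carrier quot_add[OF f] quot_smult[OF f] coset_zero[OF f] quot_mult[OF assms(2)])
qed

section \<open>Homomorphisms of algebras\<close>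

lemma alg_homI:
  assumes "f \<in> lin A B C"
    and "\<And>x y. x \<in> carrier B \<Longrightarrow> y \<in> carrier B \<Longrightarrow> f (x \<otimes>\<^bsub>B\<^esub> y) = f x \<otimes>\<^bsub>C\<^esub> f y"
    and "f \<one>\<^bsub>B\<^esub> = \<one>\<^bsub>C\<^esub>"
  shows "f \<in> alg_hom A B C"
  using assms lin_closed[OF assms(1)] lin_add[OF assms(1)] unfolding alg_hom_def ring_hom_def by blast

lemma alg_hom_lin: "f \<in> alg_hom A B C \<Longrightarrow> f \<in> lin A B C"
  unfolding alg_hom_def by blast

lemma alg_hom_mult: "f \<in> alg_hom A B C \<Longrightarrow> x \<in> carrier B \<Longrightarrow> y \<in> carrier B \<Longrightarrow> f (x \<otimes>\<^bsub>B\<^esub> y) = f x \<otimes>\<^bsub>C\<^esub> f y"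
  unfolding alg_hom_def ring_hom_def by blast

lemma alg_hom_one: "f \<in> alg_hom A B C \<Longrightarrow> f \<one>\<^bsub>B\<^esub> = \<one>\<^bsub>C\<^esub>"
  unfolding alg_hom_def ring_hom_def by blast

lemma alg_hom_comp:
  assumes f: "f \<in> alg_hom A B C" and g: "g \<in> alg_hom A C D"
  shows "(\<lambda>x. g (f x)) \<in> alg_hom A B D"
  using lin_closed[OF alg_hom_lin[OF f]]
  by (intro alg_homI lin_comp[OF alg_hom_lin[OF f] alg_hom_lin[OF g]])
    (simp_all add: alg_hom_mult[OF f] alg_hom_mult[OF g] alg_hom_one[OF f] alg_hom_one[OF g])

lemma quot_proj_alg_hom:
  assumes "algebra A B" "ideal K B"
  shows "(+>\<^bsub>B\<^esub>) K \<in> alg_hom A B (quot B K)"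
  by (intro alg_homI quot_proj_lin algebra_module ideal_submodule assms)
    (simp_all add: quot_mult[OF assms(2)])

lemma submod_gen:
  assumes "module A Q" "G \<subseteq> carrier Q"
  shows "submodule (submod_gen A Q G) A Q" "G \<subseteq> submod_gen A Q G"
    "\<And>K. submodule K A Q \<Longrightarrow> G \<subseteq> K \<Longrightarrow> submod_gen A Q G \<subseteq> K"
proof -
  interpret Q: module A Q by fact
  have c: "submodule (carrier Q) A Q" by (rule Q.carrier_is_submodule)
  show "submodule (submod_gen A Q G) A Q"
    unfolding submod_gen_def
  proof (rule Q.submoduleI)
    show "\<Inter> {K. submodule K A Q \<and> G \<subseteq> K} \<subseteq> carrier Q" using c assms(2) by blast
    have "\<zero>\<^bsub>Q\<^esub> \<in> K" if "submodule K A Q" for K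
      using abelian_subgroup.axioms(1)[OF submodule_abelian_subgroup[OF assms(1) that]]
      by (simp add: additive_subgroup.zero_closed)
    then show "\<zero>\<^bsub>Q\<^esub> \<in> \<Inter> {K. submodule K A Q \<and> G \<subseteq> K}" by blast
  qed (use Q.submoduleE(3-5) in blast)+
  show "G \<subseteq> submod_gen A Q G" unfolding submod_gen_def by blast
  show "\<And>K. submodule K A Q \<Longrightarrow> G \<subseteq> K \<Longrightarrow> submod_gen A Q G \<subseteq> K" unfolding submod_gen_def by blast
qed

lemma kernel_submodule:
  assumes "module A Q" "module A P" "f \<in> lin A Q P"
  shows "submodule {x \<in> carrier Q. f x = \<zero>\<^bsub>P\<^esub>} A Q"
proof -
  interpret Q: module A Q by fact
  interpret P: module A P by fact
  note z = lin_zero[OF assms]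
  show ?thesis
  proof (rule Q.submoduleI)
    fix a assume a: "a \<in> {x \<in> carrier Q. f x = \<zero>\<^bsub>P\<^esub>}"
    then have "f (\<zero>\<^bsub>Q\<^esub> \<ominus>\<^bsub>Q\<^esub> a) = \<zero>\<^bsub>P\<^esub> \<ominus>\<^bsub>P\<^esub> \<zero>\<^bsub>P\<^esub>" using lin_minus[OF assms, of "\<zero>\<^bsub>Q\<^esub>" a] z by simp
    then show "\<ominus>\<^bsub>Q\<^esub> a \<in> {x \<in> carrier Q. f x = \<zero>\<^bsub>P\<^esub>}" using a by (simp add: a_minus_def)
  qed (simp_all add: z lin_add[OF assms(3)] lin_smult[OF assms(3)] subset_iff)
qed

section \<open>Tensor products\<close>

lemma tensor_rel_carrier:
  assumes "module A N" "module A P"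
  shows "tensor_rel A N P \<subseteq> carrier (free_mod A (carrier N \<times> carrier P))"
proof -
  interpret N: module A N by fact
  interpret P: module A P by fact
  let ?F = "free_mod A (carrier N \<times> carrier P)"
  interpret F: module A ?F by (rule module_free_mod[OF N.is_cring])
  have u: "unit_vec A (x, y) \<in> carrier ?F" if "x \<in> carrier N" "y \<in> carrier P" for x y
    using that by (intro unit_vec_closed[OF N.is_cring]) simp
  have "d \<ominus>\<^bsub>?F\<^esub> (e \<oplus>\<^bsub>?F\<^esub> f) \<in> carrier ?F" if "d \<in> carrier ?F" "e \<in> carrier ?F" "f \<in> carrier ?F" for d e f
    by (intro F.minus_closed F.a_closed that)
  moreover have "d \<ominus>\<^bsub>?F\<^esub> (a \<odot>\<^bsub>?F\<^esub> e) \<in> carrier ?F" if "d \<in> carrier ?F" "e \<in> carrier ?F" "a \<in> carrier A" for d e a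
    by (intro F.minus_closed F.smult_closed that)
  ultimately show ?thesis
    unfolding tensor_rel_def Let_def
    by (intro Un_least subsetI; clarify) (simp_all only: u N.a_closed P.a_closed N.smult_closed P.smult_closed)
qed

lemma tensor_ker_submodule:
  assumes "module A N" "module A P"
  shows "submodule (tensor_ker A N P) A (free_mod A (carrier N \<times> carrier P))"
  unfolding tensor_ker_def
  by (intro submod_gen module_free_mod module_cring[OF assms(1)] tensor_rel_carrier assms)

lemma module_tensor:
  assumes "module A N" "module A P"
  shows "module A (tensor A N P)"
  unfolding tensor_def
  by (intro module_quot module_free_mod module_cring[OF assms(1)] tensor_ker_submodule assms)

lemma tens_closed:
  assumes "module A N" "module A P" "x \<in> carrier N" "y \<in> carrier P"
  shows "tens A N P x y \<in> carrier (tensor A N P)"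
  unfolding tensor_def tens_def quot_carrier using assms
  by (intro imageI unit_vec_closed module_cring[OF assms(1)]) simp

text \<open>Each of the four families of relations is one of the four laws, additivity and
  homogeneity in either argument, read as a congruence modulo \<open>tensor_ker\<close>.\<close>

lemma tens_bilin:
  assumes "module A N" "module A P"
  shows "bilin A N P (tensor A N P) (tens A N P)"
proof -
  interpret N: module A N by fact
  interpret P: module A P by fact
  let ?F = "free_mod A (carrier N \<times> carrier P)" and ?K = "tensor_ker A N P"
  have mF: "module A ?F" by (rule module_free_mod[OF N.is_cring])
  interpret F: module A ?F by (rule mF)
  note sK = tensor_ker_submodule[OF assms]
  have u: "unit_vec A (x, y) \<in> carrier ?F" if "x \<in> carrier N" "y \<in> carrier P" for x y
    using that by (intro unit_vec_closed[OF N.is_cring]) simp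
  have rel: "z \<in> ?K" if "z \<in> tensor_rel A N P" for z
    using submod_gen(2)[OF mF tensor_rel_carrier[OF assms]] that unfolding tensor_ker_def by blast
  note eq = coset_eq_iff[OF mF sK, THEN iffD2]
  show ?thesis
    unfolding bilin_def
  proof (intro conjI ballI linI)
    fix x y y' assume *: "x \<in> carrier N" "y \<in> carrier P" "y' \<in> carrier P"
    have "unit_vec A (x, y \<oplus>\<^bsub>P\<^esub> y') \<ominus>\<^bsub>?F\<^esub> (unit_vec A (x, y) \<oplus>\<^bsub>?F\<^esub> unit_vec A (x, y')) \<in> ?K"
      by (rule rel) (use * in \<open>unfold tensor_rel_def Let_def, blast\<close>)
    then have "tens A N P x (y \<oplus>\<^bsub>P\<^esub> y') = ?K +>\<^bsub>?F\<^esub> (unit_vec A (x, y) \<oplus>\<^bsub>?F\<^esub> unit_vec A (x, y'))"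
      unfolding tens_def by (intro eq u F.a_closed P.a_closed *)
    then show "tens A N P x (y \<oplus>\<^bsub>P\<^esub> y') = tens A N P x y \<oplus>\<^bsub>tensor A N P\<^esub> tens A N P x y'"
      unfolding tens_def tensor_def by (simp only: quot_add[OF mF sK u u] *)
  next
    fix x x' y assume *: "y \<in> carrier P" "x \<in> carrier N" "x' \<in> carrier N"
    have "unit_vec A (x \<oplus>\<^bsub>N\<^esub> x', y) \<ominus>\<^bsub>?F\<^esub> (unit_vec A (x, y) \<oplus>\<^bsub>?F\<^esub> unit_vec A (x', y)) \<in> ?K"
      by (rule rel) (use * in \<open>unfold tensor_rel_def Let_def, blast\<close>)
    then have "tens A N P (x \<oplus>\<^bsub>N\<^esub> x') y = ?K +>\<^bsub>?F\<^esub> (unit_vec A (x, y) \<oplus>\<^bsub>?F\<^esub> unit_vec A (x', y))"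
      unfolding tens_def by (intro eq u F.a_closed N.a_closed *)
    then show "tens A N P (x \<oplus>\<^bsub>N\<^esub> x') y = tens A N P x y \<oplus>\<^bsub>tensor A N P\<^esub> tens A N P x' y"
      unfolding tens_def tensor_def by (simp only: quot_add[OF mF sK u u] *)
  next
    fix x a y assume *: "x \<in> carrier N" "a \<in> carrier A" "y \<in> carrier P"
    have "unit_vec A (x, a \<odot>\<^bsub>P\<^esub> y) \<ominus>\<^bsub>?F\<^esub> (a \<odot>\<^bsub>?F\<^esub> unit_vec A (x, y)) \<in> ?K"
      by (rule rel) (use * in \<open>unfold tensor_rel_def Let_def, blast\<close>)
    then have "tens A N P x (a \<odot>\<^bsub>P\<^esub> y) = ?K +>\<^bsub>?F\<^esub> (a \<odot>\<^bsub>?F\<^esub> unit_vec A (x, y))"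
      unfolding tens_def by (intro eq u F.smult_closed P.smult_closed *)
    then show "tens A N P x (a \<odot>\<^bsub>P\<^esub> y) = a \<odot>\<^bsub>tensor A N P\<^esub> tens A N P x y"
      unfolding tens_def tensor_def by (simp only: quot_smult[OF mF sK _ u] *)
  next
    fix y a x assume *: "y \<in> carrier P" "a \<in> carrier A" "x \<in> carrier N"
    have "unit_vec A (a \<odot>\<^bsub>N\<^esub> x, y) \<ominus>\<^bsub>?F\<^esub> (a \<odot>\<^bsub>?F\<^esub> unit_vec A (x, y)) \<in> ?K"
      by (rule rel) (use * in \<open>unfold tensor_rel_def Let_def, blast\<close>)
    then have "tens A N P (a \<odot>\<^bsub>N\<^esub> x) y = ?K +>\<^bsub>?F\<^esub> (a \<odot>\<^bsub>?F\<^esub> unit_vec A (x, y))"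
      unfolding tens_def by (intro eq u F.smult_closed N.smult_closed *)
    then show "tens A N P (a \<odot>\<^bsub>N\<^esub> x) y = a \<odot>\<^bsub>tensor A N P\<^esub> tens A N P x y"
      unfolding tens_def tensor_def by (simp only: quot_smult[OF mF sK _ u] *)
  qed (simp_all only: tens_closed[OF assms])
qed

text \<open>Pure tensors and sums are the only cases: a multiple of x \<otimes> y is the pure tensor
  (a x) \<otimes> y, and zero is a pure tensor of zeros.\<close>

lemma tensor_induct:
  assumes "module A N" "module A P" "z \<in> carrier (tensor A N P)"
    and tens: "\<And>x y. x \<in> carrier N \<Longrightarrow> y \<in> carrier P \<Longrightarrow> Pr (tens A N P x y)"
    and add: "\<And>z w. z \<in> carrier (tensor A N P) \<Longrightarrow> w \<in> carrier (tensor A N P) \<Longrightarrow> Pr z \<Longrightarrow> Pr w \<Longrightarrow>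
      Pr (z \<oplus>\<^bsub>tensor A N P\<^esub> w)"
  shows "Pr z"
proof -
  interpret N: module A N by fact
  interpret P: module A P by fact
  let ?F = "free_mod A (carrier N \<times> carrier P)" and ?K = "tensor_ker A N P"
  have mF: "module A ?F" by (rule module_free_mod[OF N.is_cring])
  interpret F: module A ?F by (rule mF)
  note sK = tensor_ker_submodule[OF assms(1,2)]
  have u: "unit_vec A (x, y) \<in> carrier ?F" if "x \<in> carrier N" "y \<in> carrier P" for x y
    using that by (intro unit_vec_closed[OF N.is_cring]) simp
  have sm: "?K +>\<^bsub>?F\<^esub> (a \<odot>\<^bsub>?F\<^esub> unit_vec A (x, y)) = tens A N P (a \<odot>\<^bsub>N\<^esub> x) y"
    if "a \<in> carrier A" "x \<in> carrier N" "y \<in> carrier P" for a x y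
    using lin_smult[OF bilinD2[OF tens_bilin[OF assms(1,2)] that(3)] that(1,2)]
      quot_smult[OF mF sK that(1) u[OF that(2,3)]]
    unfolding tens_def tensor_def by (simp only:)
  obtain r where r: "r \<in> carrier ?F" "z = ?K +>\<^bsub>?F\<^esub> r"
    using assms(3) unfolding tensor_def quot_carrier by blast
  have "Pr (?K +>\<^bsub>?F\<^esub> r)"
  proof (rule free_induct[where Pr = "\<lambda>r. Pr (?K +>\<^bsub>?F\<^esub> r)", OF N.is_cring r(1)])
    have "?K +>\<^bsub>?F\<^esub> (\<zero>\<^bsub>A\<^esub> \<odot>\<^bsub>?F\<^esub> unit_vec A (\<zero>\<^bsub>N\<^esub>, \<zero>\<^bsub>P\<^esub>)) = tens A N P (\<zero>\<^bsub>A\<^esub> \<odot>\<^bsub>N\<^esub> \<zero>\<^bsub>N\<^esub>) \<zero>\<^bsub>P\<^esub>"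
      by (rule sm) simp_all
    moreover have "\<zero>\<^bsub>A\<^esub> \<odot>\<^bsub>?F\<^esub> unit_vec A (\<zero>\<^bsub>N\<^esub>, \<zero>\<^bsub>P\<^esub>) = \<zero>\<^bsub>?F\<^esub>"
      by (rule F.smult_l_null[OF u]) simp_all
    ultimately have "?K +>\<^bsub>?F\<^esub> (\<lambda>x. \<zero>\<^bsub>A\<^esub>) = tens A N P (\<zero>\<^bsub>A\<^esub> \<odot>\<^bsub>N\<^esub> \<zero>\<^bsub>N\<^esub>) \<zero>\<^bsub>P\<^esub>" by simp
    then show "Pr (?K +>\<^bsub>?F\<^esub> (\<lambda>x. \<zero>\<^bsub>A\<^esub>))" by (simp only: tens N.smult_closed N.zero_closed P.zero_closed N.R.zero_closed)
  next
    fix a v assume a: "a \<in> carrier A" and v: "v \<in> carrier N \<times> carrier P"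
    obtain x y where xy: "v = (x, y)" "x \<in> carrier N" "y \<in> carrier P" using v by blast
    show "Pr (?K +>\<^bsub>?F\<^esub> (a \<odot>\<^bsub>?F\<^esub> unit_vec A v))"
      unfolding xy(1) sm[OF a xy(2,3)] by (intro tens N.smult_closed a xy)
  next
    fix r s assume *: "r \<in> carrier ?F" "s \<in> carrier ?F" "Pr (?K +>\<^bsub>?F\<^esub> r)" "Pr (?K +>\<^bsub>?F\<^esub> s)"
    have "Pr ((?K +>\<^bsub>?F\<^esub> r) \<oplus>\<^bsub>tensor A N P\<^esub> (?K +>\<^bsub>?F\<^esub> s))"
      by (rule add) (use * in \<open>simp_all add: tensor_def quot_carrier\<close>)
    then show "Pr (?K +>\<^bsub>?F\<^esub> (r \<oplus>\<^bsub>?F\<^esub> s))"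
      unfolding tensor_def by (simp only: quot_add[OF mF sK *(1,2)])
  qed
  then show ?thesis using r by simp
qed

lemma tensor_ext:
  assumes "module A N" "module A P" "f \<in> lin A (tensor A N P) Q" "g \<in> lin A (tensor A N P) Q"
    and "\<And>x y. x \<in> carrier N \<Longrightarrow> y \<in> carrier P \<Longrightarrow> f (tens A N P x y) = g (tens A N P x y)"
    and "z \<in> carrier (tensor A N P)"
  shows "f z = g z"
  by (rule tensor_induct[where Pr = "\<lambda>z. f z = g z", OF assms(1,2,6) assms(5)])
    (simp_all only: lin_add[OF assms(3)] lin_add[OF assms(4)])

lemma tensor_bilin_ext:
  assumes "module A N" "module A P" "module A N'" "module A P'"
    and b: "bilin A (tensor A N P) (tensor A N' P') Q b" and b': "bilin A (tensor A N P) (tensor A N' P') Q b'"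
    and eq: "\<And>x y x' y'. x \<in> carrier N \<Longrightarrow> y \<in> carrier P \<Longrightarrow> x' \<in> carrier N' \<Longrightarrow> y' \<in> carrier P' \<Longrightarrow>
      b (tens A N P x y) (tens A N' P' x' y') = b' (tens A N P x y) (tens A N' P' x' y')"
    and z: "z \<in> carrier (tensor A N P)" "w \<in> carrier (tensor A N' P')"
  shows "b z w = b' z w"
proof (rule tensor_ext[OF assms(1,2), where f = "\<lambda>z. b z w" and g = "\<lambda>z. b' z w", OF _ _ _ z(1)])
  show "(\<lambda>z. b z w) \<in> lin A (tensor A N P) Q" "(\<lambda>z. b' z w) \<in> lin A (tensor A N P) Q"
    by (rule bilinD2[OF b z(2)], rule bilinD2[OF b' z(2)])
  fix x y assume xy: "x \<in> carrier N" "y \<in> carrier P"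
  note t = tens_closed[OF assms(1,2) xy]
  show "b (tens A N P x y) w = b' (tens A N P x y) w"
    by (rule tensor_ext[OF assms(3,4) bilinD1[OF b t] bilinD1[OF b' t] eq[OF xy] z(2)])
qed

text \<open>The linear extension of b to the free module on pairs kills the four families of
  relations, hence the submodule they generate. Its value on the representative chosen in
  \<open>tensor_lift\<close> is therefore the same as on any other.\<close>

lemma tensor_lift:
  assumes "module A N" "module A P" "module A Q" and b: "bilin A N P Q b"
  shows "tensor_lift A Q b \<in> lin A (tensor A N P) Q"
    and "\<And>x y. x \<in> carrier N \<Longrightarrow> y \<in> carrier P \<Longrightarrow> tensor_lift A Q b (tens A N P x y) = b x y"
proof -
  interpret N: module A N by fact
  interpret P: module A P by fact
  interpret Q: module A Q by fact
  let ?F = "free_mod A (carrier N \<times> carrier P)" and ?K = "tensor_ker A N P"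
  define c where "c = (\<lambda>(x, y). b x y)"
  let ?L = "lsum A Q c"
  have c: "c v \<in> carrier Q" if "v \<in> carrier N \<times> carrier P" for v
    using that bilin_closed[OF b] unfolding c_def by (auto simp only: split_paired_all case_prod_conv mem_Sigma_iff)
  have mF: "module A ?F" by (rule module_free_mod[OF N.is_cring])
  interpret F: module A ?F by (rule mF)
  note sK = tensor_ker_submodule[OF assms(1,2)]
  interpret K: abelian_subgroup ?K ?F by (rule submodule_abelian_subgroup[OF mF sK])
  have L: "?L \<in> lin A ?F Q" by (rule lsum_lin[OF assms(3) c])
  have u: "unit_vec A (x, y) \<in> carrier ?F" if "x \<in> carrier N" "y \<in> carrier P" for x y
    using that by (intro unit_vec_closed[OF N.is_cring]) simp
  have Lu: "?L (unit_vec A (x, y)) = b x y" if "x \<in> carrier N" "y \<in> carrier P" for x y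
  proof -
    have "?L (unit_vec A (x, y)) = c (x, y)"
      using that by (intro lsum_unit assms(3) c SigmaI)
    then show ?thesis by (simp only: c_def case_prod_conv)
  qed
  note bl = lin_add[OF bilinD1[OF b]] lin_add[OF bilinD2[OF b]] lin_smult[OF bilinD1[OF b]] lin_smult[OF bilinD2[OF b]]
  have "tensor_rel A N P \<subseteq> {r \<in> carrier ?F. ?L r = \<zero>\<^bsub>Q\<^esub>}"
  proof
    fix z assume z: "z \<in> tensor_rel A N P"
    then have zF: "z \<in> carrier ?F" using tensor_rel_carrier[OF assms(1,2)] by blast
    have r0: "q \<ominus>\<^bsub>Q\<^esub> q = \<zero>\<^bsub>Q\<^esub>" if "q \<in> carrier Q" for q using that by (simp add: a_minus_def Q.r_neg)
    \<comment> \<open>Two patterns cover the four families: \<open>L1\<close> treats the additivity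
      relations, \<open>L2\<close> the homogeneity relations.\<close>
    have L1: "?L (d \<ominus>\<^bsub>?F\<^esub> (e \<oplus>\<^bsub>?F\<^esub> f)) = \<zero>\<^bsub>Q\<^esub>" if "d \<in> carrier ?F" "e \<in> carrier ?F" "f \<in> carrier ?F"
      "?L d = ?L e \<oplus>\<^bsub>Q\<^esub> ?L f" for d e f
      by (simp only: lin_minus[OF mF assms(3) L] lin_add[OF L] that F.a_closed)
        (simp only: r0 Q.a_closed lin_closed[OF L] that)
    have L2: "?L (d \<ominus>\<^bsub>?F\<^esub> (a \<odot>\<^bsub>?F\<^esub> e)) = \<zero>\<^bsub>Q\<^esub>" if "d \<in> carrier ?F" "e \<in> carrier ?F" "a \<in> carrier A"
      "?L d = a \<odot>\<^bsub>Q\<^esub> ?L e" for d e a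
      by (simp only: lin_minus[OF mF assms(3) L] lin_smult[OF L] that F.smult_closed)
        (simp only: r0 Q.smult_closed lin_closed[OF L] that)
    from z consider
      x x' y where "z = unit_vec A (x \<oplus>\<^bsub>N\<^esub> x', y) \<ominus>\<^bsub>?F\<^esub> (unit_vec A (x, y) \<oplus>\<^bsub>?F\<^esub> unit_vec A (x', y))"
        "x \<in> carrier N" "x' \<in> carrier N" "y \<in> carrier P"
    | x y y' where "z = unit_vec A (x, y \<oplus>\<^bsub>P\<^esub> y') \<ominus>\<^bsub>?F\<^esub> (unit_vec A (x, y) \<oplus>\<^bsub>?F\<^esub> unit_vec A (x, y'))"
        "x \<in> carrier N" "y \<in> carrier P" "y' \<in> carrier P"
    | a x y where "z = unit_vec A (a \<odot>\<^bsub>N\<^esub> x, y) \<ominus>\<^bsub>?F\<^esub> a \<odot>\<^bsub>?F\<^esub> unit_vec A (x, y)"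
        "a \<in> carrier A" "x \<in> carrier N" "y \<in> carrier P"
    | a x y where "z = unit_vec A (x, a \<odot>\<^bsub>P\<^esub> y) \<ominus>\<^bsub>?F\<^esub> a \<odot>\<^bsub>?F\<^esub> unit_vec A (x, y)"
        "a \<in> carrier A" "x \<in> carrier N" "y \<in> carrier P"
      unfolding tensor_rel_def Let_def by blast
    then have "?L z = \<zero>\<^bsub>Q\<^esub>"
    proof cases
      case 1
      show ?thesis unfolding 1(1)
        by (rule L1) (use 1 in \<open>simp_all only: u Lu bl N.a_closed\<close>)
    next
      case 2
      show ?thesis unfolding 2(1)
        by (rule L1) (use 2 in \<open>simp_all only: u Lu bl P.a_closed\<close>)
    next
      case 3
      show ?thesis unfolding 3(1)
        by (rule L2) (use 3 in \<open>simp_all only: u Lu bl N.smult_closed\<close>)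
    next
      case 4
      show ?thesis unfolding 4(1)
        by (rule L2) (use 4 in \<open>simp_all only: u Lu bl P.smult_closed\<close>)
    qed
    with zF show "z \<in> {r \<in> carrier ?F. ?L r = \<zero>\<^bsub>Q\<^esub>}" by blast
  qed
  then have "?K \<subseteq> {r \<in> carrier ?F. ?L r = \<zero>\<^bsub>Q\<^esub>}"
    unfolding tensor_ker_def
    by (rule submod_gen(3)[OF mF tensor_rel_carrier[OF assms(1,2)] kernel_submodule[OF mF assms(3) L]])
  then have K0: "?L k = \<zero>\<^bsub>Q\<^esub>" "k \<in> carrier ?F" if "k \<in> ?K" for k using that by blast+
  have lift: "tensor_lift A Q b (?K +>\<^bsub>?F\<^esub> r) = ?L r" if r: "r \<in> carrier ?F" for r
  proof -
    \<comment> \<open>The representative picked by the choice inside \<open>tensor_lift\<close>. It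
      differs from r by an element of \<open>?K\<close>, on which the extension vanishes.\<close>
    define r' where "r' = (SOME r'. r' \<in> ?K +>\<^bsub>?F\<^esub> r)"
    have r': "r' \<in> ?K +>\<^bsub>?F\<^esub> r"
      unfolding r'_def by (rule someI[where x = r]) (rule K.a_rcos_self[OF r])
    have r'F: "r' \<in> carrier ?F" by (rule K.a_elemrcos_carrier[OF r r'])
    have "r' \<ominus>\<^bsub>?F\<^esub> r \<in> ?K" unfolding a_minus_def by (rule K.a_rcos_module_imp[OF r r'])
    then have "?L r' \<ominus>\<^bsub>Q\<^esub> ?L r = \<zero>\<^bsub>Q\<^esub>"
      using K0 lin_minus[OF mF assms(3) L r'F r] by (simp only:)
    then have "?L r' = ?L r" using lin_closed[OF L r] lin_closed[OF L r'F] by (simp only: module_minus_zero_iff[OF assms(3)])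
    moreover have "tensor_lift A Q b (?K +>\<^bsub>?F\<^esub> r) = ?L r'"
      unfolding tensor_lift_def Let_def r'_def[symmetric] lsum_def c_def by (simp only: case_prod_unfold prod.collapse)
    ultimately show ?thesis by simp
  qed
  show "tensor_lift A Q b \<in> lin A (tensor A N P) Q"
  proof (rule linI)
    fix z assume "z \<in> carrier (tensor A N P)"
    then obtain r where r: "r \<in> carrier ?F" "z = ?K +>\<^bsub>?F\<^esub> r"
      unfolding tensor_def quot_carrier by blast
    show "tensor_lift A Q b z \<in> carrier Q" by (simp only: r lift lin_closed[OF L])
    show "tensor_lift A Q b (a \<odot>\<^bsub>tensor A N P\<^esub> z) = a \<odot>\<^bsub>Q\<^esub> tensor_lift A Q b z" if a: "a \<in> carrier A" for a
      unfolding tensor_def r(2) by (simp only: quot_smult[OF mF sK a r(1)] lift r(1) a F.smult_closed lin_smult[OF L])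
    fix w assume "w \<in> carrier (tensor A N P)"
    then obtain s where s: "s \<in> carrier ?F" "w = ?K +>\<^bsub>?F\<^esub> s"
      unfolding tensor_def quot_carrier by blast
    show "tensor_lift A Q b (z \<oplus>\<^bsub>tensor A N P\<^esub> w) = tensor_lift A Q b z \<oplus>\<^bsub>Q\<^esub> tensor_lift A Q b w"
      unfolding tensor_def r(2) s(2)
      by (simp only: quot_add[OF mF sK r(1) s(1)] lift r(1) s(1) F.a_closed lin_add[OF L])
  qed
  show "tensor_lift A Q b (tens A N P x y) = b x y" if "x \<in> carrier N" "y \<in> carrier P" for x y
    unfolding tens_def lift[OF u[OF that]] by (rule Lu[OF that])
qed

lemma tensor_map:
  assumes "module A N" "module A P" "module A N1" "module A P1" "f \<in> lin A N N1" "g \<in> lin A P P1"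
  shows "tensor_map A N1 P1 f g \<in> lin A (tensor A N P) (tensor A N1 P1)"
    and "\<And>x y. x \<in> carrier N \<Longrightarrow> y \<in> carrier P \<Longrightarrow>
      tensor_map A N1 P1 f g (tens A N P x y) = tens A N1 P1 (f x) (g y)"
  unfolding tensor_map_def
  by (fact tensor_lift[OF assms(1,2) module_tensor[OF assms(3,4)]
      bilin_comp[OF tens_bilin[OF assms(3,4)] assms(5,6)]])+

section \<open>Base change\<close>

text \<open>Restriction of scalars along A \<rightarrow> C, a \<mapsto> a 1. The multiplication and
  unit of Q are kept so that the result can also be the codomain of homomorphisms of
  A-algebras.\<close>

definition restr :: "('a, 'm) ring_scheme \<Rightarrow> ('a, 'c) module \<Rightarrow> ('c, 'q) module \<Rightarrow> ('a, 'q) module" where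
  "restr A C Q = \<lparr>carrier = carrier Q, mult = mult Q, one = one Q, zero = zero Q, add = add Q,
     smult = (\<lambda>a x. (a \<odot>\<^bsub>C\<^esub> \<one>\<^bsub>C\<^esub>) \<odot>\<^bsub>Q\<^esub> x)\<rparr>"

lemma restr_simps [simp]:
  "carrier (restr A C Q) = carrier Q" "mult (restr A C Q) = mult Q" "one (restr A C Q) = one Q"
  "zero (restr A C Q) = zero Q" "add (restr A C Q) = add Q"
  "smult (restr A C Q) = (\<lambda>a x. (a \<odot>\<^bsub>C\<^esub> \<one>\<^bsub>C\<^esub>) \<odot>\<^bsub>Q\<^esub> x)"
  unfolding restr_def by simp_all

lemma module_restr:
  assumes "algebra A C" "module C Q"
  shows "module A (restr A C Q)"
proof -
  interpret C': cring C by (rule algebra_cring[OF assms(1)])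
  interpret C: algebra A C by fact
  interpret Q: module C Q by fact
  have 1: "(a \<otimes>\<^bsub>A\<^esub> b) \<odot>\<^bsub>C\<^esub> \<one>\<^bsub>C\<^esub> = (a \<odot>\<^bsub>C\<^esub> \<one>\<^bsub>C\<^esub>) \<otimes>\<^bsub>C\<^esub> (b \<odot>\<^bsub>C\<^esub> \<one>\<^bsub>C\<^esub>)" if "a \<in> carrier A" "b \<in> carrier A" for a b
    using that by (simp add: C.smult_assoc2 C.smult_assoc1)
  show ?thesis
  proof (rule moduleI)
    show "abelian_group (restr A C Q)"
      by (rule abelian_group_record_cong[OF Q.abelian_group_axioms]) simp_all
  qed (simp_all add: C.R_cring C.smult_l_distr Q.smult_l_distr Q.smult_r_distr 1 Q.smult_assoc1)
qed

lemma lin_restr: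
  assumes "algebra A C" "module C N" "f \<in> lin C N Q"
  shows "f \<in> lin A (restr A C N) (restr A C Q)"
proof -
  interpret C': cring C by (rule algebra_cring[OF assms(1)])
  interpret C: algebra A C by fact
  show ?thesis
    by (rule linI) (simp_all add: lin_closed[OF assms(3)] lin_add[OF assms(3)] lin_smult[OF assms(3)])
qed

text \<open>Homogeneity in the second argument rests on the commutativity of C, and in the first on
  a c = (a 1) c.\<close>

lemma smult_restr_bilin:
  assumes "algebra A C" "module C Q"
  shows "bilin A C (restr A C Q) (restr A C Q) (smult Q)"
proof -
  interpret C': cring C by (rule algebra_cring[OF assms(1)])
  interpret C: algebra A C by fact
  interpret Q: module C Q by fact
  have 2: "c \<odot>\<^bsub>Q\<^esub> ((a \<odot>\<^bsub>C\<^esub> \<one>\<^bsub>C\<^esub>) \<odot>\<^bsub>Q\<^esub> x) = (a \<odot>\<^bsub>C\<^esub> \<one>\<^bsub>C\<^esub>) \<odot>\<^bsub>Q\<^esub> (c \<odot>\<^bsub>Q\<^esub> x)"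
    if "c \<in> carrier C" "a \<in> carrier A" "x \<in> carrier Q" for c a x
  proof -
    have d: "a \<odot>\<^bsub>C\<^esub> \<one>\<^bsub>C\<^esub> \<in> carrier C" by (rule C.smult_closed[OF that(2) C'.one_closed])
    show ?thesis
      by (simp only: Q.smult_assoc1[OF that(1) d that(3), symmetric]
          Q.smult_assoc1[OF d that(1,3), symmetric] C'.m_comm[OF that(1) d])
  qed
  have 3: "(a \<odot>\<^bsub>C\<^esub> c) \<odot>\<^bsub>Q\<^esub> x = (a \<odot>\<^bsub>C\<^esub> \<one>\<^bsub>C\<^esub>) \<odot>\<^bsub>Q\<^esub> (c \<odot>\<^bsub>Q\<^esub> x)" if "a \<in> carrier A" "c \<in> carrier C" "x \<in> carrier Q" for a c x
  proof -
    have d: "a \<odot>\<^bsub>C\<^esub> \<one>\<^bsub>C\<^esub> \<in> carrier C" by (rule C.smult_closed[OF that(1) C'.one_closed])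
    show ?thesis
      by (simp only: Q.smult_assoc1[OF d that(2,3), symmetric] C.smult_assoc2[OF that(1) C'.one_closed that(2)]
          C'.l_one[OF that(2)])
  qed
  show ?thesis
    unfolding bilin_def restr_simps
  proof (intro conjI ballI)
    fix c assume c: "c \<in> carrier C"
    show "(\<odot>\<^bsub>Q\<^esub>) c \<in> lin A (restr A C Q) (restr A C Q)"
      by (rule linI; unfold restr_simps) (simp_all only: c 2 Q.smult_closed Q.smult_r_distr)
  next
    fix x assume x: "x \<in> carrier Q"
    show "(\<lambda>c. c \<odot>\<^bsub>Q\<^esub> x) \<in> lin A C (restr A C Q)"
      by (rule linI; unfold restr_simps) (simp_all only: x 3 Q.smult_closed Q.smult_l_distr)
  qed
qed

lemma base_change_simps [simp]:
  "carrier (base_change A C N) = carrier (tensor A C N)" "zero (base_change A C N) = zero (tensor A C N)"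
  "add (base_change A C N) = add (tensor A C N)" "one (base_change A C N) = tens A C N \<one>\<^bsub>C\<^esub> \<one>\<^bsub>N\<^esub>"
  unfolding base_change_def by (simp_all add: Let_def)

context
  fixes A :: "('a, 'm) ring_scheme" and C :: "('a, 'c) module" and N :: "('a, 'n) module"
  assumes alg: "algebra A C" and modN: "module A N"
begin

private lemmas C_module = algebra_module[OF alg]
private lemmas CN_module = module_tensor[OF C_module modN]

text \<open>For fixed c the scalar action is a lift, hence linear in the tensor by construction.
  Linearity in c is not visible from the lift and is proved by induction on the tensor.\<close>

lemma base_change_smult_bilin:
  "bilin A C (tensor A C N) (tensor A C N) (smult (base_change A C N))"
  and base_change_smult_tens:
  "\<And>c d x. c \<in> carrier C \<Longrightarrow> d \<in> carrier C \<Longrightarrow> x \<in> carrier N \<Longrightarrow>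
    c \<odot>\<^bsub>base_change A C N\<^esub> tens A C N d x = tens A C N (c \<otimes>\<^bsub>C\<^esub> d) x"
proof -
  let ?T = "tensor A C N"
  have sm: "smult (base_change A C N) = (\<lambda>c. tensor_lift A ?T (\<lambda>d x. tens A C N (c \<otimes>\<^bsub>C\<^esub> d) x))"
    unfolding base_change_def by (simp add: Let_def)
  note mb = nalg_bilin[OF algebra_nalg[OF alg]]
  have b: "bilin A C N ?T (\<lambda>d x. tens A C N (c \<otimes>\<^bsub>C\<^esub> d) x)" if "c \<in> carrier C" for c
    by (rule bilin_comp[OF tens_bilin[OF C_module modN] bilinD1[OF mb that] lin_id])
  note L = tensor_lift[OF C_module modN CN_module b]
  show t: "c \<odot>\<^bsub>base_change A C N\<^esub> tens A C N d x = tens A C N (c \<otimes>\<^bsub>C\<^esub> d) x"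
    if "c \<in> carrier C" "d \<in> carrier C" "x \<in> carrier N" for c d x
    unfolding sm by (rule L(2)[OF that])
  interpret T: module A ?T by (rule CN_module)
  have B: "(\<lambda>c. tensor_lift A ?T (\<lambda>d x. tens A C N (c \<otimes>\<^bsub>C\<^esub> d) x) z) \<in> lin A C ?T" if "z \<in> carrier ?T" for z
  proof (rule tensor_induct[OF C_module modN that])
    fix d x assume dx: "d \<in> carrier C" "x \<in> carrier N"
    have "(\<lambda>c. tens A C N (c \<otimes>\<^bsub>C\<^esub> d) x) \<in> lin A C ?T"
      by (rule lin_comp[OF bilinD2[OF mb dx(1)] bilinD2[OF tens_bilin[OF C_module modN] dx(2)]])
    then show "(\<lambda>c. tensor_lift A ?T (\<lambda>d x. tens A C N (c \<otimes>\<^bsub>C\<^esub> d) x) (tens A C N d x)) \<in> lin A C ?T"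
      by (rule lin_cong[OF _ C_module]) (rule L(2)[OF _ dx])
  next
    fix z w assume zw: "z \<in> carrier ?T" "w \<in> carrier ?T"
      and lz: "(\<lambda>c. tensor_lift A ?T (\<lambda>d x. tens A C N (c \<otimes>\<^bsub>C\<^esub> d) x) z) \<in> lin A C ?T"
      and lw: "(\<lambda>c. tensor_lift A ?T (\<lambda>d x. tens A C N (c \<otimes>\<^bsub>C\<^esub> d) x) w) \<in> lin A C ?T"
    show "(\<lambda>c. tensor_lift A ?T (\<lambda>d x. tens A C N (c \<otimes>\<^bsub>C\<^esub> d) x) (z \<oplus>\<^bsub>?T\<^esub> w)) \<in> lin A C ?T"
      by (rule lin_cong[OF lin_plus[OF CN_module lz lw] C_module]) (rule lin_add[OF L(1) zw])
  qed
  show "bilin A C ?T ?T (smult (base_change A C N))"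
    unfolding bilin_def sm using B L(1) by blast
qed

lemma tens_one_smult:
  assumes "c \<in> carrier C" "x \<in> carrier N"
  shows "tens A C N c x = c \<odot>\<^bsub>base_change A C N\<^esub> tens A C N \<one>\<^bsub>C\<^esub> x"
proof -
  interpret C': cring C by (rule algebra_cring[OF alg])
  show ?thesis using assms by (simp add: base_change_smult_tens)
qed

lemma module_base_change: "module C (base_change A C N)"
proof -
  interpret C': cring C by (rule algebra_cring[OF alg])
  let ?B = "base_change A C N" and ?T = "tensor A C N"
  interpret T: module A ?T by (rule CN_module)
  note sb = base_change_smult_bilin and st = base_change_smult_tens
  show ?thesis
  proof (rule moduleI)
    show "cring C" by (rule algebra_cring[OF alg])
    show "abelian_group ?B"
      by (rule abelian_group_record_cong[OF T.abelian_group_axioms]) simp_all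
    show "c \<odot>\<^bsub>?B\<^esub> z \<in> carrier ?B" if "c \<in> carrier C" "z \<in> carrier ?B" for c z
      using bilin_closed[OF sb that(1)] that(2) by simp
    show "(c \<oplus>\<^bsub>C\<^esub> d) \<odot>\<^bsub>?B\<^esub> z = c \<odot>\<^bsub>?B\<^esub> z \<oplus>\<^bsub>?B\<^esub> d \<odot>\<^bsub>?B\<^esub> z" if "c \<in> carrier C" "d \<in> carrier C" "z \<in> carrier ?B" for c d z
      using lin_add[OF bilinD2[OF sb] that(1,2)] that(3) by simp
    show "c \<odot>\<^bsub>?B\<^esub> (z \<oplus>\<^bsub>?B\<^esub> w) = c \<odot>\<^bsub>?B\<^esub> z \<oplus>\<^bsub>?B\<^esub> c \<odot>\<^bsub>?B\<^esub> w" if "c \<in> carrier C" "z \<in> carrier ?B" "w \<in> carrier ?B" for c z w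
      using lin_add[OF bilinD1[OF sb that(1)]] that(2,3) by simp
    show "(c \<otimes>\<^bsub>C\<^esub> d) \<odot>\<^bsub>?B\<^esub> z = c \<odot>\<^bsub>?B\<^esub> (d \<odot>\<^bsub>?B\<^esub> z)" if c: "c \<in> carrier C" "d \<in> carrier C" and z: "z \<in> carrier ?B" for c d z
    proof (rule tensor_ext[OF C_module modN, where f = "\<lambda>z. (c \<otimes>\<^bsub>C\<^esub> d) \<odot>\<^bsub>?B\<^esub> z" and g = "\<lambda>z. c \<odot>\<^bsub>?B\<^esub> (d \<odot>\<^bsub>?B\<^esub> z)"])
      show "(\<lambda>z. (c \<otimes>\<^bsub>C\<^esub> d) \<odot>\<^bsub>?B\<^esub> z) \<in> lin A ?T ?T" by (rule bilinD1[OF sb]) (simp add: c)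
      show "(\<lambda>z. c \<odot>\<^bsub>?B\<^esub> (d \<odot>\<^bsub>?B\<^esub> z)) \<in> lin A ?T ?T" by (rule lin_comp[OF bilinD1[OF sb c(2)] bilinD1[OF sb c(1)]])
      show "z \<in> carrier ?T" using z by simp
    qed (use c in \<open>simp add: st C'.m_assoc\<close>)
    show "\<one>\<^bsub>C\<^esub> \<odot>\<^bsub>?B\<^esub> z = z" if z: "z \<in> carrier ?B" for z
    proof (rule tensor_ext[OF C_module modN bilinD1[OF sb] lin_id])
      show "z \<in> carrier ?T" using z by simp
    qed (simp_all add: st)
  qed
qed

text \<open>The elements 1 \<otimes> x generate the C-module, since c \<otimes> x = c (1 \<otimes>
  x).\<close>

lemma base_change_ext:
  assumes "f \<in> lin C (base_change A C N) Q" "g \<in> lin C (base_change A C N) Q"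
    and "\<And>x. x \<in> carrier N \<Longrightarrow> f (tens A C N \<one>\<^bsub>C\<^esub> x) = g (tens A C N \<one>\<^bsub>C\<^esub> x)"
    and "z \<in> carrier (base_change A C N)"
  shows "f z = g z"
proof -
  interpret C': cring C by (rule algebra_cring[OF alg])
  have z: "z \<in> carrier (tensor A C N)" using assms(4) by simp
  show ?thesis
  proof (rule tensor_induct[where Pr = "\<lambda>z. f z = g z", OF C_module modN z])
    fix c x assume cx: "c \<in> carrier C" "x \<in> carrier N"
    have t: "tens A C N \<one>\<^bsub>C\<^esub> x \<in> carrier (base_change A C N)"
      using tens_closed[OF C_module modN C'.one_closed cx(2)] by simp
    show "f (tens A C N c x) = g (tens A C N c x)"
      unfolding tens_one_smult[OF cx]
      by (simp only: lin_smult[OF assms(1) cx(1) t] lin_smult[OF assms(2) cx(1) t] assms(3)[OF cx(2)])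
  next
    fix z w assume zw: "z \<in> carrier (tensor A C N)" "w \<in> carrier (tensor A C N)" "f z = g z" "f w = g w"
    show "f (z \<oplus>\<^bsub>tensor A C N\<^esub> w) = g (z \<oplus>\<^bsub>tensor A C N\<^esub> w)"
      using lin_add[OF assms(1), of z w] lin_add[OF assms(2), of z w] zw by simp
  qed
qed

text \<open>The two A-module structures on C \<otimes> N, one through C and one from the tensor
  product, coincide: (a 1) z = a (1 z) = a z, by linearity of the action in its scalar. Statements
  about A-linear maps can thus be moved between \<open>tensor\<close> and
  \<open>base_change\<close>.\<close>

lemma restr_base_change:
  "f \<in> lin A P (restr A C (base_change A C N)) \<longleftrightarrow> f \<in> lin A P (tensor A C N)"
proof -
  interpret C': cring C by (rule algebra_cring[OF alg])
  interpret C: algebra A C by (rule alg)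
  interpret T: module A "tensor A C N" by (rule CN_module)
  interpret B: module C "base_change A C N" by (rule module_base_change)
  have s: "(a \<odot>\<^bsub>C\<^esub> \<one>\<^bsub>C\<^esub>) \<odot>\<^bsub>base_change A C N\<^esub> z = a \<odot>\<^bsub>tensor A C N\<^esub> z" if a: "a \<in> carrier A" and z: "z \<in> carrier (tensor A C N)" for a z
  proof -
    have "(a \<odot>\<^bsub>C\<^esub> \<one>\<^bsub>C\<^esub>) \<odot>\<^bsub>base_change A C N\<^esub> z = a \<odot>\<^bsub>tensor A C N\<^esub> (\<one>\<^bsub>C\<^esub> \<odot>\<^bsub>base_change A C N\<^esub> z)"
      by (rule lin_smult[OF bilinD2[OF base_change_smult_bilin z] a C'.one_closed])
    also have "\<one>\<^bsub>C\<^esub> \<odot>\<^bsub>base_change A C N\<^esub> z = z" by (rule B.smult_one) (simp add: z)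
    finally show ?thesis .
  qed
  show ?thesis
  proof
    assume f: "f \<in> lin A P (restr A C (base_change A C N))"
    have c: "f x \<in> carrier (tensor A C N)" if "x \<in> carrier P" for x using lin_closed[OF f that] by simp
    show "f \<in> lin A P (tensor A C N)"
      by (rule linI) (simp_all add: c lin_add[OF f] lin_smult[OF f] s)
  next
    assume f: "f \<in> lin A P (tensor A C N)"
    note c = lin_closed[OF f]
    show "f \<in> lin A P (restr A C (base_change A C N))"
      by (rule linI) (simp_all add: c lin_add[OF f] lin_smult[OF f] s)
  qed
qed

text \<open>The adjunction between extension and restriction of scalars. A-linearity comes from the
  universal property of the tensor product; C-linearity is then an identity of A-linear maps and is
  checked on pure tensors.\<close>

lemma base_change_lift:
  assumes "module C Q" and psi: "\<psi> \<in> lin A N (restr A C Q)"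
  shows "tensor_lift A (restr A C Q) (\<lambda>c x. c \<odot>\<^bsub>Q\<^esub> \<psi> x) \<in> lin C (base_change A C N) Q"
    and "\<And>c x. c \<in> carrier C \<Longrightarrow> x \<in> carrier N \<Longrightarrow>
      tensor_lift A (restr A C Q) (\<lambda>c x. c \<odot>\<^bsub>Q\<^esub> \<psi> x) (tens A C N c x) = c \<odot>\<^bsub>Q\<^esub> \<psi> x"
proof -
  interpret C': cring C by (rule algebra_cring[OF alg])
  interpret C: algebra A C by (rule alg)
  interpret Q: module C Q by fact
  let ?B = "base_change A C N"
  note mR = module_restr[OF alg assms(1)]
  let ?l = "tensor_lift A (restr A C Q) (\<lambda>c x. c \<odot>\<^bsub>Q\<^esub> \<psi> x)"
  note L = tensor_lift[OF C_module modN mR bilin_comp[OF smult_restr_bilin[OF alg assms(1)] lin_id psi]]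
  show t: "?l (tens A C N c x) = c \<odot>\<^bsub>Q\<^esub> \<psi> x" if "c \<in> carrier C" "x \<in> carrier N" for c x by (rule L(2)[OF that])
  have p: "\<psi> x \<in> carrier Q" if "x \<in> carrier N" for x using lin_closed[OF psi that] by simp
  show "?l \<in> lin C ?B Q"
  proof (rule linI)
    fix z assume "z \<in> carrier ?B"
    then have z: "z \<in> carrier (tensor A C N)" by simp
    show "?l z \<in> carrier Q" using lin_closed[OF L(1) z] by simp
    fix c assume c: "c \<in> carrier C"
    show "?l (c \<odot>\<^bsub>?B\<^esub> z) = c \<odot>\<^bsub>Q\<^esub> ?l z"
    proof (rule tensor_ext[OF C_module modN, where f = "\<lambda>z. ?l (c \<odot>\<^bsub>?B\<^esub> z)" and g = "\<lambda>z. c \<odot>\<^bsub>Q\<^esub> ?l z", OF _ _ _ z])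
      show "(\<lambda>z. ?l (c \<odot>\<^bsub>?B\<^esub> z)) \<in> lin A (tensor A C N) (restr A C Q)"
        by (rule lin_comp[OF bilinD1[OF base_change_smult_bilin c] L(1)])
      show "(\<lambda>z. c \<odot>\<^bsub>Q\<^esub> ?l z) \<in> lin A (tensor A C N) (restr A C Q)"
        by (rule lin_comp[OF L(1) bilinD1[OF smult_restr_bilin[OF alg assms(1)] c]])
    qed (simp add: base_change_smult_tens c t p Q.smult_assoc1)
  next
    fix z w assume "z \<in> carrier ?B" "w \<in> carrier ?B"
    then show "?l (z \<oplus>\<^bsub>?B\<^esub> w) = ?l z \<oplus>\<^bsub>Q\<^esub> ?l w" using lin_add[OF L(1), of z w] by simp
  qed
qed

end

lemma smult_lin:
  assumes "module A N" "x \<in> carrier N"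
  shows "(\<lambda>a. a \<odot>\<^bsub>N\<^esub> x) \<in> lin A (self_mod A) N"
proof -
  interpret N: module A N by fact
  show ?thesis using assms(2) by (intro linI) (simp_all add: N.smult_l_distr N.smult_assoc1)
qed

lemma base_change_bilin_ext:
  assumes "algebra A C" "module A N" "module A P"
    and b: "bilin C (base_change A C N) (base_change A C P) Q b" "bilin C (base_change A C N) (base_change A C P) Q b'"
    and eq: "\<And>x y. x \<in> carrier N \<Longrightarrow> y \<in> carrier P \<Longrightarrow>
      b (tens A C N \<one>\<^bsub>C\<^esub> x) (tens A C P \<one>\<^bsub>C\<^esub> y) = b' (tens A C N \<one>\<^bsub>C\<^esub> x) (tens A C P \<one>\<^bsub>C\<^esub> y)"
    and z: "z \<in> carrier (base_change A C N)" "w \<in> carrier (base_change A C P)"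
  shows "b z w = b' z w"
proof -
  interpret C': cring C by (rule algebra_cring[OF assms(1)])
  have 1: "b (tens A C N \<one>\<^bsub>C\<^esub> x) w = b' (tens A C N \<one>\<^bsub>C\<^esub> x) w" if x: "x \<in> carrier N" for x
  proof -
    have t: "tens A C N \<one>\<^bsub>C\<^esub> x \<in> carrier (base_change A C N)"
      using tens_closed[OF algebra_module[OF assms(1)] assms(2) C'.one_closed x] by simp
    show ?thesis
      by (rule base_change_ext[OF assms(1,3) bilinD1[OF b(1) t] bilinD1[OF b(2) t] eq[OF x] z(2)])
  qed
  show ?thesis
    by (rule base_change_ext[OF assms(1,2), where f = "\<lambda>z. b z w" and g = "\<lambda>z. b' z w",
          OF bilinD2[OF b(1) z(2)] bilinD2[OF b(2) z(2)] 1 z(1)])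
qed

section \<open>Multiplication on an extension of scalars\<close>

context
  fixes A :: "('a, 'm) ring_scheme" and C :: "('a, 'c) module" and N :: "('a, 'n) module"
  assumes alg: "algebra A C" and nalgN: "nalg A N"
begin

private lemmas algC_module = algebra_module[OF alg]
private lemmas nalgN_module = nalg_module[OF nalgN]
private lemmas tensorCN_module = module_tensor[OF algC_module nalgN_module]
private lemmas mult_C = nalg_bilin[OF algebra_nalg[OF alg]]
private lemmas mult_N = nalg_bilin[OF nalgN]

text \<open>The product is a lift nested in a lift: \<open>G b x\<close> is the inner one,
  multiplication by b \<otimes> x as a function of the right factor. The outer lift makes sense only
  once \<open>G\<close> is bilinear in (b, x) for every right factor, and linearity of the product
  in that factor takes a further induction.\<close>

lemma base_change_mult:
  shows base_change_mult_bilin_base: "bilin A (tensor A C N) (tensor A C N) (tensor A C N) (mult (base_change A C N))"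
  and base_change_mult_tens: "\<And>b x c y. b \<in> carrier C \<Longrightarrow> x \<in> carrier N \<Longrightarrow> c \<in> carrier C \<Longrightarrow> y \<in> carrier N \<Longrightarrow>
      tens A C N b x \<otimes>\<^bsub>base_change A C N\<^esub> tens A C N c y = tens A C N (b \<otimes>\<^bsub>C\<^esub> c) (x \<otimes>\<^bsub>N\<^esub> y)"
proof -
  let ?T = "tensor A C N"
  define G where "G b x = tensor_lift A ?T (\<lambda>c y. tens A C N (b \<otimes>\<^bsub>C\<^esub> c) (x \<otimes>\<^bsub>N\<^esub> y))" for b x
  have mu: "mult (base_change A C N) = (\<lambda>u v. tensor_lift A ?T (\<lambda>b x. G b x v) u)"
    unfolding base_change_def G_def by (simp add: Let_def)
  have L: "G b x \<in> lin A ?T ?T"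
    "\<And>c y. c \<in> carrier C \<Longrightarrow> y \<in> carrier N \<Longrightarrow> G b x (tens A C N c y) = tens A C N (b \<otimes>\<^bsub>C\<^esub> c) (x \<otimes>\<^bsub>N\<^esub> y)"
    if "b \<in> carrier C" "x \<in> carrier N" for b x
    unfolding G_def
    by (fact tensor_lift[OF algC_module nalgN_module tensorCN_module bilin_comp[OF tens_bilin[OF algC_module nalgN_module] bilinD1[OF mult_C that(1)] bilinD1[OF mult_N that(2)]]])+
  \<comment> \<open>Induction on the right factor: on a pure tensor \<open>G\<close> is given by its
    formula, and bilinear maps are closed under sums.\<close>
  have B: "bilin A C N ?T (\<lambda>b x. G b x v)" if "v \<in> carrier ?T" for v
  proof (rule tensor_induct[where Pr = "\<lambda>v. bilin A C N ?T (\<lambda>b x. G b x v)", OF algC_module nalgN_module that])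
    fix c y assume cy: "c \<in> carrier C" "y \<in> carrier N"
    have "bilin A C N ?T (\<lambda>b x. tens A C N (b \<otimes>\<^bsub>C\<^esub> c) (x \<otimes>\<^bsub>N\<^esub> y))"
      by (rule bilin_comp[OF tens_bilin[OF algC_module nalgN_module] bilinD2[OF mult_C cy(1)] bilinD2[OF mult_N cy(2)]])
    note bb = this
    show "bilin A C N ?T (\<lambda>b x. G b x (tens A C N c y))"
      unfolding bilin_def
    proof (intro conjI ballI)
      show "(\<lambda>x. G b x (tens A C N c y)) \<in> lin A N ?T" if b: "b \<in> carrier C" for b
        by (rule lin_cong[OF bilinD1[OF bb b] nalgN_module]) (rule L(2)[OF b _ cy])
      show "(\<lambda>b. G b x (tens A C N c y)) \<in> lin A C ?T" if x: "x \<in> carrier N" for x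
        by (rule lin_cong[OF bilinD2[OF bb x] algC_module]) (rule L(2)[OF _ x cy])
    qed
  next
    fix z w assume zw: "z \<in> carrier ?T" "w \<in> carrier ?T"
      and z: "bilin A C N ?T (\<lambda>b x. G b x z)" and w: "bilin A C N ?T (\<lambda>b x. G b x w)"
    show "bilin A C N ?T (\<lambda>b x. G b x (z \<oplus>\<^bsub>?T\<^esub> w))"
      unfolding bilin_def
    proof (intro conjI ballI)
      show "(\<lambda>x. G b x (z \<oplus>\<^bsub>?T\<^esub> w)) \<in> lin A N ?T" if b: "b \<in> carrier C" for b
        by (rule lin_cong[OF lin_plus[OF tensorCN_module bilinD1[OF z b] bilinD1[OF w b]] nalgN_module])
          (rule lin_add[OF L(1)[OF b] zw])
      show "(\<lambda>b. G b x (z \<oplus>\<^bsub>?T\<^esub> w)) \<in> lin A C ?T" if x: "x \<in> carrier N" for x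
        by (rule lin_cong[OF lin_plus[OF tensorCN_module bilinD2[OF z x] bilinD2[OF w x]] algC_module])
          (rule lin_add[OF L(1)[OF _ x] zw])
    qed
  qed
  note M = tensor_lift[OF algC_module nalgN_module tensorCN_module B]
  \<comment> \<open>Linearity in the right factor, by induction on the left one: for a pure tensor b
    \<otimes> x the product is \<open>G b x\<close>.\<close>
  have R: "(\<lambda>v. tensor_lift A ?T (\<lambda>b x. G b x v) u) \<in> lin A ?T ?T" if "u \<in> carrier ?T" for u
  proof (rule tensor_induct[where Pr = "\<lambda>u. (\<lambda>v. tensor_lift A ?T (\<lambda>b x. G b x v) u) \<in> lin A ?T ?T", OF algC_module nalgN_module that])
    fix b x assume bx: "b \<in> carrier C" "x \<in> carrier N"
    show "(\<lambda>v. tensor_lift A ?T (\<lambda>b x. G b x v) (tens A C N b x)) \<in> lin A ?T ?T"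
      by (rule lin_cong[OF L(1)[OF bx] tensorCN_module]) (rule M(2)[OF _ bx])
  next
    fix z w assume zw: "z \<in> carrier ?T" "w \<in> carrier ?T"
      and z: "(\<lambda>v. tensor_lift A ?T (\<lambda>b x. G b x v) z) \<in> lin A ?T ?T"
      and w: "(\<lambda>v. tensor_lift A ?T (\<lambda>b x. G b x v) w) \<in> lin A ?T ?T"
    show "(\<lambda>v. tensor_lift A ?T (\<lambda>b x. G b x v) (z \<oplus>\<^bsub>?T\<^esub> w)) \<in> lin A ?T ?T"
      by (rule lin_cong[OF lin_plus[OF tensorCN_module z w] tensorCN_module]) (rule lin_add[OF M(1) zw])
  qed
  show "bilin A ?T ?T ?T (mult (base_change A C N))"
    unfolding bilin_def mu
  proof (intro conjI ballI)
    show "(\<lambda>v. tensor_lift A ?T (\<lambda>b x. G b x v) u) \<in> lin A ?T ?T" if "u \<in> carrier ?T" for u by (rule R[OF that])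
    show "(\<lambda>u. tensor_lift A ?T (\<lambda>b x. G b x v) u) \<in> lin A ?T ?T" if "v \<in> carrier ?T" for v by (rule M(1)[OF that])
  qed
  show "tens A C N b x \<otimes>\<^bsub>base_change A C N\<^esub> tens A C N c y = tens A C N (b \<otimes>\<^bsub>C\<^esub> c) (x \<otimes>\<^bsub>N\<^esub> y)"
    if bx: "b \<in> carrier C" "x \<in> carrier N" and cy: "c \<in> carrier C" "y \<in> carrier N" for b x c y
    unfolding mu M(2)[OF tens_closed[OF algC_module nalgN_module cy] bx] by (rule L(2)[OF bx cy])
qed

text \<open>The product is already A-bilinear. What remains is its compatibility with scalars from
  C, an identity between A-bilinear maps that is checked on pure tensors.\<close>

lemma nalg_base_change: "nalg C (base_change A C N)"
proof -
  interpret C': cring C by (rule algebra_cring[OF alg])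
  let ?T = "tensor A C N" and ?B = "base_change A C N"
  interpret B: module C ?B by (rule module_base_change[OF alg nalgN_module])
  note mb = base_change_mult_bilin_base and mt = base_change_mult_tens
  note sb = base_change_smult_bilin[OF alg nalgN_module] and st = base_change_smult_tens[OF alg nalgN_module]
  note mcl = bilin_closed[OF mult_C] bilin_closed[OF mult_N]
  have l: "(d \<odot>\<^bsub>?B\<^esub> u) \<otimes>\<^bsub>?B\<^esub> v = d \<odot>\<^bsub>?B\<^esub> (u \<otimes>\<^bsub>?B\<^esub> v)" if d: "d \<in> carrier C" and uv: "u \<in> carrier ?T" "v \<in> carrier ?T" for d u v
    by (rule tensor_bilin_ext[OF algC_module nalgN_module algC_module nalgN_module, where b = "\<lambda>u v. (d \<odot>\<^bsub>?B\<^esub> u) \<otimes>\<^bsub>?B\<^esub> v" and b' = "\<lambda>u v. d \<odot>\<^bsub>?B\<^esub> (u \<otimes>\<^bsub>?B\<^esub> v)",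
          OF bilin_comp[OF mb bilinD1[OF sb d] lin_id] bilin_post[OF mb bilinD1[OF sb d]] _ uv])
      (use d in \<open>simp add: st mt mcl C'.m_assoc\<close>)
  have r: "u \<otimes>\<^bsub>?B\<^esub> (d \<odot>\<^bsub>?B\<^esub> v) = d \<odot>\<^bsub>?B\<^esub> (u \<otimes>\<^bsub>?B\<^esub> v)" if d: "d \<in> carrier C" and uv: "u \<in> carrier ?T" "v \<in> carrier ?T" for d u v
    by (rule tensor_bilin_ext[OF algC_module nalgN_module algC_module nalgN_module, where b = "\<lambda>u v. u \<otimes>\<^bsub>?B\<^esub> (d \<odot>\<^bsub>?B\<^esub> v)" and b' = "\<lambda>u v. d \<odot>\<^bsub>?B\<^esub> (u \<otimes>\<^bsub>?B\<^esub> v)",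
          OF bilin_comp[OF mb lin_id bilinD1[OF sb d]] bilin_post[OF mb bilinD1[OF sb d]] _ uv])
      (use d in \<open>simp add: st mt mcl C'.m_lcomm\<close>)
  have "bilin C ?B ?B ?B (mult ?B)"
    unfolding bilin_def
  proof (intro conjI ballI)
    fix u assume "u \<in> carrier ?B"
    then have u: "u \<in> carrier ?T" by simp
    show "(\<otimes>\<^bsub>?B\<^esub>) u \<in> lin C ?B ?B"
      by (rule linI; unfold base_change_simps) (simp_all only: u r lin_closed[OF bilinD1[OF mb u]] lin_add[OF bilinD1[OF mb u]])
    show "(\<lambda>v. v \<otimes>\<^bsub>?B\<^esub> u) \<in> lin C ?B ?B"
      by (rule linI; unfold base_change_simps) (simp_all only: u l lin_closed[OF bilinD2[OF mb u]] lin_add[OF bilinD2[OF mb u]])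
  qed
  then show ?thesis
    unfolding nalg_def using B.module_axioms tens_closed[OF algC_module nalgN_module C'.one_closed nalg_one[OF nalgN]] by simp
qed

end

section \<open>Finite bases and ideals of zeros\<close>

text \<open>\<open>d\<close> is the dual basis of \<open>e\<close>, so that ideals of zeros are generated by coordinates.\<close>

definition fin_basis :: "('a, 'm) ring_scheme \<Rightarrow> ('a, 'n) module \<Rightarrow> 'v set \<Rightarrow> ('v \<Rightarrow> 'n) \<Rightarrow> ('v \<Rightarrow> 'n \<Rightarrow> 'a) \<Rightarrow> bool" where
  "fin_basis A N V e d \<longleftrightarrow> finite V \<and> (\<forall>v\<in>V. e v \<in> carrier N) \<and> (\<forall>v\<in>V. d v \<in> lin A N (self_mod A)) \<and>
     (\<forall>v\<in>V. \<forall>w\<in>V. d v (e w) = (if v = w then \<one>\<^bsub>A\<^esub> else \<zero>\<^bsub>A\<^esub>)) \<and>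
     (\<forall>x\<in>carrier N. x = finsum N (\<lambda>v. d v x \<odot>\<^bsub>N\<^esub> e v) V)"

lemma fin_basisD:
  assumes "fin_basis A N V e d"
  shows "finite V" "\<And>v. v \<in> V \<Longrightarrow> e v \<in> carrier N" "\<And>v. v \<in> V \<Longrightarrow> d v \<in> lin A N (self_mod A)"
    "\<And>v w. v \<in> V \<Longrightarrow> w \<in> V \<Longrightarrow> d v (e w) = (if v = w then \<one>\<^bsub>A\<^esub> else \<zero>\<^bsub>A\<^esub>)"
    "\<And>x. x \<in> carrier N \<Longrightarrow> x = finsum N (\<lambda>v. d v x \<odot>\<^bsub>N\<^esub> e v) V"
  using assms unfolding fin_basis_def by blast+

lemma fin_basis_coord_closed:
  assumes "fin_basis A N V e d" "v \<in> V" "x \<in> carrier N"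
  shows "d v x \<in> carrier A"
  using lin_closed[OF fin_basisD(3)[OF assms(1,2)] assms(3)] by simp

lemma fin_basis_coord_sum:
  assumes "module A N" "fin_basis A N V e d" "\<And>v. v \<in> V \<Longrightarrow> p v \<in> carrier A" "w \<in> V"
  shows "d w (finsum N (\<lambda>v. p v \<odot>\<^bsub>N\<^esub> e v) V) = p w"
proof -
  interpret N: module A N by fact
  note B = fin_basisD[OF assms(2)]
  have "d w (finsum N (\<lambda>v. p v \<odot>\<^bsub>N\<^esub> e v) V) = finsum (self_mod A) (\<lambda>v. d w (p v \<odot>\<^bsub>N\<^esub> e v)) V"
    by (rule lin_finsum[OF assms(1) module_self_mod[OF N.is_cring] B(3)[OF assms(4)]])
      (intro N.smult_closed assms(3) B(2))
  also have "\<dots> = finsum A (\<lambda>v. d w (p v \<odot>\<^bsub>N\<^esub> e v)) V"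
    by (rule finsum_record_cong) simp_all
  also have "\<dots> = finsum A (\<lambda>v. if w = v then p v else \<zero>\<^bsub>A\<^esub>) V"
    by (rule N.R.finsum_cong') (auto simp: lin_smult[OF B(3)[OF assms(4)]] assms(3) B(2) B(4)[OF assms(4)])
  also have "\<dots> = p w"
    by (rule N.R.finsum_singleton) (use assms(3,4) B(1) in auto)
  finally show ?thesis .
qed

text \<open>The functional id \<otimes> d, with C \<otimes> A identified with C.\<close>

definition bc_coord :: "('a, 'm) ring_scheme \<Rightarrow> ('a, 'c) module \<Rightarrow> ('n \<Rightarrow> 'a) \<Rightarrow> ('c \<times> 'n \<Rightarrow> 'a) set \<Rightarrow> 'c" where
  "bc_coord A C d = tensor_lift A (restr A C (self_mod C)) (\<lambda>c x. c \<odot>\<^bsub>self_mod C\<^esub> (d x \<odot>\<^bsub>C\<^esub> \<one>\<^bsub>C\<^esub>))"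

lemma bc_coord:
  assumes "algebra A C" "module A N" "d \<in> lin A N (self_mod A)"
  shows "bc_coord A C d \<in> lin C (base_change A C N) (self_mod C)"
    and "\<And>c x. c \<in> carrier C \<Longrightarrow> x \<in> carrier N \<Longrightarrow> bc_coord A C d (tens A C N c x) = c \<otimes>\<^bsub>C\<^esub> (d x \<odot>\<^bsub>C\<^esub> \<one>\<^bsub>C\<^esub>)"
proof -
  interpret C': cring C by (rule algebra_cring[OF assms(1)])
  interpret C: algebra A C by fact
  have dc: "d x \<in> carrier A" if "x \<in> carrier N" for x using lin_closed[OF assms(3) that] by simp
  have "(\<lambda>x. d x \<odot>\<^bsub>C\<^esub> \<one>\<^bsub>C\<^esub>) \<in> lin A N (restr A C (self_mod C))"
    by (rule linI) (simp_all add: dc lin_add[OF assms(3)] lin_smult[OF assms(3)] C.smult_l_distr C.smult_assoc1 C.smult_assoc2)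
  note L = base_change_lift[OF assms(1,2) module_self_mod[OF C'.is_cring] this]
  show "bc_coord A C d \<in> lin C (base_change A C N) (self_mod C)"
    unfolding bc_coord_def by (rule L(1))
  show "bc_coord A C d (tens A C N c x) = c \<otimes>\<^bsub>C\<^esub> (d x \<odot>\<^bsub>C\<^esub> \<one>\<^bsub>C\<^esub>)" if "c \<in> carrier C" "x \<in> carrier N" for c x
    unfolding bc_coord_def L(2)[OF that] by simp
qed

lemma fin_basis_base_change:
  assumes "algebra A C" "module A N" "fin_basis A N V e d"
  shows "fin_basis C (base_change A C N) V (\<lambda>v. tens A C N \<one>\<^bsub>C\<^esub> (e v)) (\<lambda>v. bc_coord A C (d v))"
proof -
  interpret C': cring C by (rule algebra_cring[OF assms(1)])
  interpret C: algebra A C by fact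
  interpret N: module A N by fact
  let ?B = "base_change A C N"
  note mB = module_base_change[OF assms(1,2)]
  interpret B: module C ?B by (rule mB)
  note F = fin_basisD[OF assms(3)]
  note mC = algebra_module[OF assms(1)]
  note co = bc_coord[OF assms(1,2) F(3)]
  note dc = fin_basis_coord_closed[OF assms(3)]
  have tB: "tens A C N \<one>\<^bsub>C\<^esub> x \<in> carrier ?B" if "x \<in> carrier N" for x
    using tens_closed[OF mC assms(2) C'.one_closed that] by simp
  show ?thesis
    unfolding fin_basis_def
  proof (intro conjI ballI)
    show "finite V" by (rule F(1))
    show "tens A C N \<one>\<^bsub>C\<^esub> (e v) \<in> carrier ?B" if "v \<in> V" for v by (rule tB[OF F(2)[OF that]])
    show "bc_coord A C (d v) \<in> lin C ?B (self_mod C)" if "v \<in> V" for v by (rule co(1)[OF that])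
    show "bc_coord A C (d v) (tens A C N \<one>\<^bsub>C\<^esub> (e w)) = (if v = w then \<one>\<^bsub>C\<^esub> else \<zero>\<^bsub>C\<^esub>)" if "v \<in> V" "w \<in> V" for v w
      using co(2)[OF that(1) C'.one_closed F(2)[OF that(2)]] by (simp add: F(4)[OF that])
    fix z assume z: "z \<in> carrier ?B"
    \<comment> \<open>Both sides are C-linear in z, so it suffices to treat 1 \<otimes> x, where the
      expansion of x is carried through the tensor sign.\<close>
    show "z = finsum ?B (\<lambda>v. bc_coord A C (d v) z \<odot>\<^bsub>?B\<^esub> tens A C N \<one>\<^bsub>C\<^esub> (e v)) V"
    proof (rule base_change_ext[OF assms(1,2) lin_id _ _ z])
      show "(\<lambda>z. finsum ?B (\<lambda>v. bc_coord A C (d v) z \<odot>\<^bsub>?B\<^esub> tens A C N \<one>\<^bsub>C\<^esub> (e v)) V) \<in> lin C ?B ?B"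
        by (intro lin_finsum_fun[OF mB mB] lin_comp[OF co(1) smult_lin[OF mB tB]] F(2))
      fix x assume x: "x \<in> carrier N"
      have "tens A C N \<one>\<^bsub>C\<^esub> x = tens A C N \<one>\<^bsub>C\<^esub> (finsum N (\<lambda>v. d v x \<odot>\<^bsub>N\<^esub> e v) V)"
        using F(5)[OF x] by simp
      also have "\<dots> = finsum (tensor A C N) (\<lambda>v. tens A C N \<one>\<^bsub>C\<^esub> (d v x \<odot>\<^bsub>N\<^esub> e v)) V"
        by (rule lin_finsum[OF assms(2) module_tensor[OF mC assms(2)] bilinD1[OF tens_bilin[OF mC assms(2)] C'.one_closed]])
          (intro N.smult_closed dc F(2) x)
      also have "\<dots> = finsum ?B (\<lambda>v. tens A C N \<one>\<^bsub>C\<^esub> (d v x \<odot>\<^bsub>N\<^esub> e v)) V"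
        by (rule finsum_record_cong) simp_all
      also have "\<dots> = finsum ?B (\<lambda>v. bc_coord A C (d v) (tens A C N \<one>\<^bsub>C\<^esub> x) \<odot>\<^bsub>?B\<^esub> tens A C N \<one>\<^bsub>C\<^esub> (e v)) V"
      proof (rule B.finsum_cong'[OF refl])
        show "(\<lambda>v. bc_coord A C (d v) (tens A C N \<one>\<^bsub>C\<^esub> x) \<odot>\<^bsub>?B\<^esub> tens A C N \<one>\<^bsub>C\<^esub> (e v)) \<in> V \<rightarrow> carrier ?B"
          by (intro Pi_I B.smult_closed tB F(2)) (simp add: co(2) x dc)
        fix v assume v: "v \<in> V"
        have "tens A C N \<one>\<^bsub>C\<^esub> (d v x \<odot>\<^bsub>N\<^esub> e v) = d v x \<odot>\<^bsub>tensor A C N\<^esub> tens A C N \<one>\<^bsub>C\<^esub> (e v)"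
          by (rule lin_smult[OF bilinD1[OF tens_bilin[OF mC assms(2)] C'.one_closed] dc[OF v x] F(2)[OF v]])
        also have "\<dots> = tens A C N (d v x \<odot>\<^bsub>C\<^esub> \<one>\<^bsub>C\<^esub>) (e v)"
          by (rule lin_smult[OF bilinD2[OF tens_bilin[OF mC assms(2)] F(2)[OF v]] dc[OF v x] C'.one_closed, symmetric])
        also have "\<dots> = (d v x \<odot>\<^bsub>C\<^esub> \<one>\<^bsub>C\<^esub>) \<odot>\<^bsub>?B\<^esub> tens A C N \<one>\<^bsub>C\<^esub> (e v)"
          by (rule tens_one_smult[OF assms(1,2) _ F(2)[OF v]]) (simp add: dc v x)
        also have "d v x \<odot>\<^bsub>C\<^esub> \<one>\<^bsub>C\<^esub> = bc_coord A C (d v) (tens A C N \<one>\<^bsub>C\<^esub> x)"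
          by (simp add: co(2) v x dc)
        finally show "tens A C N \<one>\<^bsub>C\<^esub> (d v x \<odot>\<^bsub>N\<^esub> e v) = bc_coord A C (d v) (tens A C N \<one>\<^bsub>C\<^esub> x) \<odot>\<^bsub>?B\<^esub> tens A C N \<one>\<^bsub>C\<^esub> (e v)" .
      qed
      finally show "tens A C N \<one>\<^bsub>C\<^esub> x = finsum ?B (\<lambda>v. bc_coord A C (d v) (tens A C N \<one>\<^bsub>C\<^esub> x) \<odot>\<^bsub>?B\<^esub> tens A C N \<one>\<^bsub>C\<^esub> (e v)) V" .
    qed
  qed
qed

section \<open>Ideals of zeros in coordinates\<close>

lemma ideal_finsum:
  assumes "ideal K C" "\<And>v. v \<in> V \<Longrightarrow> f v \<in> K"
  shows "finsum C f V \<in> K"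
proof -
  interpret ideal K C by fact
  show ?thesis
    by (rule finsum_induct[where Pr = "\<lambda>x. x \<in> K", OF abelian_monoid_axioms])
      (simp_all add: assms(2) a_Hcarr)
qed

text \<open>A functional l takes p = \<Sum> d_v(p) e_v to \<Sum> d_v(p) l(e_v), which lies in the
  ideal of the coordinates; conversely the coordinates are themselves functionals. Working with a
  set of vectors covers \<open>Z_elt\<close> (a singleton) and \<open>Z_map\<close> (the image of u)
  at once.\<close>

lemma Idl_zeros_fin_basis:
  assumes "cring C" "module C P" "fin_basis C P V e d" "U \<subseteq> carrier P"
  shows "Idl\<^bsub>C\<^esub> {l p | l p. l \<in> lin C P (self_mod C) \<and> p \<in> U} = Idl\<^bsub>C\<^esub> {d v p | v p. v \<in> V \<and> p \<in> U}"
proof -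
  interpret C: cring C by fact
  interpret P: module C P by fact
  note F = fin_basisD[OF assms(3)] and dc = fin_basis_coord_closed[OF assms(3)]
  let ?D = "{d v p | v p. v \<in> V \<and> p \<in> U}"
  have D: "?D \<subseteq> carrier C" using dc assms(4) by blast
  have I: "ideal (Idl\<^bsub>C\<^esub> ?D) C" by (rule C.genideal_ideal[OF D])
  interpret I: ideal "Idl\<^bsub>C\<^esub> ?D" C by (rule I)
  have l: "l p \<in> Idl\<^bsub>C\<^esub> ?D" if l: "l \<in> lin C P (self_mod C)" and p: "p \<in> U" for l p
  proof -
    have pc: "p \<in> carrier P" using p assms(4) by blast
    have lc: "l x \<in> carrier C" if "x \<in> carrier P" for x using lin_closed[OF l that] by simp
    have "l p = l (finsum P (\<lambda>v. d v p \<odot>\<^bsub>P\<^esub> e v) V)" using F(5)[OF pc] by simp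
    also have "\<dots> = finsum (self_mod C) (\<lambda>v. l (d v p \<odot>\<^bsub>P\<^esub> e v)) V"
      by (rule lin_finsum[OF assms(2) module_self_mod[OF assms(1)] l]) (intro P.smult_closed dc F(2) pc)
    also have "\<dots> = finsum C (\<lambda>v. l (d v p \<odot>\<^bsub>P\<^esub> e v)) V"
      by (rule finsum_record_cong) simp_all
    also have "\<dots> \<in> Idl\<^bsub>C\<^esub> ?D"
    proof (rule ideal_finsum[OF I])
      fix v assume v: "v \<in> V"
      have "d v p \<in> Idl\<^bsub>C\<^esub> ?D" using C.genideal_self[OF D] v p by blast
      then show "l (d v p \<odot>\<^bsub>P\<^esub> e v) \<in> Idl\<^bsub>C\<^esub> ?D"
        unfolding lin_smult[OF l dc[OF v pc] F(2)[OF v]] self_mod_simps by (rule I.I_r_closed[OF _ lc[OF F(2)[OF v]]])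
    qed
    finally show ?thesis .
  qed
  show ?thesis
  proof
    show "Idl\<^bsub>C\<^esub> {l p | l p. l \<in> lin C P (self_mod C) \<and> p \<in> U} \<subseteq> Idl\<^bsub>C\<^esub> ?D"
      by (rule C.genideal_minimal[OF I]) (use l in blast)
    have c: "{l p | l p. l \<in> lin C P (self_mod C) \<and> p \<in> U} \<subseteq> carrier C"
    proof clarify
      fix l p assume "l \<in> lin C P (self_mod C)" "p \<in> U"
      then show "l p \<in> carrier C" using lin_closed[of l C P "self_mod C" p] assms(4) by auto
    qed
    show "Idl\<^bsub>C\<^esub> ?D \<subseteq> Idl\<^bsub>C\<^esub> {l p | l p. l \<in> lin C P (self_mod C) \<and> p \<in> U}"
      by (rule C.genideal_minimal[OF C.genideal_ideal[OF c]], rule subset_trans[OF _ C.genideal_self[OF c]])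
        (use F(3) in blast)
  qed
qed

lemma Z_elt_fin_basis:
  assumes "cring C" "module C P" "fin_basis C P V e d" "p \<in> carrier P"
  shows "Z_elt C P p = Idl\<^bsub>C\<^esub> {d v p | v. v \<in> V}"
  using Idl_zeros_fin_basis[OF assms(1-3), of "{p}"] assms(4) unfolding Z_elt_def by simp

lemma Z_map_fin_basis:
  assumes "cring C" "module C P" "fin_basis C P V e d" "\<And>x. x \<in> carrier N \<Longrightarrow> u x \<in> carrier P"
  shows "Z_map C N P u = Idl\<^bsub>C\<^esub> {d v (u x) | v x. v \<in> V \<and> x \<in> carrier N}"
proof -
  have 1: "{l (u x) | l x. l \<in> lin C P (self_mod C) \<and> x \<in> carrier N} =
      {l p | l p. l \<in> lin C P (self_mod C) \<and> p \<in> u ` carrier N}" by blast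
  have 2: "{d v (u x) | v x. v \<in> V \<and> x \<in> carrier N} = {d v p | v p. v \<in> V \<and> p \<in> u ` carrier N}" by blast
  show ?thesis unfolding Z_map_def 1 2 using assms(4) by (intro Idl_zeros_fin_basis[OF assms(1-3)]) blast
qed

section \<open>Modules of homomorphisms\<close>

lemma hom_mod_simps [simp]:
  "carrier (hom_mod A N P) = lin A N P \<inter> extensional (carrier N)"
  "zero (hom_mod A N P) = (\<lambda>x\<in>carrier N. \<zero>\<^bsub>P\<^esub>)"
  "add (hom_mod A N P) = (\<lambda>f g. \<lambda>x\<in>carrier N. f x \<oplus>\<^bsub>P\<^esub> g x)"
  "smult (hom_mod A N P) = (\<lambda>a f. \<lambda>x\<in>carrier N. a \<odot>\<^bsub>P\<^esub> f x)"
  unfolding hom_mod_def by simp_all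

lemma end_alg_simps [simp]:
  "carrier (end_alg A N) = carrier (hom_mod A N N)" "zero (end_alg A N) = zero (hom_mod A N N)"
  "add (end_alg A N) = add (hom_mod A N N)" "smult (end_alg A N) = smult (hom_mod A N N)"
  "mult (end_alg A N) = compose (carrier N)" "one (end_alg A N) = (\<lambda>x\<in>carrier N. x)"
  unfolding end_alg_def by simp_all

lemma lin_restrict:
  assumes "f \<in> lin A N P" "module A N"
  shows "(\<lambda>x\<in>carrier N. f x) \<in> lin A N P"
  by (rule lin_cong[OF assms]) simp

lemma hom_modI:
  assumes "f \<in> lin A N P" "module A N"
  shows "(\<lambda>x\<in>carrier N. f x) \<in> carrier (hom_mod A N P)"
  using lin_restrict[OF assms] by simp

lemma hom_mod_lin: "f \<in> carrier (hom_mod A N P) \<Longrightarrow> f \<in> lin A N P"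
  by simp

lemma hom_mod_eqI:
  assumes "f \<in> carrier (hom_mod A N P)" "g \<in> carrier (hom_mod A N P)" "\<And>x. x \<in> carrier N \<Longrightarrow> f x = g x"
  shows "f = g"
  by (rule extensionalityI[of f "carrier N"]) (use assms in simp_all)

lemma module_hom_mod:
  assumes "module A N" "module A P"
  shows "module A (hom_mod A N P)"
proof -
  interpret N: module A N by fact
  interpret P: module A P by fact
  let ?H = "hom_mod A N P"
  note cl = lin_closed[OF hom_mod_lin]
  have z: "\<zero>\<^bsub>?H\<^esub> \<in> carrier ?H"
    unfolding hom_mod_simps(2) by (rule hom_modI[OF lin_zero_fun[OF assms(2)] assms(1)])
  have a: "f \<oplus>\<^bsub>?H\<^esub> g \<in> carrier ?H" if "f \<in> carrier ?H" "g \<in> carrier ?H" for f g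
    unfolding hom_mod_simps(3) by (rule hom_modI[OF lin_plus[OF assms(2) hom_mod_lin[OF that(1)] hom_mod_lin[OF that(2)]] assms(1)])
  have s: "c \<odot>\<^bsub>?H\<^esub> f \<in> carrier ?H" if "c \<in> carrier A" "f \<in> carrier ?H" for c f
    unfolding hom_mod_simps(4) by (rule hom_modI[OF lin_smult_fun[OF assms(2) hom_mod_lin[OF that(2)] that(1)] assms(1)])
  have av: "(f \<oplus>\<^bsub>?H\<^esub> g) x = f x \<oplus>\<^bsub>P\<^esub> g x" "(c \<odot>\<^bsub>?H\<^esub> f) x = c \<odot>\<^bsub>P\<^esub> f x" "\<zero>\<^bsub>?H\<^esub> x = \<zero>\<^bsub>P\<^esub>" if "x \<in> carrier N" for f g x c
    using that by simp_all
  have ag: "abelian_group ?H"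
  proof (rule abelian_groupI)
    fix f g h assume f: "f \<in> carrier ?H" and g: "g \<in> carrier ?H" and h: "h \<in> carrier ?H"
    show "f \<oplus>\<^bsub>?H\<^esub> g \<in> carrier ?H" by (rule a[OF f g])
    show "f \<oplus>\<^bsub>?H\<^esub> g \<oplus>\<^bsub>?H\<^esub> h = f \<oplus>\<^bsub>?H\<^esub> (g \<oplus>\<^bsub>?H\<^esub> h)"
      by (rule hom_mod_eqI[OF a[OF a[OF f g] h] a[OF f a[OF g h]]])
        (simp only: av P.a_assoc cl[OF f] cl[OF g] cl[OF h])
    show "f \<oplus>\<^bsub>?H\<^esub> g = g \<oplus>\<^bsub>?H\<^esub> f"
      by (rule hom_mod_eqI[OF a[OF f g] a[OF g f]]) (simp only: av P.a_comm cl[OF f] cl[OF g])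
  next
    fix f assume f: "f \<in> carrier ?H"
    show "\<zero>\<^bsub>?H\<^esub> \<oplus>\<^bsub>?H\<^esub> f = f"
      by (rule hom_mod_eqI[OF a[OF z f] f]) (simp only: av P.l_zero cl[OF f])
    have m: "(\<ominus>\<^bsub>A\<^esub> \<one>\<^bsub>A\<^esub>) \<odot>\<^bsub>?H\<^esub> f \<in> carrier ?H" by (rule s[OF _ f]) simp
    have "(\<ominus>\<^bsub>A\<^esub> \<one>\<^bsub>A\<^esub>) \<odot>\<^bsub>?H\<^esub> f \<oplus>\<^bsub>?H\<^esub> f = \<zero>\<^bsub>?H\<^esub>"
      by (rule hom_mod_eqI[OF a[OF m f] z])
        (simp only: av, simp add: P.smult_l_minus P.l_neg cl[OF f])
    from this m show "\<exists>g\<in>carrier ?H. g \<oplus>\<^bsub>?H\<^esub> f = \<zero>\<^bsub>?H\<^esub>" by (rule bexI)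
  qed (rule z)
  show ?thesis
  proof (rule moduleI[OF N.is_cring ag])
    fix c d f g assume c: "c \<in> carrier A" and d: "d \<in> carrier A" and f: "f \<in> carrier ?H" and g: "g \<in> carrier ?H"
    have cd: "c \<oplus>\<^bsub>A\<^esub> d \<in> carrier A" "c \<otimes>\<^bsub>A\<^esub> d \<in> carrier A" using c d by simp_all
    show "c \<odot>\<^bsub>?H\<^esub> f \<in> carrier ?H" by (rule s[OF c f])
    show "(c \<oplus>\<^bsub>A\<^esub> d) \<odot>\<^bsub>?H\<^esub> f = c \<odot>\<^bsub>?H\<^esub> f \<oplus>\<^bsub>?H\<^esub> d \<odot>\<^bsub>?H\<^esub> f"
      by (rule hom_mod_eqI[OF s[OF cd(1) f] a[OF s[OF c f] s[OF d f]]]) (simp only: av P.smult_l_distr cl[OF f] c d)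
    show "c \<odot>\<^bsub>?H\<^esub> (f \<oplus>\<^bsub>?H\<^esub> g) = c \<odot>\<^bsub>?H\<^esub> f \<oplus>\<^bsub>?H\<^esub> c \<odot>\<^bsub>?H\<^esub> g"
      by (rule hom_mod_eqI[OF s[OF c a[OF f g]] a[OF s[OF c f] s[OF c g]]]) (simp only: av P.smult_r_distr cl[OF f] cl[OF g] c)
    show "(c \<otimes>\<^bsub>A\<^esub> d) \<odot>\<^bsub>?H\<^esub> f = c \<odot>\<^bsub>?H\<^esub> (d \<odot>\<^bsub>?H\<^esub> f)"
      by (rule hom_mod_eqI[OF s[OF cd(2) f] s[OF c s[OF d f]]]) (simp only: av P.smult_assoc1 cl[OF f] c d)
  next
    fix f assume f: "f \<in> carrier ?H"
    show "\<one>\<^bsub>A\<^esub> \<odot>\<^bsub>?H\<^esub> f = f"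
      by (rule hom_mod_eqI[OF s[OF N.R.one_closed f] f]) (simp only: av P.smult_one cl[OF f])
  qed
qed

lemma hom_eval_lin:
  assumes "x \<in> carrier N"
  shows "(\<lambda>f. f x) \<in> lin A (hom_mod A N P) P"
proof (rule linI)
  show "f x \<in> carrier P" if "f \<in> carrier (hom_mod A N P)" for f
    by (rule lin_closed[OF hom_mod_lin[OF that] assms])
qed (simp_all add: assms)

lemma hom_finsum:
  assumes "module A N" "module A P" "x \<in> carrier N" "\<And>v. v \<in> V \<Longrightarrow> f v \<in> carrier (hom_mod A N P)"
  shows "finsum (hom_mod A N P) f V x = finsum P (\<lambda>v. f v x) V"
  by (rule lin_finsum[OF module_hom_mod[OF assms(1,2)] assms(2) hom_eval_lin[OF assms(3)] assms(4)])

lemma module_end_alg: "module A N \<Longrightarrow> module A (end_alg A N)"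
  by (rule module_record_cong[OF module_hom_mod]) simp_all

lemma nalg_end_alg:
  assumes "module A N"
  shows "nalg A (end_alg A N)"
proof -
  let ?E = "end_alg A N" and ?H = "hom_mod A N N"
  interpret N: module A N by fact
  interpret E: module A ?E by (rule module_end_alg[OF assms])
  note cl = lin_closed[OF hom_mod_lin]
  have c: "compose (carrier N) f g \<in> carrier ?H" if "f \<in> carrier ?H" "g \<in> carrier ?H" for f g
    unfolding compose_def by (rule hom_modI[OF lin_comp[OF hom_mod_lin[OF that(2)] hom_mod_lin[OF that(1)]] assms])
  have cv: "compose (carrier N) f g x = f (g x)" if "x \<in> carrier N" for f g x using that by (simp add: compose_def)
  have av: "(f \<oplus>\<^bsub>?H\<^esub> g) x = f x \<oplus>\<^bsub>N\<^esub> g x" "(c \<odot>\<^bsub>?H\<^esub> f) x = c \<odot>\<^bsub>N\<^esub> f x" if "x \<in> carrier N" for f g x c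
    using that by simp_all
  interpret H: module A ?H by (rule module_hom_mod[OF assms assms])
  have 1: "compose (carrier N) f \<in> lin A ?H ?H" if f: "f \<in> carrier ?H" for f
  proof (rule linI)
    fix g h assume g: "g \<in> carrier ?H" and h: "h \<in> carrier ?H"
    show "compose (carrier N) f g \<in> carrier ?H" by (rule c[OF f g])
    show "compose (carrier N) f (g \<oplus>\<^bsub>?H\<^esub> h) = compose (carrier N) f g \<oplus>\<^bsub>?H\<^esub> compose (carrier N) f h"
      by (rule hom_mod_eqI[OF c[OF f H.a_closed[OF g h]] H.a_closed[OF c[OF f g] c[OF f h]]])
        (simp only: cv av lin_add[OF hom_mod_lin[OF f]] cl[OF g] cl[OF h])
    show "compose (carrier N) f (a \<odot>\<^bsub>?H\<^esub> g) = a \<odot>\<^bsub>?H\<^esub> compose (carrier N) f g" if a: "a \<in> carrier A" for a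
      by (rule hom_mod_eqI[OF c[OF f H.smult_closed[OF a g]] H.smult_closed[OF a c[OF f g]]])
        (simp only: cv av lin_smult[OF hom_mod_lin[OF f] a] cl[OF g])
  qed
  have 2: "(\<lambda>g. compose (carrier N) g f) \<in> lin A ?H ?H" if f: "f \<in> carrier ?H" for f
  proof (rule linI)
    fix g h assume g: "g \<in> carrier ?H" and h: "h \<in> carrier ?H"
    show "compose (carrier N) g f \<in> carrier ?H" by (rule c[OF g f])
    show "compose (carrier N) (g \<oplus>\<^bsub>?H\<^esub> h) f = compose (carrier N) g f \<oplus>\<^bsub>?H\<^esub> compose (carrier N) h f"
      by (rule hom_mod_eqI[OF c[OF H.a_closed[OF g h] f] H.a_closed[OF c[OF g f] c[OF h f]]])
        (simp only: cv av cl[OF f])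
    show "compose (carrier N) (a \<odot>\<^bsub>?H\<^esub> g) f = a \<odot>\<^bsub>?H\<^esub> compose (carrier N) g f" if a: "a \<in> carrier A" for a
      by (rule hom_mod_eqI[OF c[OF H.smult_closed[OF a g] f] H.smult_closed[OF a c[OF g f]]])
        (simp only: cv av cl[OF f])
  qed
  \<comment> \<open>\<open>lin\<close> reads only the carrier, addition and scalars, which
    \<open>end_alg\<close> shares with \<open>hom_mod\<close>.\<close>
  have e: "lin A ?E ?E = lin A ?H ?H" unfolding lin_def by simp
  show ?thesis
    unfolding nalg_def bilin_def e end_alg_simps
    using module_end_alg[OF assms] hom_modI[OF lin_id assms] 1 2 by blast
qed

text \<open>Vectors and functionals exchange roles: the coordinates on the dual are the evaluations
  at the e_v. The functionals are restricted to the carrier because \<open>hom_mod\<close> contains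
  extensional functions only.\<close>

lemma fin_basis_dual:
  assumes "module A N" "fin_basis A N V e d"
  shows "fin_basis A (dual_mod A N) V (\<lambda>v. \<lambda>x\<in>carrier N. d v x) (\<lambda>v t. t (e v))"
proof -
  interpret N: module A N by fact
  note mS = module_self_mod[OF N.is_cring]
  interpret S: module A "self_mod A" by (rule mS)
  note F = fin_basisD[OF assms(2)] and dc = fin_basis_coord_closed[OF assms(2)]
  interpret D: module A "hom_mod A N (self_mod A)" by (rule module_hom_mod[OF assms(1) mS])
  have de: "(\<lambda>x\<in>carrier N. d v x) \<in> carrier (hom_mod A N (self_mod A))" if "v \<in> V" for v
    by (rule hom_modI[OF F(3)[OF that] assms(1)])
  show ?thesis
    unfolding fin_basis_def dual_mod_def
  proof (intro conjI ballI)
    show "(\<lambda>x\<in>carrier N. d w x) (e v) = (if v = w then \<one>\<^bsub>A\<^esub> else \<zero>\<^bsub>A\<^esub>)" if "v \<in> V" "w \<in> V" for v w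
      using F(2)[OF that(1)] F(4)[OF that(2,1)] by auto
    show "(\<lambda>t. t (e v)) \<in> lin A (hom_mod A N (self_mod A)) (self_mod A)" if "v \<in> V" for v
      by (rule hom_eval_lin[OF F(2)[OF that]])
    fix t assume t: "t \<in> carrier (hom_mod A N (self_mod A))"
    have te: "t (e v) \<in> carrier A" if "v \<in> V" for v using lin_closed[OF hom_mod_lin[OF t] F(2)[OF that]] by simp
    let ?s = "finsum (hom_mod A N (self_mod A)) (\<lambda>v. t (e v) \<odot>\<^bsub>hom_mod A N (self_mod A)\<^esub> (\<lambda>x\<in>carrier N. d v x)) V"
    have c: "t (e v) \<odot>\<^bsub>hom_mod A N (self_mod A)\<^esub> (\<lambda>x\<in>carrier N. d v x) \<in> carrier (hom_mod A N (self_mod A))" if "v \<in> V" for v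
      by (rule D.smult_closed[OF te[OF that] de[OF that]])
    show "t = ?s"
    proof (rule hom_mod_eqI[OF t])
      show "?s \<in> carrier (hom_mod A N (self_mod A))" by (rule finsum_cl[OF D.module_axioms c])
      fix x assume x: "x \<in> carrier N"
      have "t x = t (finsum N (\<lambda>v. d v x \<odot>\<^bsub>N\<^esub> e v) V)" using F(5)[OF x] by simp
      also have "\<dots> = finsum (self_mod A) (\<lambda>v. t (d v x \<odot>\<^bsub>N\<^esub> e v)) V"
        by (rule lin_finsum[OF assms(1) mS hom_mod_lin[OF t]]) (intro N.smult_closed dc F(2) x)
      also have "\<dots> = finsum (self_mod A) (\<lambda>v. (t (e v) \<odot>\<^bsub>hom_mod A N (self_mod A)\<^esub> (\<lambda>x\<in>carrier N. d v x)) x) V"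
      proof (rule S.finsum_cong'[OF refl])
        show "(\<lambda>v. (t (e v) \<odot>\<^bsub>hom_mod A N (self_mod A)\<^esub> (\<lambda>x\<in>carrier N. d v x)) x) \<in> V \<rightarrow> carrier (self_mod A)"
          by (rule Pi_I) (rule lin_closed[OF hom_mod_lin[OF c] x])
        fix v assume v: "v \<in> V"
        show "t (d v x \<odot>\<^bsub>N\<^esub> e v) = (t (e v) \<odot>\<^bsub>hom_mod A N (self_mod A)\<^esub> (\<lambda>x\<in>carrier N. d v x)) x"
          using lin_smult[OF hom_mod_lin[OF t] dc[OF v x] F(2)[OF v]] x te[OF v] dc[OF v x]
          by (simp add: N.R.m_comm)
      qed
      also have "\<dots> = ?s x" by (rule hom_finsum[OF assms(1) mS x c, symmetric])
      finally show "t x = ?s x" .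
    qed
  qed (use F(1) de in simp_all)
qed

section \<open>Endomorphisms of the free module\<close>

lemma fin_basis_FM:
  assumes "cring A"
  shows "fin_basis A (FM A n) {1..n} (unit_vec A) (\<lambda>k x. x k)"
  unfolding fin_basis_def
proof (intro conjI ballI)
  fix x assume x: "x \<in> carrier (FM A n)"
  have "x = lsum A (FM A n) (unit_vec A) x" by (rule free_expand[OF assms x, symmetric])
  also have "\<dots> = finsum (FM A n) (\<lambda>v. x v \<odot>\<^bsub>FM A n\<^esub> unit_vec A v) {1..n}"
  proof (rule lsum_eq_finsum[OF module_free_mod[OF assms]])
    show "{v. x v \<noteq> \<zero>\<^bsub>A\<^esub>} \<subseteq> {1..n}" using free_mod_outside[OF x] by blast
  qed (rule finite_atLeastAtMost free_mod_coeff[OF x] unit_vec_closed[OF assms], assumption?)+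
  finally show "x = finsum (FM A n) (\<lambda>v. x v \<odot>\<^bsub>FM A n\<^esub> unit_vec A v) {1..n}" .
next
  show "unit_vec A w v = (if v = w then \<one>\<^bsub>A\<^esub> else \<zero>\<^bsub>A\<^esub>)" for v w :: nat
    by (simp only: unit_vec_def)
qed (rule finite_atLeastAtMost unit_vec_closed[OF assms] coeff_lin[OF assms], assumption?)+

lemma T_end_closed:
  assumes "cring A" "i \<in> {1..n}"
  shows "T_end A n i j \<in> carrier (EndF A n)"
  unfolding T_end_def end_alg_simps
  by (rule hom_modI[OF lin_comp[OF coeff_lin[OF assms(1)] smult_lin[OF module_free_mod[OF assms(1)]
          unit_vec_closed[OF assms]]] module_free_mod[OF assms(1)]])

lemma module_EndF: "cring A \<Longrightarrow> module A (EndF A n)"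
  by (rule module_end_alg[OF module_free_mod])

lemma nalg_EndF: "cring A \<Longrightarrow> nalg A (EndF A n)"
  by (rule nalg_end_alg[OF module_free_mod])

lemma EndF_eval_lin:
  "x \<in> carrier (FM A n) \<Longrightarrow> (\<lambda>g. g x) \<in> lin A (EndF A n) (FM A n)"
  using hom_eval_lin[of x "FM A n" A "FM A n"] unfolding lin_def by simp

lemma T_dual_lin:
  assumes "cring A" "j \<in> {1..n}"
  shows "T_dual A n i j \<in> lin A (EndF A n) (self_mod A)"
  unfolding T_dual_def
  by (rule lin_restrict[OF lin_comp[OF EndF_eval_lin[OF unit_vec_closed[OF assms]] coeff_lin[OF assms(1)]]
        module_EndF[OF assms(1)]])

lemma T_dual_T_end:
  assumes "cring A" "i \<in> {1..n}" "j \<in> {1..n}" "k \<in> {1..n}" "l \<in> {1..n}"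
  shows "T_dual A n i j (T_end A n k l) = (if (i, j) = (k, l) then \<one>\<^bsub>A\<^esub> else \<zero>\<^bsub>A\<^esub>)"
proof -
  interpret cring A by fact
  show ?thesis
    unfolding T_dual_def using T_end_closed[OF assms(1,4), of l] unit_vec_closed[OF assms(1,3)]
    by (simp add: T_end_def del: end_alg_simps free_mod_carrier) (simp add: unit_vec_def)
qed

text \<open>The matrix unit T_ij sends T_k to T_i when j = k and to zero otherwise, so evaluating
  \<Sum> g_ij T_ij at T_k leaves exactly column k of g.\<close>

lemma fin_basis_EndF:
  assumes "cring A"
  shows "fin_basis A (EndF A n) ({1..n} \<times> {1..n}) (\<lambda>(i, j). T_end A n i j) (\<lambda>(i, j). T_dual A n i j)"
proof -
  interpret A: cring A by fact
  let ?E = "EndF A n" and ?V = "{1..n} \<times> {1..n}" and ?F = "FM A n"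
  let ?e = "\<lambda>(i, j). T_end A n i j" and ?d = "\<lambda>(i, j). T_dual A n i j"
  note mF = module_free_mod[OF assms, of "{1..n}"] and mE = module_EndF[OF assms, of n]
  interpret F: module A ?F by (rule mF)
  interpret E: module A ?E by (rule mE)
  have e: "?e v \<in> carrier ?E" if "v \<in> ?V" for v
    using T_end_closed[OF assms, of "fst v" n "snd v"] that by (cases v) (simp del: end_alg_simps)
  have d: "?d v \<in> lin A ?E (self_mod A)" if "v \<in> ?V" for v
    using T_dual_lin[OF assms, of "snd v" n "fst v"] that by (cases v) (simp del: end_alg_simps)
  have dc: "?d v g \<in> carrier A" if "v \<in> ?V" "g \<in> carrier ?E" for v g
    using lin_closed[OF d[OF that(1)] that(2)] by simp
  show ?thesis
    unfolding fin_basis_def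
  proof (intro conjI ballI)
    show "?d v (?e w) = (if v = w then \<one>\<^bsub>A\<^esub> else \<zero>\<^bsub>A\<^esub>)" if "v \<in> ?V" "w \<in> ?V" for v w
      using T_dual_T_end[OF assms, of "fst v" n "snd v" "fst w" "snd w"] that by (cases v; cases w) simp
    fix g assume g: "g \<in> carrier ?E"
    have gH: "g \<in> carrier (hom_mod A ?F ?F)" using g by (simp only: end_alg_simps)
    have glin: "g \<in> lin A ?F ?F" by (rule hom_mod_lin[OF gH])
    let ?s = "finsum ?E (\<lambda>v. ?d v g \<odot>\<^bsub>?E\<^esub> ?e v) ?V"
    have c: "?d v g \<odot>\<^bsub>?E\<^esub> ?e v \<in> carrier ?E" if "v \<in> ?V" for v
      by (rule E.smult_closed[OF dc[OF that g] e[OF that]])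
    have s: "?s \<in> carrier ?E" by (rule finsum_cl[OF mE c])
    have sH: "?s \<in> carrier (hom_mod A ?F ?F)" using s by (simp only: end_alg_simps)
    show "g = ?s"
    proof (rule hom_mod_eqI[OF gH sH])
      fix x assume x: "x \<in> carrier ?F"
      show "g x = ?s x"
      proof (rule free_ext[OF mF, where f = g and g = ?s, OF glin hom_mod_lin[OF sH] _ x])
        fix k assume k: "k \<in> {1..n}"
        note uk = unit_vec_closed[OF assms k]
        have ev: "(\<lambda>h. h (unit_vec A k) l) \<in> lin A ?E (self_mod A)" for l
          by (rule lin_comp[OF EndF_eval_lin[OF uk] coeff_lin[OF assms]])
        show "g (unit_vec A k) = ?s (unit_vec A k)"
        proof
          fix l
          have gk: "g (unit_vec A k) \<in> carrier ?F" by (rule lin_closed[OF glin uk])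
          have sk: "?s (unit_vec A k) \<in> carrier ?F" by (rule lin_closed[OF hom_mod_lin[OF sH] uk])
          show "g (unit_vec A k) l = ?s (unit_vec A k) l"
          proof (cases "l \<in> {1..n}")
            case True
            have "?s (unit_vec A k) l = finsum (self_mod A) (\<lambda>v. (?d v g \<odot>\<^bsub>?E\<^esub> ?e v) (unit_vec A k) l) ?V"
              by (rule lin_finsum[OF mE module_self_mod[OF assms] ev c])
            also have "\<dots> = finsum A (\<lambda>v. (?d v g \<odot>\<^bsub>?E\<^esub> ?e v) (unit_vec A k) l) ?V"
              by (rule finsum_record_cong) simp_all
            \<comment> \<open>Only the matrix unit T_lk contributes to the coordinate l of the image
              of T_k.\<close>
            also have "\<dots> = finsum A (\<lambda>v. if (l, k) = v then g (unit_vec A k) l else \<zero>\<^bsub>A\<^esub>) ?V"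
            proof (rule A.finsum_cong'[OF refl])
              show "(\<lambda>v. if (l, k) = v then g (unit_vec A k) l else \<zero>\<^bsub>A\<^esub>) \<in> ?V \<rightarrow> carrier A"
                using free_mod_coeff[OF gk] by simp
              fix v assume v: "v \<in> ?V"
              obtain i j where ij: "v = (i, j)" "i \<in> {1..n}" "j \<in> {1..n}" using v by blast
              have dg: "T_dual A n i j g = g (unit_vec A j) i" using g by (simp add: T_dual_def del: end_alg_simps)
              have gj: "g (unit_vec A j) i \<in> carrier A"
                by (rule free_mod_coeff[OF lin_closed[OF glin unit_vec_closed[OF assms ij(3)]]])
              show "(?d v g \<odot>\<^bsub>?E\<^esub> ?e v) (unit_vec A k) l = (if (l, k) = v then g (unit_vec A k) l else \<zero>\<^bsub>A\<^esub>)"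
                using uk gj by (simp add: ij dg T_end_def) (simp add: unit_vec_def)
            qed
            also have "\<dots> = g (unit_vec A k) l"
              using True k free_mod_coeff[OF gk] by (intro A.finsum_singleton) auto
            finally show ?thesis by simp
          next
            case False
            \<comment> \<open>Vectors of F are functions on all natural numbers; outside the range
              from 1 to n both values are zero.\<close>
            show ?thesis by (simp only: free_mod_outside[OF gk False] free_mod_outside[OF sk False])
          qed
        qed
      qed
    qed
  qed (use e d in \<open>simp_all del: end_alg_simps\<close>)
qed

section \<open>Matrices\<close>

lemma finsum_swap:
  assumes "abelian_monoid G" "finite J" "\<And>i j. i \<in> I \<Longrightarrow> j \<in> J \<Longrightarrow> f i j \<in> carrier G"
  shows "finsum G (\<lambda>i. finsum G (\<lambda>j. f i j) J) I = finsum G (\<lambda>j. finsum G (\<lambda>i. f i j) I) J"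
proof -
  interpret G: abelian_monoid G by fact
  show ?thesis
  proof (cases "finite I")
    case True
    then show ?thesis using assms(3)
    proof (induction I)
      case empty
      then show ?case by (simp add: G.finsum_zero)
    next
      case (insert i I)
      have c: "finsum G (\<lambda>j. f a j) J \<in> carrier G" if "a \<in> insert i I" for a
        using insert.prems that by (intro G.finsum_closed) auto
      have c': "finsum G (\<lambda>i. f i j) I \<in> carrier G" if "j \<in> J" for j
        using insert.prems that by (intro G.finsum_closed) auto
      have "finsum G (\<lambda>i. finsum G (\<lambda>j. f i j) J) (insert i I) =
          finsum G (\<lambda>j. f i j) J \<oplus>\<^bsub>G\<^esub> finsum G (\<lambda>j. finsum G (\<lambda>i. f i j) I) J"
        using insert c by (subst G.finsum_insert) auto
      also have "\<dots> = finsum G (\<lambda>j. f i j \<oplus>\<^bsub>G\<^esub> finsum G (\<lambda>i. f i j) I) J"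
        using insert.prems c' by (intro G.finsum_addf[symmetric]) auto
      also have "\<dots> = finsum G (\<lambda>j. finsum G (\<lambda>i. f i j) (insert i I)) J"
        using insert c' by (intro G.finsum_cong' refl) (auto simp: G.finsum_insert Pi_iff)
      finally show ?case .
    qed
  next
    case False
    then show ?thesis by (simp add: G.finsum_infinite G.finsum_zero)
  qed
qed

lemma mat_alg_simps:
  "carrier (mat_alg n B) = {1..n} \<times> {1..n} \<rightarrow>\<^sub>E carrier B"
  "zero (mat_alg n B) = (\<lambda>x\<in>{1..n} \<times> {1..n}. \<zero>\<^bsub>B\<^esub>)"
  "one (mat_alg n B) = (\<lambda>(i, j)\<in>{1..n} \<times> {1..n}. if i = j then \<one>\<^bsub>B\<^esub> else \<zero>\<^bsub>B\<^esub>)"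
  "add (mat_alg n B) = (\<lambda>p q. \<lambda>x\<in>{1..n} \<times> {1..n}. p x \<oplus>\<^bsub>B\<^esub> q x)"
  "smult (mat_alg n B) = (\<lambda>a p. \<lambda>x\<in>{1..n} \<times> {1..n}. a \<odot>\<^bsub>B\<^esub> p x)"
  "mult (mat_alg n B) = (\<lambda>p q. \<lambda>(i, j)\<in>{1..n} \<times> {1..n}. finsum B (\<lambda>k. p (i, k) \<otimes>\<^bsub>B\<^esub> q (k, j)) {1..n})"
  unfolding mat_alg_def by (simp_all add: Let_def)

lemma mat_closed: "p \<in> carrier (mat_alg n B) \<Longrightarrow> v \<in> {1..n} \<times> {1..n} \<Longrightarrow> p v \<in> carrier B"
  unfolding mat_alg_simps by (rule PiE_mem)

lemma matI: "(\<And>v. v \<in> {1..n} \<times> {1..n} \<Longrightarrow> f v \<in> carrier B) \<Longrightarrow> (\<lambda>v\<in>{1..n} \<times> {1..n}. f v) \<in> carrier (mat_alg n B)"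
  unfolding mat_alg_simps by simp

lemma mat_eqI:
  assumes "p \<in> carrier (mat_alg n B)" "q \<in> carrier (mat_alg n B)" "\<And>v. v \<in> {1..n} \<times> {1..n} \<Longrightarrow> p v = q v"
  shows "p = q"
  using assms unfolding mat_alg_simps by (rule PiE_ext)

lemma module_mat_alg:
  assumes "module A B"
  shows "module A (mat_alg n B)"
proof -
  interpret B: module A B by fact
  let ?M = "mat_alg n B" and ?V = "{1..n} \<times> {1..n}"
  have z: "\<zero>\<^bsub>?M\<^esub> \<in> carrier ?M" unfolding mat_alg_simps(2) by (rule matI) simp
  have a: "p \<oplus>\<^bsub>?M\<^esub> q \<in> carrier ?M" if "p \<in> carrier ?M" "q \<in> carrier ?M" for p q
    unfolding mat_alg_simps(4) by (rule matI) (intro B.a_closed mat_closed[OF that(1)] mat_closed[OF that(2)])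
  have s: "c \<odot>\<^bsub>?M\<^esub> p \<in> carrier ?M" if "c \<in> carrier A" "p \<in> carrier ?M" for c p
    unfolding mat_alg_simps(5) by (rule matI) (intro B.smult_closed that mat_closed[OF that(2)])
  have av: "(p \<oplus>\<^bsub>?M\<^esub> q) x = p x \<oplus>\<^bsub>B\<^esub> q x" "(c \<odot>\<^bsub>?M\<^esub> p) x = c \<odot>\<^bsub>B\<^esub> p x" "\<zero>\<^bsub>?M\<^esub> x = \<zero>\<^bsub>B\<^esub>" if "x \<in> ?V" for p q x c
    using that by (simp_all add: mat_alg_simps)
  note cl = mat_closed
  have ag: "abelian_group ?M"
  proof (rule abelian_groupI)
    fix f g h assume f: "f \<in> carrier ?M" and g: "g \<in> carrier ?M" and h: "h \<in> carrier ?M"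
    show "f \<oplus>\<^bsub>?M\<^esub> g \<in> carrier ?M" by (rule a[OF f g])
    show "f \<oplus>\<^bsub>?M\<^esub> g \<oplus>\<^bsub>?M\<^esub> h = f \<oplus>\<^bsub>?M\<^esub> (g \<oplus>\<^bsub>?M\<^esub> h)"
      by (rule mat_eqI[OF a[OF a[OF f g] h] a[OF f a[OF g h]]])
        (simp only: av B.a_assoc cl[OF f] cl[OF g] cl[OF h])
    show "f \<oplus>\<^bsub>?M\<^esub> g = g \<oplus>\<^bsub>?M\<^esub> f"
      by (rule mat_eqI[OF a[OF f g] a[OF g f]]) (simp only: av B.a_comm cl[OF f] cl[OF g])
  next
    fix f assume f: "f \<in> carrier ?M"
    show "\<zero>\<^bsub>?M\<^esub> \<oplus>\<^bsub>?M\<^esub> f = f"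
      by (rule mat_eqI[OF a[OF z f] f]) (simp only: av B.l_zero cl[OF f])
    have m: "(\<ominus>\<^bsub>A\<^esub> \<one>\<^bsub>A\<^esub>) \<odot>\<^bsub>?M\<^esub> f \<in> carrier ?M" by (rule s[OF _ f]) simp
    have "(\<ominus>\<^bsub>A\<^esub> \<one>\<^bsub>A\<^esub>) \<odot>\<^bsub>?M\<^esub> f \<oplus>\<^bsub>?M\<^esub> f = \<zero>\<^bsub>?M\<^esub>"
      by (rule mat_eqI[OF a[OF m f] z])
        (simp only: av, simp add: B.smult_l_minus B.l_neg cl[OF f])
    from this m show "\<exists>g\<in>carrier ?M. g \<oplus>\<^bsub>?M\<^esub> f = \<zero>\<^bsub>?M\<^esub>" by (rule bexI)
  qed (rule z)
  show ?thesis
  proof (rule moduleI[OF B.is_cring ag])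
    fix c d f g assume c: "c \<in> carrier A" and d: "d \<in> carrier A" and f: "f \<in> carrier ?M" and g: "g \<in> carrier ?M"
    have cd: "c \<oplus>\<^bsub>A\<^esub> d \<in> carrier A" "c \<otimes>\<^bsub>A\<^esub> d \<in> carrier A" using c d by simp_all
    show "c \<odot>\<^bsub>?M\<^esub> f \<in> carrier ?M" by (rule s[OF c f])
    show "(c \<oplus>\<^bsub>A\<^esub> d) \<odot>\<^bsub>?M\<^esub> f = c \<odot>\<^bsub>?M\<^esub> f \<oplus>\<^bsub>?M\<^esub> d \<odot>\<^bsub>?M\<^esub> f"
      by (rule mat_eqI[OF s[OF cd(1) f] a[OF s[OF c f] s[OF d f]]]) (simp only: av B.smult_l_distr cl[OF f] c d)
    show "c \<odot>\<^bsub>?M\<^esub> (f \<oplus>\<^bsub>?M\<^esub> g) = c \<odot>\<^bsub>?M\<^esub> f \<oplus>\<^bsub>?M\<^esub> c \<odot>\<^bsub>?M\<^esub> g"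
      by (rule mat_eqI[OF s[OF c a[OF f g]] a[OF s[OF c f] s[OF c g]]]) (simp only: av B.smult_r_distr cl[OF f] cl[OF g] c)
    show "(c \<otimes>\<^bsub>A\<^esub> d) \<odot>\<^bsub>?M\<^esub> f = c \<odot>\<^bsub>?M\<^esub> (d \<odot>\<^bsub>?M\<^esub> f)"
      by (rule mat_eqI[OF s[OF cd(2) f] s[OF c s[OF d f]]]) (simp only: av B.smult_assoc1 cl[OF f] c d)
  next
    fix f assume f: "f \<in> carrier ?M"
    show "\<one>\<^bsub>A\<^esub> \<odot>\<^bsub>?M\<^esub> f = f"
      by (rule mat_eqI[OF s[OF B.R.one_closed f] f]) (simp only: av B.smult_one cl[OF f])
  qed
qed

lemma mat_entry_lin:
  assumes "v \<in> {1..n} \<times> {1..n}"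
  shows "(\<lambda>p. p v) \<in> lin A (mat_alg n B) B"
  by (rule linI) (use assms in \<open>simp_all add: mat_closed[OF _ assms] mat_alg_simps(4,5)\<close>)

lemma mat_linI:
  assumes "module A N" "module A B" "\<And>x. x \<in> carrier N \<Longrightarrow> f x \<in> carrier (mat_alg n B)"
    and l: "\<And>v. v \<in> {1..n} \<times> {1..n} \<Longrightarrow> (\<lambda>x. f x v) \<in> lin A N B"
  shows "f \<in> lin A N (mat_alg n B)"
proof -
  interpret N: module A N by fact
  interpret M: module A "mat_alg n B" by (rule module_mat_alg[OF assms(2)])
  show ?thesis
  proof (rule linI)
    fix x y assume xy: "x \<in> carrier N" "y \<in> carrier N"
    show "f (x \<oplus>\<^bsub>N\<^esub> y) = f x \<oplus>\<^bsub>mat_alg n B\<^esub> f y"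
      by (rule mat_eqI[OF assms(3)[OF N.a_closed[OF xy]] M.a_closed[OF assms(3)[OF xy(1)] assms(3)[OF xy(2)]]])
        (simp add: lin_add[OF l xy] mat_alg_simps(4))
  next
    fix a x assume a: "a \<in> carrier A" and x: "x \<in> carrier N"
    show "f (a \<odot>\<^bsub>N\<^esub> x) = a \<odot>\<^bsub>mat_alg n B\<^esub> f x"
      by (rule mat_eqI[OF assms(3)[OF N.smult_closed[OF a x]] M.smult_closed[OF a assms(3)[OF x]]])
        (simp add: lin_smult[OF l a x] mat_alg_simps(5))
  qed (rule assms(3))
qed

lemma mat_mult_entry:
  "i \<in> {1..n} \<Longrightarrow> j \<in> {1..n} \<Longrightarrow> (p \<otimes>\<^bsub>mat_alg n B\<^esub> q) (i, j) = finsum B (\<lambda>k. p (i, k) \<otimes>\<^bsub>B\<^esub> q (k, j)) {1..n}"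
  by (simp add: mat_alg_simps(6))

text \<open>Associativity of the matrix product is the interchange of two summations. It is
  established in addition to bilinearity because substitution forms products of several matrices and
  regroups them.\<close>

lemma galg_mat_alg:
  assumes "algebra A B"
  shows "galg A (mat_alg n B)"
proof -
  interpret B': cring B by (rule algebra_cring[OF assms])
  let ?M = "mat_alg n B" and ?V = "{1..n} \<times> {1..n}"
  note mB = algebra_module[OF assms]
  note mM = module_mat_alg[OF mB, of n]
  note bB = nalg_bilin[OF algebra_nalg[OF assms]]
  have fc: "finsum B f {1..n} \<in> carrier B" if "\<And>k. k \<in> {1..n} \<Longrightarrow> f k \<in> carrier B" for f
    using that by (intro B'.finsum_closed) blast
  have ent: "p (i, j) \<in> carrier B" if "p \<in> carrier ?M" "i \<in> {1..n}" "j \<in> {1..n}" for p i j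
    by (rule mat_closed[OF that(1)]) (use that in simp)
  have c: "p \<otimes>\<^bsub>?M\<^esub> q \<in> carrier ?M" if "p \<in> carrier ?M" "q \<in> carrier ?M" for p q
    unfolding mat_alg_simps(6) case_prod_unfold
    by (rule matI) (intro fc B'.m_closed ent that; force)
  have o: "\<one>\<^bsub>?M\<^esub> \<in> carrier ?M"
    unfolding mat_alg_simps(3) case_prod_unfold by (rule matI) simp
  have oe: "\<one>\<^bsub>?M\<^esub> (i, j) = (if i = j then \<one>\<^bsub>B\<^esub> else \<zero>\<^bsub>B\<^esub>)" if "i \<in> {1..n}" "j \<in> {1..n}" for i j
    using that by (simp add: mat_alg_simps(3))
  have b: "bilin A ?M ?M ?M (mult ?M)"
    unfolding bilin_def
  proof (intro conjI ballI)
    fix p assume p: "p \<in> carrier ?M"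
    show "(\<otimes>\<^bsub>?M\<^esub>) p \<in> lin A ?M ?M"
    proof (rule mat_linI[OF mM mB c[OF p]])
      fix v assume "v \<in> ?V"
      then obtain i j where v: "v = (i, j)" "i \<in> {1..n}" "j \<in> {1..n}" by blast
      show "(\<lambda>x. (p \<otimes>\<^bsub>?M\<^esub> x) v) \<in> lin A ?M B"
        unfolding v(1) mat_mult_entry[OF v(2,3)]
        by (rule lin_finsum_fun[OF mB mM])
          (rule lin_comp[OF mat_entry_lin bilinD1[OF bB ent[OF p v(2)]]]; (intro SigmaI v(2) v(3) | assumption)+)
    qed
    show "(\<lambda>q. q \<otimes>\<^bsub>?M\<^esub> p) \<in> lin A ?M ?M"
    proof (rule mat_linI[OF mM mB c[OF _ p]])
      fix v assume "v \<in> ?V"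
      then obtain i j where v: "v = (i, j)" "i \<in> {1..n}" "j \<in> {1..n}" by blast
      show "(\<lambda>x. (x \<otimes>\<^bsub>?M\<^esub> p) v) \<in> lin A ?M B"
        unfolding v(1) mat_mult_entry[OF v(2,3)]
        by (rule lin_finsum_fun[OF mB mM])
          (rule lin_comp[OF mat_entry_lin bilinD2[OF bB ent[OF p _ v(3)]]]; (intro SigmaI v(2) v(3) | assumption)+)
    qed
  qed
  have m: "Group.monoid ?M"
  proof (rule monoidI)
    fix p q r assume p: "p \<in> carrier ?M" and q: "q \<in> carrier ?M" and r: "r \<in> carrier ?M"
    show "p \<otimes>\<^bsub>?M\<^esub> q \<in> carrier ?M" by (rule c[OF p q])
    show "p \<otimes>\<^bsub>?M\<^esub> q \<otimes>\<^bsub>?M\<^esub> r = p \<otimes>\<^bsub>?M\<^esub> (q \<otimes>\<^bsub>?M\<^esub> r)"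
    proof (rule mat_eqI[OF c[OF c[OF p q] r] c[OF p c[OF q r]]])
      fix v assume "v \<in> ?V"
      then obtain i j where v: "v = (i, j)" "i \<in> {1..n}" "j \<in> {1..n}" by blast
      note I = Pi_I fc B'.m_closed ent[OF p] ent[OF q] ent[OF r] v(2) v(3)
      have "(p \<otimes>\<^bsub>?M\<^esub> q \<otimes>\<^bsub>?M\<^esub> r) v = finsum B (\<lambda>k. finsum B (\<lambda>l. p (i, l) \<otimes>\<^bsub>B\<^esub> q (l, k)) {1..n} \<otimes>\<^bsub>B\<^esub> r (k, j)) {1..n}"
        unfolding v(1) mat_mult_entry[OF v(2,3)]
      proof (rule B'.finsum_cong'[OF refl])
        show "(\<lambda>k. finsum B (\<lambda>l. p (i, l) \<otimes>\<^bsub>B\<^esub> q (l, k)) {1..n} \<otimes>\<^bsub>B\<^esub> r (k, j)) \<in> {1..n} \<rightarrow> carrier B"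
          by (intro I | assumption)+
      qed (simp only: mat_mult_entry[OF v(2)])
      also have "\<dots> = finsum B (\<lambda>k. finsum B (\<lambda>l. p (i, l) \<otimes>\<^bsub>B\<^esub> q (l, k) \<otimes>\<^bsub>B\<^esub> r (k, j)) {1..n}) {1..n}"
      proof (rule B'.finsum_cong'[OF refl])
        show "(\<lambda>k. finsum B (\<lambda>l. p (i, l) \<otimes>\<^bsub>B\<^esub> q (l, k) \<otimes>\<^bsub>B\<^esub> r (k, j)) {1..n}) \<in> {1..n} \<rightarrow> carrier B"
          by (intro I | assumption)+
        fix k assume k: "k \<in> {1..n}"
        show "finsum B (\<lambda>l. p (i, l) \<otimes>\<^bsub>B\<^esub> q (l, k)) {1..n} \<otimes>\<^bsub>B\<^esub> r (k, j) = finsum B (\<lambda>l. p (i, l) \<otimes>\<^bsub>B\<^esub> q (l, k) \<otimes>\<^bsub>B\<^esub> r (k, j)) {1..n}"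
          by (rule B'.finsum_ldistr[OF finite_atLeastAtMost]) (intro I k | assumption)+
      qed
      \<comment> \<open>The summations over k and l are interchanged; the other steps only move
        factors in and out of sums.\<close>
      also have "\<dots> = finsum B (\<lambda>l. finsum B (\<lambda>k. p (i, l) \<otimes>\<^bsub>B\<^esub> q (l, k) \<otimes>\<^bsub>B\<^esub> r (k, j)) {1..n}) {1..n}"
        by (rule finsum_swap[OF B'.abelian_monoid_axioms finite_atLeastAtMost]) (intro I | assumption)+
      also have "\<dots> = finsum B (\<lambda>l. p (i, l) \<otimes>\<^bsub>B\<^esub> finsum B (\<lambda>k. q (l, k) \<otimes>\<^bsub>B\<^esub> r (k, j)) {1..n}) {1..n}"
      proof (rule B'.finsum_cong'[OF refl])
        show "(\<lambda>l. p (i, l) \<otimes>\<^bsub>B\<^esub> finsum B (\<lambda>k. q (l, k) \<otimes>\<^bsub>B\<^esub> r (k, j)) {1..n}) \<in> {1..n} \<rightarrow> carrier B"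
          by (intro I | assumption)+
        fix l assume l: "l \<in> {1..n}"
        have "finsum B (\<lambda>k. p (i, l) \<otimes>\<^bsub>B\<^esub> q (l, k) \<otimes>\<^bsub>B\<^esub> r (k, j)) {1..n} = finsum B (\<lambda>k. p (i, l) \<otimes>\<^bsub>B\<^esub> (q (l, k) \<otimes>\<^bsub>B\<^esub> r (k, j))) {1..n}"
        proof (rule B'.finsum_cong'[OF refl])
          show "(\<lambda>k. p (i, l) \<otimes>\<^bsub>B\<^esub> (q (l, k) \<otimes>\<^bsub>B\<^esub> r (k, j))) \<in> {1..n} \<rightarrow> carrier B"
            by (intro I l | assumption)+
          show "p (i, l) \<otimes>\<^bsub>B\<^esub> q (l, k) \<otimes>\<^bsub>B\<^esub> r (k, j) = p (i, l) \<otimes>\<^bsub>B\<^esub> (q (l, k) \<otimes>\<^bsub>B\<^esub> r (k, j))" if k: "k \<in> {1..n}" for k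
            by (rule B'.m_assoc) (intro I l k)+
        qed
        also have "\<dots> = p (i, l) \<otimes>\<^bsub>B\<^esub> finsum B (\<lambda>k. q (l, k) \<otimes>\<^bsub>B\<^esub> r (k, j)) {1..n}"
          by (rule B'.finsum_rdistr[OF finite_atLeastAtMost, symmetric]) (intro I l | assumption)+
        finally show "finsum B (\<lambda>k. p (i, l) \<otimes>\<^bsub>B\<^esub> q (l, k) \<otimes>\<^bsub>B\<^esub> r (k, j)) {1..n} =
          p (i, l) \<otimes>\<^bsub>B\<^esub> finsum B (\<lambda>k. q (l, k) \<otimes>\<^bsub>B\<^esub> r (k, j)) {1..n}" .
      qed
      also have "\<dots> = (p \<otimes>\<^bsub>?M\<^esub> (q \<otimes>\<^bsub>?M\<^esub> r)) v"
        unfolding v(1) mat_mult_entry[OF v(2,3)]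
      proof (rule B'.finsum_cong'[OF refl])
        show "(\<lambda>k. p (i, k) \<otimes>\<^bsub>B\<^esub> (q \<otimes>\<^bsub>?M\<^esub> r) (k, j)) \<in> {1..n} \<rightarrow> carrier B"
          by (intro Pi_I B'.m_closed ent[OF p] ent[OF c[OF q r]] v(2) v(3) | assumption)+
      qed (simp only: mat_mult_entry[OF _ v(3)])
      finally show "(p \<otimes>\<^bsub>?M\<^esub> q \<otimes>\<^bsub>?M\<^esub> r) v = (p \<otimes>\<^bsub>?M\<^esub> (q \<otimes>\<^bsub>?M\<^esub> r)) v" .
    qed
  next
    fix p assume p: "p \<in> carrier ?M"
    show "\<one>\<^bsub>?M\<^esub> \<otimes>\<^bsub>?M\<^esub> p = p"
    proof (rule mat_eqI[OF c[OF o p] p])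
      fix v assume "v \<in> ?V"
      then obtain i j where v: "v = (i, j)" "i \<in> {1..n}" "j \<in> {1..n}" by blast
      have "(\<one>\<^bsub>?M\<^esub> \<otimes>\<^bsub>?M\<^esub> p) v = finsum B (\<lambda>k. if i = k then p (k, j) else \<zero>\<^bsub>B\<^esub>) {1..n}"
        unfolding v(1) mat_mult_entry[OF v(2,3)]
      proof (rule B'.finsum_cong'[OF refl])
        show "(\<lambda>k. if i = k then p (k, j) else \<zero>\<^bsub>B\<^esub>) \<in> {1..n} \<rightarrow> carrier B" using ent[OF p _ v(3)] by simp
        show "\<one>\<^bsub>?M\<^esub> (i, k) \<otimes>\<^bsub>B\<^esub> p (k, j) = (if i = k then p (k, j) else \<zero>\<^bsub>B\<^esub>)" if k: "k \<in> {1..n}" for k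
          unfolding oe[OF v(2) k] using ent[OF p k v(3)] by simp
      qed
      also have "\<dots> = p v"
        unfolding v(1) using v ent[OF p _ v(3)] by (intro B'.finsum_singleton) auto
      finally show "(\<one>\<^bsub>?M\<^esub> \<otimes>\<^bsub>?M\<^esub> p) v = p v" .
    qed
    show "p \<otimes>\<^bsub>?M\<^esub> \<one>\<^bsub>?M\<^esub> = p"
    proof (rule mat_eqI[OF c[OF p o] p])
      fix v assume "v \<in> ?V"
      then obtain i j where v: "v = (i, j)" "i \<in> {1..n}" "j \<in> {1..n}" by blast
      have "(p \<otimes>\<^bsub>?M\<^esub> \<one>\<^bsub>?M\<^esub>) v = finsum B (\<lambda>k. if j = k then p (i, k) else \<zero>\<^bsub>B\<^esub>) {1..n}"
        unfolding v(1) mat_mult_entry[OF v(2,3)]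
      proof (rule B'.finsum_cong'[OF refl])
        show "(\<lambda>k. if j = k then p (i, k) else \<zero>\<^bsub>B\<^esub>) \<in> {1..n} \<rightarrow> carrier B" using ent[OF p v(2)] by simp
        show "p (i, k) \<otimes>\<^bsub>B\<^esub> \<one>\<^bsub>?M\<^esub> (k, j) = (if j = k then p (i, k) else \<zero>\<^bsub>B\<^esub>)" if k: "k \<in> {1..n}" for k
          unfolding oe[OF k v(3)] using ent[OF p v(2) k] by simp
      qed
      also have "\<dots> = p v"
        unfolding v(1) using v ent[OF p v(2)] by (intro B'.finsum_singleton) auto
      finally show "(p \<otimes>\<^bsub>?M\<^esub> \<one>\<^bsub>?M\<^esub>) v = p v" .
    qed
  qed (rule o)
  show ?thesis unfolding galg_def nalg_def using mM o b m by blast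
qed

lemma self_mult_bilin:
  assumes "cring A"
  shows "bilin A (self_mod A) (self_mod A) (self_mod A) (mult A)"
proof -
  interpret cring A by fact
  show ?thesis
    unfolding bilin_def self_mod_simps
  proof (intro conjI ballI)
    fix a assume a: "a \<in> carrier A"
    show "(\<otimes>\<^bsub>A\<^esub>) a \<in> lin A (self_mod A) (self_mod A)"
      by (rule linI) (simp_all add: a r_distr m_lcomm)
    show "(\<lambda>x. x \<otimes>\<^bsub>A\<^esub> a) \<in> lin A (self_mod A) (self_mod A)"
      by (rule linI) (simp_all add: a l_distr m_assoc)
  qed
qed

lemma bilin_finsum:
  assumes "module A Q" "module A N" "module A P" "\<And>i. i \<in> I \<Longrightarrow> bilin A N P Q (b i)"
  shows "bilin A N P Q (\<lambda>x y. finsum Q (\<lambda>i. b i x y) I)"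
  unfolding bilin_def
proof (intro conjI ballI)
  show "(\<lambda>y. finsum Q (\<lambda>i. b i x y) I) \<in> lin A P Q" if "x \<in> carrier N" for x
    by (rule lin_finsum_fun[OF assms(1,3)]) (rule bilinD1[OF assms(4) that])
  show "(\<lambda>x. finsum Q (\<lambda>i. b i x y) I) \<in> lin A N Q" if "y \<in> carrier P" for y
    by (rule lin_finsum_fun[OF assms(1,2)]) (rule bilinD2[OF assms(4) that])
qed

section \<open>Matrices over C as elements of C \<otimes> End(F)\<close>

context
  fixes A :: "('a, 'm) ring_scheme" and C :: "('a, 'c) module" and n :: nat
  assumes alg: "algebra A C"
begin

private lemmas A_cring = module_cring[OF algebra_module[OF alg]]
private lemmas coeff_module = algebra_module[OF alg]
private lemmas EndF_module = module_EndF[OF A_cring, of n]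
private lemmas EndF_nalg = nalg_EndF[OF A_cring, of n]

definition mat_coord :: "nat \<Rightarrow> nat \<Rightarrow> ('c \<times> ((nat \<Rightarrow> 'a) \<Rightarrow> nat \<Rightarrow> 'a) \<Rightarrow> 'a) set \<Rightarrow> 'c" where
  "mat_coord i j = bc_coord A C (T_dual A n i j)"

lemma fin_basis_mat_coord:
  "fin_basis C (base_change A C (EndF A n)) ({1..n} \<times> {1..n})
    (\<lambda>(i, j). tens A C (EndF A n) \<one>\<^bsub>C\<^esub> (T_end A n i j)) (\<lambda>(i, j). mat_coord i j)"
proof -
  have 1: "(\<lambda>v. bc_coord A C ((\<lambda>(i, j). T_dual A n i j) v)) = (\<lambda>(i, j). mat_coord i j)"
    "(\<lambda>v. tens A C (EndF A n) \<one>\<^bsub>C\<^esub> ((\<lambda>(i, j). T_end A n i j) v)) = (\<lambda>(i, j). tens A C (EndF A n) \<one>\<^bsub>C\<^esub> (T_end A n i j))"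
    by (simp_all add: fun_eq_iff mat_coord_def)
  show ?thesis
    using fin_basis_base_change[OF alg EndF_module fin_basis_EndF[OF A_cring]] unfolding 1 .
qed

lemma mat_coord_lin:
  assumes "j \<in> {1..n}"
  shows "mat_coord i j \<in> lin C (base_change A C (EndF A n)) (self_mod C)"
  unfolding mat_coord_def by (rule bc_coord(1)[OF alg EndF_module T_dual_lin[OF A_cring assms]])

lemma mat_coord_closed:
  assumes "j \<in> {1..n}" "z \<in> carrier (base_change A C (EndF A n))"
  shows "mat_coord i j z \<in> carrier C"
  using lin_closed[OF mat_coord_lin[OF assms(1)] assms(2)] by simp

lemma mat_coord_tens:
  assumes "j \<in> {1..n}" "c \<in> carrier C" "g \<in> carrier (EndF A n)"
  shows "mat_coord i j (tens A C (EndF A n) c g) = c \<otimes>\<^bsub>C\<^esub> (g (unit_vec A j) i \<odot>\<^bsub>C\<^esub> \<one>\<^bsub>C\<^esub>)"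
  unfolding mat_coord_def bc_coord(2)[OF alg EndF_module T_dual_lin[OF A_cring assms(1)] assms(2,3)]
  using assms(3) by (simp add: T_dual_def del: end_alg_simps)

text \<open>The vector h(T_j) is expanded in the basis T_k and g is applied term by term, which
  turns composition into the product of matrices.\<close>

lemma EndF_comp_coord:
  assumes "g \<in> carrier (EndF A n)" "h \<in> carrier (EndF A n)" "j \<in> {1..n}"
  shows "(g \<otimes>\<^bsub>EndF A n\<^esub> h) (unit_vec A j) i = finsum A (\<lambda>k. g (unit_vec A k) i \<otimes>\<^bsub>A\<^esub> h (unit_vec A j) k) {1..n}"
proof -
  interpret A: cring A by (rule A_cring)
  let ?F = "FM A n"
  note mF = module_free_mod[OF A_cring, of "{1..n}"]
  interpret F: module A ?F by (rule mF)
  have g: "g \<in> lin A ?F ?F" and h: "h \<in> lin A ?F ?F"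
    using assms(1,2) by (simp_all)
  note B = fin_basis_FM[OF A_cring, of n]
  note u = unit_vec_closed[OF A_cring]
  have hu: "h (unit_vec A j) \<in> carrier ?F" by (rule lin_closed[OF h u[OF assms(3)]])
  note hc = free_mod_coeff[OF hu]
  have l: "(\<lambda>x. g x i) \<in> lin A ?F (self_mod A)" by (rule lin_comp[OF g coeff_lin[OF A_cring]])
  have gc: "g (unit_vec A k) i \<in> carrier A" if "k \<in> {1..n}" for k
    using lin_closed[OF l u[OF that]] by simp
  have "(g \<otimes>\<^bsub>EndF A n\<^esub> h) (unit_vec A j) i = g (h (unit_vec A j)) i"
    unfolding end_alg_simps compose_def using u[OF assms(3)] by simp
  also have "h (unit_vec A j) = finsum ?F (\<lambda>k. h (unit_vec A j) k \<odot>\<^bsub>?F\<^esub> unit_vec A k) {1..n}"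
    by (rule fin_basisD(5)[OF B hu])
  also have "g \<dots> i = finsum (self_mod A) (\<lambda>k. g (h (unit_vec A j) k \<odot>\<^bsub>?F\<^esub> unit_vec A k) i) {1..n}"
    by (rule lin_finsum[OF mF module_self_mod[OF A_cring] l]) (intro F.smult_closed hc u)
  also have "\<dots> = finsum A (\<lambda>k. g (h (unit_vec A j) k \<odot>\<^bsub>?F\<^esub> unit_vec A k) i) {1..n}"
    by (rule finsum_record_cong) simp_all
  also have "\<dots> = finsum A (\<lambda>k. g (unit_vec A k) i \<otimes>\<^bsub>A\<^esub> h (unit_vec A j) k) {1..n}"
  proof (rule A.finsum_cong'[OF refl])
    show "(\<lambda>k. g (unit_vec A k) i \<otimes>\<^bsub>A\<^esub> h (unit_vec A j) k) \<in> {1..n} \<rightarrow> carrier A"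
      by (intro Pi_I A.m_closed gc hc)
    fix k assume k: "k \<in> {1..n}"
    show "g (h (unit_vec A j) k \<odot>\<^bsub>?F\<^esub> unit_vec A k) i = g (unit_vec A k) i \<otimes>\<^bsub>A\<^esub> h (unit_vec A j) k"
      using lin_smult[OF l hc u[OF k], of k] gc[OF k] hc[of k] by (simp add: A.m_comm)
  qed
  finally show ?thesis .
qed

text \<open>Both sides are C-bilinear in u and v, so it suffices to take 1 \<otimes> g and 1
  \<otimes> h. There the formula is the image under a \<mapsto> a 1 of the matrix product formula
  for composition.\<close>

lemma mat_coord_mult:
  assumes "j \<in> {1..n}" "u \<in> carrier (base_change A C (EndF A n))" "v \<in> carrier (base_change A C (EndF A n))"
  shows "mat_coord i j (u \<otimes>\<^bsub>base_change A C (EndF A n)\<^esub> v) =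
    finsum C (\<lambda>k. mat_coord i k u \<otimes>\<^bsub>C\<^esub> mat_coord k j v) {1..n}"
proof -
  interpret C': cring C by (rule algebra_cring[OF alg])
  interpret C: algebra A C by (rule alg)
  let ?E = "EndF A n" and ?S = "self_mod C"
  let ?B = "base_change A C ?E"
  note crC = algebra_cring[OF alg]
  note mB = module_base_change[OF alg EndF_module] and mS = module_self_mod[OF crC]
  have fs: "finsum ?S f {1..n} = finsum C f {1..n}" for f by (rule finsum_record_cong) simp_all
  have fA: "finsum A f {1..n} = finsum (self_mod A) f {1..n}" for f by (rule finsum_record_cong) simp_all
  have b1: "bilin C ?B ?B ?S (\<lambda>u v. mat_coord i j (u \<otimes>\<^bsub>?B\<^esub> v))"
    by (rule bilin_post[OF nalg_bilin[OF nalg_base_change[OF alg EndF_nalg]] mat_coord_lin[OF assms(1)]])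
  have b2: "bilin C ?B ?B ?S (\<lambda>u v. finsum ?S (\<lambda>k. mat_coord i k u \<otimes>\<^bsub>C\<^esub> mat_coord k j v) {1..n})"
    by (rule bilin_finsum[OF mS mB mB])
      (rule bilin_comp[OF self_mult_bilin[OF crC] mat_coord_lin mat_coord_lin[OF assms(1)]])
  have "mat_coord i j (u \<otimes>\<^bsub>?B\<^esub> v) = finsum ?S (\<lambda>k. mat_coord i k u \<otimes>\<^bsub>C\<^esub> mat_coord k j v) {1..n}"
  proof (rule base_change_bilin_ext[OF alg EndF_module EndF_module b1 b2 _ assms(2,3)])
    fix g h assume g: "g \<in> carrier ?E" and h: "h \<in> carrier ?E"
    have gh: "g \<otimes>\<^bsub>?E\<^esub> h \<in> carrier ?E" by (rule bilin_closed[OF nalg_bilin[OF EndF_nalg] g h])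
    have gF: "g (unit_vec A k) l \<in> carrier A" "h (unit_vec A k) l \<in> carrier A" if "k \<in> {1..n}" for k l
      by (rule free_mod_coeff[OF lin_closed[OF EndF_eval_lin[OF unit_vec_closed[OF A_cring that]] g]])
        (rule free_mod_coeff[OF lin_closed[OF EndF_eval_lin[OF unit_vec_closed[OF A_cring that]] h]])
    have s: "(\<lambda>a. a \<odot>\<^bsub>C\<^esub> \<one>\<^bsub>C\<^esub>) \<in> lin A (self_mod A) C" by (rule smult_lin[OF coeff_module C'.one_closed])
    have "mat_coord i j (tens A C ?E \<one>\<^bsub>C\<^esub> g \<otimes>\<^bsub>?B\<^esub> tens A C ?E \<one>\<^bsub>C\<^esub> h) = mat_coord i j (tens A C ?E \<one>\<^bsub>C\<^esub> (g \<otimes>\<^bsub>?E\<^esub> h))"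
      by (simp only: base_change_mult_tens[OF alg EndF_nalg C'.one_closed g C'.one_closed h] C'.l_one[OF C'.one_closed])
    also have "\<dots> = (g \<otimes>\<^bsub>?E\<^esub> h) (unit_vec A j) i \<odot>\<^bsub>C\<^esub> \<one>\<^bsub>C\<^esub>"
      unfolding mat_coord_tens[OF assms(1) C'.one_closed gh] EndF_comp_coord[OF g h assms(1)]
      by (rule C'.l_one) (intro C.smult_closed C'.one_closed C.R.finsum_closed Pi_I C.R.m_closed gF assms(1))
    also have "\<dots> = finsum A (\<lambda>k. g (unit_vec A k) i \<otimes>\<^bsub>A\<^esub> h (unit_vec A j) k) {1..n} \<odot>\<^bsub>C\<^esub> \<one>\<^bsub>C\<^esub>"
      by (simp only: EndF_comp_coord[OF g h assms(1)])
    also have "\<dots> = finsum (self_mod A) (\<lambda>k. g (unit_vec A k) i \<otimes>\<^bsub>A\<^esub> h (unit_vec A j) k) {1..n} \<odot>\<^bsub>C\<^esub> \<one>\<^bsub>C\<^esub>"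
      by (simp only: fA)
    also have "\<dots> = finsum C (\<lambda>k. (g (unit_vec A k) i \<otimes>\<^bsub>A\<^esub> h (unit_vec A j) k) \<odot>\<^bsub>C\<^esub> \<one>\<^bsub>C\<^esub>) {1..n}"
      by (rule lin_finsum[OF module_self_mod[OF A_cring] coeff_module s]) (simp only: self_mod_simps, intro C.R.m_closed gF assms(1))
    also have "\<dots> = finsum C (\<lambda>k. mat_coord i k (tens A C ?E \<one>\<^bsub>C\<^esub> g) \<otimes>\<^bsub>C\<^esub> mat_coord k j (tens A C ?E \<one>\<^bsub>C\<^esub> h)) {1..n}"
    proof (rule C'.finsum_cong'[OF refl])
      have t: "tens A C ?E \<one>\<^bsub>C\<^esub> x \<in> carrier ?B" if "x \<in> carrier ?E" for x
        using tens_closed[OF coeff_module EndF_module C'.one_closed that] by simp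
      show "(\<lambda>k. mat_coord i k (tens A C ?E \<one>\<^bsub>C\<^esub> g) \<otimes>\<^bsub>C\<^esub> mat_coord k j (tens A C ?E \<one>\<^bsub>C\<^esub> h)) \<in> {1..n} \<rightarrow> carrier C"
        by (intro Pi_I C'.m_closed mat_coord_closed t g h assms(1))
      fix k assume k: "k \<in> {1..n}"
      show "(g (unit_vec A k) i \<otimes>\<^bsub>A\<^esub> h (unit_vec A j) k) \<odot>\<^bsub>C\<^esub> \<one>\<^bsub>C\<^esub> =
          mat_coord i k (tens A C ?E \<one>\<^bsub>C\<^esub> g) \<otimes>\<^bsub>C\<^esub> mat_coord k j (tens A C ?E \<one>\<^bsub>C\<^esub> h)"
        unfolding mat_coord_tens[OF k C'.one_closed g] mat_coord_tens[OF assms(1) C'.one_closed h]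
        using gF(1)[OF k, of i] gF(2)[OF assms(1), of k] by (simp add: C.smult_assoc1 C.smult_assoc2)
    qed
    finally show "mat_coord i j (tens A C ?E \<one>\<^bsub>C\<^esub> g \<otimes>\<^bsub>?B\<^esub> tens A C ?E \<one>\<^bsub>C\<^esub> h) =
      finsum ?S (\<lambda>k. mat_coord i k (tens A C ?E \<one>\<^bsub>C\<^esub> g) \<otimes>\<^bsub>C\<^esub> mat_coord k j (tens A C ?E \<one>\<^bsub>C\<^esub> h)) {1..n}"
      unfolding fs .
  qed
  then show ?thesis unfolding fs .
qed

text \<open>Rewriting p_ij \<otimes> T_ij as p_ij (1 \<otimes> T_ij) exhibits the entries of p as
  coordinates in the base-changed basis.\<close>

lemma mat_tens_expand:
  assumes "p \<in> carrier (mat_alg n C)"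
  shows "mat_tens A n C p = finsum (base_change A C (EndF A n))
    (\<lambda>v. p v \<odot>\<^bsub>base_change A C (EndF A n)\<^esub> (\<lambda>(i, j). tens A C (EndF A n) \<one>\<^bsub>C\<^esub> (T_end A n i j)) v) ({1..n} \<times> {1..n})"
proof -
  let ?B = "base_change A C (EndF A n)"
  interpret B: module C ?B by (rule module_base_change[OF alg EndF_module])
  interpret C': cring C by (rule algebra_cring[OF alg])
  note FB = fin_basisD[OF fin_basis_mat_coord]
  show ?thesis
    unfolding mat_tens_def
  proof (rule B.finsum_cong'[OF refl])
    show "(\<lambda>v. p v \<odot>\<^bsub>?B\<^esub> (\<lambda>(i, j). tens A C (EndF A n) \<one>\<^bsub>C\<^esub> (T_end A n i j)) v) \<in> {1..n} \<times> {1..n} \<rightarrow> carrier ?B"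
      by (intro Pi_I B.smult_closed mat_closed[OF assms] FB(2))
    fix v assume v: "v \<in> {1..n} \<times> {1..n}"
    obtain i j where ij: "v = (i, j)" "i \<in> {1..n}" "j \<in> {1..n}" using v by blast
    have pc: "p (i, j) \<in> carrier C" using mat_closed[OF assms v] unfolding ij(1) .
    show "(case v of (i, j) \<Rightarrow> tens A C (EndF A n) (p (i, j)) (T_end A n i j)) =
        p v \<odot>\<^bsub>?B\<^esub> (\<lambda>(i, j). tens A C (EndF A n) \<one>\<^bsub>C\<^esub> (T_end A n i j)) v"
      unfolding ij(1) case_prod_conv by (rule tens_one_smult[OF alg EndF_module pc T_end_closed[OF A_cring ij(2)]])
  qed
qed

lemma mat_tens_closed:
  assumes "p \<in> carrier (mat_alg n C)"
  shows "mat_tens A n C p \<in> carrier (base_change A C (EndF A n))"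
proof -
  let ?B = "base_change A C (EndF A n)"
  note mB = module_base_change[OF alg EndF_module]
  interpret B: module C ?B by (rule mB)
  note FB = fin_basisD[OF fin_basis_mat_coord]
  show ?thesis
    unfolding mat_tens_expand[OF assms]
    by (rule finsum_cl[OF mB]) (intro B.smult_closed mat_closed[OF assms] FB(2))
qed

lemma mat_coord_mat_tens:
  assumes "p \<in> carrier (mat_alg n C)" "i \<in> {1..n}" "j \<in> {1..n}"
  shows "mat_coord i j (mat_tens A n C p) = p (i, j)"
  using fin_basis_coord_sum[where w = "(i, j)", OF module_base_change[OF alg EndF_module] fin_basis_mat_coord mat_closed[OF assms(1)]]
    assms(2,3)
  unfolding mat_tens_expand[OF assms(1)] by simp

lemma mat_coord_eqI:
  assumes "z \<in> carrier (base_change A C (EndF A n))" "w \<in> carrier (base_change A C (EndF A n))"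
    "\<And>i j. i \<in> {1..n} \<Longrightarrow> j \<in> {1..n} \<Longrightarrow> mat_coord i j z = mat_coord i j w"
  shows "z = w"
proof -
  let ?B = "base_change A C (EndF A n)" and ?V = "{1..n} \<times> {1..n}"
  let ?e = "\<lambda>(i, j). tens A C (EndF A n) \<one>\<^bsub>C\<^esub> (T_end A n i j)"
  interpret B: module C ?B by (rule module_base_change[OF alg EndF_module])
  note FB = fin_basisD[OF fin_basis_mat_coord] and c = fin_basis_coord_closed[OF fin_basis_mat_coord]
  have "z = finsum ?B (\<lambda>v. (\<lambda>(i, j). mat_coord i j) v z \<odot>\<^bsub>?B\<^esub> ?e v) ?V" by (rule FB(5)[OF assms(1)])
  also have "\<dots> = finsum ?B (\<lambda>v. (\<lambda>(i, j). mat_coord i j) v w \<odot>\<^bsub>?B\<^esub> ?e v) ?V"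
  proof (rule B.finsum_cong'[OF refl])
    show "(\<lambda>v. (\<lambda>(i, j). mat_coord i j) v w \<odot>\<^bsub>?B\<^esub> ?e v) \<in> ?V \<rightarrow> carrier ?B"
      by (intro Pi_I B.smult_closed FB(2) c[OF _ assms(2)])
    fix v assume "v \<in> ?V"
    then show "(\<lambda>(i, j). mat_coord i j) v z \<odot>\<^bsub>?B\<^esub> ?e v = (\<lambda>(i, j). mat_coord i j) v w \<odot>\<^bsub>?B\<^esub> ?e v"
      using assms(3) by (simp only: case_prod_unfold mem_Times_iff)
  qed
  also have "\<dots> = w" by (rule FB(5)[OF assms(2), symmetric])
  finally show ?thesis .
qed

lemma mat_tens_lin: "mat_tens A n C \<in> lin A (mat_alg n C) (tensor A C (EndF A n))"
proof -
  let ?T = "tensor A C (EndF A n)"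
  note mT = module_tensor[OF coeff_module EndF_module] and mM = module_mat_alg[OF coeff_module, of n]
  have 1: "mat_tens A n C p = finsum ?T (\<lambda>(i, j). tens A C (EndF A n) (p (i, j)) (T_end A n i j)) ({1..n} \<times> {1..n})" for p
    unfolding mat_tens_def by (rule finsum_record_cong) simp_all
  have "(\<lambda>p. finsum ?T (\<lambda>v. (\<lambda>(i, j). tens A C (EndF A n) (p (i, j)) (T_end A n i j)) v) ({1..n} \<times> {1..n})) \<in> lin A (mat_alg n C) ?T"
  proof (rule lin_finsum_fun[OF mT mM])
    fix v assume v: "v \<in> {1..n} \<times> {1..n}"
    obtain i j where ij: "v = (i, j)" "i \<in> {1..n}" "j \<in> {1..n}" using v by blast
    show "(\<lambda>p. (\<lambda>(i, j). tens A C (EndF A n) (p (i, j)) (T_end A n i j)) v) \<in> lin A (mat_alg n C) ?T"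
      unfolding ij(1) case_prod_conv
      by (rule lin_comp[OF mat_entry_lin bilinD2[OF tens_bilin[OF coeff_module EndF_module] T_end_closed[OF A_cring ij(2)]]])
        (intro SigmaI ij)
  qed
  then show ?thesis unfolding 1[abs_def] by simp
qed

text \<open>An element of C \<otimes> End(F) is determined by its coordinates, and the coordinates
  of a product there follow the same rule as the entries of a product of matrices.\<close>

lemma mat_tens_mult:
  assumes "p \<in> carrier (mat_alg n C)" "q \<in> carrier (mat_alg n C)"
  shows "mat_tens A n C (p \<otimes>\<^bsub>mat_alg n C\<^esub> q) = mat_tens A n C p \<otimes>\<^bsub>base_change A C (EndF A n)\<^esub> mat_tens A n C q"
proof -
  note nB = nalg_bilin[OF nalg_base_change[OF alg EndF_nalg]] and nM = nalg_bilin[OF galg_nalg[OF galg_mat_alg[OF alg]]]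
  interpret C': cring C by (rule algebra_cring[OF alg])
  have pq: "p \<otimes>\<^bsub>mat_alg n C\<^esub> q \<in> carrier (mat_alg n C)" by (rule bilin_closed[OF nM assms])
  note t = mat_tens_closed
  show ?thesis
  proof (rule mat_coord_eqI[OF t[OF pq] bilin_closed[OF nB t[OF assms(1)] t[OF assms(2)]]])
    fix i j assume ij: "i \<in> {1..n}" "j \<in> {1..n}"
    show "mat_coord i j (mat_tens A n C (p \<otimes>\<^bsub>mat_alg n C\<^esub> q)) =
        mat_coord i j (mat_tens A n C p \<otimes>\<^bsub>base_change A C (EndF A n)\<^esub> mat_tens A n C q)"
      unfolding mat_coord_mat_tens[OF pq ij] mat_coord_mult[OF ij(2) t[OF assms(1)] t[OF assms(2)]] mat_mult_entry[OF ij]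
    proof (rule C'.finsum_cong'[OF refl])
      show "(\<lambda>k. mat_coord i k (mat_tens A n C p) \<otimes>\<^bsub>C\<^esub> mat_coord k j (mat_tens A n C q)) \<in> {1..n} \<rightarrow> carrier C"
        by (intro Pi_I C'.m_closed mat_coord_closed t assms ij)
    qed (simp only: mat_coord_mat_tens[OF assms(1) ij(1)] mat_coord_mat_tens[OF assms(2) _ ij(2)])
  qed
qed

lemma mat_tens_one: "mat_tens A n C \<one>\<^bsub>mat_alg n C\<^esub> = \<one>\<^bsub>base_change A C (EndF A n)\<^esub>"
proof -
  interpret C': cring C by (rule algebra_cring[OF alg])
  interpret C: algebra A C by (rule alg)
  note nM = galg_nalg[OF galg_mat_alg[OF alg]]
  note o = nalg_one[OF nM]
  note oE = nalg_one[OF EndF_nalg]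
  show ?thesis
  proof (rule mat_coord_eqI[OF mat_tens_closed[OF o] nalg_one[OF nalg_base_change[OF alg EndF_nalg]]])
    fix i j assume ij: "i \<in> {1..n}" "j \<in> {1..n}"
    have "\<one>\<^bsub>EndF A n\<^esub> (unit_vec A j) = unit_vec A j"
      using unit_vec_closed[OF A_cring ij(2)] by simp
    then have "mat_coord i j \<one>\<^bsub>base_change A C (EndF A n)\<^esub> = unit_vec A j i \<odot>\<^bsub>C\<^esub> \<one>\<^bsub>C\<^esub>"
      using mat_coord_tens[OF ij(2) C'.one_closed oE, of i] free_mod_coeff[OF unit_vec_closed[OF A_cring ij(2)], of i]
      by (simp del: end_alg_simps)
    also have "\<dots> = (if i = j then \<one>\<^bsub>C\<^esub> else \<zero>\<^bsub>C\<^esub>)" unfolding unit_vec_def by simp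
    also have "\<dots> = mat_coord i j (mat_tens A n C \<one>\<^bsub>mat_alg n C\<^esub>)"
      unfolding mat_coord_mat_tens[OF o ij] using ij by (simp add: mat_alg_simps(3))
    finally show "mat_coord i j (mat_tens A n C \<one>\<^bsub>mat_alg n C\<^esub>) = mat_coord i j \<one>\<^bsub>base_change A C (EndF A n)\<^esub>" by (rule sym)
  qed
qed

text \<open>The scalars are restricted to A so that the map can be composed with homomorphisms of
  A-algebras into matrices before the result is extended back to C.\<close>

lemma mat_tens_alg_hom:
  "mat_tens A n C \<in> alg_hom A (mat_alg n C) (restr A C (base_change A C (EndF A n)))"
  by (rule alg_homI)
    (simp_all only: restr_base_change[OF alg EndF_module] mat_tens_lin restr_simps mat_tens_mult mat_tens_one)

end

lemma mat_map_alg_hom: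
  assumes "algebra A B" "algebra A C" and h: "h \<in> alg_hom A B C"
  shows "(\<lambda>p. \<lambda>v\<in>{1..n} \<times> {1..n}. h (p v)) \<in> alg_hom A (mat_alg n B) (mat_alg n C)"
proof -
  note mB = algebra_module[OF assms(1)] and mC = algebra_module[OF assms(2)]
  interpret B': cring B by (rule algebra_cring[OF assms(1)])
  interpret C': cring C by (rule algebra_cring[OF assms(2)])
  let ?V = "{1..n} \<times> {1..n}"
  note hl = alg_hom_lin[OF h] and gB = galg_nalg[OF galg_mat_alg[OF assms(1)]] and gC = galg_nalg[OF galg_mat_alg[OF assms(2)]]
  have c: "(\<lambda>v\<in>?V. h (p v)) \<in> carrier (mat_alg n C)" if "p \<in> carrier (mat_alg n B)" for p
    by (rule matI) (rule lin_closed[OF hl mat_closed[OF that]])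
  show ?thesis
  proof (rule alg_homI)
    show "(\<lambda>p. \<lambda>v\<in>?V. h (p v)) \<in> lin A (mat_alg n B) (mat_alg n C)"
    proof (rule mat_linI[OF module_mat_alg[OF mB] mC c])
      fix v assume v: "v \<in> ?V"
      show "(\<lambda>p. (\<lambda>v\<in>?V. h (p v)) v) \<in> lin A (mat_alg n B) C"
        by (rule lin_cong[OF lin_comp[OF mat_entry_lin[OF v] hl] module_mat_alg[OF mB]]) (simp only: v restrict_apply if_True)
    qed
    fix p q assume p: "p \<in> carrier (mat_alg n B)" and q: "q \<in> carrier (mat_alg n B)"
    show "(\<lambda>v\<in>?V. h ((p \<otimes>\<^bsub>mat_alg n B\<^esub> q) v)) = (\<lambda>v\<in>?V. h (p v)) \<otimes>\<^bsub>mat_alg n C\<^esub> (\<lambda>v\<in>?V. h (q v))"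
    proof (rule mat_eqI[OF c[OF bilin_closed[OF nalg_bilin[OF gB] p q]] bilin_closed[OF nalg_bilin[OF gC] c[OF p] c[OF q]]])
      fix v assume "v \<in> ?V"
      then obtain i j where v: "v = (i, j)" "i \<in> {1..n}" "j \<in> {1..n}" by blast
      have pe: "p (i, k) \<in> carrier B" "q (k, j) \<in> carrier B" if "k \<in> {1..n}" for k
        by (rule mat_closed[OF p], rule SigmaI[OF v(2) that], rule mat_closed[OF q], rule SigmaI[OF that v(3)])
      have "h (finsum B (\<lambda>k. p (i, k) \<otimes>\<^bsub>B\<^esub> q (k, j)) {1..n}) = finsum C (\<lambda>k. h (p (i, k) \<otimes>\<^bsub>B\<^esub> q (k, j))) {1..n}"
        by (rule lin_finsum[OF mB mC hl]) (intro B'.m_closed pe)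
      also have "\<dots> = finsum C (\<lambda>k. (\<lambda>v\<in>?V. h (p v)) (i, k) \<otimes>\<^bsub>C\<^esub> (\<lambda>v\<in>?V. h (q v)) (k, j)) {1..n}"
      proof (rule C'.finsum_cong'[OF refl])
        show "(\<lambda>k. (\<lambda>v\<in>?V. h (p v)) (i, k) \<otimes>\<^bsub>C\<^esub> (\<lambda>v\<in>?V. h (q v)) (k, j)) \<in> {1..n} \<rightarrow> carrier C"
          by (intro Pi_I C'.m_closed mat_closed[OF c[OF p]] mat_closed[OF c[OF q]] SigmaI v(2) v(3) | assumption)+
        fix k assume k: "k \<in> {1..n}"
        show "h (p (i, k) \<otimes>\<^bsub>B\<^esub> q (k, j)) = (\<lambda>v\<in>?V. h (p v)) (i, k) \<otimes>\<^bsub>C\<^esub> (\<lambda>v\<in>?V. h (q v)) (k, j)"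
          unfolding alg_hom_mult[OF h pe[OF k]] restrict_apply'[OF SigmaI[OF v(2) k]] restrict_apply'[OF SigmaI[OF k v(3)]] ..
      qed
      finally show "(\<lambda>v\<in>?V. h ((p \<otimes>\<^bsub>mat_alg n B\<^esub> q) v)) v = ((\<lambda>v\<in>?V. h (p v)) \<otimes>\<^bsub>mat_alg n C\<^esub> (\<lambda>v\<in>?V. h (q v))) v"
        unfolding v(1) mat_mult_entry[OF v(2,3)] restrict_apply'[OF SigmaI[OF v(2,3)]] .
    qed
  next
    show "(\<lambda>v\<in>?V. h (\<one>\<^bsub>mat_alg n B\<^esub> v)) = \<one>\<^bsub>mat_alg n C\<^esub>"
    proof (rule mat_eqI[OF c[OF nalg_one[OF gB]] nalg_one[OF gC]])
      fix v assume "v \<in> ?V"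
      then obtain i j where v: "v = (i, j)" "i \<in> {1..n}" "j \<in> {1..n}" by blast
      then show "(\<lambda>v\<in>?V. h (\<one>\<^bsub>mat_alg n B\<^esub> v)) v = \<one>\<^bsub>mat_alg n C\<^esub> v"
        using alg_hom_one[OF h] lin_zero[OF mB mC hl] by (simp add: mat_alg_simps(3))
    qed
  qed
qed

text \<open>Naturality of the matrix identification in the coefficient algebra: the map is pushed
  through the sum of the p_ij \<otimes> T_ij. It evaluates the right-hand sides in the descriptions
  of \<open>mu_H\<close> and \<open>mu_HR\<close>.\<close>

lemma tensor_map_mat_tens:
  assumes "algebra A B" "algebra A C" and h: "h \<in> lin A B C" and p: "p \<in> carrier (mat_alg n B)"
  shows "tensor_map A C (EndF A n) h (\<lambda>t. t) (mat_tens A n B p) = mat_tens A n C (\<lambda>v\<in>{1..n} \<times> {1..n}. h (p v))"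
proof -
  let ?E = "EndF A n" and ?V = "{1..n} \<times> {1..n}"
  note mB = algebra_module[OF assms(1)] and mC = algebra_module[OF assms(2)]
  note mE = module_EndF[OF module_cring[OF mB], of n]
  note tm = tensor_map[OF mB mE mC mE h lin_id]
  interpret T: module A "tensor A C ?E" by (rule module_tensor[OF mC mE])
  have 1: "mat_tens A n C' p = finsum (tensor A C' ?E) (\<lambda>(i, j). tens A C' ?E (p (i, j)) (T_end A n i j)) ?V"
    for C' :: "('a, 'z) module" and p
    unfolding mat_tens_def by (rule finsum_record_cong) simp_all
  have c: "(\<lambda>(i, j). tens A B ?E (p (i, j)) (T_end A n i j)) v \<in> carrier (tensor A B ?E)" if "v \<in> ?V" for v
    using mat_closed[OF p that] T_end_closed[OF module_cring[OF mB], of "fst v" n "snd v"] that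
    by (cases v) (simp add: tens_closed[OF mB mE] del: end_alg_simps One_nat_def)
  have "tensor_map A C ?E h (\<lambda>t. t) (mat_tens A n B p) =
      finsum (tensor A C ?E) (\<lambda>v. tensor_map A C ?E h (\<lambda>t. t) ((\<lambda>(i, j). tens A B ?E (p (i, j)) (T_end A n i j)) v)) ?V"
    unfolding 1 by (rule lin_finsum[OF module_tensor[OF mB mE] T.module_axioms tm(1) c])
  also have "\<dots> = finsum (tensor A C ?E) (\<lambda>(i, j). tens A C ?E ((\<lambda>v\<in>?V. h (p v)) (i, j)) (T_end A n i j)) ?V"
  proof (rule T.finsum_cong'[OF refl])
    have e: "tensor_map A C ?E h (\<lambda>t. t) ((\<lambda>(i, j). tens A B ?E (p (i, j)) (T_end A n i j)) v) =
        (\<lambda>(i, j). tens A C ?E ((\<lambda>v\<in>?V. h (p v)) (i, j)) (T_end A n i j)) v" if "v \<in> ?V" for v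
      using mat_closed[OF p that] T_end_closed[OF module_cring[OF mB], of "fst v" n "snd v"] that
      by (cases v) (simp add: tm(2) del: end_alg_simps One_nat_def)
    show "(\<lambda>(i, j). tens A C ?E ((\<lambda>v\<in>?V. h (p v)) (i, j)) (T_end A n i j)) \<in> ?V \<rightarrow> carrier (tensor A C ?E)"
      by (rule Pi_I, subst e[symmetric]) (assumption, rule lin_closed[OF tm(1) c])
    show "tensor_map A C ?E h (\<lambda>t. t) ((\<lambda>(i, j). tens A B ?E (p (i, j)) (T_end A n i j)) v) =
        (\<lambda>(i, j). tens A C ?E ((\<lambda>v\<in>?V. h (p v)) (i, j)) (T_end A n i j)) v" if "v \<in> ?V" for v by (rule e[OF that])
  qed
  finally show ?thesis unfolding 1 .
qed

section \<open>Polynomial rings and substitution\<close>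

text \<open>The basis of monomials that presents the underlying module of \<open>mpoly\<close> as a
  free module.\<close>

definition mons :: "'x set \<Rightarrow> 'x multiset set" where
  "mons V = {m. set_mset m \<subseteq> V}"

lemma mpoly_simps:
  assumes "cring A"
  shows "\<zero>\<^bsub>mpoly A V\<^esub> = (\<lambda>m. \<zero>\<^bsub>A\<^esub>)" "\<one>\<^bsub>mpoly A V\<^esub> = unit_vec A {#}"
    "add (mpoly A V) = (\<lambda>f g x. f x \<oplus>\<^bsub>A\<^esub> g x)" "smult (mpoly A V) = (\<lambda>a p m. a \<otimes>\<^bsub>A\<^esub> p m)"
    "mult (mpoly A V) = (\<lambda>p q m. finsum A (\<lambda>k. p k \<otimes>\<^bsub>A\<^esub> q (m - k)) {k. k \<subseteq># m})"
proof -
  interpret cring A by fact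
  show "\<zero>\<^bsub>mpoly A V\<^esub> = (\<lambda>m. \<zero>\<^bsub>A\<^esub>)" "\<one>\<^bsub>mpoly A V\<^esub> = unit_vec A {#}"
    "add (mpoly A V) = (\<lambda>f g x. f x \<oplus>\<^bsub>A\<^esub> g x)" "smult (mpoly A V) = (\<lambda>a p m. a \<otimes>\<^bsub>A\<^esub> p m)"
    "mult (mpoly A V) = (\<lambda>p q m. finsum A (\<lambda>k. p k \<otimes>\<^bsub>A\<^esub> q (m - k)) {k. k \<subseteq># m})"
    unfolding mpoly_def by (simp_all add: indexed_const_def unit_vec_def indexed_padd_def fun_eq_iff)
qed

lemma indexed_var_unit:
  assumes "cring A" shows "ring.indexed_var A s = unit_vec A {#s#}"
proof -
  interpret cring A by fact
  have "m - {#s#} = {#} \<longleftrightarrow> m = {#s#}" if "s \<in># m" for m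
    using that by (metis add_mset_remove_trivial empty_not_add_mset insert_DiffM)
  then show ?thesis
    unfolding indexed_var_def indexed_pmult_def indexed_const_def unit_vec_def by (auto simp: fun_eq_iff)
qed

text \<open>Polynomials are generated inductively by constants, sums and multiplication by a
  variable. Finitely supported functions on monomials are closed under these operations; conversely
  each single term is reached from a constant by multiplying with its variables one at a
  time.\<close>

lemma mpoly_carrier:
  assumes "cring A"
  shows "carrier (mpoly A V) = carrier (free_mod A (mons V))"
proof -
  interpret cring A by fact
  interpret F: module A "free_mod A (mons V)" by (rule module_free_mod[OF assms])
  have c: "carrier (mpoly A V) = indexed_pset V (carrier A)"
    unfolding mpoly_def by simp
  show ?thesis
  proof
    show "carrier (mpoly A V) \<subseteq> carrier (free_mod A (mons V))"
    proof
      fix p assume "p \<in> carrier (mpoly A V)"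
      then have "p \<in> indexed_pset V (carrier A)" unfolding c .
      then show "p \<in> carrier (free_mod A (mons V))"
      proof induction
        case (indexed_const k)
        have "k \<odot>\<^bsub>free_mod A (mons V)\<^esub> unit_vec A {#} \<in> carrier (free_mod A (mons V))"
          by (intro F.smult_closed indexed_const unit_vec_closed[OF assms]) (simp add: mons_def)
        moreover have "k \<odot>\<^bsub>free_mod A (mons V)\<^esub> unit_vec A {#} = indexed_const k"
          using indexed_const by (simp add: fun_eq_iff unit_vec_def indexed_const_def)
        ultimately show ?case by simp
      next
        case (indexed_padd P Q)
        then show ?case using F.a_closed[of P Q] by (simp add: indexed_padd_def[abs_def])
      next
        case (indexed_pmult P i)
        show ?case
        proof (rule free_modI)
          show "indexed_pmult P i m \<in> carrier A" for m
            using free_mod_coeff[OF indexed_pmult.IH] by (simp add: indexed_pmult_def)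
          show "indexed_pmult P i m = \<zero>\<^bsub>A\<^esub>" if "m \<notin> mons V" for m
          proof (cases "i \<in># m")
            case True
            then have "m - {#i#} \<notin> mons V"
              using that \<open>i \<in> V\<close> unfolding mons_def by (auto simp: subset_iff in_diff_count)
            then show ?thesis using True free_mod_outside[OF indexed_pmult.IH] by (simp add: indexed_pmult_def)
          qed (simp add: indexed_pmult_def)
          have "{m. indexed_pmult P i m \<noteq> \<zero>\<^bsub>A\<^esub>} \<subseteq> (\<lambda>m. add_mset i m) ` {m. P m \<noteq> \<zero>\<^bsub>A\<^esub>}"
          proof
            fix m assume "m \<in> {m. indexed_pmult P i m \<noteq> \<zero>\<^bsub>A\<^esub>}"
            then have "i \<in># m" "P (m - {#i#}) \<noteq> \<zero>\<^bsub>A\<^esub>" by (auto simp: indexed_pmult_def split: if_splits)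
            then show "m \<in> (\<lambda>m. add_mset i m) ` {m. P m \<noteq> \<zero>\<^bsub>A\<^esub>}"
              by (intro image_eqI[of _ _ "m - {#i#}"]) simp_all
          qed
          then show "finite {m. indexed_pmult P i m \<noteq> \<zero>\<^bsub>A\<^esub>}"
            using free_mod_finite[OF indexed_pmult.IH] by (rule finite_subset[OF _ finite_imageI])
        qed
      qed
    qed
    have mono: "a \<odot>\<^bsub>free_mod A (mons V)\<^esub> unit_vec A m \<in> indexed_pset V (carrier A)"
      if "a \<in> carrier A" "set_mset m \<subseteq> V" for a m
      using that(2)
    proof (induction m)
      case empty
      have "a \<odot>\<^bsub>free_mod A (mons V)\<^esub> unit_vec A {#} = indexed_const a"
        using that(1) by (simp add: fun_eq_iff unit_vec_def indexed_const_def)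
      then show ?case using indexed_pset.indexed_const[OF that(1)] by simp
    next
      case (add i m)
      have "a \<otimes>\<^bsub>A\<^esub> (if k = add_mset i m then \<one>\<^bsub>A\<^esub> else \<zero>\<^bsub>A\<^esub>) =
          (if i \<in># k then a \<otimes>\<^bsub>A\<^esub> (if k - {#i#} = m then \<one>\<^bsub>A\<^esub> else \<zero>\<^bsub>A\<^esub>) else \<zero>\<^bsub>A\<^esub>)" for k
        using that(1) by auto
      then have "a \<odot>\<^bsub>free_mod A (mons V)\<^esub> unit_vec A (add_mset i m) =
          indexed_pmult (a \<odot>\<^bsub>free_mod A (mons V)\<^esub> unit_vec A m) i"
        by (simp add: fun_eq_iff unit_vec_def indexed_pmult_def)
      then show ?case using add by (simp only:) (intro indexed_pset.indexed_pmult; simp)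
    qed
    show "carrier (free_mod A (mons V)) \<subseteq> carrier (mpoly A V)"
      unfolding c
    proof
      fix p assume "p \<in> carrier (free_mod A (mons V))"
      then show "p \<in> indexed_pset V (carrier A)"
      proof (rule free_induct[where Pr = "\<lambda>p. p \<in> indexed_pset V (carrier A)", OF assms])
        show "(\<lambda>x. \<zero>\<^bsub>A\<^esub>) \<in> indexed_pset V (carrier A)"
          using indexed_pset.indexed_const[OF zero_closed] unfolding indexed_zero_def .
        show "a \<odot>\<^bsub>free_mod A (mons V)\<^esub> unit_vec A v \<in> indexed_pset V (carrier A)" if "a \<in> carrier A" "v \<in> mons V" for a v
          using mono[OF that(1)] that(2) by (simp only: mons_def mem_Collect_eq)
        show "r \<oplus>\<^bsub>free_mod A (mons V)\<^esub> s \<in> indexed_pset V (carrier A)"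
          if "r \<in> indexed_pset V (carrier A)" "s \<in> indexed_pset V (carrier A)" for r s
          using indexed_pset.indexed_padd[OF that] by (simp add: indexed_padd_def[abs_def])
      qed
    qed
  qed
qed

lemma module_mpoly:
  assumes "cring A" shows "module A (mpoly A V)"
  by (rule module_record_cong[OF module_free_mod[OF assms, of "mons V"]])
    (simp_all add: mpoly_carrier[OF assms] mpoly_simps[OF assms])

lemma lin_mpoly:
  assumes "cring A"
  shows "lin A (mpoly A V) Q = lin A (free_mod A (mons V)) Q" "lin A Q (mpoly A V) = lin A Q (free_mod A (mons V))"
  unfolding lin_def by (simp_all add: mpoly_carrier[OF assms] mpoly_simps[OF assms])

text \<open>The coefficients of a product of polynomials are sums over submultisets; without
  finiteness \<open>finsum\<close> would collapse them to zero.\<close>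

lemma finite_submultisets: "finite {k. k \<subseteq># (m :: 'x multiset)}"
proof (induction m)
  case (add x m)
  have "{k. k \<subseteq># add_mset x m} \<subseteq> {k. k \<subseteq># m} \<union> add_mset x ` {k. k \<subseteq># m}"
  proof
    fix k assume k: "k \<in> {k. k \<subseteq># add_mset x m}"
    show "k \<in> {k. k \<subseteq># m} \<union> add_mset x ` {k. k \<subseteq># m}"
    proof (cases "x \<in># k")
      case True
      then obtain k' where "k = add_mset x k'" by (metis insert_DiffM)
      then show ?thesis using k by auto
    next
      case False
      have "count k a \<le> count m a" for a
        using mset_subset_eq_count[of k "add_mset x m" a] k False by (cases "a = x") (simp_all add: not_in_iff)
      then show ?thesis by (simp add: subseteq_mset_def)
    qed
  qed
  then show ?case using add.IH finite_subset by blast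
qed simp

text \<open>The product is a convolution, so its support lies in the sums of monomials from the two
  supports. The fact \<open>nz\<close> extracts such a decomposition from a nonzero coefficient,
  which bounds both the variables that occur and the number of monomials.\<close>

lemma mpoly_mult_closed_bilin:
  assumes "cring A"
  shows "bilin A (free_mod A (mons V)) (free_mod A (mons V)) (free_mod A (mons V)) (mult (mpoly A V))"
proof -
  interpret cring A by fact
  let ?F = "free_mod A (mons V)"
  interpret F: module A ?F by (rule module_free_mod[OF assms])
  note fin = finite_submultisets
  note mm = mpoly_simps(5)[OF assms, of V]
  note cf = free_mod_coeff
  have nz: "\<exists>k. k \<subseteq># m \<and> p k \<noteq> \<zero>\<^bsub>A\<^esub> \<and> q (m - k) \<noteq> \<zero>\<^bsub>A\<^esub>"
    if "p \<in> carrier ?F" "q \<in> carrier ?F" "(p \<otimes>\<^bsub>mpoly A V\<^esub> q) m \<noteq> \<zero>\<^bsub>A\<^esub>" for p q m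
  proof (rule ccontr)
    assume n: "\<not> ?thesis"
    have "finsum A (\<lambda>k. p k \<otimes>\<^bsub>A\<^esub> q (m - k)) {k. k \<subseteq># m} = finsum A (\<lambda>k. \<zero>\<^bsub>A\<^esub>) {k. k \<subseteq># m}"
      by (rule finsum_cong'[OF refl]) (use n cf[OF that(1)] cf[OF that(2)] in force)+
    then show False using that(3) unfolding mm by (simp add: finsum_zero)
  qed
  have c: "p \<otimes>\<^bsub>mpoly A V\<^esub> q \<in> carrier ?F" if p: "p \<in> carrier ?F" and q: "q \<in> carrier ?F" for p q
  proof (rule free_modI)
    show "(p \<otimes>\<^bsub>mpoly A V\<^esub> q) m \<in> carrier A" for m
      unfolding mm by (intro finsum_closed Pi_I m_closed cf[OF p] cf[OF q])
    show "(p \<otimes>\<^bsub>mpoly A V\<^esub> q) m = \<zero>\<^bsub>A\<^esub>" if "m \<notin> mons V" for m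
    proof (rule ccontr)
      assume "(p \<otimes>\<^bsub>mpoly A V\<^esub> q) m \<noteq> \<zero>\<^bsub>A\<^esub>"
      then obtain k where k: "k \<subseteq># m" "p k \<noteq> \<zero>\<^bsub>A\<^esub>" "q (m - k) \<noteq> \<zero>\<^bsub>A\<^esub>" using nz[OF p q] by blast
      then have "k \<in> mons V" "m - k \<in> mons V" using free_mod_outside[OF p] free_mod_outside[OF q] by blast+
      moreover have "m = k + (m - k)" using k(1) by simp
      ultimately have "set_mset m \<subseteq> V" unfolding mons_def by (metis Un_subset_iff mem_Collect_eq set_mset_union)
      then show False using that unfolding mons_def by simp
    qed
    have "{m. (p \<otimes>\<^bsub>mpoly A V\<^esub> q) m \<noteq> \<zero>\<^bsub>A\<^esub>} \<subseteq> (\<lambda>(a, b). a + b) ` ({m. p m \<noteq> \<zero>\<^bsub>A\<^esub>} \<times> {m. q m \<noteq> \<zero>\<^bsub>A\<^esub>})"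
    proof
      fix m assume "m \<in> {m. (p \<otimes>\<^bsub>mpoly A V\<^esub> q) m \<noteq> \<zero>\<^bsub>A\<^esub>}"
      then obtain k where "k \<subseteq># m" "p k \<noteq> \<zero>\<^bsub>A\<^esub>" "q (m - k) \<noteq> \<zero>\<^bsub>A\<^esub>" using nz[OF p q] by blast
      then show "m \<in> (\<lambda>(a, b). a + b) ` ({m. p m \<noteq> \<zero>\<^bsub>A\<^esub>} \<times> {m. q m \<noteq> \<zero>\<^bsub>A\<^esub>})"
        by (intro image_eqI[of _ _ "(k, m - k)"]) simp_all
    qed
    then show "finite {m. (p \<otimes>\<^bsub>mpoly A V\<^esub> q) m \<noteq> \<zero>\<^bsub>A\<^esub>}"
      using free_mod_finite[OF p] free_mod_finite[OF q] by (rule finite_subset[OF _ finite_imageI[OF finite_cartesian_product]])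
  qed
  show ?thesis
    unfolding bilin_def
  proof (intro conjI ballI)
    fix p assume p: "p \<in> carrier ?F"
    show "(\<otimes>\<^bsub>mpoly A V\<^esub>) p \<in> lin A ?F ?F"
    proof (rule linI)
      fix q q' assume q: "q \<in> carrier ?F" and q': "q' \<in> carrier ?F"
      show "p \<otimes>\<^bsub>mpoly A V\<^esub> q \<in> carrier ?F" by (rule c[OF p q])
      have "finsum A (\<lambda>k. p k \<otimes>\<^bsub>A\<^esub> (q (m - k) \<oplus>\<^bsub>A\<^esub> q' (m - k))) {k. k \<subseteq># m} =
        finsum A (\<lambda>k. p k \<otimes>\<^bsub>A\<^esub> q (m - k) \<oplus>\<^bsub>A\<^esub> p k \<otimes>\<^bsub>A\<^esub> q' (m - k)) {k. k \<subseteq># m}" for m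
        by (rule finsum_cong'[OF refl]) (simp_all add: r_distr cf[OF p] cf[OF q] cf[OF q'])
      also have "finsum A (\<lambda>k. p k \<otimes>\<^bsub>A\<^esub> q (m - k) \<oplus>\<^bsub>A\<^esub> p k \<otimes>\<^bsub>A\<^esub> q' (m - k)) {k. k \<subseteq># m} =
        finsum A (\<lambda>k. p k \<otimes>\<^bsub>A\<^esub> q (m - k)) {k. k \<subseteq># m} \<oplus>\<^bsub>A\<^esub> finsum A (\<lambda>k. p k \<otimes>\<^bsub>A\<^esub> q' (m - k)) {k. k \<subseteq># m}" for m
        by (rule finsum_addf) (simp_all add: cf[OF p] cf[OF q] cf[OF q'])
      finally show "p \<otimes>\<^bsub>mpoly A V\<^esub> (q \<oplus>\<^bsub>?F\<^esub> q') = p \<otimes>\<^bsub>mpoly A V\<^esub> q \<oplus>\<^bsub>?F\<^esub> p \<otimes>\<^bsub>mpoly A V\<^esub> q'"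
        unfolding mm by (simp add: fun_eq_iff)
    next
      fix a q assume a: "a \<in> carrier A" and q: "q \<in> carrier ?F"
      have "finsum A (\<lambda>k. p k \<otimes>\<^bsub>A\<^esub> (a \<otimes>\<^bsub>A\<^esub> q (m - k))) {k. k \<subseteq># m} =
        finsum A (\<lambda>k. a \<otimes>\<^bsub>A\<^esub> (p k \<otimes>\<^bsub>A\<^esub> q (m - k))) {k. k \<subseteq># m}" for m
        by (rule finsum_cong'[OF refl]) (simp_all add: m_lcomm a cf[OF p] cf[OF q])
      also have "finsum A (\<lambda>k. a \<otimes>\<^bsub>A\<^esub> (p k \<otimes>\<^bsub>A\<^esub> q (m - k))) {k. k \<subseteq># m} =
         a \<otimes>\<^bsub>A\<^esub> finsum A (\<lambda>k. p k \<otimes>\<^bsub>A\<^esub> q (m - k)) {k. k \<subseteq># m}" for m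
        by (rule finsum_rdistr[symmetric]) (simp_all add: fin a cf[OF p] cf[OF q])
      finally show "p \<otimes>\<^bsub>mpoly A V\<^esub> (a \<odot>\<^bsub>?F\<^esub> q) = a \<odot>\<^bsub>?F\<^esub> (p \<otimes>\<^bsub>mpoly A V\<^esub> q)"
        unfolding mm by (simp add: fun_eq_iff)
    qed
    show "(\<lambda>q. q \<otimes>\<^bsub>mpoly A V\<^esub> p) \<in> lin A ?F ?F"
    proof (rule linI)
      fix q q' assume q: "q \<in> carrier ?F" and q': "q' \<in> carrier ?F"
      show "q \<otimes>\<^bsub>mpoly A V\<^esub> p \<in> carrier ?F" by (rule c[OF q p])
      have "finsum A (\<lambda>k. (q k \<oplus>\<^bsub>A\<^esub> q' k) \<otimes>\<^bsub>A\<^esub> p (m - k)) {k. k \<subseteq># m} =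
        finsum A (\<lambda>k. q k \<otimes>\<^bsub>A\<^esub> p (m - k) \<oplus>\<^bsub>A\<^esub> q' k \<otimes>\<^bsub>A\<^esub> p (m - k)) {k. k \<subseteq># m}" for m
        by (rule finsum_cong'[OF refl]) (simp_all add: l_distr cf[OF p] cf[OF q] cf[OF q'])
      also have "finsum A (\<lambda>k. q k \<otimes>\<^bsub>A\<^esub> p (m - k) \<oplus>\<^bsub>A\<^esub> q' k \<otimes>\<^bsub>A\<^esub> p (m - k)) {k. k \<subseteq># m} =
        finsum A (\<lambda>k. q k \<otimes>\<^bsub>A\<^esub> p (m - k)) {k. k \<subseteq># m} \<oplus>\<^bsub>A\<^esub> finsum A (\<lambda>k. q' k \<otimes>\<^bsub>A\<^esub> p (m - k)) {k. k \<subseteq># m}" for m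
        by (rule finsum_addf) (simp_all add: cf[OF p] cf[OF q] cf[OF q'])
      finally show "(q \<oplus>\<^bsub>?F\<^esub> q') \<otimes>\<^bsub>mpoly A V\<^esub> p = q \<otimes>\<^bsub>mpoly A V\<^esub> p \<oplus>\<^bsub>?F\<^esub> q' \<otimes>\<^bsub>mpoly A V\<^esub> p"
        unfolding mm by (simp add: fun_eq_iff)
    next
      fix a q assume a: "a \<in> carrier A" and q: "q \<in> carrier ?F"
      have "finsum A (\<lambda>k. a \<otimes>\<^bsub>A\<^esub> q k \<otimes>\<^bsub>A\<^esub> p (m - k)) {k. k \<subseteq># m} =
        finsum A (\<lambda>k. a \<otimes>\<^bsub>A\<^esub> (q k \<otimes>\<^bsub>A\<^esub> p (m - k))) {k. k \<subseteq># m}" for m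
        by (rule finsum_cong'[OF refl]) (simp_all add: m_assoc a cf[OF p] cf[OF q])
      also have "finsum A (\<lambda>k. a \<otimes>\<^bsub>A\<^esub> (q k \<otimes>\<^bsub>A\<^esub> p (m - k))) {k. k \<subseteq># m} =
         a \<otimes>\<^bsub>A\<^esub> finsum A (\<lambda>k. q k \<otimes>\<^bsub>A\<^esub> p (m - k)) {k. k \<subseteq># m}" for m
        by (rule finsum_rdistr[symmetric]) (simp_all add: fin a cf[OF p] cf[OF q])
      finally show "(a \<odot>\<^bsub>?F\<^esub> q) \<otimes>\<^bsub>mpoly A V\<^esub> p = a \<odot>\<^bsub>?F\<^esub> (q \<otimes>\<^bsub>mpoly A V\<^esub> p)"
        unfolding mm by (simp add: fun_eq_iff)
    qed
  qed
qed

lemma unit_vec_mult: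
  assumes "cring A"
  shows "unit_vec A m \<otimes>\<^bsub>mpoly A V\<^esub> unit_vec A k = unit_vec A (m + k)"
proof
  fix w
  interpret cring A by fact
  have "(unit_vec A m \<otimes>\<^bsub>mpoly A V\<^esub> unit_vec A k) w =
      finsum A (\<lambda>j. if m = j then unit_vec A k (w - m) else \<zero>\<^bsub>A\<^esub>) {j. j \<subseteq># w}"
    unfolding mpoly_simps(5)[OF assms] by (rule finsum_cong'[OF refl]) (auto simp: unit_vec_def)
  also have "\<dots> = unit_vec A (m + k) w"
  \<comment> \<open>Subtraction of multisets truncates, so w - m = k expresses w = m + k only when m
    is contained in w.\<close>
  proof (cases "m \<subseteq># w")
    case True
    then have "finsum A (\<lambda>j. if m = j then unit_vec A k (w - m) else \<zero>\<^bsub>A\<^esub>) {j. j \<subseteq># w} = unit_vec A k (w - m)"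
      using finite_submultisets[of w] by (intro finsum_singleton) (auto simp: unit_vec_def)
    moreover have "w - m = k \<longleftrightarrow> w = m + k" using True by auto
    ultimately show ?thesis by (simp add: unit_vec_def)
  next
    case False
    then have "finsum A (\<lambda>j. if m = j then unit_vec A k (w - m) else \<zero>\<^bsub>A\<^esub>) {j. j \<subseteq># w} = finsum A (\<lambda>j. \<zero>\<^bsub>A\<^esub>) {j. j \<subseteq># w}"
      by (intro finsum_cong'[OF refl]) auto
    moreover have "w \<noteq> m + k" using False by auto
    ultimately show ?thesis by (simp add: finsum_zero unit_vec_def)
  qed
  finally show "(unit_vec A m \<otimes>\<^bsub>mpoly A V\<^esub> unit_vec A k) w = unit_vec A (m + k) w" .
qed

text \<open>Associativity, commutativity and the unit law are multilinear, so they are checked on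
  monomials, where the product is the sum of multisets. Distributivity is bilinearity
  itself.\<close>

lemma algebra_mpoly:
  assumes "cring A"
  shows "algebra A (mpoly A V)"
proof -
  interpret A: cring A by fact
  let ?F = "free_mod A (mons V)" and ?P = "mpoly A V"
  note mF = module_free_mod[OF assms, of "mons V"] and mP = module_mpoly[OF assms, of V]
  interpret P: module A ?P by (rule mP)
  note b = mpoly_mult_closed_bilin[OF assms, of V]
  note c = mpoly_carrier[OF assms, of V] and um = unit_vec_mult[OF assms, where V = V]
  have u: "unit_vec A m \<in> carrier ?F" if "m \<in> mons V" for m by (rule unit_vec_closed[OF assms that])
  have m1: "{#} \<in> mons V" "m + k \<in> mons V" if "m \<in> mons V" "k \<in> mons V" for m k
    using that by (simp_all add: mons_def)
  have assoc: "p \<otimes>\<^bsub>?P\<^esub> q \<otimes>\<^bsub>?P\<^esub> r = p \<otimes>\<^bsub>?P\<^esub> (q \<otimes>\<^bsub>?P\<^esub> r)"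
    if p: "p \<in> carrier ?F" and q: "q \<in> carrier ?F" and r: "r \<in> carrier ?F" for p q r
  proof (rule free_bilin_ext[OF mF, where b = "\<lambda>p q. p \<otimes>\<^bsub>?P\<^esub> q \<otimes>\<^bsub>?P\<^esub> r" and b' = "\<lambda>p q. p \<otimes>\<^bsub>?P\<^esub> (q \<otimes>\<^bsub>?P\<^esub> r)", OF _ _ _ p q])
    show "bilin A ?F ?F ?F (\<lambda>p q. p \<otimes>\<^bsub>?P\<^esub> q \<otimes>\<^bsub>?P\<^esub> r)" by (rule bilin_post[OF b bilinD2[OF b r]])
    show "bilin A ?F ?F ?F (\<lambda>p q. p \<otimes>\<^bsub>?P\<^esub> (q \<otimes>\<^bsub>?P\<^esub> r))" by (rule bilin_comp[OF b lin_id bilinD2[OF b r]])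
    fix m k assume m: "m \<in> mons V" and k: "k \<in> mons V"
    show "unit_vec A m \<otimes>\<^bsub>?P\<^esub> unit_vec A k \<otimes>\<^bsub>?P\<^esub> r = unit_vec A m \<otimes>\<^bsub>?P\<^esub> (unit_vec A k \<otimes>\<^bsub>?P\<^esub> r)"
      unfolding um
    proof (rule free_ext[OF mF, where f = "\<lambda>r. unit_vec A (m + k) \<otimes>\<^bsub>?P\<^esub> r" and g = "\<lambda>r. unit_vec A m \<otimes>\<^bsub>?P\<^esub> (unit_vec A k \<otimes>\<^bsub>?P\<^esub> r)", OF _ _ _ r])
      show "(\<lambda>r. unit_vec A (m + k) \<otimes>\<^bsub>?P\<^esub> r) \<in> lin A ?F ?F" by (rule bilinD1[OF b u[OF m1(2)[OF m k]]])
      show "(\<lambda>r. unit_vec A m \<otimes>\<^bsub>?P\<^esub> (unit_vec A k \<otimes>\<^bsub>?P\<^esub> r)) \<in> lin A ?F ?F"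
        by (rule lin_comp[OF bilinD1[OF b u[OF k]] bilinD1[OF b u[OF m]]])
    qed (simp only: um add.assoc)
  qed
  have comm: "p \<otimes>\<^bsub>?P\<^esub> q = q \<otimes>\<^bsub>?P\<^esub> p" if p: "p \<in> carrier ?F" and q: "q \<in> carrier ?F" for p q
  proof (rule free_bilin_ext[OF mF, where b = "\<lambda>p q. p \<otimes>\<^bsub>?P\<^esub> q" and b' = "\<lambda>p q. q \<otimes>\<^bsub>?P\<^esub> p", OF b _ _ p q])
    show "bilin A ?F ?F ?F (\<lambda>p q. q \<otimes>\<^bsub>?P\<^esub> p)" using b unfolding bilin_def by blast
  qed (simp only: um add.commute)
  have one: "\<one>\<^bsub>?P\<^esub> \<otimes>\<^bsub>?P\<^esub> p = p" if p: "p \<in> carrier ?F" for p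
    unfolding mpoly_simps(2)[OF assms]
  proof (rule free_ext[OF mF bilinD1[OF b] lin_id _ p])
    show "unit_vec A {#} \<in> carrier ?F" by (rule u) (simp add: mons_def)
  qed (simp only: um add_0)
  have cl: "p \<otimes>\<^bsub>?P\<^esub> q \<in> carrier ?F" if "p \<in> carrier ?F" "q \<in> carrier ?F" for p q
    by (rule bilin_closed[OF b that])
  have o: "\<one>\<^bsub>?P\<^esub> \<in> carrier ?F" unfolding mpoly_simps(2)[OF assms] by (rule u) (simp add: mons_def)
  have e: "add ?P = add ?F" "smult ?P = smult ?F" by (simp_all add: mpoly_simps[OF assms])
  have "cring ?P"
  proof (rule cringI)
    show "abelian_group ?P" by (rule P.abelian_group_axioms)
    show "comm_monoid ?P"
      by (rule comm_monoidI; unfold c) (fact cl o assoc comm one)+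
    show "(p \<oplus>\<^bsub>?P\<^esub> q) \<otimes>\<^bsub>?P\<^esub> r = p \<otimes>\<^bsub>?P\<^esub> r \<oplus>\<^bsub>?P\<^esub> q \<otimes>\<^bsub>?P\<^esub> r"
      if "p \<in> carrier ?P" "q \<in> carrier ?P" "r \<in> carrier ?P" for p q r
      using that unfolding c e by (intro lin_add[OF bilinD2[OF b]])
  qed
  then show ?thesis
    unfolding algebra_def algebra_axioms_def
  proof (intro conjI allI impI mP)
    show "a \<odot>\<^bsub>?P\<^esub> p \<otimes>\<^bsub>?P\<^esub> q = a \<odot>\<^bsub>?P\<^esub> (p \<otimes>\<^bsub>?P\<^esub> q)"
      if "a \<in> carrier A" "p \<in> carrier ?P" "q \<in> carrier ?P" for a p q
      using that unfolding c e by (intro lin_smult[OF bilinD2[OF b]])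
  qed
qed

section \<open>Words in noncommuting elements, and substitution\<close>

definition word :: "('a, 'b) module \<Rightarrow> ('x \<Rightarrow> 'b) \<Rightarrow> 'x list \<Rightarrow> 'b" where
  "word B x l = foldr (\<lambda>s r. x s \<otimes>\<^bsub>B\<^esub> r) l \<one>\<^bsub>B\<^esub>"

lemma poly_eval_lsum: "poly_eval A B arr x = lsum A B (\<lambda>m. word B x (arr m))"
  unfolding poly_eval_def lsum_def word_def by (rule ext) simp

context
  fixes B :: "('a, 'b) module" and x :: "'x \<Rightarrow> 'b" and V :: "'x set"
  assumes mon: "Group.monoid B" and x: "\<And>s. s \<in> V \<Longrightarrow> x s \<in> carrier B"
begin

lemma word_closed: "set l \<subseteq> V \<Longrightarrow> word B x l \<in> carrier B"
  unfolding word_def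
  by (induction l) (use x monoid.m_closed[OF mon] monoid.one_closed[OF mon] in auto)

lemma word_append: "set l \<subseteq> V \<Longrightarrow> set l' \<subseteq> V \<Longrightarrow> word B x (l @ l') = word B x l \<otimes>\<^bsub>B\<^esub> word B x l'"
proof (induction l)
  case Nil
  then show ?case using word_closed[of l'] monoid.l_one[OF mon] by (simp add: word_def)
next
  case (Cons s l)
  then have "word B x ((s # l) @ l') = x s \<otimes>\<^bsub>B\<^esub> (word B x l \<otimes>\<^bsub>B\<^esub> word B x l')" by (simp add: word_def)
  also have "\<dots> = word B x (s # l) \<otimes>\<^bsub>B\<^esub> word B x l'"
    using Cons.prems word_closed[of l] word_closed[of l'] x[of s] monoid.m_assoc[OF mon, of "x s" "word B x l" "word B x l'"]
    by (simp add: word_def)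
  finally show ?case .
qed

lemma word_commute:
  assumes comm: "\<And>s t. s \<in> V \<Longrightarrow> t \<in> V \<Longrightarrow> x s \<otimes>\<^bsub>B\<^esub> x t = x t \<otimes>\<^bsub>B\<^esub> x s" and "s \<in> V" "set l \<subseteq> V"
  shows "word B x l \<otimes>\<^bsub>B\<^esub> x s = x s \<otimes>\<^bsub>B\<^esub> word B x l"
  using assms(3)
proof (induction l)
  case Nil
  then show ?case using x[OF assms(2)] by (simp add: word_def monoid.l_one[OF mon] monoid.r_one[OF mon])
next
  case (Cons t l)
  note cl = word_closed[of l] x[OF assms(2)] x[of t]
  have l: "set l \<subseteq> V" "t \<in> V" using Cons.prems by simp_all
  have "word B x (t # l) \<otimes>\<^bsub>B\<^esub> x s = x t \<otimes>\<^bsub>B\<^esub> (word B x l \<otimes>\<^bsub>B\<^esub> x s)"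
    using monoid.m_assoc[OF mon cl(3) cl(1) cl(2)] l by (simp add: word_def)
  also have "\<dots> = (x t \<otimes>\<^bsub>B\<^esub> x s) \<otimes>\<^bsub>B\<^esub> word B x l"
    unfolding Cons.IH[OF l(1)] by (rule monoid.m_assoc[OF mon cl(3)[OF l(2)] cl(2) cl(1)[OF l(1)], symmetric])
  also have "\<dots> = x s \<otimes>\<^bsub>B\<^esub> (x t \<otimes>\<^bsub>B\<^esub> word B x l)"
    unfolding comm[OF l(2) assms(2)] by (rule monoid.m_assoc[OF mon cl(2) cl(3)[OF l(2)] cl(1)[OF l(1)]])
  finally show ?case by (simp add: word_def)
qed

text \<open>Induction on l: its first letter is located in l' and moved to the front past the
  preceding letters by \<open>word_commute\<close>; what is left of l' is a rearrangement of the
  tail of l.\<close>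

lemma word_perm:
  assumes comm: "\<And>s t. s \<in> V \<Longrightarrow> t \<in> V \<Longrightarrow> x s \<otimes>\<^bsub>B\<^esub> x t = x t \<otimes>\<^bsub>B\<^esub> x s"
    and "mset l = mset l'" "set l \<subseteq> V"
  shows "word B x l = word B x l'"
  using assms(2,3)
proof (induction l arbitrary: l')
  case (Cons s l)
  have s: "s \<in> V" "set l \<subseteq> V" using Cons.prems by simp_all
  have "s \<in> set l'" using Cons.prems(1) by (metis list.set_intros(1) set_mset_mset)
  then obtain a b where l': "l' = a @ s # b" by (meson split_list)
  have ab: "mset l = mset (a @ b)" using Cons.prems(1) unfolding l' by simp
  have abV: "set a \<subseteq> V" "set b \<subseteq> V" using s(2) ab by (metis le_sup_iff set_append set_mset_mset)+
  have w: "word B x (s # l) = x s \<otimes>\<^bsub>B\<^esub> word B x l" for l by (simp add: word_def)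
  have "word B x l' = word B x a \<otimes>\<^bsub>B\<^esub> (x s \<otimes>\<^bsub>B\<^esub> word B x b)"
    unfolding l' using word_append[of a "s # b"] abV s(1) w[of b] by simp
  also have "\<dots> = (x s \<otimes>\<^bsub>B\<^esub> word B x a) \<otimes>\<^bsub>B\<^esub> word B x b"
    using monoid.m_assoc[OF mon word_closed[OF abV(1)] x[OF s(1)] word_closed[OF abV(2)]] word_commute[OF comm s(1) abV(1)]
    by simp
  also have "\<dots> = x s \<otimes>\<^bsub>B\<^esub> word B x (a @ b)"
    using monoid.m_assoc[OF mon x[OF s(1)] word_closed[OF abV(1)] word_closed[OF abV(2)]] word_append[OF abV] by simp
  also have "\<dots> = word B x (s # l)"
    unfolding w Cons.IH[OF ab s(2)] ..
  finally show ?case ..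
qed simp

end

lemma mset_set_mons:
  assumes "\<And>m. mset (arr m) = m" "m \<in> mons V"
  shows "set (arr m) \<subseteq> V"
  using assms(2) assms(1)[of m] unfolding mons_def by (metis mem_Collect_eq set_mset_mset)

text \<open>The values on monomials are words, and \<open>arr (m + k)\<close> is a rearrangement of
  the concatenation of \<open>arr m\<close> and \<open>arr k\<close>. Commuting values make the two
  words equal, and bilinearity extends the product rule from monomials to polynomials.\<close>

lemma poly_eval_alg_hom:
  assumes "galg A B" and x: "\<And>s. s \<in> V \<Longrightarrow> x s \<in> carrier B"
    and comm: "\<And>s t. s \<in> V \<Longrightarrow> t \<in> V \<Longrightarrow> x s \<otimes>\<^bsub>B\<^esub> x t = x t \<otimes>\<^bsub>B\<^esub> x s"
    and arr: "\<And>m. mset (arr m) = m"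
  shows "poly_eval A B arr x \<in> alg_hom A (mpoly A V) B"
    and "\<And>s. s \<in> V \<Longrightarrow> poly_eval A B arr x (ring.indexed_var A s) = x s"
proof -
  note n = galg_nalg[OF assms(1)] and mon = galg_monoid[OF assms(1)]
  note mB = nalg_module[OF n] and bB = nalg_bilin[OF n]
  note crA = module_cring[OF mB]
  let ?F = "free_mod A (mons V)" and ?P = "mpoly A V"
  note aV = mset_set_mons[OF arr]
  have wc: "word B x (arr m) \<in> carrier B" if "m \<in> mons V" for m by (rule word_closed[OF mon x aV[OF that]])
  have L: "poly_eval A B arr x \<in> lin A ?F B" unfolding poly_eval_lsum by (rule lsum_lin[OF mB wc])
  have u: "poly_eval A B arr x (unit_vec A m) = word B x (arr m)" if "m \<in> mons V" for m
    unfolding poly_eval_lsum by (rule lsum_unit[where b = "\<lambda>m. word B x (arr m)", OF mB wc[OF that]])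
  show "poly_eval A B arr x \<in> alg_hom A ?P B"
  proof (rule alg_homI)
    show "poly_eval A B arr x \<in> lin A ?P B" unfolding lin_mpoly[OF crA] by (rule L)
    show "poly_eval A B arr x \<one>\<^bsub>?P\<^esub> = \<one>\<^bsub>B\<^esub>"
      unfolding mpoly_simps[OF crA] using u[of "{#}"] arr[of "{#}"] by (simp add: mons_def word_def)
    fix p q assume "p \<in> carrier ?P" "q \<in> carrier ?P"
    then have pq: "p \<in> carrier ?F" "q \<in> carrier ?F" unfolding mpoly_carrier[OF crA] .
    show "poly_eval A B arr x (p \<otimes>\<^bsub>?P\<^esub> q) = poly_eval A B arr x p \<otimes>\<^bsub>B\<^esub> poly_eval A B arr x q"
    proof (rule free_bilin_ext[OF mB, where b = "\<lambda>p q. poly_eval A B arr x (p \<otimes>\<^bsub>?P\<^esub> q)" and b' = "\<lambda>p q. poly_eval A B arr x p \<otimes>\<^bsub>B\<^esub> poly_eval A B arr x q",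
          OF bilin_post[OF mpoly_mult_closed_bilin[OF crA] L] bilin_comp[OF bB L L] _ pq])
      fix m k assume m: "m \<in> mons V" and k: "k \<in> mons V"
      have mk: "m + k \<in> mons V" using m k by (simp add: mons_def)
      have "word B x (arr (m + k)) = word B x (arr m @ arr k)"
        by (rule word_perm[OF mon x comm _ aV[OF mk]]) (simp_all add: arr)
      then show "poly_eval A B arr x (unit_vec A m \<otimes>\<^bsub>?P\<^esub> unit_vec A k) =
          poly_eval A B arr x (unit_vec A m) \<otimes>\<^bsub>B\<^esub> poly_eval A B arr x (unit_vec A k)"
        unfolding unit_vec_mult[OF crA] u[OF m] u[OF k] u[OF mk] using word_append[OF mon x aV[OF m] aV[OF k]] by simp
    qed
  qed
  show "poly_eval A B arr x (ring.indexed_var A s) = x s" if s: "s \<in> V" for s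
  proof -
    have "arr {#s#} = [s]" using arr[of "{#s#}"] by simp
    then show ?thesis
      unfolding indexed_var_unit[OF crA] using u[of "{#s#}"] s x[OF s] by (simp add: mons_def word_def monoid.r_one[OF mon])
  qed
qed

lemma indexed_var_closed:
  assumes "cring A" "s \<in> V" shows "ring.indexed_var A s \<in> carrier (mpoly A V)"
  unfolding mpoly_carrier[OF assms(1)] indexed_var_unit[OF assms(1)]
  by (rule unit_vec_closed[OF assms(1)]) (simp add: mons_def assms(2))

lemma mpoly_hom_ext:
  assumes "module A D" and f: "f \<in> alg_hom A (mpoly A V) D" and g: "g \<in> alg_hom A (mpoly A V) D"
    and var: "\<And>s. s \<in> V \<Longrightarrow> f (ring.indexed_var A s) = g (ring.indexed_var A s)"
    and p: "p \<in> carrier (mpoly A V)"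
  shows "f p = g p"
proof -
  note crA = module_cring[OF assms(1)]
  let ?F = "free_mod A (mons V)" and ?P = "mpoly A V"
  note c = mpoly_carrier[OF crA, of V]
  have u: "unit_vec A m \<in> carrier ?P" if "m \<in> mons V" for m unfolding c by (rule unit_vec_closed[OF crA that])
  have "f (unit_vec A m) = g (unit_vec A m)" if "set_mset m \<subseteq> V" for m
    using that
  proof (induction m)
    case empty
    show ?case using alg_hom_one[OF f] alg_hom_one[OF g] unfolding mpoly_simps[OF crA] by simp
  next
    case (add s m)
    have m: "unit_vec A m \<in> carrier ?P" "unit_vec A {#s#} \<in> carrier ?P"
      using add.prems by (auto intro!: u simp: mons_def)
    have e: "unit_vec A (add_mset s m) = unit_vec A m \<otimes>\<^bsub>?P\<^esub> unit_vec A {#s#}"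
      unfolding unit_vec_mult[OF crA] by simp
    have "f (unit_vec A {#s#}) = g (unit_vec A {#s#})"
      using var[of s] add.prems unfolding indexed_var_unit[OF crA] by simp
    then show ?case
      unfolding e alg_hom_mult[OF f m] alg_hom_mult[OF g m] using add.IH add.prems by simp
  qed
  then have e: "f (unit_vec A m) = g (unit_vec A m)" if "m \<in> mons V" for m
    using that unfolding mons_def by blast
  have p': "p \<in> carrier ?F" using p unfolding c .
  show ?thesis
    by (rule free_ext[OF assms(1), where f = f and g = g, OF alg_hom_lin[OF f, unfolded lin_mpoly[OF crA]]
          alg_hom_lin[OF g, unfolded lin_mpoly[OF crA]] e p'])
qed

text \<open>The same list \<open>arr m\<close> is used on both sides, so each word is carried factor
  by factor to the corresponding word, even if the values do not commute. This relates substitution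
  over A[U] to substitution over its quotients.\<close>

lemma poly_eval_comp:
  assumes "galg A B" "module A B'" and h: "h \<in> alg_hom A B B'" and x: "\<And>s. s \<in> V \<Longrightarrow> x s \<in> carrier B"
    and arr: "\<And>m. mset (arr m) = m" and p: "p \<in> carrier (mpoly A V)"
  shows "h (poly_eval A B arr x p) = poly_eval A B' arr (\<lambda>s. h (x s)) p"
proof -
  note n = galg_nalg[OF assms(1)] and mon = galg_monoid[OF assms(1)]
  note mB = nalg_module[OF n]
  note crA = module_cring[OF mB]
  have hw: "h (word B x l) = word B' (\<lambda>s. h (x s)) l" if "set l \<subseteq> V" for l
    using that
  proof (induction l)
    case Nil
    show ?case using alg_hom_one[OF h] by (simp add: word_def)
  next
    case (Cons s l)
    have "h (x s \<otimes>\<^bsub>B\<^esub> word B x l) = h (x s) \<otimes>\<^bsub>B'\<^esub> h (word B x l)"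
      by (rule alg_hom_mult[OF h]) (use Cons.prems in \<open>simp_all add: x word_closed[OF mon x]\<close>)
    then show ?case using Cons by (simp add: word_def)
  qed
  have p': "p \<in> carrier (free_mod A (mons V))" using p unfolding mpoly_carrier[OF crA] .
  have wc: "word B x (arr m) \<in> carrier B" if "m \<in> mons V" for m
    by (rule word_closed[OF mon x mset_set_mons[OF arr that]])
  have wc': "word B' (\<lambda>s. h (x s)) (arr m) \<in> carrier B'" if "m \<in> mons V" for m
    using lin_closed[OF alg_hom_lin[OF h] wc[OF that]] unfolding hw[OF mset_set_mons[OF arr that]] .
  show ?thesis
    unfolding poly_eval_lsum
  proof (rule free_ext[OF assms(2), where f = "\<lambda>p. h (lsum A B (\<lambda>m. word B x (arr m)) p)" and
        g = "lsum A B' (\<lambda>m. word B' (\<lambda>s. h (x s)) (arr m))", OF _ _ _ p'])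
    show "(\<lambda>p. h (lsum A B (\<lambda>m. word B x (arr m)) p)) \<in> lin A (free_mod A (mons V)) B'"
      by (rule lin_comp[OF lsum_lin[OF mB wc] alg_hom_lin[OF h]])
    show "lsum A B' (\<lambda>m. word B' (\<lambda>s. h (x s)) (arr m)) \<in> lin A (free_mod A (mons V)) B'"
      by (rule lsum_lin[OF assms(2) wc'])
    fix m assume m: "m \<in> mons V"
    show "h (lsum A B (\<lambda>m. word B x (arr m)) (unit_vec A m)) = lsum A B' (\<lambda>m. word B' (\<lambda>s. h (x s)) (arr m)) (unit_vec A m)"
      unfolding lsum_unit[where b = "\<lambda>m. word B x (arr m)", OF mB wc[OF m]]
        lsum_unit[where b = "\<lambda>m. word B' (\<lambda>s. h (x s)) (arr m)", OF assms(2) wc'[OF m]]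
      by (rule hw[OF mset_set_mons[OF arr m]])
  qed
qed

section \<open>Factorization through quotients\<close>

lemma kernel_ideal:
  assumes "algebra A B" "nalg A D" and h: "h \<in> alg_hom A B D"
  shows "ideal {b \<in> carrier B. h b = \<zero>\<^bsub>D\<^esub>} B"
proof -
  interpret BM: cring B by (rule algebra_cring[OF assms(1)])
  note mB = algebra_module[OF assms(1)] and mD = nalg_module[OF assms(2)] and bD = nalg_bilin[OF assms(2)]
  note hl = alg_hom_lin[OF h]
  note sm = kernel_submodule[OF mB mD hl]
  note hc = lin_closed[OF hl]
  \<comment> \<open>D is only an \<open>nalg\<close>, so absorption by zero is read off from the
    linearity of the product in each argument.\<close>
  have z: "x \<otimes>\<^bsub>D\<^esub> \<zero>\<^bsub>D\<^esub> = \<zero>\<^bsub>D\<^esub>" "\<zero>\<^bsub>D\<^esub> \<otimes>\<^bsub>D\<^esub> x = \<zero>\<^bsub>D\<^esub>" if "x \<in> carrier D" for x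
    using lin_zero[OF mD mD bilinD1[OF bD that]] lin_zero[OF mD mD bilinD2[OF bD that]] by simp_all
  show ?thesis
  proof (rule idealI[OF BM.ring_axioms submodule.axioms(1)[OF sm]])
    fix a x assume "a \<in> {b \<in> carrier B. h b = \<zero>\<^bsub>D\<^esub>}" and x: "x \<in> carrier B"
    then have a: "a \<in> carrier B" "h a = \<zero>\<^bsub>D\<^esub>" by simp_all
    show "x \<otimes>\<^bsub>B\<^esub> a \<in> {b \<in> carrier B. h b = \<zero>\<^bsub>D\<^esub>}"
      using a x alg_hom_mult[OF h x a(1)] z(1)[OF hc[OF x]] by simp
    show "a \<otimes>\<^bsub>B\<^esub> x \<in> {b \<in> carrier B. h b = \<zero>\<^bsub>D\<^esub>}"
      using a x alg_hom_mult[OF h a(1) x] z(2)[OF hc[OF x]] by simp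
  qed
qed

text \<open>The induced map is defined through a chosen representative; the condition on K makes its
  value independent of the choice.\<close>

lemma quot_factor:
  assumes "algebra A B" "ideal K B" "module A D" and h: "h \<in> alg_hom A B D"
    and ker: "\<And>k. k \<in> K \<Longrightarrow> h k = \<zero>\<^bsub>D\<^esub>"
  shows "\<exists>g \<in> alg_hom A (quot B K) D. \<forall>b\<in>carrier B. g (K +>\<^bsub>B\<^esub> b) = h b"
proof -
  note mB = algebra_module[OF assms(1)] and sK = ideal_submodule[OF assms(1,2)]
  note hl = alg_hom_lin[OF h]
  interpret B: module A B by (rule mB)
  interpret BM: cring B by (rule algebra_cring[OF assms(1)])
  define g where "g C = h (SOME b. b \<in> carrier B \<and> C = K +>\<^bsub>B\<^esub> b)" for C
  have g: "g (K +>\<^bsub>B\<^esub> b) = h b" if b: "b \<in> carrier B" for b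
  proof -
    define c where "c = (SOME c. c \<in> carrier B \<and> K +>\<^bsub>B\<^esub> b = K +>\<^bsub>B\<^esub> c)"
    have c: "c \<in> carrier B \<and> K +>\<^bsub>B\<^esub> b = K +>\<^bsub>B\<^esub> c"
      unfolding c_def by (rule someI[where x = b]) (simp add: b)
    then have "b \<ominus>\<^bsub>B\<^esub> c \<in> K" using coset_eq_iff[OF mB sK b, of c] by blast
    then have "h b \<ominus>\<^bsub>D\<^esub> h c = \<zero>\<^bsub>D\<^esub>" using ker lin_minus[OF mB assms(3) hl b, of c] c by simp
    then have "h b = h c"
      using module_minus_zero_iff[OF assms(3) lin_closed[OF hl b] lin_closed[OF hl, of c]] c by blast
    then show ?thesis unfolding g_def c_def by simp
  qed
  have "g \<in> alg_hom A (quot B K) D"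
  proof (rule alg_homI)
    show "g \<in> lin A (quot B K) D"
    proof (rule linI)
      fix x assume "x \<in> carrier (quot B K)"
      then obtain b where b: "b \<in> carrier B" "x = K +>\<^bsub>B\<^esub> b" unfolding quot_carrier by blast
      show "g x \<in> carrier D" unfolding b(2) g[OF b(1)] by (rule lin_closed[OF hl b(1)])
      show "g (a \<odot>\<^bsub>quot B K\<^esub> x) = a \<odot>\<^bsub>D\<^esub> g x" if a: "a \<in> carrier A" for a
        unfolding b(2) quot_smult[OF mB sK a b(1)] g[OF b(1)] g[OF B.smult_closed[OF a b(1)]] by (rule lin_smult[OF hl a b(1)])
      fix y assume "y \<in> carrier (quot B K)"
      then obtain c where c: "c \<in> carrier B" "y = K +>\<^bsub>B\<^esub> c" unfolding quot_carrier by blast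
      show "g (x \<oplus>\<^bsub>quot B K\<^esub> y) = g x \<oplus>\<^bsub>D\<^esub> g y"
        unfolding b(2) c(2) quot_add[OF mB sK b(1) c(1)] g[OF b(1)] g[OF c(1)] g[OF B.a_closed[OF b(1) c(1)]]
        by (rule lin_add[OF hl b(1) c(1)])
    qed
    fix x y assume "x \<in> carrier (quot B K)" "y \<in> carrier (quot B K)"
    then obtain b c where b: "b \<in> carrier B" "x = K +>\<^bsub>B\<^esub> b" and c: "c \<in> carrier B" "y = K +>\<^bsub>B\<^esub> c"
      unfolding quot_carrier by blast
    show "g (x \<otimes>\<^bsub>quot B K\<^esub> y) = g x \<otimes>\<^bsub>D\<^esub> g y"
      unfolding b(2) c(2) quot_mult[OF assms(2) b(1) c(1)] g[OF b(1)] g[OF c(1)] g[OF BM.m_closed[OF b(1) c(1)]]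
      by (rule alg_hom_mult[OF h b(1) c(1)])
  next
    show "g \<one>\<^bsub>quot B K\<^esub> = \<one>\<^bsub>D\<^esub>" unfolding quot_simps g[OF BM.one_closed] by (rule alg_hom_one[OF h])
  qed
  with g show ?thesis by blast
qed

text \<open>Records that C is B/K without forming that quotient, so that a further quotient of C can
  be presented over the same B.\<close>

definition surj_ker :: "('a, 'm) ring_scheme \<Rightarrow> ('a, 'b) module \<Rightarrow> ('a, 'c) module \<Rightarrow> ('b \<Rightarrow> 'c) \<Rightarrow> 'b set \<Rightarrow> bool" where
  "surj_ker A B C h K \<longleftrightarrow> h \<in> alg_hom A B C \<and> h ` carrier B = carrier C \<and> {b \<in> carrier B. h b = \<zero>\<^bsub>C\<^esub>} = K"

lemma surj_kerD:
  assumes "surj_ker A B C h K"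
  shows "h \<in> alg_hom A B C" "h ` carrier B = carrier C" "{b \<in> carrier B. h b = \<zero>\<^bsub>C\<^esub>} = K"
  using assms unfolding surj_ker_def by blast+

lemma surj_ker_iso:
  assumes "algebra A B" "algebra A C" and s: "surj_ker A B C h K"
  shows "\<exists>g \<in> alg_iso A (quot B K) C. \<forall>b\<in>carrier B. g (K +>\<^bsub>B\<^esub> b) = h b"
proof -
  note h = surj_kerD[OF s] and mB = algebra_module[OF assms(1)] and mC = algebra_module[OF assms(2)]
  have iK: "ideal K B" using kernel_ideal[OF assms(1) algebra_nalg[OF assms(2)] h(1)] unfolding h(3) .
  note sK = ideal_submodule[OF assms(1) iK]
  interpret B: module A B by (rule mB)
  obtain g where g: "g \<in> alg_hom A (quot B K) C" "\<And>b. b \<in> carrier B \<Longrightarrow> g (K +>\<^bsub>B\<^esub> b) = h b"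
    using quot_factor[OF assms(1) iK mC h(1)] h(3) by blast
  have "inj_on g (carrier (quot B K))"
  proof (rule inj_onI)
    fix x y assume "x \<in> carrier (quot B K)" "y \<in> carrier (quot B K)" and e: "g x = g y"
    then obtain b c where b: "b \<in> carrier B" "x = K +>\<^bsub>B\<^esub> b" and c: "c \<in> carrier B" "y = K +>\<^bsub>B\<^esub> c"
      unfolding quot_carrier by blast
    have "h b = h c" using e unfolding b(2) c(2) g(2)[OF b(1)] g(2)[OF c(1)] .
    moreover note hb = lin_closed[OF alg_hom_lin[OF h(1)] b(1)] and hc = lin_closed[OF alg_hom_lin[OF h(1)] c(1)]
    ultimately have "h (b \<ominus>\<^bsub>B\<^esub> c) = \<zero>\<^bsub>C\<^esub>"
      using lin_minus[OF mB mC alg_hom_lin[OF h(1)] b(1) c(1)] module_minus_zero_iff[OF mC hb hc] by simp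
    then have "b \<ominus>\<^bsub>B\<^esub> c \<in> K" unfolding h(3)[symmetric] using b c by simp
    then show "x = y" unfolding b(2) c(2) coset_eq_iff[OF mB sK b(1) c(1)] .
  qed
  moreover have "g ` carrier (quot B K) = carrier C"
    unfolding quot_carrier image_image h(2)[symmetric] using g(2) by simp
  ultimately have "g \<in> alg_iso A (quot B K) C"
    unfolding alg_iso_def bij_betw_def using g(1) by blast
  with g(2) show ?thesis by blast
qed

text \<open>Surjectivity lets an arbitrary element of C act on the image of J through a preimage in
  B.\<close>

lemma ideal_image_surj:
  assumes "algebra A B" "algebra A C" "surj_ker A B C h K" "ideal J B"
  shows "ideal (h ` J) C"
proof -
  interpret BM: cring B by (rule algebra_cring[OF assms(1)])
  interpret CM: cring C by (rule algebra_cring[OF assms(2)])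
  interpret J: ideal J B by (rule assms(4))
  note h = surj_kerD[OF assms(3)] and mB = algebra_module[OF assms(1)] and mC = algebra_module[OF assms(2)]
  note hl = alg_hom_lin[OF h(1)]
  have J: "b \<in> carrier B" if "b \<in> J" for b using that by (rule J.a_Hcarr)
  have "subgroup (h ` J) (add_monoid C)"
  proof (rule CM.add.subgroupI)
    show "h ` J \<subseteq> carrier C" by (rule image_subsetI) (rule lin_closed[OF hl J])
    show "h ` J \<noteq> {}" using imageI[OF J.zero_closed, of h] by (metis empty_iff)
    show "\<ominus>\<^bsub>C\<^esub> a \<in> h ` J" if ah: "a \<in> h ` J" for a
    proof -
      obtain b where b': "a = h b" "b \<in> J" using ah by (rule imageE)
      note b = b'(2,1)
      have "h (\<zero>\<^bsub>B\<^esub> \<ominus>\<^bsub>B\<^esub> b) = \<zero>\<^bsub>C\<^esub> \<ominus>\<^bsub>C\<^esub> h b"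
        using lin_minus[OF mB mC hl BM.zero_closed J[OF b(1)]] lin_zero[OF mB mC hl] by simp
      then have "\<ominus>\<^bsub>C\<^esub> a = h (\<ominus>\<^bsub>B\<^esub> b)"
        using J[OF b(1)] lin_closed[OF hl J[OF b(1)]] by (simp add: a_minus_def b(2))
      then show ?thesis using imageI[OF J.a_inv_closed[OF b(1)], of h] by (simp only:)
    qed
    show "a \<oplus>\<^bsub>C\<^esub> b \<in> h ` J" if ab: "a \<in> h ` J" "b \<in> h ` J" for a b
    proof -
      obtain c where c': "a = h c" "c \<in> J" using ab(1) by (rule imageE)
      obtain d where d': "b = h d" "d \<in> J" using ab(2) by (rule imageE)
      note c = c'(2,1) and d = d'(2,1)
      have "a \<oplus>\<^bsub>C\<^esub> b = h (c \<oplus>\<^bsub>B\<^esub> d)" unfolding c(2) d(2) by (rule lin_add[OF hl J[OF c(1)] J[OF d(1)], symmetric])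
      then show ?thesis using imageI[OF J.a_closed[OF c(1) d(1)], of h] by (simp only:)
    qed
  qed
  moreover have "x \<otimes>\<^bsub>C\<^esub> a \<in> h ` J" if ax: "a \<in> h ` J" "x \<in> carrier C" for a x
  proof -
    obtain c where c': "a = h c" "c \<in> J" using ax(1) by (rule imageE)
    obtain d where d': "x = h d" "d \<in> carrier B" using ax(2) unfolding h(2)[symmetric] by (rule imageE)
    note c = c'(2,1) and d = d'(2,1)
    have "x \<otimes>\<^bsub>C\<^esub> a = h (d \<otimes>\<^bsub>B\<^esub> c)" unfolding c(2) d(2) by (rule alg_hom_mult[OF h(1) d(1) J[OF c(1)], symmetric])
    then show ?thesis using imageI[OF J.I_l_closed[OF c(1) d(1)], of h] by (simp only:)
  qed
  moreover have "a \<otimes>\<^bsub>C\<^esub> x \<in> h ` J" if ax: "a \<in> h ` J" "x \<in> carrier C" for a x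
  proof -
    obtain c where c': "a = h c" "c \<in> J" using ax(1) by (rule imageE)
    obtain d where d': "x = h d" "d \<in> carrier B" using ax(2) unfolding h(2)[symmetric] by (rule imageE)
    note c = c'(2,1) and d = d'(2,1)
    have "a \<otimes>\<^bsub>C\<^esub> x = h (c \<otimes>\<^bsub>B\<^esub> d)" unfolding c(2) d(2) by (rule alg_hom_mult[OF h(1) J[OF c(1)] d(1), symmetric])
    then show ?thesis using imageI[OF J.I_r_closed[OF c(1) d(1)], of h] by (simp only:)
  qed
  ultimately show ?thesis by (intro idealI CM.ring_axioms)
qed

text \<open>Let J be the ideal generated by \<open>G0 \<union> G\<close>. By surjectivity h(J) is an
  ideal of C, so it contains the ideal generated by h(G). An element b mapping into the latter thus
  has the same image as some c in J, and b - c lies in the kernel, which is contained in J.\<close>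

lemma surj_ker_step:
  assumes "algebra A B" "algebra A C" and s: "surj_ker A B C h (Idl\<^bsub>B\<^esub> G0)" and G: "G0 \<subseteq> carrier B" "G \<subseteq> carrier B"
  shows "surj_ker A B (quot C (Idl\<^bsub>C\<^esub> (h ` G))) (\<lambda>b. Idl\<^bsub>C\<^esub> (h ` G) +>\<^bsub>C\<^esub> h b) (Idl\<^bsub>B\<^esub> (G0 \<union> G))"
proof -
  interpret BM: cring B by (rule algebra_cring[OF assms(1)])
  interpret CM: cring C by (rule algebra_cring[OF assms(2)])
  note h = surj_kerD[OF s] and mB = algebra_module[OF assms(1)] and mC = algebra_module[OF assms(2)]
  note hl = alg_hom_lin[OF h(1)]
  let ?L = "Idl\<^bsub>C\<^esub> (h ` G)" and ?J = "Idl\<^bsub>B\<^esub> (G0 \<union> G)"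
  have hG: "h ` G \<subseteq> carrier C" using G(2) h(2) by blast
  have iL: "ideal ?L C" by (rule CM.genideal_ideal[OF hG])
  have GG: "G0 \<union> G \<subseteq> carrier B" using G by blast
  have iJ: "ideal ?J B" by (rule BM.genideal_ideal[OF GG])
  interpret J: ideal ?J B by (rule iJ)
  interpret L: ideal ?L C by (rule iL)
  note sL = ideal_submodule[OF assms(2) iL]
  have comp: "(\<lambda>b. ?L +>\<^bsub>C\<^esub> h b) \<in> alg_hom A B (quot C ?L)"
    by (rule alg_hom_comp[OF h(1) quot_proj_alg_hom[OF assms(2) iL]])
  have z: "?L +>\<^bsub>C\<^esub> c = ?L \<longleftrightarrow> c \<in> ?L" if "c \<in> carrier C" for c
    using coset_eq_iff[OF mC sL that CM.zero_closed] coset_zero[OF mC sL] that by (simp add: a_minus_def)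
  have "{b \<in> carrier B. ?L +>\<^bsub>C\<^esub> h b = ?L} = {b \<in> carrier B. h b \<in> ?L}"
    using z[OF lin_closed[OF hl]] by blast
  also have "\<dots> = ?J"
  proof
    have "ideal {b \<in> carrier B. ?L +>\<^bsub>C\<^esub> h b = \<zero>\<^bsub>quot C ?L\<^esub>} B"
      by (rule kernel_ideal[OF assms(1) algebra_nalg[OF algebra_quot[OF assms(2) iL]] comp])
    moreover have "{b \<in> carrier B. ?L +>\<^bsub>C\<^esub> h b = \<zero>\<^bsub>quot C ?L\<^esub>} = {b \<in> carrier B. h b \<in> ?L}"
      unfolding quot_simps using z[OF lin_closed[OF hl]] by blast
    ultimately have i: "ideal {b \<in> carrier B. h b \<in> ?L} B" by simp
    have "h g \<in> ?L" if "g \<in> G0" for g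
    proof -
      have "h g = \<zero>\<^bsub>C\<^esub>" using BM.genideal_self[OF G(1)] that h(3) by blast
      then show ?thesis by simp
    qed
    moreover have "h g \<in> ?L" if "g \<in> G" for g using CM.genideal_self[OF hG] that by blast
    ultimately have "G0 \<union> G \<subseteq> {b \<in> carrier B. h b \<in> ?L}" using GG by blast
    then show "?J \<subseteq> {b \<in> carrier B. h b \<in> ?L}" by (rule BM.genideal_minimal[OF i])
    have "ideal (h ` ?J) C" by (rule ideal_image_surj[OF assms(1,2) s iJ])
    moreover have "h ` G \<subseteq> h ` ?J" using BM.genideal_self[OF GG] by blast
    ultimately have LJ: "?L \<subseteq> h ` ?J" by (rule CM.genideal_minimal)
    have G0J: "Idl\<^bsub>B\<^esub> G0 \<subseteq> ?J"
      using BM.genideal_self[OF GG] by (intro BM.genideal_minimal[OF iJ]) blast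
    show "{b \<in> carrier B. h b \<in> ?L} \<subseteq> ?J"
    proof clarify
      fix b assume b: "b \<in> carrier B" "h b \<in> ?L"
      then obtain c where c: "c \<in> ?J" "h b = h c" using LJ by blast
      have cB: "c \<in> carrier B" by (rule J.a_Hcarr[OF c(1)])
      have "h (b \<ominus>\<^bsub>B\<^esub> c) = \<zero>\<^bsub>C\<^esub>"
        using lin_minus[OF mB mC hl b(1) cB] module_minus_zero_iff[OF mC lin_closed[OF hl b(1)] lin_closed[OF hl cB]] c(2) by simp
      then have "b \<ominus>\<^bsub>B\<^esub> c \<in> Idl\<^bsub>B\<^esub> G0" unfolding h(3)[symmetric] using b(1) cB by simp
      then have "(b \<ominus>\<^bsub>B\<^esub> c) \<oplus>\<^bsub>B\<^esub> c \<in> ?J" using G0J c(1) by (intro J.a_closed) blast+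
      moreover have "(b \<ominus>\<^bsub>B\<^esub> c) \<oplus>\<^bsub>B\<^esub> c = b" using b(1) cB by (simp add: a_minus_def BM.a_assoc BM.l_neg)
      ultimately show "b \<in> ?J" by simp
    qed
  qed
  finally have ker: "{b \<in> carrier B. ?L +>\<^bsub>C\<^esub> h b = ?L} = ?J" .
  show ?thesis
    unfolding surj_ker_def quot_simps
  proof (intro conjI comp ker)
    show "(\<lambda>b. ?L +>\<^bsub>C\<^esub> h b) ` carrier B = carrier (quot C ?L)"
      unfolding quot_carrier h(2)[symmetric] image_image ..
  qed
qed

text \<open>Replaces an ideal by its generators inside a larger generating set; this passes from the
  ideals I_1, I_2, I_3 to the union of their generators.\<close>

lemma Idl_absorb:
  assumes "cring B" "G \<subseteq> carrier B" "G' \<subseteq> carrier B"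
  shows "Idl\<^bsub>B\<^esub> (G \<union> Idl\<^bsub>B\<^esub> G') = Idl\<^bsub>B\<^esub> (G \<union> G')"
proof -
  interpret cring B by fact
  have U: "G \<union> G' \<subseteq> carrier B" using assms by blast
  note i = genideal_ideal[OF U] and s = genideal_self[OF U]
  have "Idl\<^bsub>B\<^esub> G' \<subseteq> carrier B"
    by (rule additive_subgroup.a_subset[OF ideal.axioms(1)[OF genideal_ideal[OF assms(3)]]])
  then have I: "G \<union> Idl\<^bsub>B\<^esub> G' \<subseteq> carrier B" using assms(2) by (rule Un_least[rotated])
  have "Idl\<^bsub>B\<^esub> G' \<subseteq> Idl\<^bsub>B\<^esub> (G \<union> G')"
    using s by (intro genideal_minimal[OF i]) blast
  then have 1: "Idl\<^bsub>B\<^esub> (G \<union> Idl\<^bsub>B\<^esub> G') \<subseteq> Idl\<^bsub>B\<^esub> (G \<union> G')"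
    using s by (intro genideal_minimal[OF i]) blast
  have 2: "Idl\<^bsub>B\<^esub> (G \<union> G') \<subseteq> Idl\<^bsub>B\<^esub> (G \<union> Idl\<^bsub>B\<^esub> G')"
    using genideal_self[OF assms(3)] genideal_self[OF I]
    by (intro genideal_minimal[OF genideal_ideal[OF I]]) blast
  show ?thesis using 1 2 by (rule equalityI)
qed

section \<open>Symmetric algebras\<close>

context
  fixes A :: "('a, 'm) ring_scheme" and N :: "('a, 'n) module"
  assumes modN: "module A N"
begin

private lemmas N_cring = module_cring[OF modN]

private abbreviation (input) "Q \<equiv> mpoly A (carrier N)"
private abbreviation (input) "Xv \<equiv> ring.indexed_var A"

lemma sym_gens_carrier:
  "({Xv (x \<oplus>\<^bsub>N\<^esub> y) \<ominus>\<^bsub>Q\<^esub> (Xv x \<oplus>\<^bsub>Q\<^esub> Xv y) | x y. x \<in> carrier N \<and> y \<in> carrier N} \<union>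
    {Xv (a \<odot>\<^bsub>N\<^esub> x) \<ominus>\<^bsub>Q\<^esub> a \<odot>\<^bsub>Q\<^esub> Xv x | a x. a \<in> carrier A \<and> x \<in> carrier N}) \<subseteq> carrier Q"
proof -
  interpret N: module A N by (rule modN)
  interpret Q: module A Q by (rule module_mpoly[OF N_cring])
  note v = indexed_var_closed[OF N_cring]
  show ?thesis
    by (intro Un_least subsetI; clarify; intro Q.minus_closed Q.a_closed Q.smult_closed v N.a_closed N.smult_closed)
qed

lemma sym_ideal_ideal: "ideal (sym_ideal A N) Q"
proof -
  interpret Q: cring Q by (rule algebra_cring[OF algebra_mpoly[OF N_cring]])
  show ?thesis unfolding sym_ideal_def Let_def by (rule Q.genideal_ideal[OF sym_gens_carrier])
qed

lemma algebra_sym_alg: "algebra A (sym_alg A N)"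
  unfolding sym_alg_def by (rule algebra_quot[OF algebra_mpoly[OF N_cring] sym_ideal_ideal])

text \<open>The two families of generators of \<open>sym_ideal\<close> are additivity and
  homogeneity, read as congruences.\<close>

lemma sym_inc_lin: "sym_inc A N \<in> lin A N (sym_alg A N)"
proof -
  interpret N: module A N by (rule modN)
  note mQ = module_mpoly[OF N_cring, of "carrier N"]
  interpret Q: module A Q by (rule mQ)
  interpret Q': cring Q by (rule algebra_cring[OF algebra_mpoly[OF N_cring]])
  note v = indexed_var_closed[OF N_cring]
  note sI = ideal_submodule[OF algebra_mpoly[OF N_cring] sym_ideal_ideal]
  have g: "z \<in> sym_ideal A N" if "z \<in> {Xv (x \<oplus>\<^bsub>N\<^esub> y) \<ominus>\<^bsub>Q\<^esub> (Xv x \<oplus>\<^bsub>Q\<^esub> Xv y) | x y. x \<in> carrier N \<and> y \<in> carrier N} \<union>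
    {Xv (a \<odot>\<^bsub>N\<^esub> x) \<ominus>\<^bsub>Q\<^esub> a \<odot>\<^bsub>Q\<^esub> Xv x | a x. a \<in> carrier A \<and> x \<in> carrier N}" for z
    using Q'.genideal_self[OF sym_gens_carrier] that unfolding sym_ideal_def Let_def by blast
  note eq = coset_eq_iff[OF mQ sI, THEN iffD2]
  show ?thesis
  proof (rule linI)
    fix x assume x: "x \<in> carrier N"
    show "sym_inc A N x \<in> carrier (sym_alg A N)"
      unfolding sym_inc_def sym_alg_def quot_carrier by (rule imageI[OF v[OF x]])
    show "sym_inc A N (a \<odot>\<^bsub>N\<^esub> x) = a \<odot>\<^bsub>sym_alg A N\<^esub> sym_inc A N x" if a: "a \<in> carrier A" for a
      unfolding sym_inc_def sym_alg_def quot_smult[OF mQ sI a v[OF x]]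
      by (rule eq[OF v[OF N.smult_closed[OF a x]] Q.smult_closed[OF a v[OF x]] g]) (use a x in blast)
    fix y assume y: "y \<in> carrier N"
    show "sym_inc A N (x \<oplus>\<^bsub>N\<^esub> y) = sym_inc A N x \<oplus>\<^bsub>sym_alg A N\<^esub> sym_inc A N y"
      unfolding sym_inc_def sym_alg_def quot_add[OF mQ sI v[OF x] v[OF y]]
      by (rule eq[OF v[OF N.a_closed[OF x y]] Q.a_closed[OF v[OF x] v[OF y]] g]) (use x y in blast)
  qed
qed

text \<open>Both homomorphisms are pulled back to the polynomial ring on the elements of N, where
  agreement on the variables suffices.\<close>

lemma sym_hom_ext:
  assumes "module A D" and f: "f \<in> alg_hom A (sym_alg A N) D" and g: "g \<in> alg_hom A (sym_alg A N) D"
    and eq: "\<And>x. x \<in> carrier N \<Longrightarrow> f (sym_inc A N x) = g (sym_inc A N x)"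
    and z: "z \<in> carrier (sym_alg A N)"
  shows "f z = g z"
proof -
  have p: "(+>\<^bsub>Q\<^esub>) (sym_ideal A N) \<in> alg_hom A Q (sym_alg A N)"
    unfolding sym_alg_def by (rule quot_proj_alg_hom[OF algebra_mpoly[OF N_cring] sym_ideal_ideal])
  obtain q where q: "q \<in> carrier Q" "z = sym_ideal A N +>\<^bsub>Q\<^esub> q"
    using z unfolding sym_alg_def quot_carrier by blast
  show ?thesis
    unfolding q(2)
    by (rule mpoly_hom_ext[OF assms(1) alg_hom_comp[OF p f] alg_hom_comp[OF p g] _ q(1)])
      (rule eq[unfolded sym_inc_def])
qed

text \<open>Since D is commutative, evaluating the variables at f is a homomorphism. It kills the
  linear relations because f is linear, hence also the ideal they generate, and so factors through
  the quotient.\<close>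

lemma sym_lift:
  assumes "algebra A D" and f: "f \<in> lin A N D"
  shows "\<exists>h \<in> alg_hom A (sym_alg A N) D. \<forall>x\<in>carrier N. h (sym_inc A N x) = f x"
proof -
  interpret N: module A N by (rule modN)
  interpret D': cring D by (rule algebra_cring[OF assms(1)])
  note mD = algebra_module[OF assms(1)]
  note aQ = algebra_mpoly[OF N_cring, of "carrier N"]
  note mQ = algebra_module[OF aQ]
  interpret Q: module A Q by (rule mQ)
  interpret Q': cring Q by (rule algebra_cring[OF aQ])
  note v = indexed_var_closed[OF N_cring] and fc = lin_closed[OF f]
  have arr: "mset (some_arr m) = m" for m :: "'n multiset"
    unfolding some_arr_def by (rule someI_ex) (rule ex_mset)
  let ?e = "poly_eval A D some_arr f"
  have cm: "f s \<otimes>\<^bsub>D\<^esub> f t = f t \<otimes>\<^bsub>D\<^esub> f s" if "s \<in> carrier N" "t \<in> carrier N" for s t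
    by (rule D'.m_comm[OF fc[OF that(1)] fc[OF that(2)]])
  note e = poly_eval_alg_hom[where x = f and V = "carrier N" and arr = some_arr, OF algebra_galg[OF assms(1)] fc cm arr]
  note el = alg_hom_lin[OF e(1)]
  have 0: "?e z = \<zero>\<^bsub>D\<^esub>" if "z \<in> sym_ideal A N" for z
  proof -
    have "ideal {q \<in> carrier Q. ?e q = \<zero>\<^bsub>D\<^esub>} Q"
      by (rule kernel_ideal[OF aQ algebra_nalg[OF assms(1)] e(1)])
    moreover have "({Xv (x \<oplus>\<^bsub>N\<^esub> y) \<ominus>\<^bsub>Q\<^esub> (Xv x \<oplus>\<^bsub>Q\<^esub> Xv y) | x y. x \<in> carrier N \<and> y \<in> carrier N} \<union>
      {Xv (a \<odot>\<^bsub>N\<^esub> x) \<ominus>\<^bsub>Q\<^esub> a \<odot>\<^bsub>Q\<^esub> Xv x | a x. a \<in> carrier A \<and> x \<in> carrier N}) \<subseteq> {q \<in> carrier Q. ?e q = \<zero>\<^bsub>D\<^esub>}" (is "?G \<subseteq> _")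
    proof
      fix q assume q: "q \<in> ?G"
      then have qc: "q \<in> carrier Q" using sym_gens_carrier by blast
      from q have "?e q = \<zero>\<^bsub>D\<^esub>"
      proof
        assume "q \<in> {Xv (x \<oplus>\<^bsub>N\<^esub> y) \<ominus>\<^bsub>Q\<^esub> (Xv x \<oplus>\<^bsub>Q\<^esub> Xv y) | x y. x \<in> carrier N \<and> y \<in> carrier N}"
        then obtain x y where xy: "q = Xv (x \<oplus>\<^bsub>N\<^esub> y) \<ominus>\<^bsub>Q\<^esub> (Xv x \<oplus>\<^bsub>Q\<^esub> Xv y)" "x \<in> carrier N" "y \<in> carrier N" by blast
        have "?e q = f (x \<oplus>\<^bsub>N\<^esub> y) \<ominus>\<^bsub>D\<^esub> (f x \<oplus>\<^bsub>D\<^esub> f y)"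
          unfolding xy(1) by (simp only: lin_minus[OF mQ mD el] lin_add[OF el] Q.a_closed v N.a_closed xy(2,3) e(2))
        then show ?thesis
          using module_minus_zero_iff[OF mD D'.a_closed D'.a_closed, of "f x" "f y" "f x" "f y"] fc[OF xy(2)] fc[OF xy(3)]
          by (simp only: lin_add[OF f xy(2,3)])
      next
        assume "q \<in> {Xv (a \<odot>\<^bsub>N\<^esub> x) \<ominus>\<^bsub>Q\<^esub> a \<odot>\<^bsub>Q\<^esub> Xv x | a x. a \<in> carrier A \<and> x \<in> carrier N}"
        then obtain a x where xy: "q = Xv (a \<odot>\<^bsub>N\<^esub> x) \<ominus>\<^bsub>Q\<^esub> a \<odot>\<^bsub>Q\<^esub> Xv x" "a \<in> carrier A" "x \<in> carrier N" by blast
        have "?e q = f (a \<odot>\<^bsub>N\<^esub> x) \<ominus>\<^bsub>D\<^esub> a \<odot>\<^bsub>D\<^esub> f x"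
          unfolding xy(1) by (simp only: lin_minus[OF mQ mD el] lin_smult[OF el] Q.smult_closed v N.smult_closed xy(2,3) e(2))
        moreover have "f (a \<odot>\<^bsub>N\<^esub> x) \<in> carrier D" by (rule fc[OF N.smult_closed[OF xy(2,3)]])
        ultimately show ?thesis
          using module_minus_zero_iff[OF mD] by (simp only: lin_smult[OF f xy(2,3)])
      qed
      with qc show "q \<in> {q \<in> carrier Q. ?e q = \<zero>\<^bsub>D\<^esub>}" by blast
    qed
    ultimately have "sym_ideal A N \<subseteq> {q \<in> carrier Q. ?e q = \<zero>\<^bsub>D\<^esub>}"
      unfolding sym_ideal_def Let_def by (rule Q'.genideal_minimal)
    then show ?thesis using that by blast
  qed
  obtain h where "h \<in> alg_hom A (quot Q (sym_ideal A N)) D" "\<And>q. q \<in> carrier Q \<Longrightarrow> h (sym_ideal A N +>\<^bsub>Q\<^esub> q) = ?e q"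
    using quot_factor[OF aQ sym_ideal_ideal mD e(1) 0] by blast
  then show ?thesis
    unfolding sym_alg_def[symmetric] sym_inc_def using e(2) v by metis
qed

text \<open>A basis that may be infinite, given with the inverse L of its linear extension. In
  contrast to \<open>fin_basis\<close> the coordinates are collected in a single map into
  \<open>free_mod\<close>, whose elements have finite support.\<close>

definition free_basis :: "'v set \<Rightarrow> ('v \<Rightarrow> 'n) \<Rightarrow> ('n \<Rightarrow> 'v \<Rightarrow> 'a) \<Rightarrow> bool" where
  "free_basis V e L \<longleftrightarrow> (\<forall>v\<in>V. e v \<in> carrier N) \<and> L \<in> lin A N (free_mod A V) \<and>
     (\<forall>v\<in>V. L (e v) = unit_vec A v) \<and> (\<forall>x\<in>carrier N. lsum A N e (L x) = x)"

text \<open>The two universal properties give maps in both directions: substitution of e_v for the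
  variable v, and the homomorphism on Sym that sends x to the linear form with coefficients L x.
  Each composite is the identity on generators.\<close>

theorem sym_alg_free_iso:
  assumes "free_basis V e L"
  shows "poly_eval A (sym_alg A N) some_arr (\<lambda>v. sym_inc A N (e v)) \<in> alg_iso A (mpoly A V) (sym_alg A N)"
    and "\<And>v. v \<in> V \<Longrightarrow> poly_eval A (sym_alg A N) some_arr (\<lambda>v. sym_inc A N (e v)) (ring.indexed_var A v) = sym_inc A N (e v)"
proof -
  have e: "e v \<in> carrier N" if "v \<in> V" for v using assms that unfolding free_basis_def by blast
  have L: "L \<in> lin A N (free_mod A V)" using assms unfolding free_basis_def by blast
  have Le: "L (e v) = unit_vec A v" if "v \<in> V" for v using assms that unfolding free_basis_def by blast
  have ex: "lsum A N e (L x) = x" if "x \<in> carrier N" for x using assms that unfolding free_basis_def by blast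
  let ?S = "sym_alg A N" and ?P = "mpoly A V"
  note aS = algebra_sym_alg and aP = algebra_mpoly[OF N_cring, of V]
  note mS = algebra_module[OF aS] and mP = algebra_module[OF aP]
  interpret S': cring ?S by (rule algebra_cring[OF aS])
  note ic = lin_closed[OF sym_inc_lin]
  have arr: "mset (some_arr m) = m" for m :: "'v multiset"
    unfolding some_arr_def by (rule someI_ex) (rule ex_mset)
  let ?f = "poly_eval A ?S some_arr (\<lambda>v. sym_inc A N (e v))"
  have cm: "sym_inc A N (e s) \<otimes>\<^bsub>?S\<^esub> sym_inc A N (e t) = sym_inc A N (e t) \<otimes>\<^bsub>?S\<^esub> sym_inc A N (e s)"
    if "s \<in> V" "t \<in> V" for s t
    by (rule S'.m_comm[OF ic[OF e[OF that(1)]] ic[OF e[OF that(2)]]])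
  have ice: "sym_inc A N (e v) \<in> carrier ?S" if "v \<in> V" for v by (rule ic[OF e[OF that]])
  note pe = poly_eval_alg_hom[where x = "\<lambda>v. sym_inc A N (e v)" and V = V and arr = some_arr, OF algebra_galg[OF aS]]
  have f1: "?f \<in> alg_hom A ?P ?S" by (rule pe(1)) (rule ice cm arr; assumption)+
  have f2: "?f (ring.indexed_var A v) = sym_inc A N (e v)" if "v \<in> V" for v
    by (rule pe(2)) (rule ice cm arr that; assumption)+
  note f = f1 f2
  show "?f (ring.indexed_var A v) = sym_inc A N (e v)" if "v \<in> V" for v by (rule f(2)[OF that])
  have vl: "lsum A ?P (ring.indexed_var A) \<in> lin A (free_mod A V) ?P"
    by (rule lsum_lin[OF mP indexed_var_closed[OF N_cring]])
  obtain g where g: "g \<in> alg_hom A ?S ?P" "\<And>x. x \<in> carrier N \<Longrightarrow> g (sym_inc A N x) = lsum A ?P (ring.indexed_var A) (L x)"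
    using sym_lift[OF aP lin_comp[OF L vl]] by blast
  have gf: "g (?f p) = p" if p: "p \<in> carrier ?P" for p
  proof (rule mpoly_hom_ext[OF mP alg_hom_comp[OF f(1) g(1)] _ _ p])
    show "(\<lambda>p. p) \<in> alg_hom A ?P ?P" by (rule alg_homI[OF lin_id]) simp_all
    show "g (?f (ring.indexed_var A v)) = ring.indexed_var A v" if v: "v \<in> V" for v
      unfolding f(2)[OF v] g(2)[OF e[OF v]] Le[OF v]
      by (rule lsum_unit[where b = "ring.indexed_var A", OF mP indexed_var_closed[OF N_cring v]])
  qed
  have fg: "?f (g z) = z" if z: "z \<in> carrier ?S" for z
  proof (rule sym_hom_ext[OF mS alg_hom_comp[OF g(1) f(1)] _ _ z])
    show "(\<lambda>z. z) \<in> alg_hom A ?S ?S" by (rule alg_homI[OF lin_id]) simp_all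
    fix x assume x: "x \<in> carrier N"
    have "?f (lsum A ?P (ring.indexed_var A) r) = sym_inc A N (lsum A N e r)" if r: "r \<in> carrier (free_mod A V)" for r
    proof (rule free_ext[OF mS, where f = "\<lambda>r. ?f (lsum A ?P (ring.indexed_var A) r)" and g = "\<lambda>r. sym_inc A N (lsum A N e r)", OF _ _ _ r])
      show "(\<lambda>r. ?f (lsum A ?P (ring.indexed_var A) r)) \<in> lin A (free_mod A V) ?S"
        by (rule lin_comp[OF vl alg_hom_lin[OF f(1)]])
      show "(\<lambda>r. sym_inc A N (lsum A N e r)) \<in> lin A (free_mod A V) ?S"
        by (rule lin_comp[OF lsum_lin[OF modN e] sym_inc_lin])
      fix v assume v: "v \<in> V"
      show "?f (lsum A ?P (ring.indexed_var A) (unit_vec A v)) = sym_inc A N (lsum A N e (unit_vec A v))"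
        unfolding lsum_unit[where b = "ring.indexed_var A", OF mP indexed_var_closed[OF N_cring v]]
          lsum_unit[where b = e, OF modN e[OF v]] by (rule f(2)[OF v])
    qed
    from this[OF lin_closed[OF L x]] show "?f (g (sym_inc A N x)) = sym_inc A N x"
      unfolding g(2)[OF x] ex[OF x] .
  qed
  have "bij_betw ?f (carrier ?P) (carrier ?S)"
    by (rule bij_betw_byWitness[where f' = g])
      (use gf fg lin_closed[OF alg_hom_lin[OF f(1)]] lin_closed[OF alg_hom_lin[OF g(1)]] in blast)+
  then show "?f \<in> alg_iso A ?P ?S" unfolding alg_iso_def using f(1) by blast
qed

end

section \<open>Tensor products of free modules and base change of algebras\<close>

text \<open>Homomorphisms are constrained on carriers only, so a map may be replaced by its
  restriction to the carrier, as the descriptions with extensional maps demand.\<close>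

lemma alg_hom_cong:
  assumes "f \<in> alg_hom A B C" "nalg A B" "\<And>x. x \<in> carrier B \<Longrightarrow> g x = f x"
  shows "g \<in> alg_hom A B C"
proof (rule alg_homI)
  note mB = nalg_module[OF assms(2)]
  show "g \<in> lin A B C" by (rule lin_cong[OF alg_hom_lin[OF assms(1)] mB assms(3)])
  fix x y assume xy: "x \<in> carrier B" "y \<in> carrier B"
  show "g (x \<otimes>\<^bsub>B\<^esub> y) = g x \<otimes>\<^bsub>C\<^esub> g y"
    unfolding assms(3)[OF bilin_closed[OF nalg_bilin[OF assms(2)] xy]] assms(3)[OF xy(1)] assms(3)[OF xy(2)]
    by (rule alg_hom_mult[OF assms(1) xy])
next
  show "g \<one>\<^bsub>B\<^esub> = \<one>\<^bsub>C\<^esub>" unfolding assms(3)[OF nalg_one[OF assms(2)]] by (rule alg_hom_one[OF assms(1)])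
qed

lemma bilin_cong:
  assumes "bilin A N P Q b" "module A N" "module A P"
    "\<And>x y. x \<in> carrier N \<Longrightarrow> y \<in> carrier P \<Longrightarrow> b' x y = b x y"
  shows "bilin A N P Q b'"
  unfolding bilin_def
proof (intro conjI ballI)
  show "b' x \<in> lin A P Q" if "x \<in> carrier N" for x
    by (rule lin_cong[OF bilinD1[OF assms(1) that] assms(3) assms(4)[OF that]])
  show "(\<lambda>x. b' x y) \<in> lin A N Q" if "y \<in> carrier P" for y
    by (rule lin_cong[OF bilinD2[OF assms(1) that] assms(2) assms(4)[OF _ that]])
qed

lemma alg_iso_inv:
  assumes "nalg A B" "nalg A C" "f \<in> alg_iso A B C"
  shows "\<exists>g \<in> alg_hom A C B. (\<forall>b\<in>carrier B. g (f b) = b) \<and> (\<forall>c\<in>carrier C. f (g c) = c)"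
proof -
  interpret B: module A B by (rule nalg_module[OF assms(1)])
  have f: "f \<in> alg_hom A B C" and bij: "bij_betw f (carrier B) (carrier C)"
    using assms(3) unfolding alg_iso_def by simp_all
  note fl = alg_hom_lin[OF f]
  define g where "g = inv_into (carrier B) f"
  have gf: "g (f b) = b" if "b \<in> carrier B" for b unfolding g_def by (rule bij_betw_inv_into_left[OF bij that])
  have fg: "f (g c) = c" if "c \<in> carrier C" for c unfolding g_def by (rule bij_betw_inv_into_right[OF bij that])
  have gc: "g c \<in> carrier B" if "c \<in> carrier C" for c
    using bij_betwE[OF bij_betw_inv_into[OF bij]] that unfolding g_def by (simp only: Ball_def)
  have "g \<in> alg_hom A C B"
  proof (rule alg_homI)
    show "g \<in> lin A C B"
    proof (rule linI[OF gc])
      fix x y assume xy: "x \<in> carrier C" "y \<in> carrier C"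
      have "g (x \<oplus>\<^bsub>C\<^esub> y) = g (f (g x \<oplus>\<^bsub>B\<^esub> g y))"
        by (simp only: lin_add[OF fl gc[OF xy(1)] gc[OF xy(2)]] fg xy)
      also have "\<dots> = g x \<oplus>\<^bsub>B\<^esub> g y" by (rule gf[OF B.a_closed[OF gc[OF xy(1)] gc[OF xy(2)]]])
      finally show "g (x \<oplus>\<^bsub>C\<^esub> y) = g x \<oplus>\<^bsub>B\<^esub> g y" .
    next
      fix a x assume a: "a \<in> carrier A" and x: "x \<in> carrier C"
      have "g (a \<odot>\<^bsub>C\<^esub> x) = g (f (a \<odot>\<^bsub>B\<^esub> g x))"
        by (simp only: lin_smult[OF fl a gc[OF x]] fg x)
      also have "\<dots> = a \<odot>\<^bsub>B\<^esub> g x" by (rule gf[OF B.smult_closed[OF a gc[OF x]]])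
      finally show "g (a \<odot>\<^bsub>C\<^esub> x) = a \<odot>\<^bsub>B\<^esub> g x" .
    qed
    fix x y assume xy: "x \<in> carrier C" "y \<in> carrier C"
    have "g (x \<otimes>\<^bsub>C\<^esub> y) = g (f (g x \<otimes>\<^bsub>B\<^esub> g y))"
      by (simp only: alg_hom_mult[OF f gc[OF xy(1)] gc[OF xy(2)]] fg xy)
    also have "\<dots> = g x \<otimes>\<^bsub>B\<^esub> g y" by (rule gf[OF bilin_closed[OF nalg_bilin[OF assms(1)] gc[OF xy(1)] gc[OF xy(2)]]])
    finally show "g (x \<otimes>\<^bsub>C\<^esub> y) = g x \<otimes>\<^bsub>B\<^esub> g y" .
  next
    show "g \<one>\<^bsub>C\<^esub> = \<one>\<^bsub>B\<^esub>" using gf[OF nalg_one[OF assms(1)]] unfolding alg_hom_one[OF f] .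
  qed
  with gf fg show ?thesis by blast
qed

lemma self_smult_bilin:
  assumes "module A Q"
  shows "bilin A (self_mod A) Q Q (smult Q)"
proof -
  interpret Q: module A Q by fact
  show ?thesis
    unfolding bilin_def
  proof (intro conjI ballI)
    show "(\<lambda>a. a \<odot>\<^bsub>Q\<^esub> x) \<in> lin A (self_mod A) Q" if "x \<in> carrier Q" for x by (rule smult_lin[OF assms that])
    show "(\<odot>\<^bsub>Q\<^esub>) a \<in> lin A Q Q" if "a \<in> carrier (self_mod A)" for a
      using lin_smult_fun[OF assms lin_id] that by simp
  qed
qed

text \<open>The coordinate map is the lift of (x, y) \<mapsto> \<Sum>_v d_v(y)
  \<open>pl v x\<close>, where \<open>pl v\<close> copies the coordinates of x into the summand
  indexed by v. This sum runs over the finite set V, while S may be infinite.\<close>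

lemma free_basis_tensor:
  fixes A :: "('a, 'm) ring_scheme" and D :: "('a, 'd) module" and S :: "'s set"
  assumes "module A D" and fb: "fin_basis A D V e d"
  shows "\<exists>L. free_basis A (tensor A (free_mod A S) D) (S \<times> V)
    (\<lambda>(s, v). tens A (free_mod A S) D (unit_vec A s) (e v)) L"
proof -
  note crA = module_cring[OF assms(1)]
  let ?M = "free_mod A S" and ?W = "free_mod A (S \<times> V)"
  let ?N = "tensor A ?M D" and ?t = "tens A ?M D"
  let ?e = "\<lambda>(s, v). ?t (unit_vec A s) (e v)"
  note mM = module_free_mod[OF crA, of S] and mW = module_free_mod[OF crA, of "S \<times> V"]
  note mN = module_tensor[OF mM assms(1)] and tb = tens_bilin[OF mM assms(1)]
  interpret N: module A ?N by (rule mN)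
  interpret W: module A ?W by (rule mW)
  interpret D: module A D by (rule assms(1))
  note F = fin_basisD[OF fb] and dc = fin_basis_coord_closed[OF fb]
  define pl where "pl v = lsum A ?W (\<lambda>s. unit_vec A (s, v))" for v
  have uW: "unit_vec A (s, v) \<in> carrier ?W" if "s \<in> S" "v \<in> V" for s v
    by (rule unit_vec_closed[OF crA]) (use that in simp)
  have pl: "pl v \<in> lin A ?M ?W" if "v \<in> V" for v
    unfolding pl_def by (rule lsum_lin[OF mW uW[OF _ that]])
  have plu: "pl v (unit_vec A s) = unit_vec A (s, v)" if "s \<in> S" "v \<in> V" for s v
    unfolding pl_def by (rule lsum_unit[where b = "\<lambda>s. unit_vec A (s, v)", OF mW uW[OF that]])
  define b where "b x y = finsum ?W (\<lambda>v. d v y \<odot>\<^bsub>?W\<^esub> pl v x) V" for x y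
  have bb: "bilin A ?M D ?W b"
    unfolding b_def
  proof (rule bilin_finsum[OF mW mM assms(1)])
    fix v assume v: "v \<in> V"
    have "bilin A D ?M ?W (\<lambda>y x. d v y \<odot>\<^bsub>?W\<^esub> pl v x)"
      by (rule bilin_comp[OF self_smult_bilin[OF mW] F(3)[OF v] pl[OF v]])
    then show "bilin A ?M D ?W (\<lambda>x y. d v y \<odot>\<^bsub>?W\<^esub> pl v x)" unfolding bilin_def by blast
  qed
  let ?L = "tensor_lift A ?W b"
  note L = tensor_lift[OF mM assms(1) mW bb]
  have e: "?e w \<in> carrier ?N" if w: "w \<in> S \<times> V" for w
  proof -
    obtain s v where sv: "w = (s, v)" "s \<in> S" "v \<in> V" using w by (rule SigmaE)
    show ?thesis unfolding sv(1) case_prod_conv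
      by (rule tens_closed[OF mM assms(1) unit_vec_closed[OF crA sv(2)] F(2)[OF sv(3)]])
  qed
  have Le: "?L (?e w) = unit_vec A w" if w: "w \<in> S \<times> V" for w
  proof -
    obtain s v where sv: "w = (s, v)" "s \<in> S" "v \<in> V" using w by (rule SigmaE)
    have "?L (?e w) = finsum ?W (\<lambda>u. d u (e v) \<odot>\<^bsub>?W\<^esub> pl u (unit_vec A s)) V"
      unfolding sv(1) case_prod_conv L(2)[OF unit_vec_closed[OF crA sv(2)] F(2)[OF sv(3)]] b_def ..
    also have "\<dots> = finsum ?W (\<lambda>u. if v = u then unit_vec A (s, v) else \<zero>\<^bsub>?W\<^esub>) V"
    proof (rule W.finsum_cong'[OF refl])
      show "(\<lambda>u. if v = u then unit_vec A (s, v) else \<zero>\<^bsub>?W\<^esub>) \<in> V \<rightarrow> carrier ?W"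
        using uW[OF sv(2,3)] W.zero_closed by (intro Pi_I) (simp only: if_split_mem2 if_cancel simp_thms split: if_split)
      fix u assume u: "u \<in> V"
      show "d u (e v) \<odot>\<^bsub>?W\<^esub> pl u (unit_vec A s) = (if v = u then unit_vec A (s, v) else \<zero>\<^bsub>?W\<^esub>)"
      proof (cases "v = u")
        case True
        show ?thesis
          unfolding True[symmetric] plu[OF sv(2,3)] F(4)[OF sv(3) sv(3)] if_P[OF refl] by (rule W.smult_one[OF uW[OF sv(2,3)]])
      next
        case False
        show ?thesis
          unfolding plu[OF sv(2) u] F(4)[OF u sv(3)] if_not_P[OF False] if_not_P[OF not_sym[OF False]]
          by (rule W.smult_l_null[OF uW[OF sv(2) u]])
      qed
    qed
    also have "\<dots> = unit_vec A (s, v)"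
      by (rule W.finsum_singleton[OF sv(3) F(1)]) (rule Pi_I, rule uW[OF sv(2,3)])
    finally show ?thesis unfolding sv(1) .
  qed
  have le: "lsum A ?N ?e \<in> lin A ?W ?N" by (rule lsum_lin[OF mN e])
  \<comment> \<open>Expanding coordinates placed in the summand v gives back x \<otimes> e_v; the
    identity is linear in x and visible on basis vectors.\<close>
  have lp: "lsum A ?N ?e (pl v x) = ?t x (e v)" if v: "v \<in> V" and x: "x \<in> carrier ?M" for v x
  proof (rule free_ext[OF mN, where f = "\<lambda>x. lsum A ?N ?e (pl v x)" and g = "\<lambda>x. ?t x (e v)", OF _ _ _ x])
    show "(\<lambda>x. lsum A ?N ?e (pl v x)) \<in> lin A ?M ?N" by (rule lin_comp[OF pl[OF v] le])
    show "(\<lambda>x. ?t x (e v)) \<in> lin A ?M ?N" by (rule bilinD2[OF tb F(2)[OF v]])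
    fix s assume s: "s \<in> S"
    show "lsum A ?N ?e (pl v (unit_vec A s)) = ?t (unit_vec A s) (e v)"
      unfolding plu[OF s v] lsum_unit[where b = ?e, OF mN e[OF SigmaI[OF s v]]] case_prod_conv ..
  qed
  have "lsum A ?N ?e (?L z) = z" if z: "z \<in> carrier ?N" for z
  proof (rule tensor_ext[OF mM assms(1) lin_comp[OF L(1) le] lin_id _ z])
    fix x y assume x: "x \<in> carrier ?M" and y: "y \<in> carrier D"
    have plx: "pl v x \<in> carrier ?W" if "v \<in> V" for v by (rule lin_closed[OF pl[OF that] x])
    have "lsum A ?N ?e (?L (?t x y)) = finsum ?N (\<lambda>v. lsum A ?N ?e (d v y \<odot>\<^bsub>?W\<^esub> pl v x)) V"
      unfolding L(2)[OF x y] b_def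
      by (rule lin_finsum[OF mW mN le]) (rule W.smult_closed[OF dc[OF _ y] plx]; assumption)
    also have "\<dots> = finsum ?N (\<lambda>v. ?t x (d v y \<odot>\<^bsub>D\<^esub> e v)) V"
    proof (rule N.finsum_cong'[OF refl])
      show "(\<lambda>v. ?t x (d v y \<odot>\<^bsub>D\<^esub> e v)) \<in> V \<rightarrow> carrier ?N"
        by (intro Pi_I tens_closed[OF mM assms(1) x] D.smult_closed dc[OF _ y] F(2))
      fix v assume v: "v \<in> V"
      show "lsum A ?N ?e (d v y \<odot>\<^bsub>?W\<^esub> pl v x) = ?t x (d v y \<odot>\<^bsub>D\<^esub> e v)"
        unfolding lin_smult[OF le dc[OF v y] plx[OF v]] lp[OF v x]
        by (rule lin_smult[OF bilinD1[OF tb x] dc[OF v y] F(2)[OF v], symmetric])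
    qed
    also have "\<dots> = ?t x (finsum D (\<lambda>v. d v y \<odot>\<^bsub>D\<^esub> e v) V)"
      by (rule lin_finsum[OF assms(1) mN bilinD1[OF tb x], symmetric]) (rule D.smult_closed[OF dc[OF _ y] F(2)]; assumption)
    also have "finsum D (\<lambda>v. d v y \<odot>\<^bsub>D\<^esub> e v) V = y" by (rule F(5)[OF y, symmetric])
    finally show "lsum A ?N ?e (?L (?t x y)) = ?t x y" .
  qed
  then have "free_basis A ?N (S \<times> V) ?e ?L"
    unfolding free_basis_def[OF mN] using e L(1) Le by blast
  then show ?thesis by blast
qed

lemma free_basis_free_mod:
  assumes "cring A"
  shows "free_basis A (free_mod A S) S (unit_vec A) (\<lambda>x. x)"
  unfolding free_basis_def[OF module_free_mod[OF assms]]
  by (intro conjI ballI unit_vec_closed[OF assms] lin_id refl free_expand[OF assms])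

section \<open>Extension of scalars of algebra homomorphisms\<close>

lemma base_change_incl_alg_hom:
  assumes "algebra A C" "nalg A P"
  shows "tens A C P \<one>\<^bsub>C\<^esub> \<in> alg_hom A P (restr A C (base_change A C P))"
proof -
  interpret C': cring C by (rule algebra_cring[OF assms(1)])
  note mP = nalg_module[OF assms(2)] and mC = algebra_module[OF assms(1)]
  show ?thesis
  proof (rule alg_homI)
    show "tens A C P \<one>\<^bsub>C\<^esub> \<in> lin A P (restr A C (base_change A C P))"
      unfolding restr_base_change[OF assms(1) mP] by (rule bilinD1[OF tens_bilin[OF mC mP] C'.one_closed])
    fix x y assume xy: "x \<in> carrier P" "y \<in> carrier P"
    show "tens A C P \<one>\<^bsub>C\<^esub> (x \<otimes>\<^bsub>P\<^esub> y) = tens A C P \<one>\<^bsub>C\<^esub> x \<otimes>\<^bsub>restr A C (base_change A C P)\<^esub> tens A C P \<one>\<^bsub>C\<^esub> y"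
      unfolding restr_simps base_change_mult_tens[OF assms C'.one_closed xy(1) C'.one_closed xy(2)]
      by (simp only: C'.l_one[OF C'.one_closed])
  qed (simp only: restr_simps base_change_simps)
qed

lemma alg_hom_restr:
  assumes "algebra A C" "module C N" "f \<in> alg_hom C N Q"
  shows "f \<in> alg_hom A (restr A C N) (restr A C Q)"
  by (rule alg_homI[OF lin_restr[OF assms(1,2) alg_hom_lin[OF assms(3)]]])
    (simp_all only: restr_simps alg_hom_mult[OF assms(3)] alg_hom_one[OF assms(3)])

text \<open>The C-linear extension of \<psi> is multiplicative because both sides of the product
  rule are C-bilinear and agree on 1 \<otimes> x and 1 \<otimes> y. An extensional version is
  produced because \<open>mu_H\<close> and \<open>mu_HR\<close> are described as unique among
  extensional functions.\<close>

lemma base_change_alg_lift: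
  assumes "algebra A C" "nalg A P" "nalg C Q" and psi: "\<psi> \<in> alg_hom A P (restr A C Q)"
  shows "\<exists>g. g \<in> extensional (carrier (base_change A C P)) \<and> g \<in> alg_hom C (base_change A C P) Q \<and>
    (\<forall>c\<in>carrier C. \<forall>p\<in>carrier P. g (tens A C P c p) = c \<odot>\<^bsub>Q\<^esub> \<psi> p)"
proof -
  interpret C': cring C by (rule algebra_cring[OF assms(1)])
  interpret Q: module C Q by (rule nalg_module[OF assms(3)])
  note mP = nalg_module[OF assms(2)] and mC = algebra_module[OF assms(1)] and mQ = nalg_module[OF assms(3)]
  let ?B = "base_change A C P"
  note nB = nalg_base_change[OF assms(1,2)] and bQ = nalg_bilin[OF assms(3)]
  let ?g = "tensor_lift A (restr A C Q) (\<lambda>c x. c \<odot>\<^bsub>Q\<^esub> \<psi> x)"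
  note g = base_change_lift[OF assms(1) mP mQ alg_hom_lin[OF psi]]
  have pc: "\<psi> p \<in> carrier Q" if "p \<in> carrier P" for p using lin_closed[OF alg_hom_lin[OF psi] that] by (simp only: restr_simps)
  have g1: "?g (tens A C P \<one>\<^bsub>C\<^esub> p) = \<psi> p" if "p \<in> carrier P" for p
    unfolding g(2)[OF C'.one_closed that] by (rule Q.smult_one[OF pc[OF that]])
  have "?g \<in> alg_hom C ?B Q"
  proof (rule alg_homI[OF g(1)])
    fix u v assume uv: "u \<in> carrier ?B" "v \<in> carrier ?B"
    show "?g (u \<otimes>\<^bsub>?B\<^esub> v) = ?g u \<otimes>\<^bsub>Q\<^esub> ?g v"
    proof (rule base_change_bilin_ext[OF assms(1) mP mP, where b = "\<lambda>u v. ?g (u \<otimes>\<^bsub>?B\<^esub> v)" and b' = "\<lambda>u v. ?g u \<otimes>\<^bsub>Q\<^esub> ?g v",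
          OF bilin_post[OF nalg_bilin[OF nB] g(1)] bilin_comp[OF bQ g(1) g(1)] _ uv])
      fix x y assume xy: "x \<in> carrier P" "y \<in> carrier P"
      have xyP: "x \<otimes>\<^bsub>P\<^esub> y \<in> carrier P" by (rule bilin_closed[OF nalg_bilin[OF assms(2)] xy])
      have m: "tens A C P \<one>\<^bsub>C\<^esub> x \<otimes>\<^bsub>?B\<^esub> tens A C P \<one>\<^bsub>C\<^esub> y = tens A C P \<one>\<^bsub>C\<^esub> (x \<otimes>\<^bsub>P\<^esub> y)"
        by (simp only: base_change_mult_tens[OF assms(1,2) C'.one_closed xy(1) C'.one_closed xy(2)] C'.l_one[OF C'.one_closed])
      show "?g (tens A C P \<one>\<^bsub>C\<^esub> x \<otimes>\<^bsub>?B\<^esub> tens A C P \<one>\<^bsub>C\<^esub> y) = ?g (tens A C P \<one>\<^bsub>C\<^esub> x) \<otimes>\<^bsub>Q\<^esub> ?g (tens A C P \<one>\<^bsub>C\<^esub> y)"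
        unfolding m g1[OF xyP] g1[OF xy(1)] g1[OF xy(2)] using alg_hom_mult[OF psi xy] by (simp only: restr_simps)
    qed
  next
    show "?g \<one>\<^bsub>?B\<^esub> = \<one>\<^bsub>Q\<^esub>"
      unfolding base_change_simps g1[OF nalg_one[OF assms(2)]] using alg_hom_one[OF psi] by (simp only: restr_simps)
  qed
  then have "restrict ?g (carrier ?B) \<in> alg_hom C ?B Q"
    by (rule alg_hom_cong[OF _ nB]) (simp only: restrict_apply if_True)
  moreover have "restrict ?g (carrier ?B) (tens A C P c p) = c \<odot>\<^bsub>Q\<^esub> \<psi> p" if "c \<in> carrier C" "p \<in> carrier P" for c p
    using g(2)[OF that] tens_closed[OF mC mP that] by (simp only: base_change_simps restrict_apply if_True)
  ultimately show ?thesis by blast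
qed

text \<open>\<open>mat_tens\<close> reads only the entries with indices in range, so an unrestricted
  function may stand for a matrix, as it does in the final statement.\<close>

lemma mat_tens_restrict:
  assumes "algebra A C" "\<And>v. v \<in> {1..n} \<times> {1..n} \<Longrightarrow> p v \<in> carrier C"
  shows "mat_tens A n C (\<lambda>v\<in>{1..n} \<times> {1..n}. p v) = mat_tens A n C p"
proof -
  note mC = algebra_module[OF assms(1)]
  note crA = module_cring[OF mC]
  let ?B = "base_change A C (EndF A n)" and ?V = "{1..n} \<times> {1..n}"
  interpret B: module C ?B by (rule module_base_change[OF assms(1) module_EndF[OF crA]])
  show ?thesis
    unfolding mat_tens_def
  proof (rule B.finsum_cong'[OF refl])
    show "(\<lambda>(i, j). tens A C (EndF A n) (p (i, j)) (T_end A n i j)) \<in> ?V \<rightarrow> carrier ?B"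
    proof (rule Pi_I)
      fix v assume v: "v \<in> ?V"
      obtain i j where ij: "v = (i, j)" "i \<in> {1..n}" "j \<in> {1..n}" using v by (rule SigmaE)
      show "(\<lambda>(i, j). tens A C (EndF A n) (p (i, j)) (T_end A n i j)) v \<in> carrier ?B"
        unfolding ij(1) case_prod_conv base_change_simps
        by (rule tens_closed[OF mC module_EndF[OF crA] assms(2)[OF SigmaI[OF ij(2,3)]] T_end_closed[OF crA ij(2)]])
    qed
    fix v assume v: "v \<in> ?V"
    obtain i j where ij: "v = (i, j)" "i \<in> {1..n}" "j \<in> {1..n}" using v by (rule SigmaE)
    show "(\<lambda>(i, j). tens A C (EndF A n) ((\<lambda>v\<in>?V. p v) (i, j)) (T_end A n i j)) v =
        (\<lambda>(i, j). tens A C (EndF A n) (p (i, j)) (T_end A n i j)) v"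
      unfolding ij(1) case_prod_conv restrict_apply'[OF SigmaI[OF ij(2,3)]] ..
  qed
qed

lemma mat_tens_smult:
  assumes "algebra A C" "c \<in> carrier C" "p \<in> carrier (mat_alg n C)"
  shows "c \<odot>\<^bsub>base_change A C (EndF A n)\<^esub> mat_tens A n C p = mat_tens A n C (\<lambda>v\<in>{1..n} \<times> {1..n}. c \<otimes>\<^bsub>C\<^esub> p v)"
proof -
  let ?B = "base_change A C (EndF A n)"
  note crA = module_cring[OF algebra_module[OF assms(1)]]
  interpret C': cring C by (rule algebra_cring[OF assms(1)])
  interpret B: module C ?B by (rule module_base_change[OF assms(1) module_EndF[OF crA]])
  have q: "(\<lambda>v\<in>{1..n} \<times> {1..n}. c \<otimes>\<^bsub>C\<^esub> p v) \<in> carrier (mat_alg n C)"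
    by (rule matI) (rule C'.m_closed[OF assms(2) mat_closed[OF assms(3)]])
  note t = mat_tens_closed[OF assms(1)]
  show ?thesis
  proof (rule mat_coord_eqI[OF assms(1) B.smult_closed[OF assms(2) t[OF assms(3)]] t[OF q]])
    fix i j assume ij: "i \<in> {1..n}" "j \<in> {1..n}"
    show "mat_coord A C n i j (c \<odot>\<^bsub>?B\<^esub> mat_tens A n C p) = mat_coord A C n i j (mat_tens A n C (\<lambda>v\<in>{1..n} \<times> {1..n}. c \<otimes>\<^bsub>C\<^esub> p v))"
      unfolding lin_smult[OF mat_coord_lin[OF assms(1) ij(2)] assms(2) t[OF assms(3)]] mat_coord_mat_tens[OF assms(1,3) ij]
        mat_coord_mat_tens[OF assms(1) q ij] self_mod_simps restrict_apply'[OF SigmaI[OF ij]] ..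
  qed
qed

text \<open>Forgets C-linearity down to A-linearity, the form in which maps out of an extension of
  scalars can be compared on pure tensors.\<close>

lemma lin_tensor_restr:
  assumes "algebra A C" "module A N" "f \<in> lin C (base_change A C N) Q"
  shows "f \<in> lin A (tensor A C N) (restr A C Q)"
  using lin_comp[OF restr_base_change[OF assms(1,2), THEN iffD2, OF lin_id]
      lin_restr[OF assms(1) module_base_change[OF assms(1,2)] assms(3)]] .

text \<open>On c \<otimes> g both sides are c times the i-th coordinate of g(T_1); the column index
  1 stands for e = T_1.\<close>

lemma mat_coord_first_column:
  assumes "algebra A C" "n \<ge> 1" "z \<in> carrier (base_change A C (EndF A n))"
  shows "bc_coord A C (\<lambda>x. x i) (tensor_map A C (FM A n) (\<lambda>h. h) (\<lambda>g. g (unit_vec A 1)) z) = mat_coord A C n i 1 z"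
proof -
  note mC = algebra_module[OF assms(1)]
  note crA = module_cring[OF mC]
  note mE = module_EndF[OF crA, of n] and mF = module_free_mod[OF crA, of "{1..n}"]
  have 1: "1 \<in> {1..n}" using assms(2) by simp
  note u = unit_vec_closed[OF crA 1]
  note tm = tensor_map[OF mC mE mC mF lin_id EndF_eval_lin[OF u]]
  have z: "z \<in> carrier (tensor A C (EndF A n))" using assms(3) by (simp only: base_change_simps)
  note co = bc_coord[OF assms(1) mF coeff_lin[OF crA]]
  show ?thesis
  proof (rule tensor_ext[OF mC mE, where f = "\<lambda>z. bc_coord A C (\<lambda>x. x i) (tensor_map A C (FM A n) (\<lambda>h. h) (\<lambda>g. g (unit_vec A 1)) z)",
        OF lin_comp[OF tm(1) lin_tensor_restr[OF assms(1) mF co(1)]] lin_tensor_restr[OF assms(1) mE mat_coord_lin[OF assms(1) 1]] _ z])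
    fix c g assume c: "c \<in> carrier C" and g: "g \<in> carrier (EndF A n)"
    show "bc_coord A C (\<lambda>x. x i) (tensor_map A C (FM A n) (\<lambda>h. h) (\<lambda>g. g (unit_vec A 1)) (tens A C (EndF A n) c g)) =
        mat_coord A C n i 1 (tens A C (EndF A n) c g)"
      unfolding tm(2)[OF c g] mat_coord_tens[OF assms(1) 1 c g]
      by (rule co(2)[OF c lin_closed[OF EndF_eval_lin[OF u] g]])
  qed
qed

section \<open>The universal commuting matrices\<close>

lemma some_arr: "mset (some_arr m) = m"
  unfolding some_arr_def by (rule someI_ex) (rule ex_mset)

text \<open>The starting point of a chain of quotients. The zero kernel is written as the ideal
  generated by the empty set so that \<open>surj_ker_step\<close> applies to it.\<close>

lemma surj_ker_zero:
  assumes "algebra A B" "algebra A C" "f \<in> alg_iso A B C"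
  shows "surj_ker A B C f (Idl\<^bsub>B\<^esub> {})"
proof -
  interpret B': cring B by (rule algebra_cring[OF assms(1)])
  note mB = algebra_module[OF assms(1)] and mC = algebra_module[OF assms(2)]
  have f: "f \<in> alg_hom A B C" and bij: "bij_betw f (carrier B) (carrier C)"
    using assms(3) unfolding alg_iso_def by simp_all
  note z = lin_zero[OF mB mC alg_hom_lin[OF f]]
  have 1: "{b \<in> carrier B. f b = \<zero>\<^bsub>C\<^esub>} = {\<zero>\<^bsub>B\<^esub>}"
  proof (rule equalityI; rule subsetI)
    fix b assume "b \<in> {b \<in> carrier B. f b = \<zero>\<^bsub>C\<^esub>}"
    then have "b \<in> carrier B" "f b = f \<zero>\<^bsub>B\<^esub>" using z by simp_all
    then have "b = \<zero>\<^bsub>B\<^esub>" by (intro inj_onD[OF bij_betw_imp_inj_on[OF bij]] B'.zero_closed)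
    then show "b \<in> {\<zero>\<^bsub>B\<^esub>}" by simp
  qed (simp add: z)
  have i: "ideal (Idl\<^bsub>B\<^esub> {}) B" by (rule B'.genideal_ideal) simp
  have 2: "Idl\<^bsub>B\<^esub> {} = {\<zero>\<^bsub>B\<^esub>}"
  proof
    show "Idl\<^bsub>B\<^esub> {} \<subseteq> {\<zero>\<^bsub>B\<^esub>}" by (rule B'.genideal_minimal[OF B'.zeroideal]) simp
    show "{\<zero>\<^bsub>B\<^esub>} \<subseteq> Idl\<^bsub>B\<^esub> {}"
      using additive_subgroup.zero_closed[OF ideal.axioms(1)[OF i]] by simp
  qed
  show ?thesis unfolding surj_ker_def 1 2 using f bij_betw_imp_surj_on[OF bij] by simp
qed

text \<open>The common source of \<open>mu_H\<close> and \<open>mu_HR\<close>: a homomorphism into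
  matrices is composed with the matrix identification and then extended to C.\<close>

lemma mat_base_change_lift:
  assumes "algebra A C" "nalg A P" "\<psi> \<in> alg_hom A P (mat_alg n C)"
  shows "\<exists>g. g \<in> extensional (carrier (base_change A C P)) \<and>
    g \<in> alg_hom C (base_change A C P) (base_change A C (EndF A n)) \<and>
    (\<forall>c\<in>carrier C. \<forall>p\<in>carrier P. g (tens A C P c p) = c \<odot>\<^bsub>base_change A C (EndF A n)\<^esub> mat_tens A n C (\<psi> p))"
  by (rule base_change_alg_lift[OF assms(1,2)
        nalg_base_change[OF assms(1) nalg_EndF[OF module_cring[OF algebra_module[OF assms(1)]]]]
        alg_hom_comp[OF assms(3) mat_tens_alg_hom[OF assms(1)]]])

text \<open>The matrix of \<mu>(1 \<otimes> x), with entries x \<otimes> T_ij^\<or>; for x = Y_s it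
  is the image of the generic matrix with upper index s.\<close>

definition gen_mat :: "('a, 'm) ring_scheme \<Rightarrow> nat \<Rightarrow> 's set \<Rightarrow> ('s \<Rightarrow> 'a) \<Rightarrow> nat \<times> nat \<Rightarrow> _" where
  "gen_mat A n S x = (\<lambda>v\<in>{1..n} \<times> {1..n}. Sig_gen A n (free_mod A S) x (fst v) (snd v))"

lemma mat_minus_entry:
  assumes "module A C" "p \<in> carrier (mat_alg n C)" "q \<in> carrier (mat_alg n C)" "v \<in> {1..n} \<times> {1..n}"
  shows "(p \<ominus>\<^bsub>mat_alg n C\<^esub> q) v = p v \<ominus>\<^bsub>C\<^esub> q v"
  by (rule lin_minus[OF module_mat_alg[OF assms(1)] assms(1) mat_entry_lin[OF assms(4)] assms(2,3)])

context
  fixes A :: "('a, 'm) ring_scheme" and n :: nat and S :: "'s set"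
  assumes crA: "cring A"
begin

private abbreviation (input) "M \<equiv> free_mod A S"
private abbreviation (input) "E \<equiv> EndF A n"
private abbreviation (input) "Sg \<equiv> Sig A n (free_mod A S)"
private abbreviation (input) "V \<equiv> {1..n} \<times> {1..n}"
private abbreviation (input) "\<phi> \<equiv> U_ident A n S"
private abbreviation (input) "D \<equiv> dual_mod A (EndF A n)"

lemma module_dual_EndF: "module A (dual_mod A (EndF A n))"
  unfolding dual_mod_def by (rule module_hom_mod[OF module_EndF[OF crA] module_self_mod[OF crA]])

private lemmas modM = module_free_mod[OF crA, of S]
private lemmas modE = module_EndF[OF crA, of n]
private lemmas modN = module_tensor[OF modM module_dual_EndF]

lemma Y_ident_iso:
  "Y_ident A S \<in> alg_iso A (mpoly A S) (sym_alg A (free_mod A S))"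
  "\<And>s. s \<in> S \<Longrightarrow> Y_ident A S (ring.indexed_var A s) = sym_inc A (free_mod A S) (unit_vec A s)"
  unfolding Y_ident_def
  by (rule sym_alg_free_iso(1)[OF modM free_basis_free_mod[OF crA]])
    (rule sym_alg_free_iso(2)[OF modM free_basis_free_mod[OF crA]])

lemma algebra_Sig: "algebra A (Sig A n (free_mod A S))"
  unfolding Sig_def by (rule algebra_sym_alg[OF modN])

lemma Sig_gen_lin:
  assumes "j \<in> {1..n}"
  shows "(\<lambda>x. Sig_gen A n (free_mod A S) x i j) \<in> lin A (free_mod A S) Sg"
proof -
  have t: "T_dual A n i j \<in> carrier D"
    using hom_modI[OF T_dual_lin[OF crA assms, of i] modE] unfolding dual_mod_def T_dual_def restrict_restrict Int_absorb .
  show ?thesis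
    unfolding Sig_gen_def Sig_def
    by (rule lin_comp[OF bilinD2[OF tens_bilin[OF modM module_dual_EndF] t] sym_inc_lin[OF modN]])
qed

text \<open>The module M \<otimes> End(F)^\<or> is free on the elements Y_s \<otimes> T_ij^\<or>,
  being the tensor product of a free module with a module that has a finite basis; its symmetric
  algebra is therefore a polynomial ring in these elements.\<close>

lemma U_ident_iso:
  "U_ident A n S \<in> alg_iso A (AU A n S) Sg"
  "\<And>s i j. s \<in> S \<Longrightarrow> i \<in> {1..n} \<Longrightarrow> j \<in> {1..n} \<Longrightarrow>
    U_ident A n S (ring.indexed_var A (s, i, j)) = Sig_gen A n (free_mod A S) (unit_vec A s) i j"
proof -
  let ?e = "\<lambda>(s, v). tens A M D (unit_vec A s) ((\<lambda>v. \<lambda>x\<in>carrier E. (\<lambda>(i, j). T_dual A n i j) v x) v)"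
  \<comment> \<open>\<open>fin_basis_dual\<close> delivers the dual basis restricted to the carrier,
    and \<open>T_dual\<close> is itself a restriction, so the double restriction has to
    collapse.\<close>
  have f: "(\<lambda>v. sym_inc A (tensor A M D) (?e v)) = (\<lambda>(s, i, j). Sig_gen A n M (unit_vec A s) i j)"
    by (rule ext) (simp only: Sig_gen_def T_dual_def restrict_restrict Int_absorb split: prod.split, simp)
  obtain L where "free_basis A (tensor A M D) (S \<times> V) ?e L"
    using free_basis_tensor[OF module_dual_EndF fin_basis_dual[OF modE fin_basis_EndF[OF crA]]] by (rule exE)
  note iso = sym_alg_free_iso[OF modN this, unfolded f]
  show "U_ident A n S \<in> alg_iso A (AU A n S) Sg"
    unfolding U_ident_def Sig_def by (rule iso(1))
  fix s i j assume sij: "s \<in> S" "i \<in> {1..n}" "j \<in> {1..n}"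
  show "U_ident A n S (ring.indexed_var A (s, i, j)) = Sig_gen A n M (unit_vec A s) i j"
    using iso(2)[OF SigmaI[OF sij(1) SigmaI[OF sij(2,3)]]] unfolding U_ident_def Sig_def
    by (simp only: case_prod_conv Sig_gen_def T_dual_def restrict_restrict Int_absorb)
qed

private lemmas algB = algebra_mpoly[OF crA, of "S \<times> {1..n} \<times> {1..n}"]
private lemmas modS = algebra_module[OF algebra_Sig]

lemma U_ident_hom: "U_ident A n S \<in> alg_hom A (AU A n S) Sg"
  using U_ident_iso(1) unfolding alg_iso_def by (simp only: mem_Collect_eq)

lemma gen_mat_lin: "gen_mat A n S \<in> lin A (free_mod A S) (mat_alg n Sg)"
proof (rule mat_linI[OF modM modS])
  fix x assume x: "x \<in> carrier M"
  show "gen_mat A n S x \<in> carrier (mat_alg n Sg)"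
    unfolding gen_mat_def by (rule matI) (rule lin_closed[OF Sig_gen_lin x], erule SigmaE, simp only: snd_conv)
next
  fix v assume v: "v \<in> V"
  then have j: "snd v \<in> {1..n}" by (rule SigmaE) (simp only: snd_conv)
  show "(\<lambda>x. gen_mat A n S x v) \<in> lin A M Sg"
    unfolding gen_mat_def restrict_apply'[OF v] by (rule Sig_gen_lin[OF j])
qed

text \<open>\<open>mu\<close> is a lift, so evaluating it on a pure tensor requires its defining
  expression to be bilinear. This is inherited from the linearity of \<open>gen_mat\<close>, once
  the defining sum is recognized as \<open>mat_tens\<close> of that matrix.\<close>

lemma mu_one_tens:
  assumes x: "x \<in> carrier (free_mod A S)"
  shows "mu A n (free_mod A S) (tens A Sg (free_mod A S) \<one>\<^bsub>Sg\<^esub> x) = mat_tens A n Sg (gen_mat A n S x)"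
proof -
  interpret S': cring Sg by (rule algebra_cring[OF algebra_Sig])
  let ?T = "tensor A Sg E" and ?B = "base_change A Sg E"
  interpret B: module Sg ?B by (rule module_base_change[OF algebra_Sig modE])
  let ?f = "\<lambda>x. finsum ?B (\<lambda>(i, j). tens A Sg E (Sig_gen A n M x i j) (T_end A n i j)) V"
  have f: "?f x = mat_tens A n Sg (gen_mat A n S x)" if "x \<in> carrier M" for x
  proof -
    have c: "Sig_gen A n M x (fst v) (snd v) \<in> carrier Sg" if v: "v \<in> V" for v
      using lin_closed[OF Sig_gen_lin \<open>x \<in> carrier M\<close>] v by (cases v) (simp only: snd_conv fst_conv mem_Sigma_iff)
    have "mat_tens A n Sg (gen_mat A n S x) = mat_tens A n Sg (\<lambda>v. Sig_gen A n M x (fst v) (snd v))"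
      unfolding gen_mat_def by (rule mat_tens_restrict[OF algebra_Sig c])
    then show ?thesis unfolding mat_tens_def by (simp only: fst_conv snd_conv)
  qed
  have bl: "bilin A Sg M ?T (\<lambda>\<sigma> x. \<sigma> \<odot>\<^bsub>?B\<^esub> mat_tens A n Sg (gen_mat A n S x))"
    by (rule bilin_comp[OF base_change_smult_bilin[OF algebra_Sig modE] lin_id lin_comp[OF gen_mat_lin mat_tens_lin[OF algebra_Sig]]])
  have b: "bilin A Sg M ?T (\<lambda>\<sigma> x. \<sigma> \<odot>\<^bsub>?B\<^esub> ?f x)"
    by (rule bilin_cong[OF bl modS modM]) (simp only: f)
  have "mu A n M (tens A Sg M \<one>\<^bsub>Sg\<^esub> x) = \<one>\<^bsub>Sg\<^esub> \<odot>\<^bsub>?B\<^esub> ?f x"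
    unfolding mu_def Let_def
    by (rule tensor_lift(2)[OF modS modM module_tensor[OF modS modE] b S'.one_closed x])
  also have "\<dots> = mat_tens A n Sg (gen_mat A n S x)"
    unfolding f[OF x] by (rule B.smult_one[OF mat_tens_closed[OF algebra_Sig lin_closed[OF gen_mat_lin x]]])
  finally show ?thesis .
qed

lemma U_mat_closed:
  assumes "s \<in> S"
  shows "U_mat A n s \<in> carrier (mat_alg n (AU A n S))"
proof -
  have "U_mat A n s = (\<lambda>v\<in>V. ring.indexed_var A (s, fst v, snd v))"
    unfolding U_mat_def by (rule restrict_ext) (simp only: case_prod_unfold)
  moreover have "(\<lambda>v\<in>V. ring.indexed_var A (s, fst v, snd v)) \<in> carrier (mat_alg n (AU A n S))"
    by (rule matI) (rule indexed_var_closed[OF crA], intro SigmaI assms; erule SigmaE; simp only: fst_conv snd_conv)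
  ultimately show ?thesis by (simp only:)
qed

lemma U_ident_U_mat:
  assumes "s \<in> S"
  shows "(\<lambda>v\<in>{1..n} \<times> {1..n}. U_ident A n S (U_mat A n s v)) = gen_mat A n S (unit_vec A s)"
  unfolding gen_mat_def
proof (rule restrict_ext)
  fix v assume v: "v \<in> V"
  obtain i j where ij: "v = (i, j)" "i \<in> {1..n}" "j \<in> {1..n}" using v by (rule SigmaE)
  show "U_ident A n S (U_mat A n s v) = Sig_gen A n M (unit_vec A s) (fst v) (snd v)"
    unfolding ij(1) U_mat_def restrict_apply'[OF SigmaI[OF ij(2,3)]] case_prod_conv fst_conv snd_conv
    by (rule U_ident_iso(2)[OF assms ij(2,3)])
qed

lemma I1_gens_alt:
  "I1_gens A n S = {(U_mat A n s \<otimes>\<^bsub>mat_alg n (AU A n S)\<^esub> U_mat A n t \<ominus>\<^bsub>mat_alg n (AU A n S)\<^esub>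
     U_mat A n t \<otimes>\<^bsub>mat_alg n (AU A n S)\<^esub> U_mat A n s) v | s t v. s \<in> S \<and> t \<in> S \<and> v \<in> V}"
  unfolding I1_gens_def Let_def by blast

lemma I1_gens_closed: "I1_gens A n S \<subseteq> carrier (AU A n S)"
proof -
  note nM = galg_nalg[OF galg_mat_alg[OF algB]]
  interpret MB: module A "mat_alg n (AU A n S)" by (rule nalg_module[OF nM])
  note c = bilin_closed[OF nalg_bilin[OF nM] U_mat_closed U_mat_closed]
  show ?thesis
  proof (rule subsetI)
    fix g assume "g \<in> I1_gens A n S"
    then obtain s t v where g: "g = (U_mat A n s \<otimes>\<^bsub>mat_alg n (AU A n S)\<^esub> U_mat A n t \<ominus>\<^bsub>mat_alg n (AU A n S)\<^esub>
        U_mat A n t \<otimes>\<^bsub>mat_alg n (AU A n S)\<^esub> U_mat A n s) v" "s \<in> S" "t \<in> S" "v \<in> V"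
      unfolding I1_gens_alt by (elim CollectE exE conjE)
    show "g \<in> carrier (AU A n S)"
      unfolding g(1) by (rule mat_closed[OF MB.minus_closed[OF c[OF g(2,3)] c[OF g(3,2)]] g(4)])
  qed
qed

private abbreviation (input) "gen_comm x y \<equiv> gen_mat A n S x \<otimes>\<^bsub>mat_alg n (Sig A n (free_mod A S))\<^esub> gen_mat A n S y
  \<ominus>\<^bsub>mat_alg n (Sig A n (free_mod A S))\<^esub> gen_mat A n S y \<otimes>\<^bsub>mat_alg n (Sig A n (free_mod A S))\<^esub> gen_mat A n S x"

lemma gen_comm_closed:
  assumes "x \<in> carrier (free_mod A S)" "y \<in> carrier (free_mod A S)"
  shows "gen_comm x y \<in> carrier (mat_alg n Sg)"
proof -
  note nM = galg_nalg[OF galg_mat_alg[OF algebra_Sig]]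
  interpret MB: module A "mat_alg n Sg" by (rule nalg_module[OF nM])
  note g = lin_closed[OF gen_mat_lin]
  show ?thesis by (intro MB.minus_closed bilin_closed[OF nalg_bilin[OF nM]] g assms)
qed

text \<open>Applying an algebra homomorphism to every entry is a homomorphism of matrix algebras, so
  it commutes with forming commutators.\<close>

lemma U_ident_I1_gen:
  assumes st: "s \<in> S" "t \<in> S" and v: "v \<in> {1..n} \<times> {1..n}"
  shows "U_ident A n S ((U_mat A n s \<otimes>\<^bsub>mat_alg n (AU A n S)\<^esub> U_mat A n t \<ominus>\<^bsub>mat_alg n (AU A n S)\<^esub>
     U_mat A n t \<otimes>\<^bsub>mat_alg n (AU A n S)\<^esub> U_mat A n s) v) = gen_comm (unit_vec A s) (unit_vec A t) v"
proof -
  let ?MB = "mat_alg n (AU A n S)" and ?MS = "mat_alg n Sg"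
  note nB = galg_nalg[OF galg_mat_alg[OF algB]] and nS = galg_nalg[OF galg_mat_alg[OF algebra_Sig]]
  note u = U_mat_closed[OF st(1)] U_mat_closed[OF st(2)]
  note c = bilin_closed[OF nalg_bilin[OF nB] u] bilin_closed[OF nalg_bilin[OF nB] u(2,1)]
  interpret MB: module A ?MB by (rule nalg_module[OF nB])
  let ?h = "\<lambda>p. \<lambda>v\<in>V. \<phi> (p v)"
  have h: "?h \<in> alg_hom A ?MB ?MS" by (rule mat_map_alg_hom[OF algB algebra_Sig U_ident_hom])
  have "\<phi> ((U_mat A n s \<otimes>\<^bsub>?MB\<^esub> U_mat A n t \<ominus>\<^bsub>?MB\<^esub> U_mat A n t \<otimes>\<^bsub>?MB\<^esub> U_mat A n s) v) =
      ?h (U_mat A n s \<otimes>\<^bsub>?MB\<^esub> U_mat A n t \<ominus>\<^bsub>?MB\<^esub> U_mat A n t \<otimes>\<^bsub>?MB\<^esub> U_mat A n s) v"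
    unfolding restrict_apply'[OF v] ..
  also have "?h (U_mat A n s \<otimes>\<^bsub>?MB\<^esub> U_mat A n t \<ominus>\<^bsub>?MB\<^esub> U_mat A n t \<otimes>\<^bsub>?MB\<^esub> U_mat A n s) =
      gen_comm (unit_vec A s) (unit_vec A t)"
    unfolding lin_minus[OF nalg_module[OF nB] nalg_module[OF nS] alg_hom_lin[OF h] c]
      alg_hom_mult[OF h u] alg_hom_mult[OF h u(2,1)] U_ident_U_mat[OF st(1)] U_ident_U_mat[OF st(2)] ..
  finally show ?thesis .
qed

text \<open>The matrix identification is linear and multiplicative, so the commutator of \<mu>(1
  \<otimes> x) and \<mu>(1 \<otimes> y) corresponds to the commutator of their matrices, and the
  entries of the latter are its coordinates.\<close>

lemma Z_elt_mu_comm: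
  assumes x: "x \<in> carrier (free_mod A S)" and y: "y \<in> carrier (free_mod A S)"
  shows "Z_elt Sg (base_change A Sg E)
      (mu A n (free_mod A S) (tens A Sg (free_mod A S) \<one>\<^bsub>Sg\<^esub> x) \<otimes>\<^bsub>base_change A Sg E\<^esub>
        mu A n (free_mod A S) (tens A Sg (free_mod A S) \<one>\<^bsub>Sg\<^esub> y) \<ominus>\<^bsub>base_change A Sg E\<^esub>
       mu A n (free_mod A S) (tens A Sg (free_mod A S) \<one>\<^bsub>Sg\<^esub> y) \<otimes>\<^bsub>base_change A Sg E\<^esub>
        mu A n (free_mod A S) (tens A Sg (free_mod A S) \<one>\<^bsub>Sg\<^esub> x)) =
    Idl\<^bsub>Sg\<^esub> {gen_comm x y v | v. v \<in> V}"
proof -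
  let ?B = "base_change A Sg E"
  note nM = galg_nalg[OF galg_mat_alg[OF algebra_Sig]]
  note g = lin_closed[OF gen_mat_lin x] lin_closed[OF gen_mat_lin y]
  note c = bilin_closed[OF nalg_bilin[OF nM] g] bilin_closed[OF nalg_bilin[OF nM] g(2,1)]
  note gc = gen_comm_closed[OF x y]
  \<comment> \<open>Subtraction agrees in \<open>base_change\<close> and in \<open>tensor\<close>;
    \<open>mat_tens_lin\<close> speaks of the latter.\<close>
  have am: "a_minus ?B = a_minus (tensor A Sg E)" by (rule a_minus_cong) simp_all
  have e: "mu A n M (tens A Sg M \<one>\<^bsub>Sg\<^esub> x) \<otimes>\<^bsub>?B\<^esub> mu A n M (tens A Sg M \<one>\<^bsub>Sg\<^esub> y) \<ominus>\<^bsub>?B\<^esub>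
      mu A n M (tens A Sg M \<one>\<^bsub>Sg\<^esub> y) \<otimes>\<^bsub>?B\<^esub> mu A n M (tens A Sg M \<one>\<^bsub>Sg\<^esub> x) = mat_tens A n Sg (gen_comm x y)"
    unfolding mu_one_tens[OF x] mu_one_tens[OF y] am
      mat_tens_mult[OF algebra_Sig g, symmetric] mat_tens_mult[OF algebra_Sig g(2,1), symmetric]
    by (rule lin_minus[OF nalg_module[OF nM] module_tensor[OF modS modE] mat_tens_lin[OF algebra_Sig] c, symmetric])
  have co: "(\<lambda>(i, j). mat_coord A Sg n i j) v (mat_tens A n Sg (gen_comm x y)) = gen_comm x y v" if v: "v \<in> V" for v
  proof -
    obtain i j where ij: "v = (i, j)" "i \<in> {1..n}" "j \<in> {1..n}" using v by (rule SigmaE)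
    show ?thesis unfolding ij(1) case_prod_conv by (rule mat_coord_mat_tens[OF algebra_Sig gc ij(2,3)])
  qed
  have s: "{(\<lambda>(i, j). mat_coord A Sg n i j) v (mat_tens A n Sg (gen_comm x y)) | v. v \<in> V} = {gen_comm x y v | v. v \<in> V}"
    by (rule Collect_cong) (use co in metis)
  show ?thesis
    unfolding e Z_elt_fin_basis[OF algebra_cring[OF algebra_Sig] module_base_change[OF algebra_Sig modE]
        fin_basis_mat_coord[OF algebra_Sig] mat_tens_closed[OF algebra_Sig gc]] s ..
qed

text \<open>Modulo the ideal generated by the commutators of the \<open>Y\<^sub>s\<close>, the commutator of two generic matrices
  is bilinear and vanishes on the basis, hence vanishes.\<close>

lemma H_ideal_eq: "H_ideal A n (free_mod A S) = Idl\<^bsub>Sg\<^esub> (U_ident A n S ` I1_gens A n S)"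
proof -
  interpret Q: cring Sg by (rule algebra_cring[OF algebra_Sig])
  let ?G = "\<phi> ` I1_gens A n S" and ?MS = "mat_alg n Sg"
  let ?L = "Idl\<^bsub>Sg\<^esub> ?G" and ?U = "\<Union>x\<in>carrier M. \<Union>y\<in>carrier M. Idl\<^bsub>Sg\<^esub> {gen_comm x y v | v. v \<in> V}"
  have H: "H_ideal A n M = Idl\<^bsub>Sg\<^esub> ?U"
    unfolding H_ideal_def Let_def
    by (rule arg_cong[where f = "genideal Sg"], intro SUP_cong refl) (rule Z_elt_mu_comm)
  have Gc: "?G \<subseteq> carrier Sg"
    by (rule image_subsetI) (rule lin_closed[OF alg_hom_lin[OF U_ident_hom] subsetD[OF I1_gens_closed]])
  have iL: "ideal ?L Sg" by (rule Q.genideal_ideal[OF Gc])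
  note sL = ideal_submodule[OF algebra_Sig iL]
  have cc: "{gen_comm x y v | v. v \<in> V} \<subseteq> carrier Sg" if "x \<in> carrier M" "y \<in> carrier M" for x y
  proof (rule subsetI)
    fix c assume "c \<in> {gen_comm x y v | v. v \<in> V}"
    then obtain v where v: "c = gen_comm x y v" "v \<in> V" by (elim CollectE exE conjE)
    show "c \<in> carrier Sg" unfolding v(1) by (rule mat_closed[OF gen_comm_closed[OF that] v(2)])
  qed
  have Uc: "?U \<subseteq> carrier Sg"
    by (intro UN_least) (rule ideal.axioms(1)[OF Q.genideal_ideal[OF cc], THEN additive_subgroup.a_subset])
  let ?C = "quot Sg ?L"
  note algC = algebra_quot[OF algebra_Sig iL]
  note nC = galg_nalg[OF galg_mat_alg[OF algC, of n]] and nS = galg_nalg[OF galg_mat_alg[OF algebra_Sig, of n]]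
  note pr = quot_proj_alg_hom[OF algebra_Sig iL]
  \<comment> \<open>Entrywise reduction modulo \<open>?L\<close>. In the quotient the vanishing of a
    commutator becomes the equality of two products.\<close>
  let ?h = "\<lambda>p. \<lambda>v\<in>V. ?L +>\<^bsub>Sg\<^esub> p v"
  have h: "?h \<in> alg_hom A ?MS (mat_alg n ?C)" by (rule mat_map_alg_hom[OF algebra_Sig algC pr])
  let ?g = "\<lambda>x. ?h (gen_mat A n S x)"
  have g: "?g \<in> lin A M (mat_alg n ?C)" by (rule lin_comp[OF gen_mat_lin alg_hom_lin[OF h]])
  have z: "?L +>\<^bsub>Sg\<^esub> c = \<zero>\<^bsub>?C\<^esub> \<longleftrightarrow> c \<in> ?L" if "c \<in> carrier Sg" for c
    using coset_eq_iff[OF modS sL that Q.zero_closed] coset_zero[OF modS sL] that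
    by (simp add: a_minus_def)
  have gg: "gen_mat A n S x \<otimes>\<^bsub>?MS\<^esub> gen_mat A n S y \<in> carrier ?MS" if "x \<in> carrier M" "y \<in> carrier M" for x y
    by (rule bilin_closed[OF nalg_bilin[OF nS] lin_closed[OF gen_mat_lin that(1)] lin_closed[OF gen_mat_lin that(2)]])
  have hgg: "?h (gen_mat A n S x \<otimes>\<^bsub>?MS\<^esub> gen_mat A n S y) = ?g x \<otimes>\<^bsub>mat_alg n ?C\<^esub> ?g y" if "x \<in> carrier M" "y \<in> carrier M" for x y
    by (rule alg_hom_mult[OF h lin_closed[OF gen_mat_lin that(1)] lin_closed[OF gen_mat_lin that(2)]])
  have pcomm: "?L +>\<^bsub>Sg\<^esub> gen_comm x y v = (?g x \<otimes>\<^bsub>mat_alg n ?C\<^esub> ?g y) v \<ominus>\<^bsub>?C\<^esub> (?g y \<otimes>\<^bsub>mat_alg n ?C\<^esub> ?g x) v"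
    if x: "x \<in> carrier M" and y: "y \<in> carrier M" and v: "v \<in> V" for x y v
  proof -
    have "?L +>\<^bsub>Sg\<^esub> gen_comm x y v = (?L +>\<^bsub>Sg\<^esub> (gen_mat A n S x \<otimes>\<^bsub>?MS\<^esub> gen_mat A n S y) v) \<ominus>\<^bsub>?C\<^esub>
        (?L +>\<^bsub>Sg\<^esub> (gen_mat A n S y \<otimes>\<^bsub>?MS\<^esub> gen_mat A n S x) v)"
      unfolding mat_minus_entry[OF modS gg[OF x y] gg[OF y x] v]
      by (rule lin_minus[OF modS algebra_module[OF algC] alg_hom_lin[OF pr] mat_closed[OF gg[OF x y] v] mat_closed[OF gg[OF y x] v]])
    also have "\<dots> = ?h (gen_mat A n S x \<otimes>\<^bsub>?MS\<^esub> gen_mat A n S y) v \<ominus>\<^bsub>?C\<^esub> ?h (gen_mat A n S y \<otimes>\<^bsub>?MS\<^esub> gen_mat A n S x) v"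
      unfolding restrict_apply'[OF v] ..
    finally show ?thesis unfolding hgg[OF x y] hgg[OF y x] .
  qed
  have gm: "?g x \<otimes>\<^bsub>mat_alg n ?C\<^esub> ?g y \<in> carrier (mat_alg n ?C)" if "x \<in> carrier M" "y \<in> carrier M" for x y
    by (rule bilin_closed[OF nalg_bilin[OF nC] lin_closed[OF g that(1)] lin_closed[OF g that(2)]])
  have uu: "unit_vec A s \<in> carrier M" if "s \<in> S" for s by (rule unit_vec_closed[OF crA that])
  have comm: "?g x \<otimes>\<^bsub>mat_alg n ?C\<^esub> ?g y = ?g y \<otimes>\<^bsub>mat_alg n ?C\<^esub> ?g x" if x: "x \<in> carrier M" and y: "y \<in> carrier M" for x y
  proof (rule free_bilin_ext[OF nalg_module[OF nC], where b = "\<lambda>x y. ?g x \<otimes>\<^bsub>mat_alg n ?C\<^esub> ?g y" and b' = "\<lambda>x y. ?g y \<otimes>\<^bsub>mat_alg n ?C\<^esub> ?g x",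
        OF bilin_comp[OF nalg_bilin[OF nC] g g] _ _ x y])
    show "bilin A M M (mat_alg n ?C) (\<lambda>x y. ?g y \<otimes>\<^bsub>mat_alg n ?C\<^esub> ?g x)"
      using bilin_comp[OF nalg_bilin[OF nC] g g] unfolding bilin_def by (rule conj_commute[THEN iffD1])
    fix s t assume st: "s \<in> S" "t \<in> S"
    show "?g (unit_vec A s) \<otimes>\<^bsub>mat_alg n ?C\<^esub> ?g (unit_vec A t) = ?g (unit_vec A t) \<otimes>\<^bsub>mat_alg n ?C\<^esub> ?g (unit_vec A s)"
    proof (rule mat_eqI[OF gm[OF uu[OF st(1)] uu[OF st(2)]] gm[OF uu[OF st(2)] uu[OF st(1)]]])
      fix v assume v: "v \<in> V"
      note c1 = mat_closed[OF gm[OF uu[OF st(1)] uu[OF st(2)]] v] and c2 = mat_closed[OF gm[OF uu[OF st(2)] uu[OF st(1)]] v]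
      have "\<phi> ((U_mat A n s \<otimes>\<^bsub>mat_alg n (AU A n S)\<^esub> U_mat A n t \<ominus>\<^bsub>mat_alg n (AU A n S)\<^esub>
          U_mat A n t \<otimes>\<^bsub>mat_alg n (AU A n S)\<^esub> U_mat A n s) v) \<in> ?L"
        by (rule subsetD[OF Q.genideal_self[OF Gc]], rule imageI) (unfold I1_gens_alt, use st v in blast)
      then have "gen_comm (unit_vec A s) (unit_vec A t) v \<in> ?L" unfolding U_ident_I1_gen[OF st v] .
      then have "?L +>\<^bsub>Sg\<^esub> gen_comm (unit_vec A s) (unit_vec A t) v = \<zero>\<^bsub>?C\<^esub>"
        by (rule z[THEN iffD2, rotated]) (rule mat_closed[OF gen_comm_closed[OF uu[OF st(1)] uu[OF st(2)]] v])
      then show "(?g (unit_vec A s) \<otimes>\<^bsub>mat_alg n ?C\<^esub> ?g (unit_vec A t)) v = (?g (unit_vec A t) \<otimes>\<^bsub>mat_alg n ?C\<^esub> ?g (unit_vec A s)) v"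
        unfolding pcomm[OF uu[OF st(1)] uu[OF st(2)] v] module_minus_zero_iff[OF algebra_module[OF algC] c1 c2] .
    qed
  qed
  \<comment> \<open>Back from the quotient: equal products mean that every entry of the commutator
    lies in \<open>?L\<close>.\<close>
  have inL: "gen_comm x y v \<in> ?L" if x: "x \<in> carrier M" and y: "y \<in> carrier M" and v: "v \<in> V" for x y v
  proof -
    note c = mat_closed[OF gm[OF y x] v]
    have "?L +>\<^bsub>Sg\<^esub> gen_comm x y v = \<zero>\<^bsub>?C\<^esub>"
      unfolding pcomm[OF x y v] comm[OF x y] module_minus_zero_iff[OF algebra_module[OF algC] c c] ..
    then show ?thesis by (rule z[THEN iffD1, rotated]) (rule mat_closed[OF gen_comm_closed[OF x y] v])
  qed
  have "?U \<subseteq> ?L"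
  proof (intro UN_least Q.genideal_minimal[OF iL] subsetI)
    fix x y c assume xy: "x \<in> carrier M" "y \<in> carrier M" and "c \<in> {gen_comm x y v | v. v \<in> V}"
    then obtain v where v: "c = gen_comm x y v" "v \<in> V" by (elim CollectE exE conjE)
    show "c \<in> ?L" unfolding v(1) by (rule inL[OF xy v(2)])
  qed
  then have 1: "Idl\<^bsub>Sg\<^esub> ?U \<subseteq> ?L" by (rule Q.genideal_minimal[OF iL])
  \<comment> \<open>For the reverse inclusion only pairs of basis elements Y_s, Y_t are taken from
    the union.\<close>
  have "?G \<subseteq> ?U"
  proof (rule image_subsetI)
    fix c assume "c \<in> I1_gens A n S"
    then obtain s t v where c: "c = (U_mat A n s \<otimes>\<^bsub>mat_alg n (AU A n S)\<^esub> U_mat A n t \<ominus>\<^bsub>mat_alg n (AU A n S)\<^esub>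
          U_mat A n t \<otimes>\<^bsub>mat_alg n (AU A n S)\<^esub> U_mat A n s) v" "s \<in> S" "t \<in> S" "v \<in> V"
      unfolding I1_gens_alt by (elim CollectE exE conjE)
    have "gen_comm (unit_vec A s) (unit_vec A t) v \<in> Idl\<^bsub>Sg\<^esub> {gen_comm (unit_vec A s) (unit_vec A t) v | v. v \<in> V}"
      by (rule subsetD[OF Q.genideal_self[OF cc[OF uu[OF c(2)] uu[OF c(3)]]]]) (use c(4) in blast)
    then show "\<phi> c \<in> ?U"
      unfolding c(1) U_ident_I1_gen[OF c(2-4)] by (intro UN_I[OF uu[OF c(2)]] UN_I[OF uu[OF c(3)]])
  qed
  then have "?L \<subseteq> Idl\<^bsub>Sg\<^esub> ?U"
    using Q.genideal_self[OF Uc] by (intro Q.genideal_minimal[OF Q.genideal_ideal[OF Uc]]) (rule subset_trans)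
  then show ?thesis unfolding H using 1 by (rule equalityI[rotated])
qed

section \<open>The presentations of the quotients\<close>

private abbreviation (input) "B \<equiv> AU A n S"
private abbreviation (input) "P \<equiv> sym_alg A (free_mod A S)"
private abbreviation (input) "\<iota> \<equiv> Y_ident A S"
private abbreviation (input) "H \<equiv> Halg A n (free_mod A S)"
private abbreviation (input) "\<pi>H \<equiv> \<lambda>p. H_ideal A n (free_mod A S) +>\<^bsub>Sig A n (free_mod A S)\<^esub> U_ident A n S p"

private lemmas algP0 = algebra_mpoly[OF crA, of S]
private lemmas algP = algebra_sym_alg[OF modM]
private lemmas algS = algebra_Sig

section \<open>The algebra H, and substitution modulo I_1\<close>

context
  fixes arr :: "'s multiset \<Rightarrow> 's list"
  assumes arr: "\<And>m. mset (arr m) = m"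
begin

private abbreviation (input) "sU \<equiv> subst_U A n S arr"

lemma H_ideal_ideal: "ideal (H_ideal A n (free_mod A S)) Sg"
proof -
  interpret Q: cring Sg by (rule algebra_cring[OF algS])
  have "\<phi> ` I1_gens A n S \<subseteq> carrier Sg"
    by (rule image_subsetI) (rule lin_closed[OF alg_hom_lin[OF U_ident_hom] subsetD[OF I1_gens_closed]])
  then show ?thesis unfolding H_ideal_eq by (rule Q.genideal_ideal)
qed

lemma algebra_Halg: "algebra A (Halg A n (free_mod A S))"
  unfolding Halg_def by (rule algebra_quot[OF algS H_ideal_ideal])

private lemmas algH = algebra_Halg

text \<open>One quotient step, starting from the identification of A[U] with \<Sigma>, whose kernel
  has the empty set of generators.\<close>

lemma surj_ker_H: "surj_ker A (AU A n S) H \<pi>H (Idl\<^bsub>B\<^esub> (I1_gens A n S))"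
  using surj_ker_step[OF algB algS surj_ker_zero[OF algB algS U_ident_iso(1)] empty_subsetI I1_gens_closed]
  unfolding H_ideal_eq[symmetric] Halg_def[symmetric] Un_empty_left .

private lemmas \<pi>H_hom = surj_kerD(1)[OF surj_ker_H]

text \<open>Over A[U] the generic matrices need not commute, so substitution cannot be treated as a
  homomorphism there; closure follows from its being the linear extension of a family of
  words.\<close>

lemma subst_U_closed:
  assumes f: "f \<in> carrier (mpoly A S)"
  shows "subst_U A n S arr f \<in> carrier (mat_alg n (AU A n S))"
proof -
  note gB = galg_mat_alg[OF algB, of n]
  have "lsum A (mat_alg n B) (\<lambda>m. word (mat_alg n B) (U_mat A n) (arr m)) \<in> lin A (free_mod A (mons S)) (mat_alg n B)"
    by (rule lsum_lin[OF nalg_module[OF galg_nalg[OF gB]]])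
      (rule word_closed[OF galg_monoid[OF gB] U_mat_closed mset_set_mons[OF arr]])
  then show ?thesis
    unfolding subst_U_def poly_eval_lsum using f unfolding mpoly_carrier[OF crA] by (rule lin_closed)
qed

lemma subst_U_entry_closed:
  "f \<in> carrier (mpoly A S) \<Longrightarrow> v \<in> {1..n} \<times> {1..n} \<Longrightarrow> subst_U A n S arr f v \<in> carrier (AU A n S)"
  by (rule mat_closed[OF subst_U_closed])

text \<open>Substitution is multiplicative only after passing to a quotient of \<open>A[U]\<close> in which the matrices
  commute; there the order \<open>arr\<close> of the factors becomes irrelevant.\<close>

lemma subst_U_hom:
  assumes algC: "algebra A C" and h: "h \<in> alg_hom A (AU A n S) C"
    and ker: "\<And>g. g \<in> I1_gens A n S \<Longrightarrow> h g = \<zero>\<^bsub>C\<^esub>"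
  shows "(\<lambda>f. \<lambda>v\<in>{1..n} \<times> {1..n}. h (subst_U A n S arr f v)) \<in> alg_hom A (mpoly A S) (mat_alg n C)"
    and "\<And>s. s \<in> S \<Longrightarrow> (\<lambda>v\<in>{1..n} \<times> {1..n}. h (subst_U A n S arr (ring.indexed_var A s) v)) =
      (\<lambda>v\<in>{1..n} \<times> {1..n}. h (U_mat A n s v))"
proof -
  let ?MB = "mat_alg n B" and ?MC = "mat_alg n C"
  note gB = galg_mat_alg[OF algB, of n] and gC = galg_mat_alg[OF algC, of n]
  note nB = galg_nalg[OF gB] and nC = galg_nalg[OF gC]
  note modB = algebra_module[OF algB] and modC = algebra_module[OF algC]
  let ?h = "\<lambda>p. \<lambda>v\<in>V. h (p v)"
  have hm: "?h \<in> alg_hom A ?MB ?MC" by (rule mat_map_alg_hom[OF algB algC h])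
  have x: "?h (U_mat A n s) \<in> carrier ?MC" if "s \<in> S" for s
    by (rule lin_closed[OF alg_hom_lin[OF hm] U_mat_closed[OF that]])
  \<comment> \<open>Vanishing of h on the generators of I_1 is precisely the commutation of the
    image matrices, entry by entry.\<close>
  have comm: "?h (U_mat A n s) \<otimes>\<^bsub>?MC\<^esub> ?h (U_mat A n t) = ?h (U_mat A n t) \<otimes>\<^bsub>?MC\<^esub> ?h (U_mat A n s)"
    if st: "s \<in> S" "t \<in> S" for s t
  proof -
    note u = U_mat_closed[OF st(1)] U_mat_closed[OF st(2)]
    note c = bilin_closed[OF nalg_bilin[OF nB] u] bilin_closed[OF nalg_bilin[OF nB] u(2,1)]
    have "?h (U_mat A n s \<otimes>\<^bsub>?MB\<^esub> U_mat A n t) = ?h (U_mat A n t \<otimes>\<^bsub>?MB\<^esub> U_mat A n s)"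
    proof (rule restrict_ext)
      fix v assume v: "v \<in> V"
      note cv = mat_closed[OF c(1) v] mat_closed[OF c(2) v]
      note hv = lin_closed[OF alg_hom_lin[OF h] cv(1)] lin_closed[OF alg_hom_lin[OF h] cv(2)]
      have "h ((U_mat A n s \<otimes>\<^bsub>?MB\<^esub> U_mat A n t \<ominus>\<^bsub>?MB\<^esub> U_mat A n t \<otimes>\<^bsub>?MB\<^esub> U_mat A n s) v) = \<zero>\<^bsub>C\<^esub>"
        by (rule ker, unfold I1_gens_alt) (use st v in blast)
      then show "h ((U_mat A n s \<otimes>\<^bsub>?MB\<^esub> U_mat A n t) v) = h ((U_mat A n t \<otimes>\<^bsub>?MB\<^esub> U_mat A n s) v)"
        unfolding mat_minus_entry[OF modB c v] lin_minus[OF modB modC alg_hom_lin[OF h] cv]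
          module_minus_zero_iff[OF modC hv] .
    qed
    then show ?thesis unfolding alg_hom_mult[OF hm u] alg_hom_mult[OF hm u(2,1)] .
  qed
  note pe = poly_eval_alg_hom[where x = "\<lambda>s. ?h (U_mat A n s)" and V = S and arr = arr, OF gC]
  have pe1: "poly_eval A ?MC arr (\<lambda>s. ?h (U_mat A n s)) \<in> alg_hom A (mpoly A S) ?MC"
    by (rule pe(1)) (rule x comm arr; assumption)+
  \<comment> \<open>\<open>poly_eval_comp\<close> moves h inside the substitution; the values then
    commute, and \<open>poly_eval_alg_hom\<close> becomes applicable.\<close>
  have eq: "?h (sU f) = poly_eval A ?MC arr (\<lambda>s. ?h (U_mat A n s)) f" if f: "f \<in> carrier (mpoly A S)" for f
    unfolding subst_U_def by (rule poly_eval_comp[OF gB nalg_module[OF nC] hm U_mat_closed arr f])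
  show "(\<lambda>f. ?h (sU f)) \<in> alg_hom A (mpoly A S) ?MC"
    by (rule alg_hom_cong[OF pe1 algebra_nalg[OF algP0]]) (rule eq)
  show "?h (sU (ring.indexed_var A s)) = ?h (U_mat A n s)" if s: "s \<in> S" for s
    unfolding eq[OF indexed_var_closed[OF crA s]]
    by (rule pe(2)) (rule x comm arr s; assumption)+
qed

lemma surj_ker_kill:
  assumes "surj_ker A (AU A n S) C h (Idl\<^bsub>B\<^esub> G)" "G \<subseteq> carrier (AU A n S)" "g \<in> G"
  shows "h g = \<zero>\<^bsub>C\<^esub>"
proof -
  interpret B': cring B by (rule algebra_cring[OF algB])
  have "g \<in> Idl\<^bsub>B\<^esub> G" by (rule subsetD[OF B'.genideal_self[OF assms(2)] assms(3)])
  then show ?thesis unfolding surj_kerD(3)[OF assms(1), symmetric] by simp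
qed

private lemma subst_H:
  "(\<lambda>f. \<lambda>v\<in>{1..n} \<times> {1..n}. \<pi>H (subst_U A n S arr f v)) \<in> alg_hom A (mpoly A S) (mat_alg n H)"
  "\<And>s. s \<in> S \<Longrightarrow> (\<lambda>v\<in>{1..n} \<times> {1..n}. \<pi>H (subst_U A n S arr (ring.indexed_var A s) v)) =
      (\<lambda>v\<in>{1..n} \<times> {1..n}. \<pi>H (U_mat A n s v))"
proof -
  note k = surj_ker_kill[OF surj_ker_H I1_gens_closed]
  show "(\<lambda>f. \<lambda>v\<in>V. \<pi>H (sU f v)) \<in> alg_hom A (mpoly A S) (mat_alg n H)"
    by (rule subst_U_hom(1)[OF algH \<pi>H_hom]) (rule k)
  show "(\<lambda>v\<in>V. \<pi>H (sU (ring.indexed_var A s) v)) = (\<lambda>v\<in>V. \<pi>H (U_mat A n s v))" if "s \<in> S" for s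
    by (rule subst_U_hom(2)[OF algH \<pi>H_hom]) (rule k, assumption, rule that)
qed

text \<open>The inverse \<kappa> reads an element of Sym(M) as a polynomial, so that substitution
  can be applied to it.\<close>

lemma Y_ident_inv:
  "\<exists>\<kappa> \<in> alg_hom A (sym_alg A (free_mod A S)) (mpoly A S). (\<forall>f\<in>carrier (mpoly A S). \<kappa> (Y_ident A S f) = f) \<and>
     (\<forall>p\<in>carrier (sym_alg A (free_mod A S)). Y_ident A S (\<kappa> p) = p)"
  by (rule alg_iso_inv[OF algebra_nalg[OF algP0] algebra_nalg[OF algP] Y_ident_iso(1)])

lemma Y_ident_hom: "Y_ident A S \<in> alg_hom A (mpoly A S) (sym_alg A (free_mod A S))"
  using Y_ident_iso(1) unfolding alg_iso_def by (simp only: mem_Collect_eq)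

text \<open>A candidate g is obtained by reading p as a polynomial f and substituting the matrices,
  and it is checked against the description of \<open>mu_H\<close>. Uniqueness holds because an
  H-algebra homomorphism is determined by its values on the 1 \<otimes> p, and these by the values
  for p in M.\<close>

lemma mu_H_hom_tens:
  shows mu_H_alg_hom: "mu_H A n (free_mod A S) \<in> alg_hom H (base_change A H P) (base_change A H E)"
    and mu_H_tens: "\<And>h f. h \<in> carrier H \<Longrightarrow> f \<in> carrier (mpoly A S) \<Longrightarrow>
      mu_H A n (free_mod A S) (tens A H P h (Y_ident A S f)) =
        h \<odot>\<^bsub>base_change A H E\<^esub> mat_tens A n H (\<lambda>v\<in>{1..n} \<times> {1..n}. \<pi>H (subst_U A n S arr f v))"
proof -
  note modP = algebra_module[OF algP] and modH = algebra_module[OF algH] and nP = algebra_nalg[OF algP]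
  interpret H': cring H by (rule algebra_cring[OF algH])
  let ?W = "\<lambda>f. \<lambda>v\<in>V. \<pi>H (sU f v)" and ?BP = "base_change A H P" and ?BE = "base_change A H E"
  let ?L = "H_ideal A n M"
  obtain \<kappa> where k: "\<kappa> \<in> alg_hom A P (mpoly A S)" "\<And>f. f \<in> carrier (mpoly A S) \<Longrightarrow> \<kappa> (\<iota> f) = f"
    using Y_ident_inv by blast
  have W: "?W \<in> alg_hom A (mpoly A S) (mat_alg n H)" by (rule subst_H(1))
  have Wk: "(\<lambda>p. ?W (\<kappa> p)) \<in> alg_hom A P (mat_alg n H)" by (rule alg_hom_comp[OF k(1) W])
  obtain g where g: "g \<in> extensional (carrier ?BP)" "g \<in> alg_hom H ?BP ?BE"
    "\<And>h p. h \<in> carrier H \<Longrightarrow> p \<in> carrier P \<Longrightarrow> g (tens A H P h p) = h \<odot>\<^bsub>?BE\<^esub> mat_tens A n H (?W (\<kappa> p))"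
    using mat_base_change_lift[OF algH nP Wk] by blast
  have modBE: "module H ?BE" by (rule module_base_change[OF algH modE])
  interpret BE: module H ?BE by (rule modBE)
  have pr: "(+>\<^bsub>Sg\<^esub>) ?L \<in> alg_hom A Sg H" unfolding Halg_def by (rule quot_proj_alg_hom[OF algS H_ideal_ideal])
  let ?h = "\<lambda>p. \<lambda>v\<in>V. ?L +>\<^bsub>Sg\<^esub> p v"
  have hm: "?h \<in> alg_hom A (mat_alg n Sg) (mat_alg n H)" by (rule mat_map_alg_hom[OF algS algH pr])
  have inc: "sym_inc A M x \<in> carrier P" if "x \<in> carrier M" for x by (rule lin_closed[OF sym_inc_lin[OF modM] that])
  \<comment> \<open>Both sides are linear in x, and for x = Y_s the substitution into a single
    variable gives the generic matrix itself.\<close>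
  have val: "?W (\<kappa> (sym_inc A M x)) = ?h (gen_mat A n S x)" if x: "x \<in> carrier M" for x
  proof (rule free_ext[OF module_mat_alg[OF modH], where f = "\<lambda>x. ?W (\<kappa> (sym_inc A M x))" and g = "\<lambda>x. ?h (gen_mat A n S x)",
        OF _ _ _ x])
    show "(\<lambda>x. ?W (\<kappa> (sym_inc A M x))) \<in> lin A M (mat_alg n H)"
      by (rule lin_comp[OF sym_inc_lin[OF modM] alg_hom_lin[OF Wk]])
    show "(\<lambda>x. ?h (gen_mat A n S x)) \<in> lin A M (mat_alg n H)"
      by (rule lin_comp[OF gen_mat_lin alg_hom_lin[OF hm]])
    fix s assume s: "s \<in> S"
    have "\<kappa> (sym_inc A M (unit_vec A s)) = ring.indexed_var A s"
      unfolding Y_ident_iso(2)[OF s, symmetric] by (rule k(2)[OF indexed_var_closed[OF crA s]])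
    then have "?W (\<kappa> (sym_inc A M (unit_vec A s))) = (\<lambda>v\<in>V. \<pi>H (U_mat A n s v))"
      using subst_H(2)[OF s] by (simp only:)
    also have "\<dots> = ?h (gen_mat A n S (unit_vec A s))"
      unfolding U_ident_U_mat[OF s, symmetric] by (rule restrict_ext) (simp only: restrict_apply if_True)
    finally show "?W (\<kappa> (sym_inc A M (unit_vec A s))) = ?h (gen_mat A n S (unit_vec A s))" .
  qed
  have rhs: "tensor_map A H E (\<lambda>\<sigma>. ?L +>\<^bsub>Sg\<^esub> \<sigma>) (\<lambda>t. t) (mu A n M (tens A Sg M \<one>\<^bsub>Sg\<^esub> x)) =
      mat_tens A n H (?h (gen_mat A n S x))" if x: "x \<in> carrier M" for x
    unfolding mu_one_tens[OF x]
    by (rule tensor_map_mat_tens[OF algS algH alg_hom_lin[OF pr] lin_closed[OF gen_mat_lin x]])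
  have g1: "g (tens A H P \<one>\<^bsub>H\<^esub> (sym_inc A M x)) = mat_tens A n H (?h (gen_mat A n S x))" if x: "x \<in> carrier M" for x
    unfolding g(3)[OF H'.one_closed inc[OF x]] val[OF x]
    by (rule BE.smult_one[OF mat_tens_closed[OF algH lin_closed[OF alg_hom_lin[OF hm] lin_closed[OF gen_mat_lin x]]]])
  have mu: "mu_H A n M = g"
    unfolding mu_H_def Let_def
  proof (rule the_equality)
    show "g \<in> extensional (carrier ?BP) \<and> g \<in> alg_hom H ?BP ?BE \<and>
        (\<forall>x\<in>carrier M. g (tens A H P \<one>\<^bsub>H\<^esub> (sym_inc A M x)) =
          tensor_map A H E (\<lambda>\<sigma>. ?L +>\<^bsub>Sg\<^esub> \<sigma>) (\<lambda>t. t) (mu A n M (tens A Sg M \<one>\<^bsub>Sg\<^esub> x)))"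
      by (intro conjI ballI g(1,2)) (simp only: g1 rhs)
    fix g' assume g': "g' \<in> extensional (carrier ?BP) \<and> g' \<in> alg_hom H ?BP ?BE \<and>
        (\<forall>x\<in>carrier M. g' (tens A H P \<one>\<^bsub>H\<^esub> (sym_inc A M x)) =
          tensor_map A H E (\<lambda>\<sigma>. ?L +>\<^bsub>Sg\<^esub> \<sigma>) (\<lambda>t. t) (mu A n M (tens A Sg M \<one>\<^bsub>Sg\<^esub> x)))"
    note gh = g'[THEN conjunct2, THEN conjunct1]
    have g1': "g' (tens A H P \<one>\<^bsub>H\<^esub> (sym_inc A M x)) = g (tens A H P \<one>\<^bsub>H\<^esub> (sym_inc A M x))" if x: "x \<in> carrier M" for x
      using g'[THEN conjunct2, THEN conjunct2, THEN bspec, OF x] by (simp only: g1[OF x] rhs[OF x])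
    \<comment> \<open>Restricting scalars to A and composing with p \<mapsto> 1 \<otimes> p gives
      homomorphisms of A-algebras on Sym(M), for which agreement on M suffices.\<close>
    note i = base_change_incl_alg_hom[OF algH nP]
    note r = alg_hom_restr[OF algH module_base_change[OF algH modP]]
    have e: "g' (tens A H P \<one>\<^bsub>H\<^esub> p) = g (tens A H P \<one>\<^bsub>H\<^esub> p)" if p: "p \<in> carrier P" for p
      by (rule sym_hom_ext[OF modM module_restr[OF algH modBE], where f = "\<lambda>p. g' (tens A H P \<one>\<^bsub>H\<^esub> p)" and
            g = "\<lambda>p. g (tens A H P \<one>\<^bsub>H\<^esub> p)", OF alg_hom_comp[OF i r[OF gh]] alg_hom_comp[OF i r[OF g(2)]] g1' p])
    show "g' = g"
    proof (rule extensionalityI[OF g'[THEN conjunct1] g(1)])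
      fix z assume z: "z \<in> carrier ?BP"
      show "g' z = g z"
        by (rule base_change_ext[OF algH modP alg_hom_lin[OF gh] alg_hom_lin[OF g(2)] _ z]) (rule e)
    qed
  qed
  show "mu_H A n M \<in> alg_hom H ?BP ?BE" unfolding mu by (rule g(2))
  show "mu_H A n M (tens A H P h (\<iota> f)) = h \<odot>\<^bsub>?BE\<^esub> mat_tens A n H (?W f)"
    if hf: "h \<in> carrier H" "f \<in> carrier (mpoly A S)" for h f
    unfolding mu g(3)[OF hf(1) lin_closed[OF alg_hom_lin[OF Y_ident_hom] hf(2)]] k(2)[OF hf(2)] ..
qed

lemma mat_coord_smult_mat_tens:
  assumes "algebra A C" "c \<in> carrier C" "p \<in> carrier (mat_alg n C)" "i \<in> {1..n}" "j \<in> {1..n}"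
  shows "mat_coord A C n i j (c \<odot>\<^bsub>base_change A C E\<^esub> mat_tens A n C p) = c \<otimes>\<^bsub>C\<^esub> p (i, j)"
  using lin_smult[OF mat_coord_lin[where i = i, OF assms(1,5)] assms(2) mat_tens_closed[OF assms(1,3)]]
  unfolding mat_coord_mat_tens[OF assms(1,3-5)] self_mod_simps .

section \<open>The algebra H_R\<close>

context
  fixes I :: "('s multiset \<Rightarrow> 'a) set"
  assumes idI: "ideal I (mpoly A S)"
begin

private abbreviation (input) "J \<equiv> Y_ident A S ` I"
private abbreviation (input) "K \<equiv> HR A n (free_mod A S) (Y_ident A S ` I)"
private abbreviation (input) "\<pi>R \<equiv> \<lambda>h. HR_ideal A n (free_mod A S) (Y_ident A S ` I) +>\<^bsub>Halg A n (free_mod A S)\<^esub> h"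
private abbreviation (input) "\<pi>K \<equiv> \<lambda>p. HR_ideal A n (free_mod A S) (Y_ident A S ` I) +>\<^bsub>Halg A n (free_mod A S)\<^esub>
  (H_ideal A n (free_mod A S) +>\<^bsub>Sig A n (free_mod A S)\<^esub> U_ident A n S p)"
private abbreviation (input) "R \<equiv> quot (sym_alg A (free_mod A S)) (Y_ident A S ` I)"

lemma I_carrier: "f \<in> I \<Longrightarrow> f \<in> carrier (mpoly A S)"
  by (rule additive_subgroup.a_Hcarr[OF ideal.axioms(1)[OF idI]])

lemma ideal_Y_image: "ideal (Y_ident A S ` I) (sym_alg A (free_mod A S))"
  by (rule ideal_image_surj[OF algP0 algP surj_ker_zero[OF algP0 algP Y_ident_iso(1)] idI])

lemma I2_gens_alt: "I2_gens A n S arr I = {subst_U A n S arr f v | f v. f \<in> I \<and> v \<in> {1..n} \<times> {1..n}}"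
  unfolding I2_gens_def by blast

lemma I2_gens_closed: "I2_gens A n S arr I \<subseteq> carrier (AU A n S)"
proof (rule subsetI)
  fix g assume "g \<in> I2_gens A n S arr I"
  then obtain f v where "g = sU f v" "f \<in> I" "v \<in> V" unfolding I2_gens_alt by (elim CollectE exE conjE)
  then show "g \<in> carrier B" using subst_U_entry_closed[OF I_carrier] by (simp only:)
qed

text \<open>On h \<otimes> f the entries of the image are h times the entries of the matrix f((U)),
  so pure tensors yield only multiples of the generators, and general tensors only sums of these.
  Taking h = 1 produces every generator.\<close>

lemma HR_ideal_eq: "HR_ideal A n (free_mod A S) (Y_ident A S ` I) = Idl\<^bsub>H\<^esub> (\<pi>H ` I2_gens A n S arr I)"
proof -
  note modP = algebra_module[OF algP] and modH = algebra_module[OF algH]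
  note crH = algebra_cring[OF algH]
  interpret H': cring H by (rule crH)
  \<comment> \<open>The ideal J as a module in its own right. Its tensor product with H need not
    embed into H \<otimes> Sym(M), so elements are followed through the induced map
    \<open>?t\<close>.\<close>
  let ?PJ = "P\<lparr>carrier := J\<rparr>" and ?BE = "base_change A H E"
  note subJ = ideal_submodule[OF algP ideal_Y_image]
  note modPJ = submodule.submodule_is_module[OF subJ modP]
  have JP: "p \<in> carrier P" if "p \<in> J" for p by (rule additive_subgroup.a_Hcarr[OF ideal.axioms(1)[OF ideal_Y_image] that])
  have inc: "(\<lambda>p. p) \<in> lin A ?PJ P" by (rule linI) (simp_all add: JP)
  note tm = tensor_map[OF modH modPJ modH modP lin_id inc]
  let ?t = "tensor_map A H P (\<lambda>h. h) (\<lambda>p. p)"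
  let ?u = "\<lambda>z. mu_H A n M (?t z)"
  have uB: "?u z \<in> carrier ?BE" if "z \<in> carrier (base_change A H ?PJ)" for z
    using lin_closed[OF alg_hom_lin[OF mu_H_alg_hom], of "?t z"] lin_closed[OF tm(1), of z] that by (simp only: base_change_simps)
  have uadd: "?u (z \<oplus>\<^bsub>tensor A H ?PJ\<^esub> w) = ?u z \<oplus>\<^bsub>?BE\<^esub> ?u w" if "z \<in> carrier (tensor A H ?PJ)" "w \<in> carrier (tensor A H ?PJ)" for z w
    unfolding lin_add[OF tm(1) that]
    using lin_add[OF alg_hom_lin[OF mu_H_alg_hom], of "?t z" "?t w"] lin_closed[OF tm(1) that(1)] lin_closed[OF tm(1) that(2)]
    by (simp only: base_change_simps)
  have W: "(\<lambda>v\<in>V. \<pi>H (sU f v)) \<in> carrier (mat_alg n H)" if "f \<in> carrier (mpoly A S)" for f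
    by (rule lin_closed[OF alg_hom_lin[OF subst_H(1)] that])
  have utens: "mat_coord A H n i j (?u (tens A H ?PJ h (\<iota> f))) = h \<otimes>\<^bsub>H\<^esub> \<pi>H (sU f (i, j))"
    if h: "h \<in> carrier H" and f: "f \<in> I" and ij: "i \<in> {1..n}" "j \<in> {1..n}" for h f i j
  proof -
    have "\<iota> f \<in> carrier ?PJ" using f by simp
    note t = tm(2)[OF h this]
    show ?thesis
      unfolding t mu_H_tens[OF h I_carrier[OF f]] mat_coord_smult_mat_tens[OF algH h W[OF I_carrier[OF f]] ij]
        restrict_apply'[OF SigmaI[OF ij]] ..
  qed
  let ?G = "\<pi>H ` I2_gens A n S arr I"
  let ?G' = "{(\<lambda>(i, j). mat_coord A H n i j) v (?u z) | v z. v \<in> V \<and> z \<in> carrier (base_change A H ?PJ)}"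
  have Gc: "?G \<subseteq> carrier H"
    by (rule image_subsetI) (rule lin_closed[OF alg_hom_lin[OF \<pi>H_hom] subsetD[OF I2_gens_closed]])
  have G'c: "?G' \<subseteq> carrier H"
  proof (rule subsetI)
    fix c assume "c \<in> ?G'"
    then obtain v z where "c = (\<lambda>(i, j). mat_coord A H n i j) v (?u z)" "v \<in> V" "z \<in> carrier (base_change A H ?PJ)"
      by (elim CollectE exE conjE)
    then show "c \<in> carrier H" using fin_basis_coord_closed[OF fin_basis_mat_coord[OF algH] _ uB] by (simp only:)
  qed
  have iG: "ideal (Idl\<^bsub>H\<^esub> ?G) H" by (rule H'.genideal_ideal[OF Gc])
  note aG = additive_subgroup.a_closed[OF ideal.axioms(1)[OF iG]]
  have main: "mat_coord A H n i j (?u z) \<in> Idl\<^bsub>H\<^esub> ?G"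
    if ij: "i \<in> {1..n}" "j \<in> {1..n}" and z: "z \<in> carrier (tensor A H ?PJ)" for i j z
  proof (rule tensor_induct[where Pr = "\<lambda>z. mat_coord A H n i j (?u z) \<in> Idl\<^bsub>H\<^esub> ?G", OF modH modPJ z])
    fix h p assume h: "h \<in> carrier H" and "p \<in> carrier ?PJ"
    then have "p \<in> J" by simp
    then obtain f where f: "p = \<iota> f" "f \<in> I" by (rule imageE)
    have "\<pi>H (sU f (i, j)) \<in> Idl\<^bsub>H\<^esub> ?G"
      by (rule subsetD[OF H'.genideal_self[OF Gc]], rule imageI) (unfold I2_gens_alt, use f(2) ij in blast)
    then show "mat_coord A H n i j (?u (tens A H ?PJ h p)) \<in> Idl\<^bsub>H\<^esub> ?G"
      unfolding f(1) utens[OF h f(2) ij] by (rule ideal.I_l_closed[OF iG _ h])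
  next
    fix z w assume z: "z \<in> carrier (tensor A H ?PJ)" and w: "w \<in> carrier (tensor A H ?PJ)"
      and zI: "mat_coord A H n i j (?u z) \<in> Idl\<^bsub>H\<^esub> ?G" and wI: "mat_coord A H n i j (?u w) \<in> Idl\<^bsub>H\<^esub> ?G"
    have c: "?u z \<in> carrier ?BE" "?u w \<in> carrier ?BE" using uB z w by (simp_all only: base_change_simps)
    show "mat_coord A H n i j (?u (z \<oplus>\<^bsub>tensor A H ?PJ\<^esub> w)) \<in> Idl\<^bsub>H\<^esub> ?G"
      unfolding uadd[OF z w] lin_add[OF mat_coord_lin[OF algH ij(2)] c] self_mod_simps by (rule aG[OF zI wI])
  qed
  have "HR_ideal A n M J = Idl\<^bsub>H\<^esub> ?G'"
    unfolding HR_ideal_def Let_def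
    by (rule Z_map_fin_basis[OF crH module_base_change[OF algH modE] fin_basis_mat_coord[OF algH] uB])
  also have "\<dots> = Idl\<^bsub>H\<^esub> ?G"
  proof
    have "?G' \<subseteq> Idl\<^bsub>H\<^esub> ?G"
    proof (rule subsetI)
      fix c assume "c \<in> ?G'"
      then obtain v z where vz: "c = (\<lambda>(i, j). mat_coord A H n i j) v (?u z)" "v \<in> V" "z \<in> carrier (base_change A H ?PJ)"
        by (elim CollectE exE conjE)
      obtain i j where ij: "v = (i, j)" "i \<in> {1..n}" "j \<in> {1..n}" using vz(2) by (rule SigmaE)
      have z: "z \<in> carrier (tensor A H ?PJ)" using vz(3) by (simp only: base_change_simps)
      show "c \<in> Idl\<^bsub>H\<^esub> ?G" unfolding vz(1) ij(1) case_prod_conv by (rule main[OF ij(2,3) z])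
    qed
    then show "Idl\<^bsub>H\<^esub> ?G' \<subseteq> Idl\<^bsub>H\<^esub> ?G" by (rule H'.genideal_minimal[OF iG])
    have "?G \<subseteq> Idl\<^bsub>H\<^esub> ?G'"
    proof (rule image_subsetI)
      fix g assume "g \<in> I2_gens A n S arr I"
      then obtain f v where g: "g = sU f v" "f \<in> I" "v \<in> V" unfolding I2_gens_alt by (elim CollectE exE conjE)
      obtain i j where ij: "v = (i, j)" "i \<in> {1..n}" "j \<in> {1..n}" using g(3) by (rule SigmaE)
      have fJ: "\<iota> f \<in> carrier ?PJ" using g(2) by simp
      have "tens A H ?PJ \<one>\<^bsub>H\<^esub> (\<iota> f) \<in> carrier (base_change A H ?PJ)"
        unfolding base_change_simps by (rule tens_closed[OF modH modPJ H'.one_closed fJ])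
      then have "(\<lambda>(i, j). mat_coord A H n i j) v (?u (tens A H ?PJ \<one>\<^bsub>H\<^esub> (\<iota> f))) \<in> ?G'"
        using g(3) by blast
      then have "mat_coord A H n i j (?u (tens A H ?PJ \<one>\<^bsub>H\<^esub> (\<iota> f))) \<in> ?G'"
        unfolding ij(1) case_prod_conv .
      then have "\<one>\<^bsub>H\<^esub> \<otimes>\<^bsub>H\<^esub> \<pi>H (sU f (i, j)) \<in> Idl\<^bsub>H\<^esub> ?G'"
        unfolding utens[OF H'.one_closed g(2) ij(2,3)] by (rule subsetD[OF H'.genideal_self[OF G'c]])
      moreover have "\<pi>H (sU f (i, j)) \<in> carrier H"
        by (rule lin_closed[OF alg_hom_lin[OF \<pi>H_hom] subst_U_entry_closed[OF I_carrier[OF g(2)] SigmaI[OF ij(2,3)]]])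
      ultimately show "\<pi>H g \<in> Idl\<^bsub>H\<^esub> ?G'" unfolding g(1) ij(1) by (simp only: H'.l_one)
    qed
    then show "Idl\<^bsub>H\<^esub> ?G \<subseteq> Idl\<^bsub>H\<^esub> ?G'" by (rule H'.genideal_minimal[OF H'.genideal_ideal[OF G'c]])
  qed
  finally show ?thesis .
qed

lemma HR_ideal_ideal: "ideal (HR_ideal A n (free_mod A S) (Y_ident A S ` I)) H"
proof -
  interpret H': cring H by (rule algebra_cring[OF algH])
  have "\<pi>H ` I2_gens A n S arr I \<subseteq> carrier H"
    by (rule image_subsetI) (rule lin_closed[OF alg_hom_lin[OF \<pi>H_hom] subsetD[OF I2_gens_closed]])
  then show ?thesis unfolding HR_ideal_eq by (rule H'.genideal_ideal)
qed

lemma algebra_HR: "algebra A (HR A n (free_mod A S) (Y_ident A S ` I))"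
  unfolding HR_def by (rule algebra_quot[OF algH HR_ideal_ideal])

private lemmas algK = algebra_HR

lemma surj_ker_HR: "surj_ker A (AU A n S) K \<pi>K (Idl\<^bsub>B\<^esub> (I1_gens A n S \<union> I2_gens A n S arr I))"
  using surj_ker_step[OF algB algH surj_ker_H I1_gens_closed I2_gens_closed]
  unfolding HR_ideal_eq[symmetric] HR_def[symmetric] .

private lemmas \<pi>K_hom = surj_kerD(1)[OF surj_ker_HR]
private lemmas \<pi>K_kill = surj_ker_kill[OF surj_ker_HR Un_least[OF I1_gens_closed I2_gens_closed]]
private lemma subst_K:
  "(\<lambda>f. \<lambda>v\<in>{1..n} \<times> {1..n}. \<pi>K (subst_U A n S arr f v)) \<in> alg_hom A (mpoly A S) (mat_alg n K)"
  by (rule subst_U_hom(1)[OF algK \<pi>K_hom]) (rule \<pi>K_kill[OF UnI1])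

text \<open>In contrast to \<open>mu_H\<close>, the homomorphism into matrices has to factor through
  R, which it does because f((U)) vanishes over H_R for f in I. The description of
  \<open>mu_HR\<close> prescribes values through \<open>mu_H\<close> on all h \<otimes> p, so the
  candidate is compared with \<open>mu_H\<close> for arbitrary h.\<close>

lemma mu_HR_hom_tens:
  shows mu_HR_alg_hom: "mu_HR A n (free_mod A S) (Y_ident A S ` I) \<in> alg_hom K (base_change A K R) (base_change A K E)"
    and mu_HR_tens: "\<And>k f. k \<in> carrier K \<Longrightarrow> f \<in> carrier (mpoly A S) \<Longrightarrow>
      mu_HR A n (free_mod A S) (Y_ident A S ` I) (tens A K R k (Y_ident A S ` I +>\<^bsub>P\<^esub> Y_ident A S f)) =
        k \<odot>\<^bsub>base_change A K E\<^esub> mat_tens A n K (\<lambda>v\<in>{1..n} \<times> {1..n}. \<pi>K (subst_U A n S arr f v))"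
proof -
  note modK = algebra_module[OF algK]
  note algR = algebra_quot[OF algP ideal_Y_image]
  note modR = algebra_module[OF algR]
  interpret H': cring H by (rule algebra_cring[OF algH])
  interpret K': cring K by (rule algebra_cring[OF algK])
  let ?W = "\<lambda>f. \<lambda>v\<in>V. \<pi>K (sU f v)" and ?BR = "base_change A K R" and ?BE = "base_change A K E"
  obtain \<kappa> where k: "\<kappa> \<in> alg_hom A P (mpoly A S)" "\<And>f. f \<in> carrier (mpoly A S) \<Longrightarrow> \<kappa> (\<iota> f) = f"
    "\<And>p. p \<in> carrier P \<Longrightarrow> \<iota> (\<kappa> p) = p"
    using Y_ident_inv by blast
  have kc: "\<kappa> p \<in> carrier (mpoly A S)" if "p \<in> carrier P" for p by (rule lin_closed[OF alg_hom_lin[OF k(1)] that])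
  have W: "?W \<in> alg_hom A (mpoly A S) (mat_alg n K)" by (rule subst_K)
  note Wc = lin_closed[OF alg_hom_lin[OF W]]
  have Wk: "(\<lambda>p. ?W (\<kappa> p)) \<in> alg_hom A P (mat_alg n K)" by (rule alg_hom_comp[OF k(1) W])
  \<comment> \<open>The entries of f((U)) for f in I are generators of I_2 and therefore die in
    H_R.\<close>
  have ker: "?W (\<kappa> p) = \<zero>\<^bsub>mat_alg n K\<^esub>" if pJ: "p \<in> J" for p
  proof -
    obtain f where f: "p = \<iota> f" "f \<in> I" using pJ by (rule imageE)
    show ?thesis
      unfolding f(1) k(2)[OF I_carrier[OF f(2)]] mat_alg_simps(2)
      by (rule restrict_ext, rule \<pi>K_kill, rule UnI2) (unfold I2_gens_alt, use f(2) in blast)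
  qed
  obtain \<psi> where psi: "\<psi> \<in> alg_hom A R (mat_alg n K)" "\<And>p. p \<in> carrier P \<Longrightarrow> \<psi> (J +>\<^bsub>P\<^esub> p) = ?W (\<kappa> p)"
    using quot_factor[OF algP ideal_Y_image module_mat_alg[OF modK] Wk ker] by blast
  obtain g where g: "g \<in> extensional (carrier ?BR)" "g \<in> alg_hom K ?BR ?BE"
    "\<And>h p. h \<in> carrier K \<Longrightarrow> p \<in> carrier R \<Longrightarrow> g (tens A K R h p) = h \<odot>\<^bsub>?BE\<^esub> mat_tens A n K (\<psi> p)"
    using mat_base_change_lift[OF algK algebra_nalg[OF algR] psi(1)] by blast
  have JR: "J +>\<^bsub>P\<^esub> p \<in> carrier R" if "p \<in> carrier P" for p unfolding quot_carrier by (rule imageI[OF that])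
  have gt: "g (tens A K R c (J +>\<^bsub>P\<^esub> p)) = c \<odot>\<^bsub>?BE\<^esub> mat_tens A n K (?W (\<kappa> p))" if "c \<in> carrier K" "p \<in> carrier P" for c p
    unfolding g(3)[OF that(1) JR[OF that(2)]] psi(2)[OF that(2)] ..
  have pr: "\<pi>R \<in> alg_hom A H K" unfolding HR_def by (rule quot_proj_alg_hom[OF algH HR_ideal_ideal])
  note prc = lin_closed[OF alg_hom_lin[OF pr]]
  have WH: "(\<lambda>v\<in>V. \<pi>H (sU f v)) \<in> carrier (mat_alg n H)" if "f \<in> carrier (mpoly A S)" for f
    by (rule lin_closed[OF alg_hom_lin[OF subst_H(1)] that])
  have rhs: "tensor_map A K E \<pi>R (\<lambda>t. t) (mu_H A n M (tens A H P h p)) = g (tens A K R (\<pi>R h) (J +>\<^bsub>P\<^esub> p))"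
    if h: "h \<in> carrier H" and p: "p \<in> carrier P" for h p
  proof -
    let ?f = "\<kappa> p"
    note f = kc[OF p]
    \<comment> \<open>Multiplication by h is moved inside the matrix before projecting, because
      \<open>tensor_map_mat_tens\<close> expects the image of a matrix.\<close>
    have q: "(\<lambda>v\<in>V. h \<otimes>\<^bsub>H\<^esub> (\<lambda>v\<in>V. \<pi>H (sU ?f v)) v) \<in> carrier (mat_alg n H)"
      by (rule matI) (rule H'.m_closed[OF h mat_closed[OF WH[OF f]]])
    have "mu_H A n M (tens A H P h p) = mu_H A n M (tens A H P h (\<iota> ?f))" unfolding k(3)[OF p] ..
    also have "\<dots> = mat_tens A n H (\<lambda>v\<in>V. h \<otimes>\<^bsub>H\<^esub> (\<lambda>v\<in>V. \<pi>H (sU ?f v)) v)"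
      unfolding mu_H_tens[OF h f] by (rule mat_tens_smult[OF algH h WH[OF f]])
    finally have "tensor_map A K E \<pi>R (\<lambda>t. t) (mu_H A n M (tens A H P h p)) =
        mat_tens A n K (\<lambda>v\<in>V. \<pi>R ((\<lambda>v\<in>V. h \<otimes>\<^bsub>H\<^esub> (\<lambda>v\<in>V. \<pi>H (sU ?f v)) v) v))"
      using tensor_map_mat_tens[OF algH algK alg_hom_lin[OF pr] q] by (simp only:)
    also have "(\<lambda>v\<in>V. \<pi>R ((\<lambda>v\<in>V. h \<otimes>\<^bsub>H\<^esub> (\<lambda>v\<in>V. \<pi>H (sU ?f v)) v) v)) = (\<lambda>v\<in>V. \<pi>R h \<otimes>\<^bsub>K\<^esub> ?W ?f v)"
    proof (rule restrict_ext)
      fix v assume v: "v \<in> V"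
      note c = lin_closed[OF alg_hom_lin[OF \<pi>H_hom] subst_U_entry_closed[OF f v]]
      show "\<pi>R ((\<lambda>v\<in>V. h \<otimes>\<^bsub>H\<^esub> (\<lambda>v\<in>V. \<pi>H (sU ?f v)) v) v) = \<pi>R h \<otimes>\<^bsub>K\<^esub> ?W ?f v"
        unfolding restrict_apply'[OF v] by (rule alg_hom_mult[OF pr h c])
    qed
    also have "mat_tens A n K \<dots> = \<pi>R h \<odot>\<^bsub>?BE\<^esub> mat_tens A n K (?W ?f)"
      by (rule mat_tens_smult[OF algK prc[OF h] Wc[OF f], symmetric])
    finally show ?thesis unfolding gt[OF prc[OF h] p] .
  qed
  have mu: "mu_HR A n M J = g"
    unfolding mu_HR_def Let_def
  proof (rule the_equality)
    show "g \<in> extensional (carrier ?BR) \<and> g \<in> alg_hom K ?BR ?BE \<and>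
        (\<forall>h\<in>carrier H. \<forall>p\<in>carrier P. g (tens A K R (\<pi>R h) (J +>\<^bsub>P\<^esub> p)) =
          tensor_map A K E \<pi>R (\<lambda>t. t) (mu_H A n M (tens A H P h p)))"
      by (intro conjI ballI g(1,2)) (simp only: rhs)
    fix g' assume g': "g' \<in> extensional (carrier ?BR) \<and> g' \<in> alg_hom K ?BR ?BE \<and>
        (\<forall>h\<in>carrier H. \<forall>p\<in>carrier P. g' (tens A K R (\<pi>R h) (J +>\<^bsub>P\<^esub> p)) =
          tensor_map A K E \<pi>R (\<lambda>t. t) (mu_H A n M (tens A H P h p)))"
    note gh = g'[THEN conjunct2, THEN conjunct1]
    have e: "g' (tens A K R \<one>\<^bsub>K\<^esub> r) = g (tens A K R \<one>\<^bsub>K\<^esub> r)" if r: "r \<in> carrier R" for r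
    proof -
      obtain p where p: "r = J +>\<^bsub>P\<^esub> p" "p \<in> carrier P" using r unfolding quot_carrier by (rule imageE)
      \<comment> \<open>The case h = 1 of the description is enough: the projection sends 1 to 1,
        and linearity over H_R recovers the other values.\<close>
      have "g' (tens A K R (\<pi>R \<one>\<^bsub>H\<^esub>) (J +>\<^bsub>P\<^esub> p)) = g (tens A K R (\<pi>R \<one>\<^bsub>H\<^esub>) (J +>\<^bsub>P\<^esub> p))"
        using g'[THEN conjunct2, THEN conjunct2, THEN bspec, OF H'.one_closed, THEN bspec, OF p(2)]
        unfolding rhs[OF H'.one_closed p(2)] .
      then show ?thesis unfolding p(1) alg_hom_one[OF pr] .
    qed
    show "g' = g"
    proof (rule extensionalityI[OF g'[THEN conjunct1] g(1)])
      fix z assume z: "z \<in> carrier ?BR"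
      show "g' z = g z"
        by (rule base_change_ext[OF algK modR alg_hom_lin[OF gh] alg_hom_lin[OF g(2)] _ z]) (rule e)
    qed
  qed
  show "mu_HR A n M J \<in> alg_hom K ?BR ?BE" unfolding mu by (rule g(2))
  show "mu_HR A n M J (tens A K R c (J +>\<^bsub>P\<^esub> \<iota> f)) = c \<odot>\<^bsub>?BE\<^esub> mat_tens A n K (?W f)"
    if cf: "c \<in> carrier K" "f \<in> carrier (mpoly A S)" for c f
    unfolding mu gt[OF cf(1) lin_closed[OF alg_hom_lin[OF Y_ident_hom] cf(2)]] k(2)[OF cf(2)] ..
qed

section \<open>The algebra H_R^beta\<close>

context
  fixes \<beta> :: "(nat \<Rightarrow> 'a) \<Rightarrow> 's multiset \<Rightarrow> 'a"
  assumes n1: "n \<ge> 1" and beta: "\<beta> \<in> lin A (FM A n) (mpoly A S)"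
begin

private abbreviation (input) "F \<equiv> FM A n"
private abbreviation (input) "\<beta>R \<equiv> \<lambda>x. Y_ident A S ` I +>\<^bsub>sym_alg A (free_mod A S)\<^esub> Y_ident A S (\<beta> x)"

private lemmas modF = module_free_mod[OF crA, of "{1..n}"]
private lemmas algR = algebra_quot[OF algP ideal_Y_image]
private lemmas betac = lin_closed[OF beta]

private lemma one_mem: "1 \<in> {1..n}"
  using n1 by simp

text \<open>Multiplying a matrix by T_1 leaves a single nonzero term in each coordinate, namely the
  entry in column 1.\<close>

lemma I3_gens_eq:
  "I3_gens A n S arr \<beta> = {subst_U A n S arr (\<beta> (unit_vec A k)) (i, 1) \<ominus>\<^bsub>AU A n S\<^esub> unit_vec (AU A n S) k i | k i.
     k \<in> {1..n} \<and> i \<in> {1..n}}"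
proof -
  note crB = algebra_cring[OF algB]
  interpret B': cring B by (rule crB)
  note mFB = module_free_mod[OF crB, of "{1..n}"] and mS = module_self_mod[OF crB]
  have "(mat_vec n B p (unit_vec B 1) \<ominus>\<^bsub>FM B n\<^esub> unit_vec B k) i = p (i, 1) \<ominus>\<^bsub>B\<^esub> unit_vec B k i"
    if p: "p \<in> carrier (mat_alg n B)" and k: "k \<in> {1..n}" and i: "i \<in> {1..n}" for p k i
  proof -
    have pe: "p (l, j) \<in> carrier B" if "l \<in> {1..n}" "j \<in> {1..n}" for l j
      by (rule mat_closed[OF p SigmaI[OF that]])
    have e: "mat_vec n B p (unit_vec B 1) l = p (l, 1)" if l: "l \<in> {1..n}" for l
    proof -
      have "mat_vec n B p (unit_vec B 1) l = finsum B (\<lambda>j. p (l, j) \<otimes>\<^bsub>B\<^esub> unit_vec B 1 j) {1..n}"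
        unfolding mat_vec_def if_P[OF l] ..
      also have "\<dots> = finsum B (\<lambda>j. if 1 = j then p (l, j) else \<zero>\<^bsub>B\<^esub>) {1..n}"
      proof (rule B'.finsum_cong'[OF refl])
        show "(\<lambda>j. if 1 = j then p (l, j) else \<zero>\<^bsub>B\<^esub>) \<in> {1..n} \<rightarrow> carrier B"
          using pe[OF l] by (simp del: One_nat_def)
        fix j assume j: "j \<in> {1..n}"
        show "p (l, j) \<otimes>\<^bsub>B\<^esub> unit_vec B 1 j = (if 1 = j then p (l, j) else \<zero>\<^bsub>B\<^esub>)"
        proof (cases "1 = j")
          case True
          show ?thesis unfolding if_P[OF True] unit_vec_def if_P[OF True[symmetric]] by (rule B'.r_one[OF pe[OF l j]])
        next
          case False
          show ?thesis unfolding if_not_P[OF False] unit_vec_def if_not_P[OF not_sym[OF False]] by (rule B'.r_null[OF pe[OF l j]])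
        qed
      qed
      also have "\<dots> = p (l, 1)"
        by (rule B'.finsum_singleton[OF one_mem finite_atLeastAtMost]) (rule Pi_I, rule pe[OF l])
      finally show ?thesis .
    qed
    have o: "mat_vec n B p (unit_vec B 1) l = \<zero>\<^bsub>B\<^esub>" if "l \<notin> {1..n}" for l
      unfolding mat_vec_def if_not_P[OF that] ..
    have mv: "mat_vec n B p (unit_vec B 1) \<in> carrier (FM B n)"
    proof (rule free_modI)
      show "mat_vec n B p (unit_vec B 1) l \<in> carrier B" for l
      proof (cases "l \<in> {1..n}")
        case True
        show ?thesis unfolding e[OF True] by (rule pe[OF True one_mem])
      next
        case False
        show ?thesis unfolding o[OF False] by (rule B'.zero_closed)
      qed
      show "mat_vec n B p (unit_vec B 1) l = \<zero>\<^bsub>B\<^esub>" if "l \<notin> {1..n}" for l by (rule o[OF that])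
      show "finite {l. mat_vec n B p (unit_vec B 1) l \<noteq> \<zero>\<^bsub>B\<^esub>}"
        by (rule finite_subset[of _ "{1..n}"]) (use o in blast, rule finite_atLeastAtMost)
    qed
    \<comment> \<open>The coordinate functional takes values in \<open>self_mod\<close>, whose
      subtraction is that of the ring.\<close>
    have am: "a_minus (self_mod B) = a_minus B" by (rule a_minus_cong) simp_all
    show ?thesis
      using lin_minus[OF mFB mS coeff_lin[OF crB] mv unit_vec_closed[OF crB k], of i] unfolding e[OF i] am .
  qed
  note gen = this[OF subst_U_closed[OF betac[OF unit_vec_closed[OF crA]]]]
  show ?thesis
    unfolding I3_gens_def Let_def by (rule Collect_cong) (use gen in metis)
qed

lemma I3_gens_closed: "I3_gens A n S arr \<beta> \<subseteq> carrier (AU A n S)"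
proof (rule subsetI)
  note crB = algebra_cring[OF algB]
  interpret B': cring B by (rule crB)
  fix g assume "g \<in> I3_gens A n S arr \<beta>"
  then obtain k i where g: "g = sU (\<beta> (unit_vec A k)) (i, 1) \<ominus>\<^bsub>B\<^esub> unit_vec B k i" "k \<in> {1..n}" "i \<in> {1..n}"
    unfolding I3_gens_eq by (elim CollectE exE conjE)
  show "g \<in> carrier B"
    unfolding g(1)
    by (intro B'.minus_closed subst_U_entry_closed betac unit_vec_closed[OF crA g(2)] SigmaI g(3) one_mem
        free_mod_coeff[OF unit_vec_closed[OF crB g(2)]])
qed

text \<open>For z = c \<otimes> x the coordinate i of z - u z is c times \<open>D i x\<close>. Since
  \<open>D i\<close> is linear, everything is generated by its values at x = T_k, which up to sign
  are the images of the generators of I_3.\<close>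

lemma HRb_ideal_eq: "HRb_ideal A n (free_mod A S) (Y_ident A S ` I) \<beta>R = Idl\<^bsub>K\<^esub> (\<pi>K ` I3_gens A n S arr \<beta>)"
proof -
  note modK = algebra_module[OF algK] and modP = algebra_module[OF algP] and modR = algebra_module[OF algR]
  note crK = algebra_cring[OF algK]
  interpret K': cring K by (rule crK)
  interpret KA: module A K by (rule modK)
  let ?KF = "base_change A K F" and ?BE = "base_change A K E"
  let ?T = "tensor A K F"
  note modKF = module_base_change[OF algK modF]
  have pl: "(+>\<^bsub>P\<^esub>) J \<in> lin A P R" by (rule quot_proj_lin[OF modP ideal_submodule[OF algP ideal_Y_image]])
  have betaR: "\<beta>R \<in> lin A F R" by (rule lin_comp[OF lin_comp[OF beta alg_hom_lin[OF Y_ident_hom]] pl])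
  note t1 = tensor_map[OF modK modF modK modR lin_id betaR]
  note t2 = tensor_map[OF modK modE modK modF lin_id EndF_eval_lin[OF unit_vec_closed[OF crA one_mem]]]
  note muH = mu_HR_alg_hom and muT = mu_HR_tens
  let ?t1 = "tensor_map A K R (\<lambda>h. h) \<beta>R" and ?t2 = "tensor_map A K F (\<lambda>h. h) (\<lambda>g. g (unit_vec A 1))"
  let ?mu = "mu_HR A n (free_mod A S) J"
  let ?u = "\<lambda>z. ?t2 (?mu (?t1 z))"
  have mul: "?mu \<in> lin A (tensor A K R) (tensor A K E)"
    using lin_tensor_restr[OF algK modR alg_hom_lin[OF muH]] unfolding restr_base_change[OF algK modE] .
  have u: "?u \<in> lin A ?T ?T" by (rule lin_comp[OF lin_comp[OF t1(1) mul] t2(1)])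
  have uK: "?u z \<in> carrier ?KF" if "z \<in> carrier ?KF" for z
    using lin_closed[OF u] that by (simp only: base_change_simps)
  have mE: "?mu (?t1 z) \<in> carrier ?BE" if "z \<in> carrier ?T" for z
    using lin_closed[OF lin_comp[OF t1(1) mul] that] by (simp only: base_change_simps)
  note co = bc_coord[OF algK modF coeff_lin[OF crA]]
  let ?d = "\<lambda>i z. bc_coord A K (\<lambda>x. x i) z"
  \<comment> \<open>Three records share the carrier of H_R: the algebra, its
    \<open>self_mod\<close>, and the restriction of the latter to A. Their subtractions
    agree.\<close>
  have amK: "a_minus (self_mod K) = a_minus K" "a_minus (restr A K (self_mod K)) = a_minus K"
    by (rule a_minus_cong; simp)+
  have W: "(\<lambda>v\<in>V. \<pi>K (sU f v)) \<in> carrier (mat_alg n K)" if "f \<in> carrier (mpoly A S)" for f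
    by (rule lin_closed[OF alg_hom_lin[OF subst_K] that])
  txt \<open>\<open>D i x\<close> is the \<open>i\<close>-th coordinate of \<open>1 \<otimes> x - u (1 \<otimes> x)\<close>.\<close>
  define D where "D i x = (x i \<odot>\<^bsub>K\<^esub> \<one>\<^bsub>K\<^esub>) \<ominus>\<^bsub>K\<^esub> \<pi>K (sU (\<beta> x) (i, 1))" for i x
  have xi: "x i \<odot>\<^bsub>K\<^esub> \<one>\<^bsub>K\<^esub> \<in> carrier K" if "x \<in> carrier F" for x i
    by (rule KA.smult_closed[OF free_mod_coeff[OF that] K'.one_closed])
  have pi1: "\<pi>K (sU (\<beta> x) (i, 1)) \<in> carrier K" if "x \<in> carrier F" "i \<in> {1..n}" for x i
    by (rule lin_closed[OF alg_hom_lin[OF \<pi>K_hom] subst_U_entry_closed[OF betac[OF that(1)] SigmaI[OF that(2) one_mem]]])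
  have Dl: "D i \<in> lin A F K" if i: "i \<in> {1..n}" for i
  proof -
    have "(\<lambda>x. (\<lambda>v\<in>V. \<pi>K (sU (\<beta> x) v)) (i, 1)) \<in> lin A F K"
      by (rule lin_comp[OF lin_comp[OF beta alg_hom_lin[OF subst_K]] mat_entry_lin[OF SigmaI[OF i one_mem]]])
    then have "(\<lambda>x. \<pi>K (sU (\<beta> x) (i, 1))) \<in> lin A F K"
      unfolding restrict_apply'[OF SigmaI[OF i one_mem]] .
    from lin_minus_fun[OF modK lin_comp[OF coeff_lin[OF crA] smult_lin[OF modK K'.one_closed]] this]
    show ?thesis unfolding D_def[abs_def] .
  qed
  \<comment> \<open>The coordinate of u z is computed by \<open>mat_coord_first_column\<close>,
    which turns evaluation at T_1 into the entry (i, 1).\<close>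
  have du: "?d i (z \<ominus>\<^bsub>?KF\<^esub> ?u z) = ?d i z \<ominus>\<^bsub>K\<^esub> mat_coord A K n i 1 (?mu (?t1 z))" if z: "z \<in> carrier ?KF" for i z
  proof -
    have z': "z \<in> carrier ?T" using z by (simp only: base_change_simps)
    show ?thesis
      unfolding lin_minus[OF modKF module_self_mod[OF crK] co(1) z uK[OF z]] amK
        mat_coord_first_column[OF algK n1 mE[OF z']] ..
  qed
  have dt: "?d i (tens A K F k x) \<ominus>\<^bsub>K\<^esub> mat_coord A K n i 1 (?mu (?t1 (tens A K F k x))) = k \<otimes>\<^bsub>K\<^esub> D i x"
    if k: "k \<in> carrier K" and x: "x \<in> carrier F" and i: "i \<in> {1..n}" for i k x
  proof -
    have "mat_coord A K n i 1 (?mu (?t1 (tens A K F k x))) = k \<otimes>\<^bsub>K\<^esub> \<pi>K (sU (\<beta> x) (i, 1))"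
      unfolding t1(2)[OF k x] muT[OF k betac[OF x]] mat_coord_smult_mat_tens[OF algK k W[OF betac[OF x]] i one_mem]
        restrict_apply'[OF SigmaI[OF i one_mem]] ..
    then show ?thesis
      unfolding co(2)[OF k x] D_def
      using K'.r_distr[OF xi[OF x] K'.a_inv_closed[OF pi1[OF x i]] k] K'.r_minus[OF k pi1[OF x i]]
      by (simp only: a_minus_def)
  qed
  let ?G = "\<pi>K ` I3_gens A n S arr \<beta>"
  let ?G' = "{?d i (z \<ominus>\<^bsub>?KF\<^esub> ?u z) | i z. i \<in> {1..n} \<and> z \<in> carrier ?KF}"
  interpret KF: module K ?KF by (rule modKF)
  have Gc: "?G \<subseteq> carrier K"
    by (rule image_subsetI) (rule lin_closed[OF alg_hom_lin[OF \<pi>K_hom] subsetD[OF I3_gens_closed]])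
  have dcl: "?d i z \<in> carrier K" if "z \<in> carrier ?KF" for i z
    using lin_closed[OF co(1) that] by (simp only: self_mod_simps)
  have G'c: "?G' \<subseteq> carrier K"
  proof (rule subsetI)
    fix c assume "c \<in> ?G'"
    then obtain i z where c: "c = ?d i (z \<ominus>\<^bsub>?KF\<^esub> ?u z)" "z \<in> carrier ?KF" by (elim CollectE exE conjE)
    show "c \<in> carrier K" unfolding c(1) by (rule dcl[OF KF.minus_closed[OF c(2) uK[OF c(2)]]])
  qed
  have iG: "ideal (Idl\<^bsub>K\<^esub> ?G) K" by (rule K'.genideal_ideal[OF Gc])
  note sG = ideal_submodule[OF algK iG]
  note aG = additive_subgroup.a_closed[OF ideal.axioms(1)[OF iG]]
  \<comment> \<open>The sign arises because \<open>I3_gens\<close> subtracts T_k from the image of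
    T_1, whereas the ideal of zeros is that of id - u.\<close>
  have gen: "\<pi>K (sU (\<beta> (unit_vec A k)) (i, 1) \<ominus>\<^bsub>B\<^esub> unit_vec B k i) = \<ominus>\<^bsub>K\<^esub> D i (unit_vec A k)"
    if k: "k \<in> {1..n}" and i: "i \<in> {1..n}" for i k
  proof -
    note crB = algebra_cring[OF algB] and modB = algebra_module[OF algB]
    note uk = unit_vec_closed[OF crA k]
    have 1: "\<pi>K (unit_vec B k i) = unit_vec A k i \<odot>\<^bsub>K\<^esub> \<one>\<^bsub>K\<^esub>"
      using alg_hom_one[OF \<pi>K_hom] lin_zero[OF modB modK alg_hom_lin[OF \<pi>K_hom]] K'.one_closed
      by (simp add: unit_vec_def)
    have "\<pi>K (sU (\<beta> (unit_vec A k)) (i, 1) \<ominus>\<^bsub>B\<^esub> unit_vec B k i) = \<pi>K (sU (\<beta> (unit_vec A k)) (i, 1)) \<ominus>\<^bsub>K\<^esub> unit_vec A k i \<odot>\<^bsub>K\<^esub> \<one>\<^bsub>K\<^esub>"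
      unfolding 1[symmetric]
      by (rule lin_minus[OF modB modK alg_hom_lin[OF \<pi>K_hom] subst_U_entry_closed[OF betac[OF uk] SigmaI[OF i one_mem]]
            free_mod_coeff[OF unit_vec_closed[OF crB k]]])
    also have "\<dots> = \<ominus>\<^bsub>K\<^esub> D i (unit_vec A k)"
      using xi[OF uk, of i] pi1[OF uk i] unfolding D_def a_minus_def by (simp add: K'.minus_add K'.a_comm)
    finally show ?thesis .
  qed
  \<comment> \<open>Linearity in x reduces to basis vectors; stability of the ideal under negation
    removes the sign, and stability under A accounts for the coefficients.\<close>
  have DI: "D i x \<in> Idl\<^bsub>K\<^esub> ?G" if i: "i \<in> {1..n}" and x: "x \<in> carrier F" for i x
  proof (rule free_induct[where Pr = "\<lambda>x. D i x \<in> Idl\<^bsub>K\<^esub> ?G", OF crA x])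
    have "D i (\<lambda>x. \<zero>\<^bsub>A\<^esub>) = \<zero>\<^bsub>K\<^esub>" using lin_zero[OF modF modK Dl[OF i]] by simp
    then show "D i (\<lambda>x. \<zero>\<^bsub>A\<^esub>) \<in> Idl\<^bsub>K\<^esub> ?G" using additive_subgroup.zero_closed[OF ideal.axioms(1)[OF iG]] by (simp only:)
  next
    fix a k assume a: "a \<in> carrier A" and k: "k \<in> {1..n}"
    note uk = unit_vec_closed[OF crA k]
    have "\<ominus>\<^bsub>K\<^esub> D i (unit_vec A k) \<in> Idl\<^bsub>K\<^esub> ?G"
      unfolding gen[OF k i, symmetric]
      by (rule subsetD[OF K'.genideal_self[OF Gc]], rule imageI) (unfold I3_gens_eq, use k i in blast)
    then have "\<ominus>\<^bsub>K\<^esub> (\<ominus>\<^bsub>K\<^esub> D i (unit_vec A k)) \<in> Idl\<^bsub>K\<^esub> ?G"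
      by (rule additive_subgroup.a_inv_closed[OF ideal.axioms(1)[OF iG]])
    then have "D i (unit_vec A k) \<in> Idl\<^bsub>K\<^esub> ?G" using lin_closed[OF Dl[OF i] uk] by (simp only: K'.minus_minus)
    then show "D i (a \<odot>\<^bsub>F\<^esub> unit_vec A k) \<in> Idl\<^bsub>K\<^esub> ?G"
      unfolding lin_smult[OF Dl[OF i] a uk] by (rule submodule.smult_closed[OF sG a])
  next
    fix r s assume rs: "r \<in> carrier F" "s \<in> carrier F" and "D i r \<in> Idl\<^bsub>K\<^esub> ?G" "D i s \<in> Idl\<^bsub>K\<^esub> ?G"
    then show "D i (r \<oplus>\<^bsub>F\<^esub> s) \<in> Idl\<^bsub>K\<^esub> ?G" unfolding lin_add[OF Dl[OF i] rs] by (intro aG)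
  qed
  \<comment> \<open>Induction on tensors; additivity of the expression in z is isolated in
    \<open>l\<close> as a linear map over A.\<close>
  have main: "?d i z \<ominus>\<^bsub>K\<^esub> mat_coord A K n i 1 (?mu (?t1 z)) \<in> Idl\<^bsub>K\<^esub> ?G" if i: "i \<in> {1..n}" and z: "z \<in> carrier ?T" for i z
  proof -
    have l: "(\<lambda>z. ?d i z \<ominus>\<^bsub>restr A K (self_mod K)\<^esub> mat_coord A K n i 1 (?mu (?t1 z))) \<in> lin A ?T (restr A K (self_mod K))"
      by (rule lin_minus_fun[OF module_restr[OF algK module_self_mod[OF crK]] lin_tensor_restr[OF algK modF co(1)]
            lin_comp[OF lin_comp[OF t1(1) mul] lin_tensor_restr[OF algK modE mat_coord_lin[OF algK one_mem]]]])
    show ?thesis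
    proof (rule tensor_induct[where Pr = "\<lambda>z. ?d i z \<ominus>\<^bsub>K\<^esub> mat_coord A K n i 1 (?mu (?t1 z)) \<in> Idl\<^bsub>K\<^esub> ?G", OF modK modF z])
      fix k x assume k: "k \<in> carrier K" and x: "x \<in> carrier F"
      show "?d i (tens A K F k x) \<ominus>\<^bsub>K\<^esub> mat_coord A K n i 1 (?mu (?t1 (tens A K F k x))) \<in> Idl\<^bsub>K\<^esub> ?G"
        unfolding dt[OF k x i] by (rule ideal.I_l_closed[OF iG DI[OF i x] k])
    next
      fix z w assume zw: "z \<in> carrier ?T" "w \<in> carrier ?T"
        and "?d i z \<ominus>\<^bsub>K\<^esub> mat_coord A K n i 1 (?mu (?t1 z)) \<in> Idl\<^bsub>K\<^esub> ?G"
        and "?d i w \<ominus>\<^bsub>K\<^esub> mat_coord A K n i 1 (?mu (?t1 w)) \<in> Idl\<^bsub>K\<^esub> ?G"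
      then show "?d i (z \<oplus>\<^bsub>?T\<^esub> w) \<ominus>\<^bsub>K\<^esub> mat_coord A K n i 1 (?mu (?t1 (z \<oplus>\<^bsub>?T\<^esub> w))) \<in> Idl\<^bsub>K\<^esub> ?G"
        using lin_add[OF l zw] unfolding amK restr_simps self_mod_simps by (simp only: aG)
    qed
  qed
  have "HRb_ideal A n (free_mod A S) J \<beta>R = Idl\<^bsub>K\<^esub> ?G'"
    unfolding HRb_ideal_def Let_def
    by (rule Z_map_fin_basis[OF crK modKF fin_basis_base_change[OF algK modF fin_basis_FM[OF crA]]])
      (rule KF.minus_closed[OF _ uK]; assumption)
  also have "\<dots> = Idl\<^bsub>K\<^esub> ?G"
  proof
    have "?G' \<subseteq> Idl\<^bsub>K\<^esub> ?G"
    proof (rule subsetI)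
      fix c assume "c \<in> ?G'"
      then obtain i z where c: "c = ?d i (z \<ominus>\<^bsub>?KF\<^esub> ?u z)" "i \<in> {1..n}" "z \<in> carrier ?KF" by (elim CollectE exE conjE)
      have z: "z \<in> carrier ?T" using c(3) by (simp only: base_change_simps)
      show "c \<in> Idl\<^bsub>K\<^esub> ?G" unfolding c(1) du[OF c(3)] by (rule main[OF c(2) z])
    qed
    then show "Idl\<^bsub>K\<^esub> ?G' \<subseteq> Idl\<^bsub>K\<^esub> ?G" by (rule K'.genideal_minimal[OF iG])
    have iG': "ideal (Idl\<^bsub>K\<^esub> ?G') K" by (rule K'.genideal_ideal[OF G'c])
    have "?G \<subseteq> Idl\<^bsub>K\<^esub> ?G'"
    proof (rule image_subsetI)
      fix g assume "g \<in> I3_gens A n S arr \<beta>"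
      then obtain k i where g: "g = sU (\<beta> (unit_vec A k)) (i, 1) \<ominus>\<^bsub>B\<^esub> unit_vec B k i" "k \<in> {1..n}" "i \<in> {1..n}"
        unfolding I3_gens_eq by (elim CollectE exE conjE)
      note uk = unit_vec_closed[OF crA g(2)]
      have tK: "tens A K F \<one>\<^bsub>K\<^esub> (unit_vec A k) \<in> carrier ?KF"
        unfolding base_change_simps by (rule tens_closed[OF modK modF K'.one_closed uk])
      have "?d i (tens A K F \<one>\<^bsub>K\<^esub> (unit_vec A k) \<ominus>\<^bsub>?KF\<^esub> ?u (tens A K F \<one>\<^bsub>K\<^esub> (unit_vec A k))) \<in> ?G'"
        using g(3) tK by blast
      then have "?d i (tens A K F \<one>\<^bsub>K\<^esub> (unit_vec A k) \<ominus>\<^bsub>?KF\<^esub> ?u (tens A K F \<one>\<^bsub>K\<^esub> (unit_vec A k))) \<in> Idl\<^bsub>K\<^esub> ?G'"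
        by (rule subsetD[OF K'.genideal_self[OF G'c]])
      then have "D i (unit_vec A k) \<in> Idl\<^bsub>K\<^esub> ?G'"
        unfolding du[OF tK] dt[OF K'.one_closed uk g(3)] K'.l_one[OF lin_closed[OF Dl[OF g(3)] uk]] .
      then have "\<ominus>\<^bsub>K\<^esub> D i (unit_vec A k) \<in> Idl\<^bsub>K\<^esub> ?G'"
        by (rule additive_subgroup.a_inv_closed[OF ideal.axioms(1)[OF iG']])
      then show "\<pi>K g \<in> Idl\<^bsub>K\<^esub> ?G'" unfolding g(1) gen[OF g(2,3)] .
    qed
    then show "Idl\<^bsub>K\<^esub> ?G \<subseteq> Idl\<^bsub>K\<^esub> ?G'" by (rule K'.genideal_minimal[OF K'.genideal_ideal[OF G'c]])
  qed
  finally show ?thesis .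
qed

lemma surj_ker_HRb:
  "surj_ker A (AU A n S) (HRb A n (free_mod A S) (Y_ident A S ` I) \<beta>R)
    (\<lambda>p. HRb_ideal A n (free_mod A S) (Y_ident A S ` I) \<beta>R +>\<^bsub>K\<^esub> \<pi>K p)
    (Idl\<^bsub>B\<^esub> (I1_gens A n S \<union> I2_gens A n S arr I \<union> I3_gens A n S arr \<beta>))"
  using surj_ker_step[OF algB algK surj_ker_HR Un_least[OF I1_gens_closed I2_gens_closed] I3_gens_closed]
  unfolding HRb_ideal_eq[symmetric] HRb_def[symmetric] .

lemma algebra_HRb: "algebra A (HRb A n (free_mod A S) (Y_ident A S ` I) \<beta>R)"
proof -
  interpret K': cring K by (rule algebra_cring[OF algK])
  have "\<pi>K ` I3_gens A n S arr \<beta> \<subseteq> carrier K"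
    by (rule image_subsetI) (rule lin_closed[OF alg_hom_lin[OF \<pi>K_hom] subsetD[OF I3_gens_closed]])
  then show ?thesis
    unfolding HRb_def HRb_ideal_eq by (intro algebra_quot[OF algK] K'.genideal_ideal)
qed

end

end

end

end

text \<open>Each equality of algebras is rendered as an isomorphism with prescribed value on every
  residue class, so that it is the one induced by A[U] = \<Sigma>. That \<open>mu_H\<close> is
  determined by the formula is rendered as uniqueness among H-linear maps, which holds because the
  elements 1 \<otimes> f generate H \<otimes> Sym(M) over H. The arrangement \<open>arr\<close> is
  arbitrary, and one and the same in I_2, in I_3 and in the formula for \<open>mu_H\<close>.\<close>

theorem mainTheorem4:
  fixes A :: "('a, 'm) ring_scheme" and n :: nat and S :: "'s set"
    and I :: "('s multiset \<Rightarrow> 'a) set"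
    and \<beta> :: "(nat \<Rightarrow> 'a) \<Rightarrow> 's multiset \<Rightarrow> 'a"
    and arr :: "'s multiset \<Rightarrow> 's list"
  assumes "cring A" and "n \<ge> 1"
    and "ideal I (mpoly A S)"
    and "\<beta> \<in> lin A (FM A n) (mpoly A S)" and "\<beta> (unit_vec A 1) = \<one>\<^bsub>mpoly A S\<^esub>"
    and "\<And>m. mset (arr m) = m"
  shows "let M = free_mod A S; P = sym_alg A M; \<Sigma> = Sig A n M; E = EndF A n;
      \<iota> = Y_ident A S; \<phi> = U_ident A n S;
      J = \<iota> ` I; \<beta>R = (\<lambda>x. J +>\<^bsub>P\<^esub> \<iota> (\<beta> x));
      H = Halg A n M; HR' = HR A n M J; HRb' = HRb A n M J \<beta>R;
      B = AU A n S;
      K1 = I1 A n S;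
      K2 = Idl\<^bsub>B\<^esub> (I1 A n S \<union> I2 A n S arr I);
      K3 = Idl\<^bsub>B\<^esub> (I1 A n S \<union> I2 A n S arr I \<union> I3 A n S arr \<beta>)
    in \<iota> \<in> alg_iso A (mpoly A S) P \<and>
       \<phi> \<in> alg_iso A B \<Sigma> \<and>
       (\<exists>\<theta>\<in>alg_iso A (quot B K1) H.
          (\<forall>p\<in>carrier B. \<theta> (K1 +>\<^bsub>B\<^esub> p) = H_ideal A n M +>\<^bsub>\<Sigma>\<^esub> \<phi> p) \<and>
          mu_H A n M \<in> alg_hom H (base_change A H P) (base_change A H E) \<and>
          (\<forall>f\<in>carrier (mpoly A S). mu_H A n M (tens A H P \<one>\<^bsub>H\<^esub> (\<iota> f)) =
             mat_tens A n H (\<lambda>ij. \<theta> (K1 +>\<^bsub>B\<^esub> subst_U A n S arr f ij))) \<and>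
          (\<forall>g\<in>lin H (base_change A H P) (base_change A H E).
             (\<forall>f\<in>carrier (mpoly A S). g (tens A H P \<one>\<^bsub>H\<^esub> (\<iota> f)) =
                mat_tens A n H (\<lambda>ij. \<theta> (K1 +>\<^bsub>B\<^esub> subst_U A n S arr f ij))) \<longrightarrow>
             (\<forall>z\<in>carrier (base_change A H P). g z = mu_H A n M z))) \<and>
       (\<exists>\<theta>\<in>alg_iso A (quot B K2) HR'.
          \<forall>p\<in>carrier B. \<theta> (K2 +>\<^bsub>B\<^esub> p) =
            HR_ideal A n M J +>\<^bsub>H\<^esub> (H_ideal A n M +>\<^bsub>\<Sigma>\<^esub> \<phi> p)) \<and>
       (\<exists>\<theta>\<in>alg_iso A (quot B K3) HRb'.
          \<forall>p\<in>carrier B. \<theta> (K3 +>\<^bsub>B\<^esub> p) =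
            HRb_ideal A n M J \<beta>R +>\<^bsub>HR'\<^esub> (HR_ideal A n M J +>\<^bsub>H\<^esub> (H_ideal A n M +>\<^bsub>\<Sigma>\<^esub> \<phi> p)))"
proof -
  have arr: "\<And>m. mset (arr m) = m" by (fact assms(6))
  note crA = assms(1) and n1 = assms(2) and idI = assms(3) and beta = assms(4)
  let ?M = "free_mod A S" and ?B = "AU A n S" and ?P = "sym_alg A (free_mod A S)" and ?E = "EndF A n"
  let ?H = "Halg A n (free_mod A S)" and ?Sg = "Sig A n (free_mod A S)"
  let ?sU = "subst_U A n S arr" and ?V = "{1..n} \<times> {1..n}"
  let ?pH = "\<lambda>p. H_ideal A n ?M +>\<^bsub>?Sg\<^esub> U_ident A n S p"
  note algB = algebra_mpoly[OF crA, of "S \<times> {1..n} \<times> {1..n}"] and algP = algebra_sym_alg[OF module_free_mod[OF crA, of S]]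
  note algH = algebra_Halg[OF crA arr, of n S] and modE = module_EndF[OF crA, of n]
  interpret B': cring ?B by (rule algebra_cring[OF algB])
  interpret H': cring ?H by (rule algebra_cring[OF algH])
  interpret HE: module ?H "base_change A ?H ?E" by (rule module_base_change[OF algH modE])
  note c1 = I1_gens_closed[OF crA, of n S] and c2 = I2_gens_closed[OF crA arr idI, of n]
    and c3 = I3_gens_closed[OF crA arr idI n1 beta]
  \<comment> \<open>The kernel is recorded through generators, whereas the statement joins the
    ideals themselves; absorbing one ideal at a time shows that both generate the same
    ideal.\<close>
  have K2: "Idl\<^bsub>?B\<^esub> (I1 A n S \<union> I2 A n S arr I) = Idl\<^bsub>?B\<^esub> (I1_gens A n S \<union> I2_gens A n S arr I)"
  proof -
    have "Idl\<^bsub>?B\<^esub> (I1 A n S \<union> I2 A n S arr I) = Idl\<^bsub>?B\<^esub> (I1 A n S \<union> I2_gens A n S arr I)"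
      unfolding I2_def
      by (rule Idl_absorb[OF B'.is_cring _ c2]) (unfold I1_def, rule additive_subgroup.a_subset[OF ideal.axioms(1)[OF B'.genideal_ideal[OF c1]]])
    also have "\<dots> = Idl\<^bsub>?B\<^esub> (I2_gens A n S arr I \<union> Idl\<^bsub>?B\<^esub> (I1_gens A n S))"
      unfolding I1_def by (simp only: Un_commute)
    also have "\<dots> = Idl\<^bsub>?B\<^esub> (I1_gens A n S \<union> I2_gens A n S arr I)"
      unfolding Idl_absorb[OF B'.is_cring c2 c1] by (simp only: Un_commute)
    finally show ?thesis .
  qed
  have K3: "Idl\<^bsub>?B\<^esub> (I1 A n S \<union> I2 A n S arr I \<union> I3 A n S arr \<beta>) =
      Idl\<^bsub>?B\<^esub> (I1_gens A n S \<union> I2_gens A n S arr I \<union> I3_gens A n S arr \<beta>)"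
  proof -
    have c12: "I1 A n S \<union> I2 A n S arr I \<subseteq> carrier ?B"
      unfolding I1_def I2_def
      by (intro Un_least additive_subgroup.a_subset[OF ideal.axioms(1)[OF B'.genideal_ideal]] c1 c2)
    have g12: "I1_gens A n S \<union> I2_gens A n S arr I \<subseteq> carrier ?B" using c1 c2 by (rule Un_least)
    have "Idl\<^bsub>?B\<^esub> (I1 A n S \<union> I2 A n S arr I \<union> I3 A n S arr \<beta>) = Idl\<^bsub>?B\<^esub> (I1 A n S \<union> I2 A n S arr I \<union> I3_gens A n S arr \<beta>)"
      unfolding I3_def by (rule Idl_absorb[OF B'.is_cring c12 c3])
    also have "\<dots> = Idl\<^bsub>?B\<^esub> (I3_gens A n S arr \<beta> \<union> Idl\<^bsub>?B\<^esub> (I1 A n S \<union> I2 A n S arr I))"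
      unfolding Idl_absorb[OF B'.is_cring c3 c12] by (simp only: Un_commute)
    also have "\<dots> = Idl\<^bsub>?B\<^esub> (I1_gens A n S \<union> I2_gens A n S arr I \<union> I3_gens A n S arr \<beta>)"
      unfolding K2 Idl_absorb[OF B'.is_cring c3 g12] by (simp only: Un_commute)
    finally show ?thesis .
  qed
  obtain \<theta> where \<theta>: "\<theta> \<in> alg_iso A (quot ?B (I1 A n S)) ?H"
    "\<And>p. p \<in> carrier ?B \<Longrightarrow> \<theta> (I1 A n S +>\<^bsub>?B\<^esub> p) = ?pH p"
    using surj_ker_iso[OF algB algH surj_ker_H[OF crA arr]] unfolding I1_def[symmetric] by blast
  have entry: "?sU f v \<in> carrier ?B" if "f \<in> carrier (mpoly A S)" "v \<in> ?V" for f v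
    by (rule subst_U_entry_closed[OF crA arr that])
  have pH: "?pH p \<in> carrier ?H" if "p \<in> carrier ?B" for p
    by (rule lin_closed[OF alg_hom_lin[OF surj_kerD(1)[OF surj_ker_H[OF crA arr]]] that])
  \<comment> \<open>The statement writes matrices as unrestricted functions of the index pair, the
    construction as restricted ones; \<open>mat_tens\<close> does not distinguish them when the
    entries in range lie in H.\<close>
  have mat: "mat_tens A n ?H (\<lambda>v\<in>?V. ?pH (?sU f v)) = mat_tens A n ?H (\<lambda>ij. \<theta> (I1 A n S +>\<^bsub>?B\<^esub> ?sU f ij))"
    if f: "f \<in> carrier (mpoly A S)" for f
  proof -
    have "(\<lambda>v\<in>?V. ?pH (?sU f v)) = (\<lambda>v\<in>?V. \<theta> (I1 A n S +>\<^bsub>?B\<^esub> ?sU f v))"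
      by (rule restrict_ext) (rule \<theta>(2)[OF entry[OF f], symmetric])
    moreover have "\<theta> (I1 A n S +>\<^bsub>?B\<^esub> ?sU f v) \<in> carrier ?H" if "v \<in> ?V" for v
      unfolding \<theta>(2)[OF entry[OF f that]] by (rule pH[OF entry[OF f that]])
    note mat_tens_restrict[OF algH this]
    ultimately show ?thesis by (simp only:)
  qed
  have muH: "mu_H A n ?M (tens A ?H ?P \<one>\<^bsub>?H\<^esub> (Y_ident A S f)) =
      mat_tens A n ?H (\<lambda>ij. \<theta> (I1 A n S +>\<^bsub>?B\<^esub> ?sU f ij))" if f: "f \<in> carrier (mpoly A S)" for f
    unfolding mu_H_tens[OF crA arr H'.one_closed f] mat[OF f, symmetric]
    by (rule HE.smult_one[OF mat_tens_closed[OF algH matI]]) (rule pH[OF entry[OF f]])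
  \<comment> \<open>Every p in Sym(M) has the form \<open>Y_ident A S f\<close>, so agreement on all
    1 \<otimes> f is agreement on all 1 \<otimes> p, which generate over H.\<close>
  have uniq: "g z = mu_H A n ?M z"
    if g: "g \<in> lin ?H (base_change A ?H ?P) (base_change A ?H ?E)"
      and gf: "\<And>f. f \<in> carrier (mpoly A S) \<Longrightarrow> g (tens A ?H ?P \<one>\<^bsub>?H\<^esub> (Y_ident A S f)) =
        mat_tens A n ?H (\<lambda>ij. \<theta> (I1 A n S +>\<^bsub>?B\<^esub> ?sU f ij))"
      and z: "z \<in> carrier (base_change A ?H ?P)" for g z
  proof (rule base_change_ext[OF algH algebra_module[OF algP] g alg_hom_lin[OF mu_H_alg_hom[OF crA arr]] _ z])
    fix p assume p: "p \<in> carrier ?P"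
    obtain \<kappa> where \<kappa>: "\<kappa> \<in> alg_hom A ?P (mpoly A S)" "(\<forall>f\<in>carrier (mpoly A S). \<kappa> (Y_ident A S f) = f) \<and>
        (\<forall>p\<in>carrier ?P. Y_ident A S (\<kappa> p) = p)"
      using Y_ident_inv[OF crA arr] by (rule bexE)
    have k: "\<kappa> p \<in> carrier (mpoly A S)" by (rule lin_closed[OF alg_hom_lin[OF \<kappa>(1)] p])
    show "g (tens A ?H ?P \<one>\<^bsub>?H\<^esub> p) = mu_H A n ?M (tens A ?H ?P \<one>\<^bsub>?H\<^esub> p)"
      using gf[OF k] muH[OF k] unfolding bspec[OF conjunct2[OF \<kappa>(2)] p] by (simp only:)
  qed
  note s2 = surj_ker_iso[OF algB algebra_HR[OF crA arr idI] surj_ker_HR[OF crA arr idI]]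
  note s3 = surj_ker_iso[OF algB algebra_HRb[OF crA arr idI n1 beta] surj_ker_HRb[OF crA arr idI n1 beta]]
  show ?thesis
    unfolding Let_def K2 K3
  proof (intro conjI)
    show "Y_ident A S \<in> alg_iso A (mpoly A S) ?P" by (rule Y_ident_iso(1)[OF crA])
    show "U_ident A n S \<in> alg_iso A ?B ?Sg" by (rule U_ident_iso(1)[OF crA])
  next
    show "\<exists>\<theta>\<in>alg_iso A (quot ?B (I1 A n S)) ?H.
        (\<forall>p\<in>carrier ?B. \<theta> (I1 A n S +>\<^bsub>?B\<^esub> p) = ?pH p) \<and>
        mu_H A n ?M \<in> alg_hom ?H (base_change A ?H ?P) (base_change A ?H ?E) \<and>
        (\<forall>f\<in>carrier (mpoly A S). mu_H A n ?M (tens A ?H ?P \<one>\<^bsub>?H\<^esub> (Y_ident A S f)) =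
           mat_tens A n ?H (\<lambda>ij. \<theta> (I1 A n S +>\<^bsub>?B\<^esub> ?sU f ij))) \<and>
        (\<forall>g\<in>lin ?H (base_change A ?H ?P) (base_change A ?H ?E).
           (\<forall>f\<in>carrier (mpoly A S). g (tens A ?H ?P \<one>\<^bsub>?H\<^esub> (Y_ident A S f)) =
              mat_tens A n ?H (\<lambda>ij. \<theta> (I1 A n S +>\<^bsub>?B\<^esub> ?sU f ij))) \<longrightarrow>
           (\<forall>z\<in>carrier (base_change A ?H ?P). g z = mu_H A n ?M z))"
    proof (rule bexI[OF _ \<theta>(1)], intro conjI)
      show "\<forall>p\<in>carrier ?B. \<theta> (I1 A n S +>\<^bsub>?B\<^esub> p) = ?pH p" by (rule ballI) (rule \<theta>(2))
      show "mu_H A n ?M \<in> alg_hom ?H (base_change A ?H ?P) (base_change A ?H ?E)" by (rule mu_H_alg_hom[OF crA arr])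
      show "\<forall>f\<in>carrier (mpoly A S). mu_H A n ?M (tens A ?H ?P \<one>\<^bsub>?H\<^esub> (Y_ident A S f)) =
           mat_tens A n ?H (\<lambda>ij. \<theta> (I1 A n S +>\<^bsub>?B\<^esub> ?sU f ij))" by (rule ballI) (rule muH)
      show "\<forall>g\<in>lin ?H (base_change A ?H ?P) (base_change A ?H ?E).
           (\<forall>f\<in>carrier (mpoly A S). g (tens A ?H ?P \<one>\<^bsub>?H\<^esub> (Y_ident A S f)) =
              mat_tens A n ?H (\<lambda>ij. \<theta> (I1 A n S +>\<^bsub>?B\<^esub> ?sU f ij))) \<longrightarrow>
           (\<forall>z\<in>carrier (base_change A ?H ?P). g z = mu_H A n ?M z)"
      proof (intro ballI impI)
        fix g z assume g: "g \<in> lin ?H (base_change A ?H ?P) (base_change A ?H ?E)"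
          and gf: "\<forall>f\<in>carrier (mpoly A S). g (tens A ?H ?P \<one>\<^bsub>?H\<^esub> (Y_ident A S f)) =
              mat_tens A n ?H (\<lambda>ij. \<theta> (I1 A n S +>\<^bsub>?B\<^esub> ?sU f ij))"
          and z: "z \<in> carrier (base_change A ?H ?P)"
        show "g z = mu_H A n ?M z" by (rule uniq[OF g bspec[OF gf] z])
      qed
    qed
  qed (rule s2, rule s3)
qed

end
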